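(* Let $n\ge 1$ and let $\Sigma$ be a complete $n$-dimensional properly immersed self-expander hypersurface in $\mathbb{R}^{n+1}$. Let $\mu_1\in[-\infty,\infty)$ be the bottom of the spectrum of the $L$-stability operator $L=\mathcal{L}+|A|^2-\frac12$ and let $\lambda_1$ be the bottom of the spectrum of the drifted Laplacian $\mathcal{L}=\Delta+\frac12\langle x,\nabla\cdot\rangle$. Then $$\mu_1\leq \lambda_1+\frac12,$$ and the equality $\mu_1=\lambda_1+\frac12$ holds if and only if $\Sigma$ is a hyperplane through the origin. Further, if $\Sigma$ is mean convex, then $$1\leq \mu_1\leq \lambda_1+\frac12.$$
   Context: Manifolds are connected. A self-expander hypersurface is a smooth $n$-dimensional hypersurface $\Sigma$ immersed in Euclidean space $\mathbb{R}^{n+1}$ whose mean curvature satisfies $H=-\frac12\langle x,{\bf n}\rangle$, where $x$ is the position vector, ${\bf n}$ is the unit normal field, and $H$ is defined by ${\bf H}=-H{\bf n}$ with ${\bf H}=\sum_{i=1}^n(\bar\nabla_{e_i}e_i)^\perp$ the mean curvature vector ($\{e_i\}$ a local orthonormal frame of $\Sigma$, $\bar\nabla$ the Euclidean connection). It is mean convex if $H\ge 0$ on $\Sigma$. $A$ is the second fundamental form of $\Sigma$. Properly immersed means that the preimage in $\Sigma$ of every compact subset of $\mathbb{R}^{n+1}$ is compact. $\nabla,\Delta,d\sigma$ denote the gradient, Laplacian and volume element of the induced metric on $\Sigma$. The bottoms of the spectra are $$\lambda_1=\inf_{\varphi}\frac{\int_{\Sigma}|\nabla \varphi|^2e^{\frac{|x|^2}{4}}d\sigma}{\int_{\Sigma}\varphi^2e^{\frac{|x|^2}{4}}d\sigma},\qquad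 \mu_1=\inf_{\varphi}\frac{\int_{\Sigma}\left(|\nabla \varphi|^2-(|A|^2-\frac12)\varphi^2\right)e^{\frac{|x|^2}{4}}d\sigma}{\int_{\Sigma}\varphi^2e^{\frac{|x|^2}{4}}d\sigma},$$ where both infima are over $\varphi\in C_0^\infty(\Sigma)$ with $\int_\Sigma\varphi^2e^{\frac{|x|^2}{4}}d\sigma\ne0$; $\mu_1$ may be $-\infty$. *)

theory Defs
  imports "HOL-Analysis.Analysis"
begin

section \<open>Smooth manifolds\<close>

text \<open>
  \<open>Ck k S f\<close> is meant for open \<open>S\<close>; it says that \<open>f\<close> is \<open>k\<close> times continuously
  differentiable on \<open>S\<close>, all iterated directional derivatives of order at most \<open>k\<close> being
  continuous.
\<close>

primrec Ck :: "nat \<Rightarrow> 'e::real_normed_vector set \<Rightarrow> ('e \<Rightarrow> 'b::real_normed_vector) \<Rightarrow> bool" where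
  "Ck 0 S f \<longleftrightarrow> continuous_on S f"
| "Ck (Suc k) S f \<longleftrightarrow> (\<forall>x\<in>S. f differentiable (at x)) \<and>
      (\<forall>v. Ck k S (\<lambda>x. frechet_derivative f (at x) v))"

definition smooth_on :: "'e::real_normed_vector set \<Rightarrow> ('e \<Rightarrow> 'b::real_normed_vector) \<Rightarrow> bool" where
  "smooth_on S f \<longleftrightarrow> (\<forall>k. Ck k S f)"

text \<open>
  An atlas is a set of local parametrizations \<open>(V, \<psi>)\<close>: \<open>V\<close> is open in \<open>\<real>\<^sup>n\<close> and \<open>\<psi>\<close>
  maps \<open>V\<close> homeomorphically onto an open subset of the manifold, so that charts in the usual
  sense are the inverses of the \<open>\<psi>\<close>. The atlas need not be maximal. The dimension is the
  cardinality of the index type \<open>'n\<close>, hence at least 1.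
\<close>

type_synonym ('n, 'a) atlas = "((real^'n) set \<times> (real^'n \<Rightarrow> 'a)) set"

definition connected_manifold :: "'a topology \<Rightarrow> ('n::finite, 'a) atlas \<Rightarrow> bool" where
  "connected_manifold X A \<longleftrightarrow>
     topspace X \<noteq> {} \<and> connected_space X \<and> Hausdorff_space X \<and> second_countable X \<and>
     (\<forall>(V,\<psi>)\<in>A. open V \<and> openin X (\<psi> ` V) \<and>
        homeomorphic_map (top_of_set V) (subtopology X (\<psi> ` V)) \<psi>) \<and>
     (\<Union>(V,\<psi>)\<in>A. \<psi> ` V) = topspace X \<and>
     (\<forall>(V,\<psi>)\<in>A. \<forall>(W,\<phi>)\<in>A. smooth_on {x\<in>V. \<psi> x \<in> \<phi> ` W} (inv_into W \<phi> \<circ> \<psi>))"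

definition smooth_map :: "('n::finite, 'a) atlas \<Rightarrow> 'a set \<Rightarrow> ('a \<Rightarrow> 'b::real_normed_vector) \<Rightarrow> bool" where
  "smooth_map A U Y \<longleftrightarrow> (\<forall>(V,\<psi>)\<in>A. smooth_on {x\<in>V. \<psi> x \<in> U} (Y \<circ> \<psi>))"

definition smooth_immersion ::
  "'a topology \<Rightarrow> ('n::finite, 'a) atlas \<Rightarrow> ('a \<Rightarrow> real^'m) \<Rightarrow> bool" where
  "smooth_immersion X A F \<longleftrightarrow> smooth_map A (topspace X) F \<and>
     (\<forall>(V,\<psi>)\<in>A. \<forall>x\<in>V. inj (frechet_derivative (F \<circ> \<psi>) (at x)))"

definition properly_immersed :: "'a topology \<Rightarrow> ('a \<Rightarrow> real^'m) \<Rightarrow> bool" where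
  "properly_immersed X F \<longleftrightarrow> (\<forall>K. compact K \<longrightarrow> compactin X {p\<in>topspace X. F p \<in> K})"


section \<open>The induced Riemannian metric\<close>

text \<open>
  Tangent vectors at \<open>p\<close> are represented by their images under the (injective) differential of
  the immersion \<open>F\<close>; the induced metric is then the inner product of the ambient space.
\<close>

definition tangent_space ::
  "('n::finite, 'a) atlas \<Rightarrow> ('a \<Rightarrow> real^'m) \<Rightarrow> 'a \<Rightarrow> (real^'m) set" where
  "tangent_space A F p =
     {frechet_derivative (F \<circ> \<psi>) (at x) a | V \<psi> x a. (V,\<psi>) \<in> A \<and> x \<in> V \<and> \<psi> x = p}"

text \<open>
  Derivative at \<open>p\<close> of a map \<open>Y\<close> on the manifold in the direction of the tangent vector \<open>u\<close>.
  For \<open>Y\<close> with values in the ambient space this is the Euclidean connection.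
\<close>

definition dir_deriv :: "('n::finite, 'a) atlas \<Rightarrow> ('a \<Rightarrow> real^'m) \<Rightarrow>
    ('a \<Rightarrow> 'b::real_normed_vector) \<Rightarrow> 'a \<Rightarrow> real^'m \<Rightarrow> 'b" where
  "dir_deriv A F Y p u =
     (THE w. \<exists>V \<psi> x a. (V,\<psi>) \<in> A \<and> x \<in> V \<and> \<psi> x = p \<and>
        frechet_derivative (F \<circ> \<psi>) (at x) a = u \<and> w = frechet_derivative (Y \<circ> \<psi>) (at x) a)"

definition gradient ::
  "('n::finite, 'a) atlas \<Rightarrow> ('a \<Rightarrow> real^'m) \<Rightarrow> ('a \<Rightarrow> real) \<Rightarrow> 'a \<Rightarrow> real^'m" where
  "gradient A F \<phi> p =
     (THE g. g \<in> tangent_space A F p \<and>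
        (\<forall>u\<in>tangent_space A F p. g \<bullet> u = dir_deriv A F \<phi> p u))"

text \<open>
  The length of a curve \<open>\<gamma>\<close> in the induced metric is the Euclidean length of \<open>F \<circ> \<gamma>\<close>; since
  \<open>F\<close> is an immersion, a continuous \<open>\<gamma>\<close> is piecewise \<open>C\<^sup>1\<close> iff \<open>F \<circ> \<gamma>\<close> is. The length is a
  nonnegative integral, hence possibly infinite, because the library notion of piecewise
  \<open>C\<^sup>1\<close> allows unbounded derivatives near the break points.
\<close>

definition curve_length :: "('a \<Rightarrow> real^'m) \<Rightarrow> (real \<Rightarrow> 'a) \<Rightarrow> ennreal" where
  "curve_length F \<gamma> =
     (\<integral>\<^sup>+ t\<in>{0..1}. ennreal (norm (vector_derivative (F \<circ> \<gamma>) (at t))) \<partial>lborel)"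

definition riem_dist :: "'a topology \<Rightarrow> ('a \<Rightarrow> real^'m) \<Rightarrow> 'a \<Rightarrow> 'a \<Rightarrow> ennreal" where
  "riem_dist X F p q =
     (INF \<gamma>\<in>{\<gamma>. pathin X \<gamma> \<and> (F \<circ> \<gamma>) piecewise_C1_differentiable_on {0..1} \<and>
                 \<gamma> 0 = p \<and> \<gamma> 1 = q}. curve_length F \<gamma>)"

definition riem_complete :: "'a topology \<Rightarrow> ('a \<Rightarrow> real^'m) \<Rightarrow> bool" where
  "riem_complete X F \<longleftrightarrow>
     (\<forall>s::nat \<Rightarrow> 'a. range s \<subseteq> topspace X \<longrightarrow>
        (\<forall>e>0. \<exists>N. \<forall>i\<ge>N. \<forall>j\<ge>N. riem_dist X F (s i) (s j) < e) \<longrightarrow>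
        (\<exists>l\<in>topspace X. (\<lambda>i. riem_dist X F (s i) l) \<longlonglongrightarrow> 0))"

definition gram_det :: "(real^'n::finite \<Rightarrow> real^'m) \<Rightarrow> real^'n \<Rightarrow> real" where
  "gram_det f x =
     det (\<chi> i j. frechet_derivative f (at x) (axis i 1) \<bullet> frechet_derivative f (at x) (axis j 1))"

text \<open>
  The volume measure of the induced metric: the unique Borel measure which has density
  \<open>sqrt (det g)\<close> in every chart.
\<close>

definition volume_measure ::
  "'a topology \<Rightarrow> ('n::finite, 'a) atlas \<Rightarrow> ('a \<Rightarrow> real^'m) \<Rightarrow> 'a measure" where
  "volume_measure X A F =
     (THE \<sigma>. space \<sigma> = topspace X \<and> sets \<sigma> = sigma_sets (topspace X) {U. openin X U} \<and>
        (\<forall>(V,\<psi>)\<in>A. \<forall>E\<in>sets \<sigma>. E \<subseteq> \<psi> ` V \<longrightarrow>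
           emeasure \<sigma> E =
             (\<integral>\<^sup>+ x\<in>{x\<in>V. \<psi> x \<in> E}. ennreal (sqrt (gram_det (F \<circ> \<psi>) x)) \<partial>lborel)))"


section \<open>Extrinsic geometry\<close>

definition normal_part ::
  "('n::finite, 'a) atlas \<Rightarrow> ('a \<Rightarrow> real^'m) \<Rightarrow> 'a \<Rightarrow> real^'m \<Rightarrow> real^'m" where
  "normal_part A F p v =
     (THE w. w \<in> (tangent_space A F p)\<^sup>\<bottom> \<and> v - w \<in> tangent_space A F p)"

definition unit_normal_at ::
  "('n::finite, 'a) atlas \<Rightarrow> ('a \<Rightarrow> real^'m) \<Rightarrow> 'a \<Rightarrow> real^'m \<Rightarrow> bool" where
  "unit_normal_at A F p \<nu> \<longleftrightarrow> norm \<nu> = 1 \<and> \<nu> \<in> (tangent_space A F p)\<^sup>\<bottom>"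

text \<open>
  The second fundamental form with values in the normal space: the normal part of the
  Euclidean derivative along \<open>u\<close> of any local smooth tangential field extending \<open>v\<close>.
\<close>

definition second_ff ::
  "'a topology \<Rightarrow> ('n::finite, 'a) atlas \<Rightarrow> ('a \<Rightarrow> real^'m) \<Rightarrow> 'a \<Rightarrow> real^'m \<Rightarrow> real^'m \<Rightarrow> real^'m" where
  "second_ff X A F p u v =
     (THE w. \<exists>U Y. openin X U \<and> p \<in> U \<and> smooth_map A U Y \<and>
        (\<forall>q\<in>U. Y q \<in> tangent_space A F q) \<and> Y p = v \<and>
        w = normal_part A F p (dir_deriv A F Y p u))"

definition tangent_onb ::
  "('n::finite, 'a) atlas \<Rightarrow> ('a \<Rightarrow> real^'m) \<Rightarrow> 'a \<Rightarrow> (real^'m) set" where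
  "tangent_onb A F p =
     (SOME B. B \<subseteq> tangent_space A F p \<and> pairwise orthogonal B \<and> (\<forall>e\<in>B. norm e = 1) \<and>
        span B = tangent_space A F p)"

definition mean_curv_vector ::
  "'a topology \<Rightarrow> ('n::finite, 'a) atlas \<Rightarrow> ('a \<Rightarrow> real^'m) \<Rightarrow> 'a \<Rightarrow> real^'m" where
  "mean_curv_vector X A F p = (\<Sum>e\<in>tangent_onb A F p. second_ff X A F p e e)"

definition second_ff_sq ::
  "'a topology \<Rightarrow> ('n::finite, 'a) atlas \<Rightarrow> ('a \<Rightarrow> real^'m) \<Rightarrow> 'a \<Rightarrow> real" where
  "second_ff_sq X A F p =
     (\<Sum>e\<in>tangent_onb A F p. \<Sum>e'\<in>tangent_onb A F p. (norm (second_ff X A F p e e'))\<^sup>2)"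

text \<open>Sign convention: the mean curvature vector is \<open>- H \<nu>\<close>.\<close>

definition mean_curv ::
  "'a topology \<Rightarrow> ('n::finite, 'a) atlas \<Rightarrow> ('a \<Rightarrow> real^'m) \<Rightarrow> 'a \<Rightarrow> real^'m \<Rightarrow> real" where
  "mean_curv X A F p \<nu> = (THE h. mean_curv_vector X A F p = - (h *\<^sub>R \<nu>))"

text \<open>
  The self-expander equation is invariant under \<open>\<nu> \<mapsto> - \<nu>\<close>, so it is required for both unit
  normals at each point and no orientation is presupposed.
\<close>

definition self_expander ::
  "'a topology \<Rightarrow> ('n::finite, 'a) atlas \<Rightarrow> ('a \<Rightarrow> real^'m) \<Rightarrow> bool" where
  "self_expander X A F \<longleftrightarrow>
     (\<forall>p\<in>topspace X. \<forall>\<nu>. unit_normal_at A F p \<nu> \<longrightarrow>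
        mean_curv X A F p \<nu> = - (1/2) * (F p \<bullet> \<nu>))"

text \<open>
  In contrast, the sign of the mean curvature is only meaningful relative to a globally
  defined unit normal field.
\<close>

definition mean_convex ::
  "'a topology \<Rightarrow> ('n::finite, 'a) atlas \<Rightarrow> ('a \<Rightarrow> real^'m) \<Rightarrow> bool" where
  "mean_convex X A F \<longleftrightarrow>
     (\<exists>N. smooth_map A (topspace X) N \<and>
        (\<forall>p\<in>topspace X. unit_normal_at A F p (N p) \<and> 0 \<le> mean_curv X A F p (N p)))"

definition hyperplane_through_origin :: "'a topology \<Rightarrow> ('a \<Rightarrow> real^'m) \<Rightarrow> bool" where
  "hyperplane_through_origin X F \<longleftrightarrow>
     (\<exists>v. v \<noteq> 0 \<and> homeomorphic_map X (top_of_set {x. v \<bullet> x = 0}) F)"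


section \<open>Bottoms of the spectra\<close>

definition test_functions :: "'a topology \<Rightarrow> ('n::finite, 'a) atlas \<Rightarrow> ('a \<Rightarrow> real) set" where
  "test_functions X A =
     {\<phi>. smooth_map A (topspace X) \<phi> \<and> compactin X (X closure_of {p\<in>topspace X. \<phi> p \<noteq> 0})}"

definition weighted_integral ::
  "'a topology \<Rightarrow> ('n::finite, 'a) atlas \<Rightarrow> ('a \<Rightarrow> real^'m) \<Rightarrow> ('a \<Rightarrow> real) \<Rightarrow> real" where
  "weighted_integral X A F f = (LINT p|volume_measure X A F. f p * exp ((norm (F p))\<^sup>2 / 4))"

definition lambda1 ::
  "'a topology \<Rightarrow> ('n::finite, 'a) atlas \<Rightarrow> ('a \<Rightarrow> real^'m) \<Rightarrow> ereal" where
  "lambda1 X A F =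
     (INF \<phi>\<in>{\<phi>\<in>test_functions X A. weighted_integral X A F (\<lambda>p. (\<phi> p)\<^sup>2) \<noteq> 0}.
        ereal (weighted_integral X A F (\<lambda>p. (norm (gradient A F \<phi> p))\<^sup>2) /
               weighted_integral X A F (\<lambda>p. (\<phi> p)\<^sup>2)))"

definition mu1 ::
  "'a topology \<Rightarrow> ('n::finite, 'a) atlas \<Rightarrow> ('a \<Rightarrow> real^'m) \<Rightarrow> ereal" where
  "mu1 X A F =
     (INF \<phi>\<in>{\<phi>\<in>test_functions X A. weighted_integral X A F (\<lambda>p. (\<phi> p)\<^sup>2) \<noteq> 0}.
        ereal (weighted_integral X A F
                 (\<lambda>p. (norm (gradient A F \<phi> p))\<^sup>2 - (second_ff_sq X A F p - 1/2) * (\<phi> p)\<^sup>2) /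
               weighted_integral X A F (\<lambda>p. (\<phi> p)\<^sup>2)))"

end

theory Submission
  imports Defs
begin

text \<open>
  Write \<open>w = exp (|x|\<^sup>2 / 4)\<close>. The inequality \<open>\<mu>\<^sub>1 \<le> \<lambda>\<^sub>1 + 1/2\<close> holds because \<open>|A|\<^sup>2 \<ge> 0\<close>.
  Everything else rests on the first variation formula \<open>\<integral> (div Y + \<langle>F, Y\<rangle> / 2) w = 0\<close> and on a
  propagation principle: a sequence of nonnegative, asymptotically superharmonic functions which
  tends to 0 in \<open>L\<^sup>2\<close> on some open set does so on every compact set (test with \<open>\<eta>\<^sup>2 / (f + \<epsilon>)\<close> to
  bound the gradient of \<open>ln (f + \<epsilon>)\<close>).

  Equality: a nonnegative normalized minimizing sequence for \<open>\<lambda>\<^sub>1\<close> is asymptotically superharmonic,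
  and \<open>\<integral> |A|\<^sup>2 \<phi>\<^sup>2 w\<close> tends to 0 along it. If \<open>A \<noteq> 0\<close> somewhere, the sequence vanishes locally; but
  \<open>Y = \<phi>\<^sup>2 F\<close> gives \<open>\<integral> \<phi>\<^sup>2 |F|\<^sup>2 w \<le> 16 \<integral> |\<nabla>\<phi>|\<^sup>2 w\<close>, so no mass escapes to infinity, a contradiction. Hence
  \<open>A = 0\<close>, the tangent space is constant, and \<open>F\<close> is a proper local homeomorphism onto a hyperplane.

  Mean convex case: \<open>f = \<langle>F, N\<rangle>\<close> satisfies \<open>L f = - f\<close>, so Barta's trick yields \<open>\<mu>\<^sub>1 \<ge> 1\<close> unless \<open>f\<close>
  vanishes on a set of positive measure. Then \<open>f = 0\<close> by propagation, the hypersurface is a cone, and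
  homogeneity of \<open>|A|\<^sup>2\<close> forces \<open>A = 0\<close>; now \<open>\<lambda>\<^sub>1 \<ge> n/2\<close> suffices.
\<close>

section \<open>Smooth functions on Euclidean space\<close>

text \<open>Neither a minimizer nor an eigenfunction is constructed. A positive first eigenfunction
  would give A = 0 at once in the equality case. An almost minimizer only has small L^2 mass where A
  \<noteq> 0, and the obstacle is to show that it then has small mass near every point. The
  logarithmic gradient bound takes the place of Harnack's inequality: at height \<epsilon> it
  tolerates any error \<delta> \<le> \<epsilon>, so for fixed \<epsilon> all late members of the
  sequence obey the same bound. A constant sequence is the case without error; propagation is then
  the strong maximum principle that Barta's trick needs, since the support function may touch 0.
  Tangent vectors are represented in the ambient space, so constant ambient vectors and their
  tangential projections take the place of local frames. All tensors become smooth maps on the whole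
  manifold, the second fundamental form is the derivative of the projection, and one commutator
  formula yields both its symmetry and the Codazzi equation.\<close>

abbreviation "Df f x \<equiv> frechet_derivative f (at x)"

section \<open>Closure properties of C^k and smooth maps\<close>

lemma Ck_cong:
  assumes "open S" "\<And>x. x \<in> S \<Longrightarrow> f x = g x"
  shows "Ck k S f \<longleftrightarrow> Ck k S g"
  using assms(2)
proof (induction k arbitrary: f g)
  case 0
  then show ?case by (simp cong: continuous_on_cong)
next
  case (Suc k)
  have imp: "Ck (Suc k) S b" if ab: "\<And>x. x \<in> S \<Longrightarrow> a x = b x" and A: "Ck (Suc k) S a" for a b :: "'a \<Rightarrow> 'b"
  proof -
    have d: "b differentiable (at x)" if x: "x \<in> S" for x
    proof -
      obtain D where "(a has_derivative D) (at x)" using A x by (auto simp: differentiable_def)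
      then have "(b has_derivative D) (at x)"
        using has_derivative_transform_within_open \<open>open S\<close> x ab by blast
      then show ?thesis by (auto simp: differentiable_def)
    qed
    have "Df a x = Df b x" if "x \<in> S" for x
      using frechet_derivative_transform_within_open[OF _ \<open>open S\<close> that, of a b] A that ab by auto
    then have "Ck k S (\<lambda>x. Df b x v)" for v
      using Suc.IH[of "\<lambda>x. Df a x v" "\<lambda>x. Df b x v"] A by auto
    with d show ?thesis by simp
  qed
  show ?case using imp[of f g] imp[of g f] Suc.prems by metis
qed

lemma Ck_subset: "Ck k S f \<Longrightarrow> T \<subseteq> S \<Longrightarrow> Ck k T f"
  by (induction k arbitrary: f) (auto intro: continuous_on_subset)

lemma Ck_SucD: "Ck (Suc k) S f \<Longrightarrow> Ck k S f"
proof (induction k arbitrary: f)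
  case 0
  then show ?case
    by (auto intro!: continuous_at_imp_continuous_on differentiable_imp_continuous_within)
qed auto

lemma Ck_has_derivative:
  "Ck (Suc k) S f \<Longrightarrow> x \<in> S \<Longrightarrow> (f has_derivative Df f x) (at x)"
  by (auto simp: frechet_derivative_works)

text \<open>Derivatives on an open set are unique, so an explicit \<open>f'\<close> may stand for
  \<open>frechet_derivative\<close>. Most closure properties below are inductions on the order in
  which \<open>f'\<close> is built from functions already covered.\<close>

lemma Ck_SucI:
  assumes "open S" "\<And>x. x \<in> S \<Longrightarrow> (f has_derivative f' x) (at x)" "\<And>v. Ck k S (\<lambda>x. f' x v)"
  shows "Ck (Suc k) S f"
proof -
  have "f' x = Df f x" if "x \<in> S" for x
    using frechet_derivative_at assms(2) that by blast
  then have "Ck k S (\<lambda>x. Df f x v)" for v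
    using Ck_cong[OF \<open>open S\<close>, of "\<lambda>x. f' x v" "\<lambda>x. Df f x v"] assms(3) by auto
  then show ?thesis using assms(2) by (auto simp: differentiable_def)
qed

lemma Ck_const: "Ck k S (\<lambda>x. c)"
  by (induction k arbitrary: c) (auto simp: frechet_derivative_const)

lemma Ck_bounded_linear:
  assumes "open S" "bounded_linear L" "Ck k S f"
  shows "Ck k S (\<lambda>x. L (f x))"
  using assms(3)
proof (induction k arbitrary: f)
  case 0
  then show ?case using bounded_linear.continuous_on[OF assms(2)] by simp
next
  case (Suc k)
  show ?case
  proof (rule Ck_SucI[OF assms(1)])
    show "((\<lambda>x. L (f x)) has_derivative (\<lambda>v. L (Df f x v))) (at x)" if "x \<in> S" for x
      using bounded_linear.has_derivative[OF assms(2) Ck_has_derivative[OF Suc.prems that]] .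
    show "Ck k S (\<lambda>x. L (Df f x v))" for v
      using Suc by simp
  qed
qed

lemma Ck_ident: "open S \<Longrightarrow> Ck k S (\<lambda>x. x)"
  by (cases k) (auto intro!: Ck_SucI[where f'="\<lambda>x v. v"] Ck_const derivative_eq_intros)

lemma Ck_add:
  assumes "open S" "Ck k S f" "Ck k S g"
  shows "Ck k S (\<lambda>x. f x + g x)"
  using assms(2,3)
proof (induction k arbitrary: f g)
  case 0
  then show ?case by (simp add: continuous_on_add)
next
  case (Suc k)
  show ?case
  proof (rule Ck_SucI[OF assms(1)])
    show "((\<lambda>x. f x + g x) has_derivative
        (\<lambda>v. Df f x v + Df g x v)) (at x)" if "x \<in> S" for x
      using Ck_has_derivative[OF Suc.prems(1) that] Ck_has_derivative[OF Suc.prems(2) that]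
      by (rule has_derivative_add)
    show "Ck k S (\<lambda>x. Df f x v + Df g x v)" for v
      using Suc by simp
  qed
qed

text \<open>Each term of the product rule keeps one factor undifferentiated; \<open>Ck_SucD\<close>
  lowers the order of that factor to the one in the induction hypothesis.\<close>

lemma Ck_bilinear:
  assumes "open S" "bounded_bilinear B" "Ck k S f" "Ck k S g"
  shows "Ck k S (\<lambda>x. B (f x) (g x))"
  using assms(3,4)
proof (induction k arbitrary: f g)
  case 0
  then show ?case by (simp add: bounded_bilinear.continuous_on[OF assms(2)])
next
  case (Suc k)
  show ?case
  proof (rule Ck_SucI[OF assms(1)])
    show "((\<lambda>x. B (f x) (g x)) has_derivative
        (\<lambda>v. B (f x) (Df g x v) + B (Df f x v) (g x))) (at x)" if "x \<in> S" for x
      using bounded_bilinear.FDERIV[OF assms(2) Ck_has_derivative[OF Suc.prems(1) that] Ck_has_derivative[OF Suc.prems(2) that]] .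
    show "Ck k S (\<lambda>x. B (f x) (Df g x v) + B (Df f x v) (g x))" for v
      using Suc.prems[THEN Ck_SucD] Suc.prems by (intro Ck_add assms(1) Suc.IH) auto
  qed
qed

lemma Ck_sum:
  "open S \<Longrightarrow> (\<And>i. i \<in> I \<Longrightarrow> Ck k S (f i)) \<Longrightarrow> Ck k S (\<lambda>x. \<Sum>i\<in>I. f i x)"
  by (induction I rule: infinite_finite_induct) (auto intro!: Ck_const Ck_add)

lemma linear_basis_expansion:
  fixes f :: "'a::euclidean_space \<Rightarrow> 'b::real_vector"
  assumes "linear f" shows "f w = (\<Sum>b\<in>Basis. (w \<bullet> b) *\<^sub>R f b)"
proof -
  have eq: "f (\<Sum>b\<in>Basis. (w \<bullet> b) *\<^sub>R b) = (\<Sum>b\<in>Basis. (w \<bullet> b) *\<^sub>R f b)"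
    by (simp only: linear_sum[OF assms] linear_cmul[OF assms])
  then show ?thesis by (simp only: euclidean_representation)
qed

text \<open>\<open>Ck\<close> only controls derivatives in fixed directions, but in the chain rule
  \<open>g\<close> is differentiated in the direction \<open>Df f x v\<close>, which moves with
  \<open>x\<close>. Expanding it in the basis makes the directions fixed; this is why the
  intermediate space is Euclidean.\<close>

lemma Ck_compose:
  fixes f :: "'e::real_normed_vector \<Rightarrow> 'b::euclidean_space" and g :: "'b \<Rightarrow> 'c::real_normed_vector"
  assumes "open S" "open T" "f ` S \<subseteq> T" "Ck k S f" "Ck k T g"
  shows "Ck k S (\<lambda>x. g (f x))"
  using assms(4,5)
proof (induction k arbitrary: g)
  case 0
  then show ?case using assms(3) by (auto intro: continuous_on_compose2)
next
  case (Suc k)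
  show ?case
  proof (rule Ck_SucI[OF assms(1)])
    fix x assume x: "x \<in> S"
    have gf: "((\<lambda>x. g (f x)) has_derivative
        (\<lambda>v. Df g (f x) (Df f x v))) (at x)"
      using diff_chain_at[OF Ck_has_derivative[OF Suc.prems(1) x] Ck_has_derivative[OF Suc.prems(2)], of ] x assms(3)
      by (auto simp: o_def)
    have lin: "linear (Df g (f x))"
      using Suc.prems(2) x assms(3) by (auto intro: linear_frechet_derivative)
    show "((\<lambda>x. g (f x)) has_derivative
        (\<lambda>v. (\<Sum>b\<in>Basis. (Df f x v \<bullet> b) *\<^sub>R Df g (f x) b))) (at x)"
      by (rule has_derivative_eq_rhs[OF gf]) (intro ext linear_basis_expansion lin)
  next
    show "Ck k S (\<lambda>x. \<Sum>b\<in>Basis. (Df f x v \<bullet> b) *\<^sub>R Df g (f x) b)" for v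
      using Suc.prems Ck_SucD[OF Suc.prems(1)]
      by (intro Ck_sum Ck_bilinear[OF _ bounded_bilinear_scaleR] assms(1) Suc.IH
          Ck_bounded_linear[OF _ bounded_linear_inner_left]) auto
  qed
qed

text \<open>The derivative is a product containing \<open>exp (f x)\<close> itself, to which the
  induction hypothesis on the order applies. Reciprocals and square roots follow the same
  pattern.\<close>

lemma Ck_exp:
  fixes f :: "'e::real_normed_vector \<Rightarrow> real"
  assumes "open S" "Ck k S f" shows "Ck k S (\<lambda>x. exp (f x))"
  using assms(2)
proof (induction k)
  case 0
  then show ?case by (auto intro!: continuous_intros)
next
  case (Suc k)
  show ?case
  proof (rule Ck_SucI[OF assms(1)])
    show "((\<lambda>x. exp (f x)) has_derivative (\<lambda>v. Df f x v * exp (f x))) (at x)" if "x \<in> S" for x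
      using Ck_has_derivative[OF Suc.prems that] by (auto intro!: derivative_eq_intros)
    show "Ck k S (\<lambda>x. Df f x v * exp (f x))" for v
      using Suc.prems by (intro Ck_bilinear[OF assms(1) bounded_bilinear_mult] Suc.IH Ck_SucD[OF Suc.prems]) auto
  qed
qed

lemma Ck_inverse:
  fixes f :: "'e::real_normed_vector \<Rightarrow> real"
  assumes "open S" "Ck k S f" "\<And>x. x \<in> S \<Longrightarrow> f x \<noteq> 0" shows "Ck k S (\<lambda>x. inverse (f x))"
  using assms(2)
proof (induction k)
  case 0
  then show ?case using assms by (auto intro!: continuous_intros)
next
  case (Suc k)
  show ?case
  proof (rule Ck_SucI[OF assms(1)])
    show "((\<lambda>x. inverse (f x)) has_derivative (\<lambda>v. (- 1) * (Df f x v * (inverse (f x) * inverse (f x))))) (at x)" if "x \<in> S" for x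
      using Ck_has_derivative[OF Suc.prems that] assms(3)[OF that] by (auto intro!: derivative_eq_intros)
    show "Ck k S (\<lambda>x. (- 1) * (Df f x v * (inverse (f x) * inverse (f x))))" for v
      using Suc.prems by (intro Ck_bilinear[OF assms(1) bounded_bilinear_mult] Ck_const Suc.IH Ck_SucD[OF Suc.prems]) auto
  qed
qed

lemma Ck_sqrt:
  fixes f :: "'e::real_normed_vector \<Rightarrow> real"
  assumes "open S" "Ck k S f" "\<And>x. x \<in> S \<Longrightarrow> f x > 0" shows "Ck k S (\<lambda>x. sqrt (f x))"
  using assms(2)
proof (induction k)
  case 0
  then show ?case using assms by (auto intro!: continuous_intros)
next
  case (Suc k)
  show ?case
  proof (rule Ck_SucI[OF assms(1)])
    show "((\<lambda>x. sqrt (f x)) has_derivative (\<lambda>v. (1/2) * (Df f x v * inverse (sqrt (f x))))) (at x)" if "x \<in> S" for x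
      using Ck_has_derivative[OF Suc.prems that] assms(3)[OF that]
      by (auto intro!: derivative_eq_intros simp: field_simps)
    have "sqrt (f x) \<noteq> 0" if "x \<in> S" for x using assms(3)[OF that] by simp
    then show "Ck k S (\<lambda>x. (1/2) * (Df f x v * inverse (sqrt (f x))))" for v
      using Suc.prems by (intro Ck_bilinear[OF assms(1) bounded_bilinear_mult] Ck_inverse Ck_const Suc.IH Ck_SucD[OF Suc.prems] assms(1)) auto
  qed
qed

lemma smooth_on_cong: "open S \<Longrightarrow> (\<And>x. x \<in> S \<Longrightarrow> f x = g x) \<Longrightarrow> smooth_on S f \<longleftrightarrow> smooth_on S g"
  unfolding smooth_on_def using Ck_cong by blast

lemma smooth_on_subset: "smooth_on S f \<Longrightarrow> T \<subseteq> S \<Longrightarrow> smooth_on T f"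
  unfolding smooth_on_def using Ck_subset by blast

lemma smooth_on_has_derivative:
  "smooth_on S f \<Longrightarrow> x \<in> S \<Longrightarrow> (f has_derivative Df f x) (at x)"
  unfolding smooth_on_def using Ck_has_derivative by blast

lemma smooth_on_differentiable: "smooth_on S f \<Longrightarrow> x \<in> S \<Longrightarrow> f differentiable (at x)"
  using smooth_on_has_derivative by (auto simp: differentiable_def)

lemma smooth_on_frechet: "smooth_on S f \<Longrightarrow> smooth_on S (\<lambda>x. Df f x v)"
  unfolding smooth_on_def by (metis Ck.simps(2))

lemma smooth_on_imp_continuous_on: "smooth_on S f \<Longrightarrow> continuous_on S f"
  unfolding smooth_on_def by (metis Ck.simps(1))

lemma smooth_on_const: "smooth_on S (\<lambda>x. c)"
  by (simp add: smooth_on_def Ck_const)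

lemma smooth_on_ident: "open S \<Longrightarrow> smooth_on S (\<lambda>x. x)"
  by (simp add: smooth_on_def Ck_ident)

lemma smooth_on_bounded_linear:
  "bounded_linear L \<Longrightarrow> open S \<Longrightarrow> smooth_on S f \<Longrightarrow> smooth_on S (\<lambda>x. L (f x))"
  by (simp add: smooth_on_def Ck_bounded_linear)

lemma smooth_on_bilinear:
  "bounded_bilinear B \<Longrightarrow> open S \<Longrightarrow> smooth_on S f \<Longrightarrow> smooth_on S g \<Longrightarrow> smooth_on S (\<lambda>x. B (f x) (g x))"
  by (simp add: smooth_on_def Ck_bilinear)

lemmas smooth_on_scaleR = smooth_on_bilinear[OF bounded_bilinear_scaleR]
lemmas smooth_on_inner = smooth_on_bilinear[OF bounded_bilinear_inner]
lemma smooth_on_mult: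
  fixes f :: "'e::real_normed_vector \<Rightarrow> real"
  shows "open S \<Longrightarrow> smooth_on S f \<Longrightarrow> smooth_on S g \<Longrightarrow> smooth_on S (\<lambda>x. f x * g x)"
  by (rule smooth_on_bilinear[OF bounded_bilinear_mult])

lemma smooth_on_add: "open S \<Longrightarrow> smooth_on S f \<Longrightarrow> smooth_on S g \<Longrightarrow> smooth_on S (\<lambda>x. f x + g x)"
  by (simp add: smooth_on_def Ck_add)

lemma smooth_on_minus: "open S \<Longrightarrow> smooth_on S f \<Longrightarrow> smooth_on S (\<lambda>x. - f x)"
  by (rule smooth_on_bounded_linear[OF bounded_linear_minus[OF bounded_linear_ident]])

lemma smooth_on_diff: "open S \<Longrightarrow> smooth_on S f \<Longrightarrow> smooth_on S g \<Longrightarrow> smooth_on S (\<lambda>x. f x - g x)"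
  using smooth_on_add[of S f "\<lambda>x. - g x"] smooth_on_minus[of S g] by simp

lemma smooth_on_sum:
  "open S \<Longrightarrow> (\<And>i. i \<in> I \<Longrightarrow> smooth_on S (f i)) \<Longrightarrow> smooth_on S (\<lambda>x. \<Sum>i\<in>I. f i x)"
  by (simp add: smooth_on_def Ck_sum)

lemma smooth_on_prod:
  fixes f :: "'i \<Rightarrow> 'e::real_normed_vector \<Rightarrow> real"
  assumes "open S" shows "(\<And>i. i \<in> I \<Longrightarrow> smooth_on S (f i)) \<Longrightarrow> smooth_on S (\<lambda>x. \<Prod>i\<in>I. f i x)"
  by (induction I rule: infinite_finite_induct) (auto intro!: smooth_on_const smooth_on_mult assms)

lemma smooth_on_exp: "open S \<Longrightarrow> smooth_on S f \<Longrightarrow> smooth_on S (\<lambda>x. exp (f x :: real))"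
  by (simp add: smooth_on_def Ck_exp)

lemma smooth_on_inverse:
  "open S \<Longrightarrow> smooth_on S f \<Longrightarrow> (\<And>x. x \<in> S \<Longrightarrow> f x \<noteq> 0) \<Longrightarrow> smooth_on S (\<lambda>x. inverse (f x :: real))"
  by (simp add: smooth_on_def Ck_inverse)

lemma smooth_on_divide:
  "open S \<Longrightarrow> smooth_on S f \<Longrightarrow> smooth_on S g \<Longrightarrow> (\<And>x. x \<in> S \<Longrightarrow> g x \<noteq> 0) \<Longrightarrow> smooth_on S (\<lambda>x. f x / g x :: real)"
  by (simp add: divide_inverse smooth_on_mult smooth_on_inverse)

lemma smooth_on_sqrt:
  "open S \<Longrightarrow> smooth_on S f \<Longrightarrow> (\<And>x. x \<in> S \<Longrightarrow> f x > 0) \<Longrightarrow> smooth_on S (\<lambda>x. sqrt (f x))"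
  by (simp add: smooth_on_def Ck_sqrt)

lemma smooth_on_compose:
  fixes f :: "'e::real_normed_vector \<Rightarrow> 'b::euclidean_space"
  shows "open S \<Longrightarrow> open T \<Longrightarrow> f ` S \<subseteq> T \<Longrightarrow> smooth_on S f \<Longrightarrow> smooth_on T g \<Longrightarrow> smooth_on S (\<lambda>x. g (f x))"
  by (simp add: smooth_on_def Ck_compose)

lemma smooth_on_euclideanI:
  fixes f :: "'e::real_normed_vector \<Rightarrow> 'b::euclidean_space"
  assumes "open S" "\<And>b. b \<in> Basis \<Longrightarrow> smooth_on S (\<lambda>x. f x \<bullet> b)"
  shows "smooth_on S f"
proof -
  have "smooth_on S (\<lambda>x. \<Sum>b\<in>Basis. (f x \<bullet> b) *\<^sub>R b)"
    by (intro smooth_on_sum smooth_on_scaleR assms smooth_on_const)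
  then show ?thesis by (simp add: euclidean_representation)
qed

lemma Ck_local:
  assumes "\<And>x. x \<in> S \<Longrightarrow> \<exists>U. open U \<and> x \<in> U \<and> Ck k U f"
  shows "Ck k S f"
  using assms
proof (induction k arbitrary: f)
  case 0
  show ?case
  proof (simp, rule continuous_at_imp_continuous_on, rule ballI)
    fix x assume "x \<in> S"
    then obtain U where "open U" "x \<in> U" "continuous_on U f" using 0 by auto
    then show "continuous (at x) f" by (simp add: continuous_on_eq_continuous_at)
  qed
next
  case (Suc k)
  have "Ck k S (\<lambda>x. Df f x v)" for v
  proof (rule Suc.IH)
    fix x assume "x \<in> S"
    then show "\<exists>U. open U \<and> x \<in> U \<and> Ck k U (\<lambda>x. Df f x v)"
      using Suc.prems[of x] by auto
  qed
  moreover have "f differentiable (at x)" if "x \<in> S" for x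
    using Suc.prems[OF that] by auto
  ultimately show ?case by simp
qed

lemma smooth_on_local:
  assumes "\<And>x. x \<in> S \<Longrightarrow> \<exists>U. open U \<and> x \<in> U \<and> smooth_on U f"
  shows "smooth_on S f"
  unfolding smooth_on_def by (metis Ck_local assms smooth_on_def)

lemma smooth_on_det:
  fixes M :: "'e::real_normed_vector \<Rightarrow> real^'n::finite^'n"
  assumes "open S" "\<And>i j. smooth_on S (\<lambda>x. M x $ i $ j)"
  shows "smooth_on S (\<lambda>x. det (M x))"
  unfolding det_def by (intro smooth_on_sum smooth_on_mult smooth_on_prod smooth_on_const assms)

section \<open>Smooth cutoff functions on Euclidean space\<close>

text \<open>The derivatives of \<open>exp (- 1 / t)\<close> are of the form \<open>p (1 / t) * exp (- 1 / t)\<close> with a polynomial \<open>p\<close>.\<close>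

definition flat :: "real poly \<Rightarrow> real \<Rightarrow> real" where
  "flat p t = (if t > 0 then poly p (inverse t) * exp (- inverse t) else 0)"

lemma poly_div_exp_tendsto_0: "((\<lambda>x. poly p x / exp x) \<longlongrightarrow> (0::real)) at_top"
proof -
  have "((\<lambda>x. \<Sum>i\<le>degree p. coeff p i * (x ^ i / exp x)) \<longlongrightarrow> (\<Sum>i\<le>degree p. coeff p i * 0)) at_top"
    by (intro tendsto_sum tendsto_mult tendsto_const tendsto_power_div_exp_0)
  then show ?thesis
    by (simp add: poly_altdef sum_divide_distrib)
qed

lemma flat_tendsto_0: "(flat p \<longlongrightarrow> 0) (at 0)"
proof -
  have "((\<lambda>t. poly p (inverse t) / exp (inverse t)) \<longlongrightarrow> 0) (at_right (0::real))"
    using filterlim_compose[OF poly_div_exp_tendsto_0 filterlim_inverse_at_top_right] .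
  moreover have "eventually (\<lambda>t. poly p (inverse t) / exp (inverse t) = flat p t) (at_right (0::real))"
    by (auto simp: flat_def exp_minus divide_inverse eventually_at_filter)
  ultimately have r: "(flat p \<longlongrightarrow> 0) (at_right 0)"
    using Lim_transform_eventually by blast
  have "eventually (\<lambda>t. 0 = flat p t) (at_left (0::real))"
    by (auto simp: flat_def eventually_at_filter)
  then have "(flat p \<longlongrightarrow> 0) (at_left 0)"
    using Lim_transform_eventually tendsto_const by blast
  with r show ?thesis by (simp add: filterlim_split_at_real)
qed

text \<open>With s = 1/t, hence ds/dt = -s^2, the derivative of p(s) exp(-s) in t is s^2 (p(s) -
  p'(s)) exp(-s). Differentiation therefore stays inside the family \<open>flat\<close>.\<close>

lemma flat_has_derivative: "(flat p has_real_derivative flat ([:0,0,1:] * (p - pderiv p)) t) (at t)"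
proof -
  consider "t < 0" | "t > 0" | "t = 0" by linarith
  then show ?thesis
  proof cases
    case 1
    have "((\<lambda>t. 0) has_real_derivative 0) (at t)" by simp
    then have "(flat p has_real_derivative 0) (at t)"
      using has_field_derivative_transform_within_open[of "\<lambda>t. 0" 0 t "{..<0}" "flat p"] 1
      by (auto simp: flat_def)
    then show ?thesis using 1 by (simp add: flat_def)
  next
    case 2
    have "((\<lambda>t. poly p (inverse t) * exp (- inverse t)) has_real_derivative
       flat ([:0,0,1:] * (p - pderiv p)) t) (at t)"
      using 2 by (auto intro!: derivative_eq_intros poly_DERIV[THEN DERIV_chain2]
          simp: flat_def field_simps power2_eq_square)
    then show ?thesis
      using has_field_derivative_transform_within_open[of "\<lambda>t. poly p (inverse t) * exp (- inverse t)" _ t "{0<..}" "flat p"] 2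
      by (auto simp: flat_def)
  next
    case 3
    \<comment> \<open>Dividing by h multiplies by s = 1/h, so the difference quotient at 0 is again
      a member of the family and tends to 0.\<close>
    have "eventually (\<lambda>h. flat ([:0,1:] * p) h = (flat p (0 + h) - flat p 0) / h) (at 0)"
      by (auto simp: flat_def eventually_at_filter field_simps)
    then have "((\<lambda>h. (flat p (0 + h) - flat p 0) / h) \<longlongrightarrow> 0) (at 0)"
      by (rule Lim_transform_eventually[OF flat_tendsto_0])
    then show ?thesis using 3 by (simp add: DERIV_def flat_def)
  qed
qed

lemma smooth_on_flat: "open S \<Longrightarrow> smooth_on S (flat p)"
  unfolding smooth_on_def
proof
  fix k assume S: "open S"
  show "Ck k S (flat p)"
  proof (induction k arbitrary: p)
    case 0
    show ?case
      by (auto intro!: continuous_at_imp_continuous_on DERIV_isCont[OF flat_has_derivative])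
  next
    case (Suc k)
    show ?case
    proof (rule Ck_SucI[OF S])
      show "(flat p has_derivative (\<lambda>v. flat ([:0,0,1:] * (p - pderiv p)) x * v)) (at x)" for x
        using flat_has_derivative by (simp add: has_field_derivative_def)
      show "Ck k S (\<lambda>x. flat ([:0,0,1:] * (p - pderiv p)) x * v)" for v
        by (intro Ck_bilinear[OF S bounded_bilinear_mult] Ck_const Suc.IH)
    qed
  qed
qed

text \<open>The denominator is positive because \<open>t\<close> and \<open>1 - t\<close> cannot
  both be nonpositive.\<close>

definition smooth_step :: "real \<Rightarrow> real" where
  "smooth_step t = flat 1 t / (flat 1 t + flat 1 (1 - t))"

lemma flat_1_sum_pos: "flat 1 t + flat 1 (1 - t) > 0"
  by (auto simp: flat_def intro: add_pos_nonneg add_nonneg_pos)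

lemma smooth_on_smooth_step: "smooth_on UNIV smooth_step"
proof -
  have 1: "smooth_on UNIV (\<lambda>t. flat 1 (1 - t))"
    by (rule smooth_on_compose[where T=UNIV, OF _ _ _ _ smooth_on_flat])
      (auto intro!: smooth_on_diff[where f="\<lambda>x. 1"] smooth_on_const smooth_on_ident)
  have "smooth_on UNIV (\<lambda>t. flat 1 t / (flat 1 t + flat 1 (1 - t)))"
    by (intro smooth_on_divide smooth_on_add smooth_on_flat 1 open_UNIV flat_1_sum_pos[THEN less_imp_neq, THEN not_sym])
  then show ?thesis unfolding smooth_step_def[abs_def] .
qed

lemma smooth_step_bounds: "0 \<le> smooth_step t" "smooth_step t \<le> 1"
  and smooth_step_eq_1: "t \<ge> 1 \<Longrightarrow> smooth_step t = 1"
  and smooth_step_eq_0: "t \<le> 0 \<Longrightarrow> smooth_step t = 0"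
  using flat_1_sum_pos[of t] by (auto simp: smooth_step_def flat_def field_simps)

text \<open>Built from the squared distance to \<open>x0\<close>, since the distance itself is not
  smooth at the centre, and rescaled so that radius \<open>r\<close> corresponds to the argument 1
  and radius \<open>s\<close> to 0.\<close>

lemma smooth_bump:
  fixes x0 :: "'e::euclidean_space"
  assumes "0 < r" "r < s"
  obtains b where "smooth_on UNIV b" "\<And>x. 0 \<le> b x" "\<And>x. b x \<le> (1::real)"
    "\<And>x. x \<in> cball x0 r \<Longrightarrow> b x = 1" "\<And>x. x \<notin> ball x0 s \<Longrightarrow> b x = 0"
proof
  let ?b = "\<lambda>x. smooth_step ((s\<^sup>2 - (x - x0) \<bullet> (x - x0)) / (s\<^sup>2 - r\<^sup>2))"
  have rs: "r\<^sup>2 < s\<^sup>2" using assms by (simp add: power_strict_mono)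
  show "smooth_on UNIV ?b"
    by (rule smooth_on_compose[where T=UNIV, OF _ _ _ _ smooth_on_smooth_step])
      (use rs in \<open>auto intro!: smooth_on_divide smooth_on_diff smooth_on_const smooth_on_inner smooth_on_ident\<close>)
  show "0 \<le> ?b x" "?b x \<le> 1" for x by (rule smooth_step_bounds)+
  have n: "(x - x0) \<bullet> (x - x0) = (dist x0 x)\<^sup>2" for x
    by (metis dist_commute dist_norm power2_norm_eq_inner)
  show "?b x = 1" if "x \<in> cball x0 r" for x
  proof (rule smooth_step_eq_1)
    have "(dist x0 x)\<^sup>2 \<le> r\<^sup>2" using that by (auto intro: power_mono)
    then show "1 \<le> (s\<^sup>2 - (x - x0) \<bullet> (x - x0)) / (s\<^sup>2 - r\<^sup>2)" using rs by (simp add: n)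
  qed
  show "?b x = 0" if "x \<notin> ball x0 s" for x
  proof (rule smooth_step_eq_0)
    have "s\<^sup>2 \<le> (dist x0 x)\<^sup>2" using that assms by (auto intro: power_mono)
    then show "(s\<^sup>2 - (x - x0) \<bullet> (x - x0)) / (s\<^sup>2 - r\<^sup>2) \<le> 0" using rs by (simp add: n divide_nonpos_pos)
  qed
qed

section \<open>Symmetry of second derivatives\<close>

lemma second_difference_MVT:
  fixes f :: "'e::real_normed_vector \<Rightarrow> real"
  assumes "smooth_on S f" "0 < s"
    and S: "\<And>a b. 0 \<le> a \<Longrightarrow> a \<le> s \<Longrightarrow> 0 \<le> b \<Longrightarrow> b \<le> s \<Longrightarrow> x + a *\<^sub>R u + b *\<^sub>R v \<in> S"
  shows "\<exists>a b. 0 \<le> a \<and> a \<le> s \<and> 0 \<le> b \<and> b \<le> s \<and>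
    f (x + s *\<^sub>R u + s *\<^sub>R v) - f (x + s *\<^sub>R v) - (f (x + s *\<^sub>R u) - f x) =
    s * s * Df (\<lambda>y. Df f y v) (x + a *\<^sub>R u + b *\<^sub>R v) u"
proof -
  let ?g = "\<lambda>b. f (x + s *\<^sub>R u + b *\<^sub>R v) - f (x + b *\<^sub>R v)"
  let ?g' = "\<lambda>b. Df f (x + s *\<^sub>R u + b *\<^sub>R v) v - Df f (x + b *\<^sub>R v) v"
  have line: "((\<lambda>b. h (y + b *\<^sub>R w)) has_real_derivative Df h (y + b *\<^sub>R w) w) (at b)"
    if "smooth_on S h" "y + b *\<^sub>R w \<in> S" for h :: "'e \<Rightarrow> real" and y w b
  proof -
    have hd: "(h has_derivative Df h (y + b *\<^sub>R w)) (at (y + b *\<^sub>R w))"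
      using smooth_on_has_derivative that by blast
    have "((\<lambda>b. y + b *\<^sub>R w) has_derivative (\<lambda>t. t *\<^sub>R w)) (at b)"
      by (auto intro!: derivative_eq_intros)
    from diff_chain_at[OF this hd]
    have "((\<lambda>b. h (y + b *\<^sub>R w)) has_derivative (\<lambda>t. Df h (y + b *\<^sub>R w) (t *\<^sub>R w))) (at b)"
      by (simp add: o_def)
    moreover have "Df h (y + b *\<^sub>R w) (t *\<^sub>R w) = Df h (y + b *\<^sub>R w) w * t" for t
      using linear_cmul[OF has_derivative_linear[OF hd]] by simp
    ultimately show ?thesis by (simp add: has_field_derivative_def)
  qed
  \<comment> \<open>The mean value theorem is applied twice: along \<open>v\<close> to the increment
    in direction \<open>u\<close>, then along \<open>u\<close> to the derivative in direction
    \<open>v\<close>.\<close>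
  have "\<exists>b>0. b < s \<and> ?g s - ?g 0 = (s - 0) * ?g' b"
  proof (rule MVT2[OF \<open>0 < s\<close>])
    fix b assume b: "0 \<le> b" "b \<le> s"
    show "(?g has_real_derivative ?g' b) (at b)"
      using line[OF assms(1), of "x + s *\<^sub>R u" b v] line[OF assms(1), of x b v] S[of s b] S[of 0 b] b \<open>0 < s\<close>
      by (intro DERIV_diff) auto
  qed
  then obtain b where b: "0 < b" "b < s" "?g s - ?g 0 = s * ?g' b" by auto
  let ?h = "\<lambda>a. Df f (x + b *\<^sub>R v + a *\<^sub>R u) v"
  have "\<exists>a>0. a < s \<and> ?h s - ?h 0 =
    (s - 0) * Df (\<lambda>y. Df f y v) (x + b *\<^sub>R v + a *\<^sub>R u) u"
  proof (rule MVT2[OF \<open>0 < s\<close>])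
    fix a assume a: "0 \<le> a" "a \<le> s"
    show "(?h has_real_derivative Df (\<lambda>y. Df f y v) (x + b *\<^sub>R v + a *\<^sub>R u) u) (at a)"
      using line[OF smooth_on_frechet[OF assms(1)], of "x + b *\<^sub>R v" a u v] S[of a b] a b
      by (simp add: algebra_simps)
  qed
  then obtain a where a: "0 < a" "a < s" "?h s - ?h 0 =
     s * Df (\<lambda>y. Df f y v) (x + b *\<^sub>R v + a *\<^sub>R u) u" by auto
  have "?g' b = ?h s - ?h 0" by (simp add: algebra_simps)
  with a b show ?thesis
    by (intro exI[of _ a] exI[of _ b]) (simp add: algebra_simps)
qed

text \<open>Both mixed derivatives, each at some point of the parallelogram spanned by
  \<open>s *\<^sub>R u\<close> and \<open>s *\<^sub>R v\<close>, equal the same second difference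
  divided by \<open>s * s\<close>. Continuity compares each with its value at
  \<open>x\<close>.\<close>

lemma frechet_derivative_symmetric_real:
  fixes f :: "'e::real_normed_vector \<Rightarrow> real"
  assumes "open S" "smooth_on S f" "x \<in> S"
  shows "Df (\<lambda>y. Df f y v) x u =
         Df (\<lambda>y. Df f y u) x v"
proof -
  let ?p = "\<lambda>y. Df (\<lambda>y. Df f y v) y u"
  let ?q = "\<lambda>y. Df (\<lambda>y. Df f y u) y v"
  have close: "\<bar>?p x - ?q x\<bar> \<le> 2 * e" if "e > 0" for e
  proof -
    have "continuous_on S ?p" "continuous_on S ?q"
      by (intro smooth_on_imp_continuous_on smooth_on_frechet assms)+
    then have "isCont ?p x" "isCont ?q x"
      using assms by (auto simp: continuous_on_eq_continuous_at)
    then obtain d1 d2 where d: "d1 > 0" "\<And>y. dist y x < d1 \<Longrightarrow> dist (?p y) (?p x) < e"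
      "d2 > 0" "\<And>y. dist y x < d2 \<Longrightarrow> dist (?q y) (?q x) < e"
      using \<open>e > 0\<close> unfolding continuous_at_eps_delta by metis
    obtain d3 where d3: "d3 > 0" "ball x d3 \<subseteq> S" using assms openE by blast
    define d where "d = Min {d1, d2, d3}"
    have dpos: "d > 0" using d d3 by (simp add: d_def)
    \<comment> \<open>Every point of the parallelogram is then within \<open>d / 2\<close> of
      \<open>x\<close>; the summand 1 only keeps the denominator positive.\<close>
    define s where "s = d / (2 * (norm u + norm v + 1))"
    have s: "s > 0" using dpos by (simp add: s_def add_nonneg_pos)
    have near: "dist (x + a *\<^sub>R u + b *\<^sub>R v) x < d" if "0 \<le> a" "a \<le> s" "0 \<le> b" "b \<le> s" for a b
    proof -
      have "dist (x + a *\<^sub>R u + b *\<^sub>R v) x \<le> a * norm u + b * norm v"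
        using norm_triangle_ineq[of "a *\<^sub>R u" "b *\<^sub>R v"] that by (simp add: dist_norm algebra_simps)
      also have "\<dots> \<le> s * norm u + s * norm v"
        using that by (intro add_mono mult_right_mono) auto
      also have "\<dots> \<le> s * (norm u + norm v + 1)" using s by (simp add: algebra_simps)
      also have "\<dots> = d / 2"
        using norm_ge_zero[of u] norm_ge_zero[of v] by (simp add: s_def field_simps del: norm_ge_zero)
      finally show ?thesis using dpos by simp
    qed
    have inS: "x + a *\<^sub>R u + b *\<^sub>R v \<in> S" if "0 \<le> a" "a \<le> s" "0 \<le> b" "b \<le> s" for a b
      using near[OF that] d3 by (auto simp: d_def subset_iff dist_commute)
    have inS': "x + a *\<^sub>R v + b *\<^sub>R u \<in> S" if "0 \<le> a" "a \<le> s" "0 \<le> b" "b \<le> s" for a b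
      using inS[of b a] that by (simp add: algebra_simps)
    obtain a b where ab: "0 \<le> a" "a \<le> s" "0 \<le> b" "b \<le> s"
      "f (x + s *\<^sub>R u + s *\<^sub>R v) - f (x + s *\<^sub>R v) - (f (x + s *\<^sub>R u) - f x) = s * s * ?p (x + a *\<^sub>R u + b *\<^sub>R v)"
      using second_difference_MVT[OF assms(2) s inS] by blast
    obtain a' b' where ab': "0 \<le> a'" "a' \<le> s" "0 \<le> b'" "b' \<le> s"
      "f (x + s *\<^sub>R v + s *\<^sub>R u) - f (x + s *\<^sub>R u) - (f (x + s *\<^sub>R v) - f x) = s * s * ?q (x + a' *\<^sub>R v + b' *\<^sub>R u)"
      using second_difference_MVT[OF assms(2) s inS'] by blast
    have "s * s * ?p (x + a *\<^sub>R u + b *\<^sub>R v) = s * s * ?q (x + a' *\<^sub>R v + b' *\<^sub>R u)"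
      unfolding ab(5)[symmetric] ab'(5)[symmetric] by (simp add: algebra_simps)
    then have eq: "?p (x + a *\<^sub>R u + b *\<^sub>R v) = ?q (x + a' *\<^sub>R v + b' *\<^sub>R u)"
      using s by simp
    have "dist (x + a *\<^sub>R u + b *\<^sub>R v) x < d1" "dist (x + a' *\<^sub>R v + b' *\<^sub>R u) x < d2"
      using near[of a b] near[of b' a'] ab ab' by (auto simp: d_def algebra_simps)
    then have "\<bar>?p (x + a *\<^sub>R u + b *\<^sub>R v) - ?p x\<bar> < e" "\<bar>?q (x + a' *\<^sub>R v + b' *\<^sub>R u) - ?q x\<bar> < e"
      using d by (auto simp: dist_real_def)
    then show ?thesis using eq by linarith
  qed
  show ?thesis
  proof (rule ccontr)
    assume "?p x \<noteq> ?q x"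
    then show False using close[of "\<bar>?p x - ?q x\<bar> / 4"] by simp
  qed
qed

lemma frechet_derivative_symmetric:
  fixes f :: "'e::real_normed_vector \<Rightarrow> 'b::euclidean_space"
  assumes S: "open S" and f: "smooth_on S f" and x: "x \<in> S"
  shows "Df (\<lambda>y. Df f y v) x u =
         Df (\<lambda>y. Df f y u) x v"
proof (rule euclidean_eqI)
  fix b :: 'b assume "b \<in> Basis"
  have inner: "Df (\<lambda>y. h y \<bullet> b) y w = Df h y w \<bullet> b"
    if "smooth_on S h" "y \<in> S" for h :: "'e \<Rightarrow> 'b" and y w
    using frechet_derivative_at[OF bounded_linear.has_derivative[OF bounded_linear_inner_left smooth_on_has_derivative[OF that]], of b]
    by metis
  have two: "Df (\<lambda>y. Df (\<lambda>y. f y \<bullet> b) y v) x u =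
      Df (\<lambda>y. Df f y v) x u \<bullet> b" for u v
  proof -
    have "Df (\<lambda>y. Df (\<lambda>y. f y \<bullet> b) y v) x u =
        Df (\<lambda>y. Df f y v \<bullet> b) x u"
    proof (rule fun_cong[OF frechet_derivative_transform_within_open[OF _ S x]])
      show "(\<lambda>y. Df (\<lambda>y. f y \<bullet> b) y v) differentiable at x"
        by (intro smooth_on_differentiable[OF _ x] smooth_on_frechet
            smooth_on_bounded_linear[OF bounded_linear_inner_left] S f)
    qed (simp add: inner f)
    also have "\<dots> = Df (\<lambda>y. Df f y v) x u \<bullet> b"
      by (rule inner[OF smooth_on_frechet[OF f] x])
    finally show ?thesis .
  qed
  have "smooth_on S (\<lambda>y. f y \<bullet> b)"
    by (intro smooth_on_bounded_linear[OF bounded_linear_inner_left] S f)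
  from frechet_derivative_symmetric_real[OF S this x, of v u]
  show "Df (\<lambda>y. Df f y v) x u \<bullet> b =
        Df (\<lambda>y. Df f y u) x v \<bullet> b"
    by (simp add: two)
qed

section \<open>Integrals of derivatives of compactly supported functions\<close>

lemma integral_translation_difference:
  fixes a :: "'e::euclidean_space \<Rightarrow> real"
  assumes "integrable lborel a"
  shows "integrable lborel (\<lambda>x. a (x + h))" "(LINT x|lborel. a (x + h)) = (LINT x|lborel. a x)"
proof -
  have m: "(\<lambda>x. x + h) \<in> measurable lborel borel" "a \<in> borel_measurable borel"
    using assms by auto
  have d: "distr lborel borel (\<lambda>x. x + h) = lborel"
  proof -
    have "(\<lambda>x. x + h) = (+) h" by (auto simp: add.commute)
    then show ?thesis using lborel_distr_plus[of h] by simp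
  qed
  show "integrable lborel (\<lambda>x. a (x + h))"
    using integrable_distr_eq[OF m] d assms by simp
  show "(LINT x|lborel. a (x + h)) = (LINT x|lborel. a x)"
    using integral_distr[OF m] d by simp
qed

text \<open>The difference quotients in direction \<open>e\<close> have integral 0 by translation
  invariance, and they converge to the derivative under a common integrable bound. Iterated
  integrals are avoided.\<close>

lemma integral_directional_derivative_eq_0:
  fixes a :: "'e::euclidean_space \<Rightarrow> real"
  assumes der: "\<And>x. (a has_derivative a' x) (at x)"
    and cont: "continuous_on UNIV (\<lambda>x. a' x e)"
    and supp: "\<And>x. x \<notin> cball 0 R \<Longrightarrow> a x = 0"
  shows "integrable lborel (\<lambda>x. a' x e)" "(LINT x|lborel. a' x e) = 0"
proof -
  have cont_a: "continuous_on UNIV a"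
    by (intro continuous_at_imp_continuous_on ballI has_derivative_continuous[OF der])
  have ind_int: "integrable lborel (\<lambda>x. indicator (cball 0 r) x * g x)" if "continuous_on UNIV g"
    for g :: "'e \<Rightarrow> real" and r
    using borel_integrable_compact[of "cball 0 r" g] continuous_on_subset[OF that]
    by (simp add: indicator_def if_distrib cong: if_cong)
  have a_int: "integrable lborel a"
  proof -
    have "(\<lambda>x. indicator (cball 0 R) x * a x) = a" using supp by (auto simp: indicator_def fun_eq_iff)
    then show ?thesis using ind_int[OF cont_a, of R] by simp
  qed
  have supp': "a' x e = 0" if "x \<notin> cball 0 R" for x
  proof -
    have "((\<lambda>x. 0) has_derivative (\<lambda>v. 0)) (at x)" by simp
    then have "(a has_derivative (\<lambda>v. 0)) (at x)"
      by (rule has_derivative_transform_within_open[where s="- cball 0 R"]) (use supp that in auto)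
    then show ?thesis using der[of x] has_derivative_unique by metis
  qed
  show a'_int: "integrable lborel (\<lambda>x. a' x e)"
  proof -
    have "(\<lambda>x. indicator (cball 0 R) x * a' x e) = (\<lambda>x. a' x e)" using supp' by (auto simp: indicator_def fun_eq_iff)
    then show ?thesis using ind_int[OF cont, of R] by simp
  qed
  obtain M where M: "\<And>x. \<bar>a' x e\<bar> \<le> M" "M \<ge> 0"
  proof -
    have "compact ((\<lambda>x. a' x e) ` cball 0 R)"
      by (intro compact_continuous_image continuous_on_subset[OF cont]) auto
    then obtain M where "\<And>x. x \<in> cball 0 R \<Longrightarrow> \<bar>a' x e\<bar> \<le> M"
      using compact_imp_bounded bounded_real by (metis image_eqI)
    then have "\<bar>a' x e\<bar> \<le> max M 0" for x using supp'[of x] by (cases "x \<in> cball 0 R") (auto simp: le_max_iff_disj)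
    then show ?thesis using that[of "max M 0"] by auto
  qed
  define q where "q = (\<lambda>(k::nat) x. real (Suc k) * (a (x + inverse (real (Suc k)) *\<^sub>R e) - a x))"
  have q0: "(LINT x|lborel. q k x) = 0" for k
    using integral_translation_difference[OF a_int, of "inverse (real (Suc k)) *\<^sub>R e"] a_int
    by (simp add: q_def)
  have dline: "((\<lambda>t. a (x + t *\<^sub>R e)) has_real_derivative a' (x + t *\<^sub>R e) e) (at t)" for x t
  proof -
    have "((\<lambda>t. x + t *\<^sub>R e) has_derivative (\<lambda>t. t *\<^sub>R e)) (at t)"
      by (auto intro!: derivative_eq_intros)
    from diff_chain_at[OF this der]
    have "((\<lambda>t. a (x + t *\<^sub>R e)) has_derivative (\<lambda>s. a' (x + t *\<^sub>R e) (s *\<^sub>R e))) (at t)"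
      by (simp add: o_def)
    moreover have "a' (x + t *\<^sub>R e) (s *\<^sub>R e) = a' (x + t *\<^sub>R e) e * s" for s
      using linear_cmul[OF has_derivative_linear[OF der]] by simp
    ultimately show ?thesis by (simp add: has_field_derivative_def)
  qed
  have lim: "(\<lambda>k. q k x) \<longlonglongrightarrow> a' x e" for x
  proof -
    have "((\<lambda>h. (a (x + (0 + h) *\<^sub>R e) - a (x + 0 *\<^sub>R e)) / h) \<longlongrightarrow> a' x e) (at 0)"
      using dline[of x 0] unfolding DERIV_def by simp
    moreover have "filterlim (\<lambda>k. inverse (real (Suc k))) (at 0) sequentially"
      by (simp add: filterlim_at LIMSEQ_inverse_real_of_nat del: of_nat_Suc)
    ultimately have "(\<lambda>k. (a (x + (0 + inverse (real (Suc k))) *\<^sub>R e) - a (x + 0 *\<^sub>R e)) / inverse (real (Suc k))) \<longlonglongrightarrow> a' x e"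
      by (rule filterlim_compose)
    then show ?thesis by (simp add: q_def divide_inverse mult.commute del: of_nat_Suc)
  qed
  \<comment> \<open>The mean value theorem bounds the quotient by \<open>M\<close>. The step length
    is at most 1, so the support grows by at most \<open>norm e\<close>.\<close>
  have bound: "\<bar>q k x\<bar> \<le> indicator (cball 0 (R + norm e)) x * M" for k x
  proof -
    let ?t = "inverse (real (Suc k))"
    have t: "0 < ?t" "?t \<le> 1" by (auto simp: field_simps)
    have "\<exists>z>0. z < ?t \<and> a (x + ?t *\<^sub>R e) - a (x + 0 *\<^sub>R e) = (?t - 0) * a' (x + z *\<^sub>R e) e"
      by (rule MVT2[OF t(1)]) (rule dline)
    then obtain z where "a (x + ?t *\<^sub>R e) - a x = ?t * a' (x + z *\<^sub>R e) e" by auto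
    then have "q k x = a' (x + z *\<^sub>R e) e"
      unfolding q_def by (simp del: of_nat_Suc add: field_simps)
    then have 1: "\<bar>q k x\<bar> \<le> M" using M by simp
    have "q k x = 0" if "x \<notin> cball 0 (R + norm e)"
    proof -
      have "norm (?t *\<^sub>R e) \<le> norm e" using t by (simp add: mult_left_le_one_le del: of_nat_Suc)
      then have "norm x \<le> norm (x + ?t *\<^sub>R e) + norm e" "R + norm e < norm x"
        using norm_triangle_ineq4[of "x + ?t *\<^sub>R e" "?t *\<^sub>R e"] that by (auto simp del: of_nat_Suc)
      then have "x \<notin> cball 0 R" "x + ?t *\<^sub>R e \<notin> cball 0 R" using norm_ge_zero[of e] by (auto simp del: of_nat_Suc norm_ge_zero)
      then show ?thesis using supp by (simp add: q_def del: of_nat_Suc)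
    qed
    then show ?thesis using 1 by (auto simp: indicator_def)
  qed
  have "(\<lambda>k. LINT x|lborel. q k x) \<longlonglongrightarrow> (LINT x|lborel. a' x e)"
  proof (rule integral_dominated_convergence[where w="\<lambda>x::'e. indicator (cball 0 (R + norm e)) x * M"])
    show "(\<lambda>x. a' x e) \<in> borel_measurable lborel" using a'_int by auto
    show "q k \<in> borel_measurable lborel" for k
      unfolding q_def using integral_translation_difference(1)[OF a_int] a_int
      by (intro borel_measurable_times borel_measurable_diff borel_measurable_const borel_measurable_integrable)
    show "integrable lborel (\<lambda>x::'e. indicator (cball 0 (R + norm e)) x * M)"
      by (rule ind_int[OF continuous_on_const])
  qed (use lim bound in auto)
  then have "(\<lambda>k. 0) \<longlonglongrightarrow> (LINT x|lborel. a' x e)" by (simp add: q0)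
  then show "(LINT x|lborel. a' x e) = 0" by (simp add: LIMSEQ_const_iff)
qed

section \<open>Immersions\<close>

lemma has_derivative_det:
  fixes M :: "'e::real_normed_vector \<Rightarrow> real^'n::finite^'n"
  assumes "\<And>i j. ((\<lambda>x. M x $ i $ j) has_derivative (\<lambda>v. M' v $ i $ j)) (at x)"
  shows "((\<lambda>x. det (M x)) has_derivative (\<lambda>v. \<Sum>i\<in>UNIV. det (\<chi> a. if a = i then M' v $ i else M x $ a))) (at x)"
proof -
  have "((\<lambda>x. \<Sum>p | p permutes UNIV. of_int (sign p) * (\<Prod>i\<in>UNIV. M x $ i $ p i)) has_derivative
    (\<lambda>v. \<Sum>p | p permutes UNIV. of_int (sign p) * (\<Sum>i\<in>UNIV. M' v $ i $ p i * (\<Prod>j\<in>UNIV - {i}. M x $ j $ p j)))) (at x)"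
    by (intro has_derivative_sum has_derivative_mult_right has_derivative_prod assms)
  moreover have "(\<Sum>p | p permutes (UNIV::'n set). of_int (sign p) * (\<Sum>i\<in>UNIV. M' v $ i $ p i * (\<Prod>j\<in>UNIV - {i}. M x $ j $ p j)))
     = (\<Sum>i\<in>UNIV. det (\<chi> a. if a = i then M' v $ i else M x $ a))" for v
  proof -
    have "M' v $ i $ p i * (\<Prod>j\<in>UNIV - {i}. M x $ j $ p j) =
      (\<Prod>a\<in>UNIV. (\<chi> a. if a = i then M' v $ i else M x $ a) $ a $ p a)" for i and p :: "'n \<Rightarrow> 'n"
      by (subst prod.remove[of UNIV i]) (auto intro!: prod.cong)
    then have "(\<Sum>p | p permutes (UNIV::'n set). of_int (sign p) * (\<Sum>i\<in>UNIV. M' v $ i $ p i * (\<Prod>j\<in>UNIV - {i}. M x $ j $ p j)))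
      = (\<Sum>p | p permutes (UNIV::'n set). \<Sum>i\<in>UNIV. of_int (sign p) * (\<Prod>a\<in>UNIV. (\<chi> a. if a = i then M' v $ i else M x $ a) $ a $ p a))"
      by (simp add: sum_distrib_left)
    also have "\<dots> = (\<Sum>i\<in>UNIV. det (\<chi> a. if a = i then M' v $ i else M x $ a))"
      unfolding det_def by (rule sum.swap)
    finally show ?thesis .
  qed
  ultimately show ?thesis unfolding det_def by simp
qed

lemma vec_basis_expansion: "a = (\<Sum>j\<in>UNIV. a $ j *\<^sub>R axis j (1::real))"
  by (simp add: vec_eq_iff axis_def if_distrib[of "\<lambda>x. _ * x"] cong: if_cong)

lemma linear_axis_expansion:
  fixes f :: "real^'n::finite \<Rightarrow> 'b::real_vector"
  assumes "linear f" shows "f a = (\<Sum>j\<in>UNIV. a $ j *\<^sub>R f (axis j 1))"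
proof -
  have eq: "f (\<Sum>j\<in>UNIV. a $ j *\<^sub>R axis j 1) = (\<Sum>j\<in>UNIV. a $ j *\<^sub>R f (axis j 1))"
    by (simp only: linear_sum[OF assms] linear_cmul[OF assms])
  then show ?thesis by (simp only: vec_basis_expansion[of a, symmetric])
qed

section \<open>Coordinate calculus of a parametrized immersion\<close>

locale local_immersion =
  fixes V :: "(real^'n::finite) set" and G :: "real^'n \<Rightarrow> real^'m::finite"
  assumes open_V: "open V" and smooth_G: "smooth_on V G"
    and inj_G: "\<And>x. x \<in> V \<Longrightarrow> inj (Df G x)"
begin

definition J :: "real^'n \<Rightarrow> 'n \<Rightarrow> real^'m" where
  "J x j = Df G x (axis j 1)"

definition gram :: "real^'n \<Rightarrow> real^'n^'n" where
  "gram x = (\<chi> i j. J x i \<bullet> J x j)"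

text \<open>The frame dual to \<open>J\<close>: the coefficients are the inverse Gram matrix, by Cramer's rule.\<close>

definition K :: "real^'n \<Rightarrow> 'n \<Rightarrow> real^'m" where
  "K x j = (\<Sum>i\<in>UNIV. (det (\<chi> k l. if l = i then axis j 1 $ k else gram x $ k $ l) / det (gram x)) *\<^sub>R J x i)"

text \<open>The orthogonal projection onto the range of the differential, in a form that is visibly
  smooth in \<open>x\<close>.\<close>

definition P :: "real^'n \<Rightarrow> real^'m \<Rightarrow> real^'m" where
  "P x u = (\<Sum>k\<in>UNIV. (J x k \<bullet> u) *\<^sub>R K x k)"

lemma gram_det_eq: "gram_det G x = det (gram x)"
  by (simp add: gram_det_def gram_def J_def)

lemma dG_linear: "x \<in> V \<Longrightarrow> linear (Df G x)"
  using smooth_on_differentiable[OF smooth_G] by (rule linear_frechet_derivative)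

lemma dG_eq: "x \<in> V \<Longrightarrow> Df G x a = (\<Sum>j\<in>UNIV. a $ j *\<^sub>R J x j)"
  unfolding J_def by (rule linear_axis_expansion[OF dG_linear])

lemma gram_quadratic: "x \<in> V \<Longrightarrow> (gram x *v a) \<bullet> a = (norm (Df G x a))\<^sup>2"
  unfolding inner_vec_def[of "gram x *v a" a]
  unfolding dG_eq power2_norm_eq_inner matrix_vector_mult_def gram_def
  by (simp add: inner_sum_left inner_sum_right sum_distrib_left sum_distrib_right mult_ac inner_commute)

text \<open>All matrices on the segment from the identity to the Gram matrix are positive definite,
  hence invertible. The determinant is 1 at one end and cannot change sign on the way, which is how
  its positivity at the other end is obtained.\<close>

lemma convex_gram_det_nz:
  assumes "x \<in> V" "0 \<le> t" "t \<le> 1"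
  shows "det ((1 - t) *\<^sub>R mat 1 + t *\<^sub>R gram x) \<noteq> 0"
proof
  assume "det ((1 - t) *\<^sub>R mat 1 + t *\<^sub>R gram x) = 0"
  then obtain a where a: "a \<noteq> 0" "((1 - t) *\<^sub>R mat 1 + t *\<^sub>R gram x) *v a = 0"
    using invertible_det_nz matrix_left_invertible_ker invertible_left_inverse by metis
  have dGa: "Df G x a \<noteq> 0"
    using inj_G[OF assms(1)] a(1) dG_linear[OF assms(1)] linear_injective_0 by blast
  have "0 = (((1 - t) *\<^sub>R mat 1 + t *\<^sub>R gram x) *v a) \<bullet> a" using a by simp
  also have "\<dots> = (1 - t) * (norm a)\<^sup>2 + t * (norm (Df G x a))\<^sup>2"
    by (simp add: matrix_vector_mult_add_rdistrib scaleR_matrix_vector_assoc[symmetric] inner_add_left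
        gram_quadratic assms power2_norm_eq_inner)
  also have "\<dots> > 0"
  proof (cases "t = 0")
    case False
    then show ?thesis using assms dGa by (intro add_nonneg_pos) auto
  qed (use a in simp)
  finally show False by simp
qed

lemma gram_det_pos: assumes "x \<in> V" shows "det (gram x) > 0"
proof (rule ccontr)
  assume neg: "\<not> det (gram x) > 0"
  let ?f = "\<lambda>t. det ((1 - t) *\<^sub>R mat 1 + t *\<^sub>R gram x)"
  have "continuous_on {0..1} ?f"
    unfolding det_def by (intro continuous_intros)
  moreover have "?f 1 \<le> 0" "0 \<le> ?f 0" using neg by auto
  ultimately obtain t where "0 \<le> t" "t \<le> 1" "?f t = 0"
    using IVT2'[of ?f 1 0 0] by auto
  then show False using convex_gram_det_nz[OF assms] by blast
qed

lemma smooth_J: "smooth_on V (\<lambda>x. J x j)"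
  unfolding J_def by (rule smooth_on_frechet[OF smooth_G])

lemma smooth_gram: "smooth_on V (\<lambda>x. gram x $ i $ j)"
  by (simp add: gram_def smooth_on_inner smooth_J open_V)

lemma smooth_det_gram: "smooth_on V (\<lambda>x. det (gram x))"
  by (rule smooth_on_det[OF open_V smooth_gram])

lemma smooth_K: "smooth_on V (\<lambda>x. K x j)"
proof -
  have "smooth_on V (\<lambda>x. det (\<chi> k l. if l = i then axis j 1 $ k else gram x $ k $ l))" for i
  proof (rule smooth_on_det[OF open_V])
    show "smooth_on V (\<lambda>x. (\<chi> k l. if l = i then axis j 1 $ k else gram x $ k $ l) $ a $ b)" for a b
      by (cases "b = i") (auto simp: smooth_on_const smooth_gram)
  qed
  moreover have "det (gram x) \<noteq> 0" if "x \<in> V" for x using gram_det_pos[OF that] by simp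
  ultimately show ?thesis
    unfolding K_def by (intro smooth_on_sum smooth_on_scaleR smooth_on_divide smooth_det_gram smooth_J open_V)
qed

lemma smooth_P: "smooth_on V (\<lambda>x. P x u)"
  unfolding P_def
  by (intro smooth_on_sum smooth_on_scaleR smooth_on_inner smooth_J smooth_K smooth_on_const open_V)

lemma K_J: assumes "x \<in> V" shows "K x j \<bullet> J x k = (if j = k then 1 else 0)"
proof -
  define y where "y = (\<chi> i. det (\<chi> k l. if l = i then axis j 1 $ k else gram x $ k $ l) / det (gram x))"
  have "det (gram x) \<noteq> 0" using gram_det_pos[OF assms] by simp
  then have "gram x *v y = axis j 1"
    using cramer[of "gram x" y "axis j 1"] by (simp add: y_def)
  then have "(gram x *v y) $ k = axis j 1 $ k" by simp
  moreover have "K x j = (\<Sum>i\<in>UNIV. y $ i *\<^sub>R J x i)" by (simp add: K_def y_def)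
  ultimately show ?thesis
    by (simp add: matrix_vector_mult_def gram_def inner_sum_right axis_def inner_commute mult.commute)
qed

lemma J_in_range: "J x j \<in> range (Df G x)"
  by (simp add: J_def)

lemma subspace_range: "x \<in> V \<Longrightarrow> subspace (range (Df G x))"
  using linear_subspace_image[OF dG_linear subspace_UNIV] .

lemma K_in_range: "x \<in> V \<Longrightarrow> K x j \<in> range (Df G x)"
  unfolding K_def using subspace_range J_in_range by (intro subspace_sum subspace_scale) auto

lemma P_in_range: "x \<in> V \<Longrightarrow> P x u \<in> range (Df G x)"
  unfolding P_def using subspace_range K_in_range by (intro subspace_sum subspace_scale) auto

lemma P_J: "x \<in> V \<Longrightarrow> (u - P x u) \<bullet> J x k = 0"
  by (simp add: P_def inner_diff_left inner_sum_left K_J inner_commute[of u] if_distrib[of "\<lambda>y. _ * y"] cong: if_cong)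

lemma P_orthogonal: "x \<in> V \<Longrightarrow> w \<in> range (Df G x) \<Longrightarrow> (u - P x u) \<bullet> w = 0"
  using P_J by (auto simp: dG_eq inner_sum_right)

text \<open>The definition of \<open>P\<close> with the two frames exchanged: coefficients with
  respect to \<open>J\<close> are found by pairing with \<open>K\<close>. Both expansions are needed
  to treat \<open>J\<close> and \<open>K\<close> as dual frames in trace formulas.\<close>

lemma sum_K_J: assumes "x \<in> V" shows "P x u = (\<Sum>k\<in>UNIV. (K x k \<bullet> u) *\<^sub>R J x k)"
proof -
  obtain a where a: "P x u = Df G x a" using P_in_range[OF assms] by auto
  have "a $ k = K x k \<bullet> u" for k
  proof -
    have "K x k \<bullet> u = K x k \<bullet> P x u"
      using P_orthogonal[OF assms K_in_range[OF assms], of u k] by (simp add: inner_diff_left inner_commute[of "K x k"])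
    also have "\<dots> = a $ k"
      by (simp add: a dG_eq assms inner_sum_right K_J if_distrib[of "\<lambda>y. _ * y"] cong: if_cong)
    finally show ?thesis by simp
  qed
  then show ?thesis using a by (simp add: dG_eq assms)
qed

text \<open>The left inverse of the differential that annihilates normal vectors.\<close>

definition coord :: "real^'n \<Rightarrow> real^'m \<Rightarrow> real^'n" where
  "coord x u = (\<chi> j. K x j \<bullet> u)"

lemma dG_coord: "x \<in> V \<Longrightarrow> Df G x (coord x u) = P x u"
  by (simp add: dG_eq coord_def sum_K_J)

lemma coord_dG: "x \<in> V \<Longrightarrow> coord x (Df G x a) = a"
  by (simp add: dG_eq coord_def vec_eq_iff inner_sum_right K_J if_distrib[of "\<lambda>y. _ * y"] cong: if_cong)

lemma dJ_symmetric:
  "x \<in> V \<Longrightarrow> Df (\<lambda>y. J y k) x (axis j 1) = Df (\<lambda>y. J y j) x (axis k 1)"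
  unfolding J_def by (rule frechet_derivative_symmetric[OF open_V smooth_G])

text \<open>Jacobi's formula. The two halves of the derivative of
  \<open>J x i \<bullet> J x l\<close> contribute equally because the inverse Gram matrix is
  symmetric; the resulting factor 2 is removed by the square root in \<open>\<rho>\<close>.\<close>

lemma det_gram_has_derivative:
  assumes x: "x \<in> V"
  shows "((\<lambda>x. det (gram x)) has_derivative
    (\<lambda>v. 2 * det (gram x) * (\<Sum>k\<in>UNIV. K x k \<bullet> Df (\<lambda>y. J y k) x v))) (at x)"
proof -
  let ?d = "\<lambda>v k. Df (\<lambda>y. J y k) x v"
  define M' where "M' = (\<lambda>v. (\<chi> i l. J x i \<bullet> ?d v l + ?d v i \<bullet> J x l) :: real^'n^'n)"
  have J': "((\<lambda>y. J y k) has_derivative (\<lambda>v. ?d v k)) (at x)" for k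
    by (rule smooth_on_has_derivative[OF smooth_J x])
  have "((\<lambda>x. gram x $ i $ l) has_derivative (\<lambda>v. M' v $ i $ l)) (at x)" for i l
    using has_derivative_inner[OF J'[of i] J'[of l]] by (simp add: gram_def M'_def)
  from has_derivative_det[of gram M', OF this]
  have "((\<lambda>x. det (gram x)) has_derivative (\<lambda>v. \<Sum>i\<in>UNIV. det (\<chi> a. if a = i then M' v $ i else gram x $ a))) (at x)" .
  moreover have "(\<Sum>i\<in>UNIV. det (\<chi> a. if a = i then M' v $ i else gram x $ a)) =
     2 * det (gram x) * (\<Sum>k\<in>UNIV. K x k \<bullet> ?d v k)" for v
  proof -
    \<comment> \<open>The numbers \<open>K x l \<bullet> K x k\<close> are the entries of the
      inverse Gram matrix. So \<open>y i\<close> writes row \<open>i\<close> of the differentiated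
      matrix as a combination of the rows of the Gram matrix, and replacing that row multiplies the
      determinant by \<open>y i $ i\<close>.\<close>
    define y where "y = (\<lambda>i. (\<chi> k. \<Sum>l\<in>UNIV. M' v $ i $ l * (K x l \<bullet> K x k)) :: real^'n)"
    have rows: "M' v $ i = (\<Sum>k\<in>UNIV. y i $ k *s row k (gram x))" for i
    proof -
      have "(\<Sum>k\<in>UNIV. y i $ k * (J x k \<bullet> J x j)) = M' v $ i $ j" for j
      proof -
        have "(\<Sum>k\<in>UNIV. y i $ k * (J x k \<bullet> J x j)) =
            (\<Sum>l\<in>UNIV. M' v $ i $ l * (\<Sum>k\<in>UNIV. (K x k \<bullet> K x l) * (J x k \<bullet> J x j)))"
          unfolding y_def by (simp add: sum_distrib_left sum_distrib_right mult_ac inner_commute) (subst sum.swap, simp add: inner_commute)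
        also have "\<dots> = (\<Sum>l\<in>UNIV. M' v $ i $ l * (P x (K x l) \<bullet> J x j))"
          by (simp add: sum_K_J x inner_sum_left)
        also have "\<dots> = (\<Sum>l\<in>UNIV. M' v $ i $ l * (K x l \<bullet> J x j))"
          using P_J[OF x, of "K x _" j] by (simp add: inner_diff_left)
        also have "\<dots> = M' v $ i $ j" by (simp add: K_J x if_distrib[of "\<lambda>y. _ * y"] cong: if_cong)
        finally show ?thesis .
      qed
      then show ?thesis by (simp add: vec_eq_iff row_def gram_def)
    qed
    have "det (\<chi> a. if a = i then M' v $ i else gram x $ a) = y i $ i * det (gram x)" for i
      using cramer_lemma_transpose[of i "y i" "gram x"] rows[of i]
      by (simp add: row_def vec_lambda_eta[symmetric] cong: if_cong)
    moreover have "(\<Sum>i\<in>UNIV. y i $ i) = 2 * (\<Sum>k\<in>UNIV. K x k \<bullet> ?d v k)"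
    proof -
      have PK: "(\<Sum>l\<in>UNIV. (K x l \<bullet> K x i) *\<^sub>R J x l) = K x i" for i
      proof -
        have "(K x i - P x (K x i)) \<bullet> (K x i - P x (K x i)) = 0"
          using P_orthogonal[OF x subspace_diff[OF subspace_range[OF x] K_in_range[OF x] P_in_range[OF x]]] .
        then show ?thesis using sum_K_J[OF x, of "K x i"] by simp
      qed
      have "(\<Sum>i\<in>UNIV. y i $ i) = (\<Sum>i\<in>UNIV. \<Sum>l\<in>UNIV. (?d v i \<bullet> J x l) * (K x l \<bullet> K x i)) +
          (\<Sum>i\<in>UNIV. \<Sum>l\<in>UNIV. (?d v l \<bullet> J x i) * (K x l \<bullet> K x i))"
        by (simp add: y_def M'_def sum.distrib algebra_simps inner_commute)
      also have "(\<Sum>i\<in>UNIV. \<Sum>l\<in>UNIV. (?d v l \<bullet> J x i) * (K x l \<bullet> K x i)) =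
          (\<Sum>l\<in>UNIV. \<Sum>i\<in>UNIV. (?d v l \<bullet> J x i) * (K x i \<bullet> K x l))"
        by (subst sum.swap) (simp add: inner_commute)
      also have "(\<Sum>i\<in>UNIV. \<Sum>l\<in>UNIV. (?d v i \<bullet> J x l) * (K x l \<bullet> K x i)) =
          (\<Sum>i\<in>UNIV. ?d v i \<bullet> (\<Sum>l\<in>UNIV. (K x l \<bullet> K x i) *\<^sub>R J x l))"
        by (simp add: inner_sum_right mult.commute)
      finally show ?thesis by (simp only: PK) (simp add: inner_commute)
    qed
    ultimately show ?thesis by (simp add: sum_distrib_right[symmetric])
  qed
  ultimately show ?thesis by simp
qed

definition \<rho> :: "real^'n \<Rightarrow> real" where "\<rho> x = sqrt (det (gram x))"

lemma rho_pos: "x \<in> V \<Longrightarrow> \<rho> x > 0"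
  by (simp add: \<rho>_def gram_det_pos)

lemma smooth_rho: "smooth_on V \<rho>"
  unfolding \<rho>_def[abs_def] by (rule smooth_on_sqrt[OF open_V smooth_det_gram gram_det_pos])

lemma rho_has_derivative:
  assumes "x \<in> V"
  shows "(\<rho> has_derivative
    (\<lambda>v. \<rho> x * (\<Sum>k\<in>UNIV. K x k \<bullet> Df (\<lambda>y. J y k) x v))) (at x)"
proof -
  have p: "det (gram x) > 0" by (rule gram_det_pos[OF assms])
  have "((\<lambda>x. sqrt (det (gram x))) has_derivative
    (\<lambda>v. (2 * det (gram x) * (\<Sum>k\<in>UNIV. K x k \<bullet> Df (\<lambda>y. J y k) x v)) * (inverse (sqrt (det (gram x))) / 2))) (at x)"
    by (rule has_derivative_real_sqrt[OF p det_gram_has_derivative[OF assms]])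
  moreover have "det (gram x) * inverse (sqrt (det (gram x))) = sqrt (det (gram x))"
    using p real_div_sqrt[of "det (gram x)"] by (simp add: divide_inverse)
  then have "2 * det (gram x) * s * (inverse (sqrt (det (gram x))) / 2) = sqrt (det (gram x)) * s" for s
    by (simp add: algebra_simps)
  ultimately show ?thesis unfolding \<rho>_def[abs_def] by (simp only:)
qed

text \<open>The mean curvature vector, as the trace of the derivative of the tangential projection.\<close>

definition Hv :: "real^'n \<Rightarrow> real^'m" where
  "Hv x = (\<Sum>j\<in>UNIV. Df (\<lambda>y. P y (K x j)) x (axis j 1))"

text \<open>The right-hand side is the coordinate divergence of the vectors
  \<open>\<rho> x *\<^sub>R K x j\<close>, divided by \<open>\<rho> x\<close>; in this form the mean
  curvature appears in \<open>divergence_chart\<close>. The tangential terms match because the mixed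
  second derivatives of the immersion commute.\<close>

lemma Hv_eq:
  assumes x: "x \<in> V"
  shows "Hv x = (\<Sum>k\<in>UNIV. (\<Sum>j\<in>UNIV. K x j \<bullet> Df (\<lambda>y. J y j) x (axis k 1)) *\<^sub>R K x k) +
     (\<Sum>j\<in>UNIV. Df (\<lambda>y. K y j) x (axis j 1))"
proof -
  let ?dJ = "\<lambda>k v. Df (\<lambda>y. J y k) x v"
  let ?dK = "\<lambda>k v. Df (\<lambda>y. K y k) x v"
  have dP: "Df (\<lambda>y. P y u) x v =
     (\<Sum>k\<in>UNIV. (J x k \<bullet> u) *\<^sub>R ?dK k v + (?dJ k v \<bullet> u) *\<^sub>R K x k)" for u v
  proof -
    have "((\<lambda>y. P y u) has_derivative (\<lambda>v. \<Sum>k\<in>UNIV. (J x k \<bullet> u) *\<^sub>R ?dK k v + (?dJ k v \<bullet> u) *\<^sub>R K x k)) (at x)"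
      unfolding P_def
      by (intro has_derivative_sum has_derivative_scaleR has_derivative_inner_left
          smooth_on_has_derivative[OF smooth_J x] smooth_on_has_derivative[OF smooth_K x])
    from fun_cong[OF frechet_derivative_at[OF this], of v, symmetric] show ?thesis .
  qed
  have "Hv x = (\<Sum>j\<in>UNIV. \<Sum>k\<in>UNIV. (J x k \<bullet> K x j) *\<^sub>R ?dK k (axis j 1)) +
      (\<Sum>j\<in>UNIV. \<Sum>k\<in>UNIV. (?dJ k (axis j 1) \<bullet> K x j) *\<^sub>R K x k)"
    by (simp add: Hv_def dP sum.distrib)
  also have "(\<Sum>j\<in>UNIV. \<Sum>k\<in>UNIV. (J x k \<bullet> K x j) *\<^sub>R ?dK k (axis j 1)) = (\<Sum>j\<in>UNIV. ?dK j (axis j 1))"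
    by (simp add: inner_commute[of "J x _"] K_J x if_distrib[of "\<lambda>y. y *\<^sub>R _"] cong: if_cong)
  also have "(\<Sum>j\<in>UNIV. \<Sum>k\<in>UNIV. (?dJ k (axis j 1) \<bullet> K x j) *\<^sub>R K x k) =
      (\<Sum>j\<in>UNIV. \<Sum>k\<in>UNIV. (?dJ j (axis k 1) \<bullet> K x j) *\<^sub>R K x k)"
    using dJ_symmetric[OF x] by (intro sum.cong) simp_all
  also have "\<dots> = (\<Sum>k\<in>UNIV. (\<Sum>j\<in>UNIV. K x j \<bullet> ?dJ j (axis k 1)) *\<^sub>R K x k)"
    by (subst sum.swap) (simp add: scaleR_sum_left inner_commute)
  finally show ?thesis by simp
qed

definition \<omega> :: "real^'n \<Rightarrow> real" where "\<omega> x = exp ((norm (G x))\<^sup>2 / 4)"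

lemma omega_has_derivative:
  assumes x: "x \<in> V"
  shows "(\<omega> has_derivative (\<lambda>v. \<omega> x * ((G x \<bullet> Df G x v) / 2))) (at x)"
proof -
  have "((\<lambda>x. exp ((G x \<bullet> G x) / 4)) has_derivative
    (\<lambda>v. exp ((G x \<bullet> G x) / 4) * ((G x \<bullet> Df G x v + Df G x v \<bullet> G x) / 4))) (at x)"
    by (auto intro!: derivative_eq_intros smooth_on_has_derivative[OF smooth_G x])
  moreover have "(\<lambda>x. exp ((G x \<bullet> G x) / 4)) = \<omega>" by (simp add: \<omega>_def fun_eq_iff power2_norm_eq_inner)
  ultimately show ?thesis by (simp add: inner_commute fun_eq_iff[of \<omega>]  \<omega>_def power2_norm_eq_inner)
qed

lemma smooth_omega: "smooth_on V \<omega>"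
proof -
  have "smooth_on V (\<lambda>x. exp ((G x \<bullet> G x) / 4))"
    by (intro smooth_on_exp smooth_on_divide smooth_on_inner smooth_G smooth_on_const open_V) simp
  moreover have "(\<lambda>x. exp ((G x \<bullet> G x) / 4)) = \<omega>" by (simp add: \<omega>_def fun_eq_iff power2_norm_eq_inner)
  ultimately show ?thesis by simp
qed

text \<open>\<open>Z\<close> need not be tangential. The \<open>K x j \<bullet> Z x\<close> are the
  coordinates of its tangential part only, and the mean curvature term compensates for the normal
  part that the divergence of \<open>Z\<close> still contains.\<close>

lemma divergence_chart:
  assumes x: "x \<in> V" and Z: "smooth_on V Z"
  shows "(\<Sum>j\<in>UNIV. Df (\<lambda>y. \<rho> y * \<omega> y * (K y j \<bullet> Z y)) x (axis j 1)) =
    \<rho> x * \<omega> x * ((\<Sum>j\<in>UNIV. K x j \<bullet> Df Z x (axis j 1)) + (Hv x + (1/2) *\<^sub>R P x (G x)) \<bullet> Z x)"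
proof -
  let ?dJ = "\<lambda>k v. Df (\<lambda>y. J y k) x v"
  let ?dK = "\<lambda>k v. Df (\<lambda>y. K y k) x v"
  let ?dZ = "\<lambda>v. Df Z x v"
  let ?t = "\<lambda>v. \<Sum>k\<in>UNIV. K x k \<bullet> ?dJ k v"
  have d: "Df (\<lambda>y. \<rho> y * \<omega> y * (K y j \<bullet> Z y)) x v =
     \<rho> x * \<omega> x * ((?t v *\<^sub>R K x j + ((G x \<bullet> Df G x v) / 2) *\<^sub>R K x j + ?dK j v) \<bullet> Z x + K x j \<bullet> ?dZ v)" for j v
  proof -
    have "((\<lambda>y. \<rho> y * \<omega> y * (K y j \<bullet> Z y)) has_derivative (\<lambda>v. \<rho> x * \<omega> x * (K x j \<bullet> ?dZ v + ?dK j v \<bullet> Z x) +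
       (\<rho> x * (\<omega> x * ((G x \<bullet> Df G x v) / 2)) + \<rho> x * ?t v * \<omega> x) * (K x j \<bullet> Z x))) (at x)"
      by (intro has_derivative_mult has_derivative_inner rho_has_derivative omega_has_derivative x
          smooth_on_has_derivative[OF smooth_K x] smooth_on_has_derivative[OF Z x])
    from fun_cong[OF frechet_derivative_at[OF this], of v, symmetric] show ?thesis
      by (simp add: inner_add_left algebra_simps)
  qed
  have tK: "(\<Sum>j\<in>UNIV. ?t (axis j 1) *\<^sub>R K x j + ?dK j (axis j 1)) = Hv x"
    using Hv_eq[OF x] by (simp add: sum.distrib)
  have PG: "(\<Sum>j\<in>UNIV. ((G x \<bullet> Df G x (axis j 1)) / 2) *\<^sub>R K x j) = (1/2) *\<^sub>R P x (G x)"
    by (simp add: P_def J_def scaleR_sum_right inner_commute)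
  have "(\<Sum>j\<in>UNIV. Df (\<lambda>y. \<rho> y * \<omega> y * (K y j \<bullet> Z y)) x (axis j 1)) =
    \<rho> x * \<omega> x * (((\<Sum>j\<in>UNIV. ?t (axis j 1) *\<^sub>R K x j + ?dK j (axis j 1)) +
      (\<Sum>j\<in>UNIV. ((G x \<bullet> Df G x (axis j 1)) / 2) *\<^sub>R K x j)) \<bullet> Z x + (\<Sum>j\<in>UNIV. K x j \<bullet> ?dZ (axis j 1)))"
    unfolding d by (simp only: sum.distrib sum_distrib_left inner_add_left inner_sum_left distrib_left)
  then show ?thesis unfolding tK PG by (simp add: algebra_simps)
qed

text \<open>\<open>V\<close> and the complement of the compact set \<open>C\<close> are open and
  cover the space; the extension is smooth on the first and 0 on the second.\<close>

lemma has_derivative_zero_extension: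
  fixes f :: "real^'n \<Rightarrow> 'b::real_normed_vector"
  assumes f: "smooth_on V f" and C: "compact C" "C \<subseteq> V" "\<And>x. x \<in> V - C \<Longrightarrow> f x = 0"
  shows "((\<lambda>x. if x \<in> V then f x else 0) has_derivative
      (\<lambda>v. if x \<in> V then Df f x v else 0)) (at x)" (is "(?g has_derivative ?g' x) _")
    and "continuous_on UNIV (\<lambda>x. if x \<in> V then Df f x v else 0)"
proof -
  have cC: "open (- C)" using C(1) by (simp add: compact_imp_closed open_Compl)
  have z: "(?g has_derivative (\<lambda>v. 0)) (at x)" if "x \<notin> C" for x
    by (rule has_derivative_transform_within_open[OF has_derivative_const cC]) (use C that in auto)
  have d: "(?g has_derivative ?g' x) (at x)" for x
  proof (cases "x \<in> V")
    case True
    have "(f has_derivative Df f x) (at x)"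
      by (rule smooth_on_has_derivative[OF f True])
    then have "(?g has_derivative Df f x) (at x)"
      by (rule has_derivative_transform_within_open[OF _ open_V True]) auto
    then show ?thesis using True by simp
  next
    case False
    then show ?thesis using z[of x] C(2) by auto
  qed
  then show "(?g has_derivative ?g' x) (at x)" .
  have "continuous_on (V \<union> - C) (\<lambda>x. ?g' x v)"
  proof (rule continuous_on_open_Un[OF open_V cC])
    have "continuous_on V (\<lambda>x. Df f x v)"
      by (intro smooth_on_imp_continuous_on smooth_on_frechet f)
    then show "continuous_on V (\<lambda>x. ?g' x v)" by (simp cong: continuous_on_cong)
    have "?g' x = (\<lambda>v. 0)" if "x \<notin> C" for x
      using has_derivative_unique[OF d z[OF that]] .
    then have "continuous_on (- C) (\<lambda>x. ?g' x v) \<longleftrightarrow> continuous_on (- C) (\<lambda>x. 0::'b)"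
      by (intro continuous_on_cong refl) (metis ComplD)
    then show "continuous_on (- C) (\<lambda>x. ?g' x v)" by simp
  qed
  moreover have "V \<union> - C = UNIV" using C(2) by auto
  ultimately show "continuous_on UNIV (\<lambda>x. ?g' x v)" by simp
qed

lemma divergence_theorem_chart:
  assumes Z: "smooth_on V Z" and C: "compact C" "C \<subseteq> V" "\<And>x. x \<in> V - C \<Longrightarrow> Z x = 0"
  shows "(LINT x|lborel. (if x \<in> V then \<rho> x * \<omega> x * ((\<Sum>j\<in>UNIV. K x j \<bullet> Df Z x (axis j 1)) +
    (Hv x + (1/2) *\<^sub>R P x (G x)) \<bullet> Z x) else 0)) = 0"
proof -
  let ?a = "\<lambda>j y. \<rho> y * \<omega> y * (K y j \<bullet> Z y)"
  let ?D = "\<lambda>j x. if x \<in> V then Df (?a j) x (axis j 1) else 0"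
  obtain R where R: "C \<subseteq> cball 0 R" using bounded_subset_ballD[OF compact_imp_bounded[OF C(1)], of 0] ball_subset_cball by blast
  have sa: "smooth_on V (?a j)" for j
    by (intro smooth_on_mult smooth_on_inner smooth_rho smooth_omega smooth_K Z open_V)
  have a0: "?a j x = 0" if "x \<in> V - C" for j x using C(3)[OF that] by simp
  have az: "(if x \<in> V then ?a j x else 0) = 0" if "x \<notin> cball 0 R" for j x
    using C(3)[of x] R that by (cases "x \<in> C") auto
  have int: "integrable lborel (?D j)" "(LINT x|lborel. ?D j x) = 0" for j
    using integral_directional_derivative_eq_0[where a="\<lambda>x. if x \<in> V then ?a j x else 0" and
        a'="\<lambda>x v. if x \<in> V then Df (?a j) x v else 0" and e="axis j 1" and R=R,
        OF has_derivative_zero_extension(1)[OF sa C(1,2) a0] has_derivative_zero_extension(2)[OF sa C(1,2) a0]]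
      az by auto
  have "(LINT x|lborel. (if x \<in> V then \<rho> x * \<omega> x * ((\<Sum>j\<in>UNIV. K x j \<bullet> Df Z x (axis j 1)) +
    (Hv x + (1/2) *\<^sub>R P x (G x)) \<bullet> Z x) else 0)) = (LINT x|lborel. (\<Sum>j\<in>UNIV. ?D j x))"
    by (rule Bochner_Integration.integral_cong) (auto simp: divergence_chart[OF _ Z, symmetric])
  also have "\<dots> = 0" using int by (simp add: Bochner_Integration.integral_sum)
  finally show ?thesis .
qed

end

text \<open>The trace of a bilinear form on a subspace does not depend on the pair of dual frames
  used to compute it. An arbitrary orthonormal basis, or the chart frames \<open>J\<close> and
  \<open>K\<close>, can thus be traded for the projections of a fixed ambient basis, which vary
  smoothly with the point.\<close>

lemma sum_bilinear_dual_frames: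
  fixes Q :: "'v::euclidean_space \<Rightarrow> 'v \<Rightarrow> 'b::real_vector" and Jf Kf :: "'k \<Rightarrow> 'v"
  assumes fin: "finite I"
    and lin: "\<And>v. linear (\<lambda>u. Q u v)" "\<And>u. linear (Q u)"
    and dual: "\<And>j k. j \<in> I \<Longrightarrow> k \<in> I \<Longrightarrow> Kf j \<bullet> Jf k = (if j = k then 1 else 0)"
    and T1: "\<And>u. T u = (\<Sum>j\<in>I. (Kf j \<bullet> u) *\<^sub>R Jf j)"
    and T2: "\<And>u. T u = (\<Sum>j\<in>I. (Jf j \<bullet> u) *\<^sub>R Kf j)"
  shows "(\<Sum>i\<in>Basis. Q (T i) (T i)) = (\<Sum>j\<in>I. Q (Jf j) (Kf j))"
proof -
  have "Q (T i) (T i) = (\<Sum>j\<in>I. \<Sum>k\<in>I. ((Kf j \<bullet> i) * (Jf k \<bullet> i)) *\<^sub>R Q (Jf j) (Kf k))" for i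
  proof -
    have "Q (T i) (T i) = Q (\<Sum>j\<in>I. (Kf j \<bullet> i) *\<^sub>R Jf j) (\<Sum>k\<in>I. (Jf k \<bullet> i) *\<^sub>R Kf k)"
      using T1 T2 by metis
    also have "\<dots> = (\<Sum>j\<in>I. Q ((Kf j \<bullet> i) *\<^sub>R Jf j) (\<Sum>k\<in>I. (Jf k \<bullet> i) *\<^sub>R Kf k))"
      by (rule linear_sum[OF lin(1)])
    also have "\<dots> = (\<Sum>j\<in>I. \<Sum>k\<in>I. ((Kf j \<bullet> i) * (Jf k \<bullet> i)) *\<^sub>R Q (Jf j) (Kf k))"
      by (simp add: linear_sum[OF lin(2)] linear_cmul[OF lin(1)] linear_cmul[OF lin(2)] scaleR_sum_right mult.commute)
    finally show ?thesis .
  qed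
  then have "(\<Sum>i\<in>Basis. Q (T i) (T i)) =
      (\<Sum>i\<in>Basis. \<Sum>j\<in>I. \<Sum>k\<in>I. ((Kf j \<bullet> i) * (Jf k \<bullet> i)) *\<^sub>R Q (Jf j) (Kf k))"
    by simp
  also have "\<dots> = (\<Sum>j\<in>I. \<Sum>i\<in>Basis. \<Sum>k\<in>I. ((Kf j \<bullet> i) * (Jf k \<bullet> i)) *\<^sub>R Q (Jf j) (Kf k))"
    by (rule sum.swap)
  also have "\<dots> = (\<Sum>j\<in>I. \<Sum>k\<in>I. (\<Sum>i\<in>Basis. (Kf j \<bullet> i) * (Jf k \<bullet> i)) *\<^sub>R Q (Jf j) (Kf k))"
    by (intro sum.cong refl) (simp add: scaleR_sum_left sum.swap[of _ Basis])
  also have "\<dots> = (\<Sum>j\<in>I. \<Sum>k\<in>I. (if j = k then Q (Jf j) (Kf k) else 0))"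
    by (intro sum.cong refl) (simp add: euclidean_inner[symmetric] dual)
  also have "\<dots> = (\<Sum>j\<in>I. Q (Jf j) (Kf j))" by (simp add: fin)
  finally show ?thesis .
qed

lemma smooth_on_vecI:
  fixes f :: "'e::real_normed_vector \<Rightarrow> real^'k::finite"
  assumes "open S" "\<And>i. smooth_on S (\<lambda>x. f x $ i)"
  shows "smooth_on S f"
proof (rule smooth_on_euclideanI[OF assms(1)])
  fix b :: "real^'k" assume "b \<in> Basis"
  then obtain i where "b = axis i 1" by (auto simp: Basis_vec_def)
  then show "smooth_on S (\<lambda>x. f x \<bullet> b)" using assms(2)[of i] by (simp add: inner_axis)
qed

section \<open>Charts and smooth maps on the manifold\<close>

locale immersed =
  fixes X :: "'a topology" and A :: "('n::finite, 'a) atlas" and F :: "'a \<Rightarrow> real^'m::finite"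
  assumes mfd: "connected_manifold X A" and imm: "smooth_immersion X A F"
begin

abbreviation "\<M> \<equiv> topspace X"

lemma chart_open: "(V, \<psi>) \<in> A \<Longrightarrow> open V"
  using mfd unfolding connected_manifold_def by fast

lemma chart_openin: "(V, \<psi>) \<in> A \<Longrightarrow> openin X (\<psi> ` V)"
  using mfd unfolding connected_manifold_def by fast

lemma chart_homeo: "(V, \<psi>) \<in> A \<Longrightarrow> homeomorphic_map (top_of_set V) (subtopology X (\<psi> ` V)) \<psi>"
  using mfd unfolding connected_manifold_def by fast

lemma chart_cover: assumes "p \<in> \<M>" obtains V \<psi> x where "(V, \<psi>) \<in> A" "x \<in> V" "\<psi> x = p"
proof -
  have "(\<Union>(V,\<psi>)\<in>A. \<psi> ` V) = \<M>" using mfd unfolding connected_manifold_def by simp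
  then obtain V \<psi> where "(V, \<psi>) \<in> A" "p \<in> \<psi> ` V" using assms by blast
  then show ?thesis using that by blast
qed

lemma chart_inj: "(V, \<psi>) \<in> A \<Longrightarrow> inj_on \<psi> V"
  using homeomorphic_imp_injective_map[OF chart_homeo] by simp

lemma chart_topspace: "(V, \<psi>) \<in> A \<Longrightarrow> x \<in> V \<Longrightarrow> \<psi> x \<in> \<M>"
  using openin_subset[OF chart_openin] by blast

lemma chart_continuous: "(V, \<psi>) \<in> A \<Longrightarrow> continuous_map (top_of_set V) X \<psi>"
  using homeomorphic_imp_continuous_map[OF chart_homeo] continuous_map_in_subtopology by blast

lemma chart_preimage_open: assumes "(V, \<psi>) \<in> A" "openin X U" shows "open {x \<in> V. \<psi> x \<in> U}"
proof -
  have "openin (top_of_set V) {x \<in> V. \<psi> x \<in> U}"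
    using openin_continuous_map_preimage[OF chart_continuous[OF assms(1)] assms(2)] by simp
  then show ?thesis using openin_open_trans chart_open[OF assms(1)] by blast
qed

lemma chart_image_open: assumes c: "(V, \<psi>) \<in> A" and W: "open W" "W \<subseteq> V" shows "openin X (\<psi> ` W)"
proof -
  have "openin (top_of_set V) W" using W chart_open[OF c] by (simp add: openin_open_eq)
  then have "openin (subtopology X (\<psi> ` V)) (\<psi> ` W)"
    using homeomorphic_imp_open_map[OF chart_homeo[OF c]] by (simp add: open_map_def)
  then show ?thesis using openin_trans_full chart_openin[OF c] by blast
qed

lemma chart_compact_image:
  assumes c: "(V, \<psi>) \<in> A" and C: "compact C" "C \<subseteq> V" shows "compactin X (\<psi> ` C)"
proof -
  have "compactin (top_of_set V) C" using C by (simp add: compactin_subtopology)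
  then show ?thesis using image_compactin chart_continuous[OF c] by blast
qed

lemma Hausdorff: "Hausdorff_space X"
  using mfd unfolding connected_manifold_def by simp

lemma connected: "connected_space X"
  using mfd unfolding connected_manifold_def by simp

lemma nonempty: "\<M> \<noteq> {}"
  using mfd unfolding connected_manifold_def by simp

lemma compactin_closed: "compactin X C \<Longrightarrow> closedin X C"
  using compactin_imp_closedin Hausdorff by blast

lemma transition_smooth:
  "(V, \<psi>) \<in> A \<Longrightarrow> (W, \<phi>) \<in> A \<Longrightarrow> smooth_on {x \<in> V. \<psi> x \<in> \<phi> ` W} (inv_into W \<phi> \<circ> \<psi>)"
  using mfd unfolding connected_manifold_def by fast

definition sm :: "'a set \<Rightarrow> ('a \<Rightarrow> 'b::real_normed_vector) \<Rightarrow> bool" where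
  "sm U Y \<longleftrightarrow> openin X U \<and> smooth_map A U Y"

lemma sm_open: "sm U Y \<Longrightarrow> openin X U" by (simp add: sm_def)

lemma sm_topspace: "sm \<M> Y \<longleftrightarrow> smooth_map A \<M> Y"
  by (simp add: sm_def)

lemma sm_chart: "sm U Y \<Longrightarrow> (V, \<psi>) \<in> A \<Longrightarrow> smooth_on {x \<in> V. \<psi> x \<in> U} (Y \<circ> \<psi>)"
  by (auto simp: sm_def smooth_map_def)

lemma sm_topspace_chart: assumes "sm \<M> Y" "(V, \<psi>) \<in> A" shows "smooth_on V (Y \<circ> \<psi>)"
proof -
  have "{x \<in> V. \<psi> x \<in> \<M>} = V" using chart_topspace[OF assms(2)] by auto
  then show ?thesis using sm_chart[OF assms] by simp
qed

lemma sm_chart_has_derivative: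
  "sm U Y \<Longrightarrow> (V, \<psi>) \<in> A \<Longrightarrow> x \<in> V \<Longrightarrow> \<psi> x \<in> U \<Longrightarrow>
   ((Y \<circ> \<psi>) has_derivative Df (Y \<circ> \<psi>) x) (at x)"
  using smooth_on_has_derivative[OF sm_chart] by blast

lemma smI:
  assumes "openin X U"
    "\<And>V \<psi>. (V, \<psi>) \<in> A \<Longrightarrow> open {x \<in> V. \<psi> x \<in> U} \<Longrightarrow> smooth_on {x \<in> V. \<psi> x \<in> U} (\<lambda>x. Y (\<psi> x))"
  shows "sm U Y"
  unfolding sm_def smooth_map_def
proof (intro conjI ballI, goal_cases)
  case (2 c)
  then show ?case
    using assms(2)[OF _ chart_preimage_open[OF _ assms(1)], of "fst c" "snd c"] by (cases c) (simp add: o_def)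
qed (rule assms(1))

lemma sm_smooth_on: "sm U Y \<Longrightarrow> (V, \<psi>) \<in> A \<Longrightarrow> smooth_on {x \<in> V. \<psi> x \<in> U} (\<lambda>x. Y (\<psi> x))"
  using sm_chart by (auto simp: o_def)

lemma sm_subset: "sm U Y \<Longrightarrow> openin X W \<Longrightarrow> W \<subseteq> U \<Longrightarrow> sm W Y"
  by (rule smI, assumption, rule smooth_on_subset[OF sm_smooth_on]) auto

lemma sm_const: "openin X U \<Longrightarrow> sm U (\<lambda>p. c)"
  by (rule smI) (auto intro: smooth_on_const)

lemma sm_add: "sm U Y \<Longrightarrow> sm U Z \<Longrightarrow> sm U (\<lambda>p. Y p + Z p)"
  by (rule smI[OF sm_open], assumption, rule smooth_on_add) (auto intro: sm_smooth_on)

lemma sm_diff: "sm U Y \<Longrightarrow> sm U Z \<Longrightarrow> sm U (\<lambda>p. Y p - Z p)"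
  by (rule smI[OF sm_open], assumption, rule smooth_on_diff) (auto intro: sm_smooth_on)

lemma sm_bilinear: "bounded_bilinear B \<Longrightarrow> sm U Y \<Longrightarrow> sm U Z \<Longrightarrow> sm U (\<lambda>p. B (Y p) (Z p))"
  by (rule smI[OF sm_open], assumption, rule smooth_on_bilinear) (auto intro: sm_smooth_on)

lemmas sm_scaleR = sm_bilinear[OF bounded_bilinear_scaleR]
lemmas sm_inner = sm_bilinear[OF bounded_bilinear_inner]

lemma sm_mult: "sm U f \<Longrightarrow> sm U g \<Longrightarrow> sm U (\<lambda>p. f p * g p :: real)"
  by (rule sm_bilinear[OF bounded_bilinear_mult])

lemma sm_sum: "openin X U \<Longrightarrow> (\<And>i. i \<in> I \<Longrightarrow> sm U (Y i)) \<Longrightarrow> sm U (\<lambda>p. \<Sum>i\<in>I. Y i p)"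
  by (rule smI, assumption, rule smooth_on_sum) (auto intro: sm_smooth_on)

lemma sm_divide:
  "sm U f \<Longrightarrow> sm U g \<Longrightarrow> (\<And>p. p \<in> U \<Longrightarrow> g p \<noteq> 0) \<Longrightarrow> sm U (\<lambda>p. f p / g p :: real)"
  by (rule smI[OF sm_open], assumption, rule smooth_on_divide) (auto intro: sm_smooth_on)

lemma sm_sqrt: "sm U f \<Longrightarrow> (\<And>p. p \<in> U \<Longrightarrow> f p > 0) \<Longrightarrow> sm U (\<lambda>p. sqrt (f p))"
  by (rule smI[OF sm_open], assumption, rule smooth_on_sqrt) (auto intro: sm_smooth_on)

lemma transition:
  assumes c: "(V, \<psi>) \<in> A" "(W, \<phi>) \<in> A"
  defines "\<tau> \<equiv> inv_into W \<phi> \<circ> \<psi>"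
  shows "x \<in> V \<Longrightarrow> \<psi> x \<in> \<phi> ` W \<Longrightarrow> \<tau> x \<in> W" "x \<in> V \<Longrightarrow> \<psi> x \<in> \<phi> ` W \<Longrightarrow> \<phi> (\<tau> x) = \<psi> x"
    "x \<in> V \<Longrightarrow> y \<in> W \<Longrightarrow> \<phi> y = \<psi> x \<Longrightarrow> \<tau> x = y"
    "open {x \<in> V. \<psi> x \<in> \<phi> ` W}"
  unfolding \<tau>_def using chart_inj[OF c(2)] chart_preimage_open[OF c(1) chart_openin[OF c(2)]]
  by (auto simp: inv_into_into f_inv_into_f inv_into_f_eq) 

text \<open>One chart around each point suffices, because the transition maps carry smoothness over
  to all other charts of the atlas.\<close>

lemma smI_local:
  assumes U: "openin X U"
    and loc: "\<And>p. p \<in> U \<Longrightarrow> \<exists>V \<psi> W. (V, \<psi>) \<in> A \<and> open W \<and> W \<subseteq> V \<and> p \<in> \<psi> ` W \<and> smooth_on W (\<lambda>x. Y (\<psi> x))"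
  shows "sm U Y"
proof (rule smI[OF U])
  fix V' \<psi>' assume c': "(V', \<psi>') \<in> A"
  show "smooth_on {x \<in> V'. \<psi>' x \<in> U} (\<lambda>x. Y (\<psi>' x))"
  proof (rule smooth_on_local)
    fix x assume "x \<in> {x \<in> V'. \<psi>' x \<in> U}"
    then have x: "x \<in> V'" "\<psi>' x \<in> U" by auto
    obtain V \<psi> W where c: "(V, \<psi>) \<in> A" and W: "open W" "W \<subseteq> V" "\<psi>' x \<in> \<psi> ` W" "smooth_on W (\<lambda>x. Y (\<psi> x))"
      using loc[OF x(2)] by blast
    let ?N = "{y \<in> V'. \<psi>' y \<in> \<psi> ` W}"
    let ?\<tau> = "inv_into V \<psi> \<circ> \<psi>'"
    have N: "open ?N" by (rule chart_preimage_open[OF c' chart_image_open[OF c W(1,2)]])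
    have sub: "?N \<subseteq> {y \<in> V'. \<psi>' y \<in> \<psi> ` V}" using W(2) by auto
    have t1: "?\<tau> ` ?N \<subseteq> W"
    proof
      fix z assume "z \<in> ?\<tau> ` ?N"
      then obtain y w where "y \<in> V'" "w \<in> W" "\<psi>' y = \<psi> w" "z = ?\<tau> y" by auto
      then show "z \<in> W" using transition(3)[OF c' c, of y w] W(2) by auto
    qed
    have eq: "Y (\<psi> (?\<tau> y)) = Y (\<psi>' y)" if "y \<in> ?N" for y
      using transition(2)[OF c' c, of y] that W(2) by auto
    have "smooth_on ?N (\<lambda>y. Y (\<psi> (?\<tau> y)))"
      by (rule smooth_on_compose[OF N W(1) t1 smooth_on_subset[OF transition_smooth[OF c' c] sub] W(4)])
    then have "smooth_on ?N (\<lambda>y. Y (\<psi>' y))"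
      using smooth_on_cong[OF N eq] by simp
    then show "\<exists>U. open U \<and> x \<in> U \<and> smooth_on U (\<lambda>x. Y (\<psi>' x))"
      using N x W(3) by blast
  qed
qed

text \<open>The chain rule for a change of chart; the transformed coordinate vector is the same for
  every \<open>Y\<close>. Comparing with \<open>Y = F\<close>, whose differential is injective,
  makes tangent vectors and directional derivatives independent of the chart.\<close>

lemma frechet_transition:
  assumes c: "(V, \<psi>) \<in> A" "(V', \<psi>') \<in> A" and x: "x \<in> V" "x' \<in> V'" "\<psi>' x' = \<psi> x" and Y: "sm U Y" "\<psi> x \<in> U"
  shows "Df (Y \<circ> \<psi>') x' a =
    Df (Y \<circ> \<psi>) x (Df (inv_into V \<psi> \<circ> \<psi>') x' a)"
proof -
  let ?\<tau> = "inv_into V \<psi> \<circ> \<psi>'"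
  let ?N = "{y \<in> V'. \<psi>' y \<in> \<psi> ` V}"
  have N: "open ?N" "x' \<in> ?N" using transition(4)[OF c(2,1)] x by auto
  have tx: "?\<tau> x' = x" using transition(3)[OF c(2,1) x(2,1)] x(3) by simp
  have dt: "(?\<tau> has_derivative Df ?\<tau> x') (at x')"
    by (rule smooth_on_has_derivative[OF transition_smooth[OF c(2,1)] N(2)])
  have dY: "((Y \<circ> \<psi>) has_derivative Df (Y \<circ> \<psi>) x) (at (?\<tau> x'))"
    unfolding tx by (rule sm_chart_has_derivative[OF Y(1) c(1) x(1) Y(2)])
  have "((Y \<circ> \<psi>) \<circ> ?\<tau> has_derivative Df (Y \<circ> \<psi>) x \<circ> Df ?\<tau> x') (at x')"
    by (rule diff_chain_at[OF dt dY])
  then have "(Y \<circ> \<psi>' has_derivative Df (Y \<circ> \<psi>) x \<circ> Df ?\<tau> x') (at x')"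
    by (rule has_derivative_transform_within_open[OF _ N]) (use transition(2)[OF c(2,1)] in auto)
  from fun_cong[OF frechet_derivative_at[OF this], of a, symmetric] show ?thesis by simp
qed

section \<open>Tangent spaces and the tangential projection\<close>

lemma sm_F: "sm \<M> F"
  using imm by (simp add: sm_topspace smooth_immersion_def)

lemma chart_immersion: assumes c: "(V, \<psi>) \<in> A" shows "local_immersion V (F \<circ> \<psi>)"
proof
  show "open V" by (rule chart_open[OF c])
  show "smooth_on V (F \<circ> \<psi>)" by (rule sm_topspace_chart[OF sm_F c])
  show "inj (Df (F \<circ> \<psi>) x)" if "x \<in> V" for x
    using imm c that unfolding smooth_immersion_def by fast
qed

lemma tangent_space_chart:
  assumes c: "(V, \<psi>) \<in> A" and x: "x \<in> V"
  shows "tangent_space A F (\<psi> x) = range (Df (F \<circ> \<psi>) x)"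
proof
  show "range (Df (F \<circ> \<psi>) x) \<subseteq> tangent_space A F (\<psi> x)"
    unfolding tangent_space_def using c x by blast
  show "tangent_space A F (\<psi> x) \<subseteq> range (Df (F \<circ> \<psi>) x)"
  proof
    fix w assume "w \<in> tangent_space A F (\<psi> x)"
    then obtain V' \<psi>' x' a where c': "(V', \<psi>') \<in> A" "x' \<in> V'" "\<psi>' x' = \<psi> x"
      and w: "w = Df (F \<circ> \<psi>') x' a"
      unfolding tangent_space_def by blast
    show "w \<in> range (Df (F \<circ> \<psi>) x)"
      unfolding w frechet_transition[OF c c'(1) x c'(2,3) sm_F chart_topspace[OF c x]] by simp
  qed
qed

text \<open>The described value is unique: equal images under the differentials of \<open>F\<close>
  force the coordinate vectors to correspond under the change of chart.\<close>

lemma dir_deriv_chart: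
  assumes c: "(V, \<psi>) \<in> A" and x: "x \<in> V" and Y: "sm U Y" "\<psi> x \<in> U"
  shows "dir_deriv A F Y (\<psi> x) (Df (F \<circ> \<psi>) x a) = Df (Y \<circ> \<psi>) x a"
  unfolding dir_deriv_def
proof (rule the_equality)
  show "\<exists>V' \<psi>' x' a'. (V', \<psi>') \<in> A \<and> x' \<in> V' \<and> \<psi>' x' = \<psi> x \<and>
    Df (F \<circ> \<psi>') x' a' = Df (F \<circ> \<psi>) x a \<and>
    Df (Y \<circ> \<psi>) x a = Df (Y \<circ> \<psi>') x' a'"
    using c x by blast
  fix w assume "\<exists>V' \<psi>' x' a'. (V', \<psi>') \<in> A \<and> x' \<in> V' \<and> \<psi>' x' = \<psi> x \<and>
    Df (F \<circ> \<psi>') x' a' = Df (F \<circ> \<psi>) x a \<and>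
    w = Df (Y \<circ> \<psi>') x' a'"
  then obtain V' \<psi>' x' a' where c': "(V', \<psi>') \<in> A" "x' \<in> V'" "\<psi>' x' = \<psi> x"
    and eq: "Df (F \<circ> \<psi>') x' a' = Df (F \<circ> \<psi>) x a"
    and w: "w = Df (Y \<circ> \<psi>') x' a'" by blast
  interpret c: local_immersion V "F \<circ> \<psi>" by (rule chart_immersion[OF c])
  have "Df (inv_into V \<psi> \<circ> \<psi>') x' a' = a"
    using eq frechet_transition[OF c c'(1) x c'(2,3) sm_F chart_topspace[OF c x], of a'] c.inj_G[OF x]
    by (simp add: inj_eq)
  then show "w = Df (Y \<circ> \<psi>) x a"
    using w frechet_transition[OF c c'(1) x c'(2,3) Y, of a'] by simp
qed

lemma tangent_subspace: assumes "p \<in> \<M>" shows "subspace (tangent_space A F p)"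
proof -
  obtain V \<psi> x where c: "(V, \<psi>) \<in> A" "x \<in> V" "\<psi> x = p" using chart_cover[OF assms] .
  interpret c: local_immersion V "F \<circ> \<psi>" by (rule chart_immersion[OF c(1)])
  show ?thesis using c.subspace_range[OF c(2)] tangent_space_chart[OF c(1,2)] c(3) by simp
qed

lemma tangent_onb:
  assumes "p \<in> \<M>"
  defines "B \<equiv> tangent_onb A F p"
  shows "B \<subseteq> tangent_space A F p" "pairwise orthogonal B" "\<And>e. e \<in> B \<Longrightarrow> norm e = 1"
    "span B = tangent_space A F p" "finite B"
proof -
  have "\<exists>B. B \<subseteq> tangent_space A F p \<and> pairwise orthogonal B \<and> (\<forall>e\<in>B. norm e = 1) \<and> span B = tangent_space A F p"
    using orthonormal_basis_subspace[OF tangent_subspace[OF assms(1)]] by metis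
  from someI_ex[OF this] have b: "B \<subseteq> tangent_space A F p \<and> pairwise orthogonal B \<and> (\<forall>e\<in>B. norm e = 1) \<and> span B = tangent_space A F p"
    unfolding B_def tangent_onb_def .
  then show "B \<subseteq> tangent_space A F p" "pairwise orthogonal B" "\<And>e. e \<in> B \<Longrightarrow> norm e = 1"
    "span B = tangent_space A F p" by auto
  show "finite B" using b pairwise_orthogonal_imp_finite by blast
qed

text \<open>The chosen basis varies arbitrarily with \<open>p\<close>, but the sum does not depend
  on it: \<open>tproj_eqI\<close> characterizes the projection, and \<open>tproj_chart\<close>
  identifies it with the smooth formula \<open>P\<close>.\<close>

definition tproj :: "'a \<Rightarrow> real^'m \<Rightarrow> real^'m" where
  "tproj p v = (\<Sum>e\<in>tangent_onb A F p. (e \<bullet> v) *\<^sub>R e)"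

lemma tproj_in: "p \<in> \<M> \<Longrightarrow> tproj p v \<in> tangent_space A F p"
  unfolding tproj_def using tangent_onb(1) tangent_subspace
  by (intro subspace_sum subspace_scale) auto

lemma onb_inner: "p \<in> \<M> \<Longrightarrow> e \<in> tangent_onb A F p \<Longrightarrow> e' \<in> tangent_onb A F p \<Longrightarrow>
    e \<bullet> e' = (if e = e' then 1 else 0)"
  using tangent_onb(2,3)[of p] by (auto simp: pairwise_def orthogonal_def norm_eq_1)

lemma tproj_orthogonal:
  assumes p: "p \<in> \<M>" and w: "w \<in> tangent_space A F p" shows "(v - tproj p v) \<bullet> w = 0"
proof -
  have "(v - tproj p v) \<bullet> e = 0" if "e \<in> tangent_onb A F p" for e
    using that by (simp add: tproj_def inner_diff_left inner_sum_left onb_inner[OF p] inner_commute[of v]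
        if_distrib[of "\<lambda>y. _ * y"] tangent_onb(5)[OF p] cong: if_cong)
  moreover have "w \<in> span (tangent_onb A F p)" using w tangent_onb(4)[OF p] by simp
  ultimately show ?thesis
    using orthogonal_to_span[of w "tangent_onb A F p" "v - tproj p v"] by (simp add: orthogonal_def)
qed

lemma tproj_eqI:
  assumes p: "p \<in> \<M>" and w: "w \<in> tangent_space A F p"
    and o: "\<And>t. t \<in> tangent_space A F p \<Longrightarrow> (v - w) \<bullet> t = 0"
  shows "tproj p v = w"
proof -
  have d: "w - tproj p v \<in> tangent_space A F p"
    using subspace_diff[OF tangent_subspace[OF p] w tproj_in[OF p]] .
  have "(w - tproj p v) \<bullet> (w - tproj p v) = 0"
    using o[OF d] tproj_orthogonal[OF p d, of v] by (simp add: inner_diff_left)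
  then show ?thesis by simp
qed

lemma tproj_id: "p \<in> \<M> \<Longrightarrow> v \<in> tangent_space A F p \<Longrightarrow> tproj p v = v"
  by (rule tproj_eqI) auto

lemma tproj_idem: "p \<in> \<M> \<Longrightarrow> tproj p (tproj p v) = tproj p v"
  by (simp add: tproj_id tproj_in)

lemma tproj_linear: "linear (tproj p)"
  unfolding tproj_def
  by (rule linearI) (simp_all add: inner_add_right scaleR_add_left sum.distrib scaleR_sum_right)

lemma tproj_selfadjoint: "tproj p u \<bullet> v = u \<bullet> tproj p v"
  by (simp add: tproj_def inner_sum_left inner_sum_right inner_commute mult.commute)

lemma tproj_chart:
  assumes c: "(V, \<psi>) \<in> A" and x: "x \<in> V"
  shows "tproj (\<psi> x) v = local_immersion.P (F \<circ> \<psi>) x v"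
proof -
  interpret c: local_immersion V "F \<circ> \<psi>" by (rule chart_immersion[OF c])
  show ?thesis
    by (rule tproj_eqI[OF chart_topspace[OF c x]])
      (auto simp: tangent_space_chart[OF c x] c.P_in_range[OF x] c.P_orthogonal[OF x])
qed

section \<open>Derivatives along projected ambient vectors\<close>

text \<open>The projection makes this meaningful for all \<open>u\<close>, and smooth in \<open>p\<close> for fixed \<open>u\<close>.\<close>

definition mD :: "('a \<Rightarrow> 'b::real_normed_vector) \<Rightarrow> 'a \<Rightarrow> real^'m \<Rightarrow> 'b" where
  "mD Y p u = dir_deriv A F Y p (tproj p u)"

lemma mD_chart:
  assumes c: "(V, \<psi>) \<in> A" and x: "x \<in> V" and Y: "sm U Y" "\<psi> x \<in> U"
  shows "mD Y (\<psi> x) u = Df (Y \<circ> \<psi>) x (local_immersion.coord (F \<circ> \<psi>) x u)"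
proof -
  interpret c: local_immersion V "F \<circ> \<psi>" by (rule chart_immersion[OF c])
  show ?thesis
    unfolding mD_def tproj_chart[OF c x] c.dG_coord[OF x, symmetric] by (rule dir_deriv_chart[OF c x Y])
qed

lemma mD_chart_dG:
  assumes c: "(V, \<psi>) \<in> A" and x: "x \<in> V" and Y: "sm U Y" "\<psi> x \<in> U"
  shows "mD Y (\<psi> x) (Df (F \<circ> \<psi>) x a) = Df (Y \<circ> \<psi>) x a"
proof -
  interpret c: local_immersion V "F \<circ> \<psi>" by (rule chart_immersion[OF c])
  show ?thesis unfolding mD_chart[OF assms] c.coord_dG[OF x] ..
qed

lemma mD_eqI:
  assumes Y: "sm U Y" "p \<in> U" and c: "(V, \<psi>) \<in> A" "x \<in> V" "\<psi> x = p" and D: "((Y \<circ> \<psi>) has_derivative D) (at x)"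
  shows "mD Y p u = D (local_immersion.coord (F \<circ> \<psi>) x u)"
  using mD_chart[OF c(1,2) Y(1), of u] frechet_derivative_at[OF D] c(3) Y(2) by simp

lemma sm_chart_cover:
  assumes "sm U Y" "p \<in> U" obtains V \<psi> x where "(V, \<psi>) \<in> A" "x \<in> V" "\<psi> x = p"
  using chart_cover openin_subset[OF sm_open[OF assms(1)]] assms(2) by blast

lemma mD_chain:
  assumes Y: "sm U Y" "sm U (\<lambda>p. h (Y p))" "p \<in> U" and h: "(h has_derivative h') (at (Y p))"
  shows "mD (\<lambda>p. h (Y p)) p u = h' (mD Y p u)"
proof -
  obtain V \<psi> x where c: "(V, \<psi>) \<in> A" "x \<in> V" "\<psi> x = p" using sm_chart_cover[OF Y(1,3)] .
  have d: "((Y \<circ> \<psi>) has_derivative Df (Y \<circ> \<psi>) x) (at x)"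
    using sm_chart_has_derivative[OF Y(1) c(1,2)] c(3) Y(3) by simp
  have "(((\<lambda>p. h (Y p)) \<circ> \<psi>) has_derivative (\<lambda>a. h' (Df (Y \<circ> \<psi>) x a))) (at x)"
    using diff_chain_at[OF d, of h h'] h c(3) by (simp add: o_def)
  from mD_eqI[OF Y(2,3) c this, of u] mD_eqI[OF Y(1,3) c d, of u] show ?thesis by simp
qed

lemma mD_real_chain:
  assumes "sm U f" "sm U (\<lambda>p. h (f p))" "p \<in> U" "(h has_real_derivative h') (at (f p))"
  shows "mD (\<lambda>p. h (f p) :: real) p u = h' * mD f p u"
  using mD_chain[OF assms(1-3), of "(*) h'"] assms(4) by (simp add: has_field_derivative_def)

lemma mD_bilinear:
  assumes B: "bounded_bilinear B" and Y: "sm U Y" and Z: "sm U Z" and p: "p \<in> U"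
  shows "mD (\<lambda>p. B (Y p) (Z p)) p u = B (Y p) (mD Z p u) + B (mD Y p u) (Z p)"
proof -
  obtain V \<psi> x where c: "(V, \<psi>) \<in> A" "x \<in> V" "\<psi> x = p" using sm_chart_cover[OF Y p] .
  have dY: "((Y \<circ> \<psi>) has_derivative Df (Y \<circ> \<psi>) x) (at x)"
    using sm_chart_has_derivative[OF Y c(1,2)] c(3) p by simp
  have dZ: "((Z \<circ> \<psi>) has_derivative Df (Z \<circ> \<psi>) x) (at x)"
    using sm_chart_has_derivative[OF Z c(1,2)] c(3) p by simp
  have "(((\<lambda>p. B (Y p) (Z p)) \<circ> \<psi>) has_derivative
      (\<lambda>a. B (Y p) (Df (Z \<circ> \<psi>) x a) + B (Df (Y \<circ> \<psi>) x a) (Z p))) (at x)"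
    using bounded_bilinear.FDERIV[OF B dY dZ] c(3) by (simp add: o_def)
  from mD_eqI[OF sm_bilinear[OF B Y Z] p c this, of u] mD_eqI[OF Y p c dY, of u] mD_eqI[OF Z p c dZ, of u]
  show ?thesis by simp
qed

lemmas mD_scaleR = mD_bilinear[OF bounded_bilinear_scaleR]
lemmas mD_inner = mD_bilinear[OF bounded_bilinear_inner]
lemmas mD_mult = mD_bilinear[OF bounded_bilinear_mult]

lemma mD_const: "p \<in> \<M> \<Longrightarrow> mD (\<lambda>q. c) p u = 0"
proof -
  assume p: "p \<in> \<M>"
  obtain V \<psi> x where c: "(V, \<psi>) \<in> A" "x \<in> V" "\<psi> x = p" using chart_cover[OF p] .
  have "(((\<lambda>q. c) \<circ> \<psi>) has_derivative (\<lambda>a. 0)) (at x)" by (simp add: o_def)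
  from mD_eqI[OF sm_const p c this] show ?thesis by simp
qed

lemma mD_add:
  assumes Y: "sm U Y" and Z: "sm U Z" and p: "p \<in> U"
  shows "mD (\<lambda>p. Y p + Z p) p u = mD Y p u + mD Z p u"
proof -
  obtain V \<psi> x where c: "(V, \<psi>) \<in> A" "x \<in> V" "\<psi> x = p" using sm_chart_cover[OF Y p] .
  have dY: "((Y \<circ> \<psi>) has_derivative Df (Y \<circ> \<psi>) x) (at x)"
    using sm_chart_has_derivative[OF Y c(1,2)] c(3) p by simp
  have dZ: "((Z \<circ> \<psi>) has_derivative Df (Z \<circ> \<psi>) x) (at x)"
    using sm_chart_has_derivative[OF Z c(1,2)] c(3) p by simp
  have "(((\<lambda>p. Y p + Z p) \<circ> \<psi>) has_derivative
      (\<lambda>a. Df (Y \<circ> \<psi>) x a + Df (Z \<circ> \<psi>) x a)) (at x)"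
    using has_derivative_add[OF dY dZ] by (simp add: o_def)
  from mD_eqI[OF sm_add[OF Y Z] p c this, of u] mD_eqI[OF Y p c dY, of u] mD_eqI[OF Z p c dZ, of u]
  show ?thesis by simp
qed

lemma mD_diff:
  assumes Y: "sm U Y" and Z: "sm U Z" and p: "p \<in> U"
  shows "mD (\<lambda>p. Y p - Z p) p u = mD Y p u - mD Z p u"
  using mD_add[OF sm_diff[OF Y Z] Z p, of u] by simp

lemma mD_sum:
  assumes "openin X U" "p \<in> U" "\<And>i. i \<in> I \<Longrightarrow> sm U (Y i)"
  shows "mD (\<lambda>p. \<Sum>i\<in>I. Y i p) p u = (\<Sum>i\<in>I. mD (Y i) p u)"
  using assms(3)
proof (induction I rule: infinite_finite_induct)
  case (insert i I)
  then show ?case using mD_add[OF _ sm_sum[OF assms(1), of I Y] assms(2), of "Y i" u] by simp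
qed (use mD_const[of p] openin_subset[OF assms(1)] assms(2) in auto)

lemma mD_cong:
  assumes Y: "sm U Y" and p: "p \<in> U" and eq: "\<And>q. q \<in> U \<Longrightarrow> Y q = Z q"
  shows "mD Y p u = mD Z p u" and "sm U Z"
proof -
  show Z: "sm U Z"
  proof (rule smI[OF sm_open[OF Y]])
    fix V \<psi> assume c: "(V, \<psi>) \<in> A" "open {x \<in> V. \<psi> x \<in> U}"
    show "smooth_on {x \<in> V. \<psi> x \<in> U} (\<lambda>x. Z (\<psi> x))"
      using smooth_on_cong[OF c(2), of "\<lambda>x. Y (\<psi> x)" "\<lambda>x. Z (\<psi> x)"] sm_smooth_on[OF Y c(1)] eq by simp
  qed
  obtain V \<psi> x where c: "(V, \<psi>) \<in> A" "x \<in> V" "\<psi> x = p" using sm_chart_cover[OF Y p] .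
  have dY: "((Y \<circ> \<psi>) has_derivative Df (Y \<circ> \<psi>) x) (at x)"
    using sm_chart_has_derivative[OF Y c(1,2)] c(3) p by simp
  have "((Z \<circ> \<psi>) has_derivative Df (Y \<circ> \<psi>) x) (at x)"
    by (rule has_derivative_transform_within_open[OF dY chart_preimage_open[OF c(1) sm_open[OF Y]]])
      (use c p eq in auto)
  from mD_eqI[OF Z p c this, of u] mD_eqI[OF Y p c dY, of u] show "mD Y p u = mD Z p u" by simp
qed

lemma mD_linear: assumes "sm U Y" "p \<in> U" shows "linear (mD Y p)"
proof -
  obtain V \<psi> x where c: "(V, \<psi>) \<in> A" "x \<in> V" "\<psi> x = p" using sm_chart_cover[OF assms] .
  interpret c: local_immersion V "F \<circ> \<psi>" by (rule chart_immersion[OF c(1)])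
  have dY: "((Y \<circ> \<psi>) has_derivative Df (Y \<circ> \<psi>) x) (at x)"
    using sm_chart_has_derivative[OF assms(1) c(1,2)] c(3) assms(2) by simp
  have lin: "linear (c.coord x)"
    unfolding c.coord_def by (rule linearI) (simp_all add: vec_eq_iff inner_add_right)
  have "mD Y p = (\<lambda>u. Df (Y \<circ> \<psi>) x (c.coord x u))"
    using mD_eqI[OF assms c dY] by auto
  then show ?thesis using linear_compose[OF lin has_derivative_linear[OF dY]] by (simp add: o_def)
qed

lemma mD_tproj_arg: "p \<in> \<M> \<Longrightarrow> mD Y p (tproj p u) = mD Y p u"
  by (simp add: mD_def tproj_idem)

lemma mD_F: assumes "p \<in> \<M>" shows "mD F p u = tproj p u"
proof -
  obtain V \<psi> x where c: "(V, \<psi>) \<in> A" "x \<in> V" "\<psi> x = p" using chart_cover[OF assms] .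
  interpret c: local_immersion V "F \<circ> \<psi>" by (rule chart_immersion[OF c(1)])
  show ?thesis
    using mD_chart[OF c(1,2) sm_F, of u] c.dG_coord[OF c(2), of u] tproj_chart[OF c(1,2), of u] c(3) assms by simp
qed

lemma sm_tproj: "sm \<M> (\<lambda>p. tproj p u)"
proof (rule smI_local)
  fix p assume "p \<in> \<M>"
  then obtain V \<psi> x where c: "(V, \<psi>) \<in> A" "x \<in> V" "\<psi> x = p" using chart_cover by blast
  interpret c: local_immersion V "F \<circ> \<psi>" by (rule chart_immersion[OF c(1)])
  have "smooth_on V (\<lambda>x. tproj (\<psi> x) u)"
    using smooth_on_cong[OF c.open_V, of "\<lambda>x. tproj (\<psi> x) u" "\<lambda>x. c.P x u"] c.smooth_P tproj_chart[OF c(1)] by simp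
  then show "\<exists>V \<psi> W. (V, \<psi>) \<in> A \<and> open W \<and> W \<subseteq> V \<and> p \<in> \<psi> ` W \<and> smooth_on W (\<lambda>x. tproj (\<psi> x) u)"
    using c c.open_V by blast
qed simp

lemma frechet_coord:
  assumes c: "(V, \<psi>) \<in> A" and x: "x \<in> V" "\<psi> x \<in> U" and Y: "sm U Y"
  shows "Df (Y \<circ> \<psi>) x a = (\<Sum>k\<in>UNIV. a $ k *\<^sub>R Df (Y \<circ> \<psi>) x (axis k 1))"
  by (rule linear_axis_expansion[OF has_derivative_linear[OF sm_chart_has_derivative[OF Y c x]]])

lemma sm_mD: assumes Y: "sm U Y" shows "sm U (\<lambda>p. mD Y p u)"
proof (rule smI[OF sm_open[OF Y]])
  fix V \<psi> assume c: "(V, \<psi>) \<in> A" and W: "open {x \<in> V. \<psi> x \<in> U}"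
  interpret c: local_immersion V "F \<circ> \<psi>" by (rule chart_immersion[OF c(1)])
  let ?f = "\<lambda>x. \<Sum>k\<in>UNIV. (c.K x k \<bullet> u) *\<^sub>R Df (Y \<circ> \<psi>) x (axis k 1)"
  have "smooth_on {x \<in> V. \<psi> x \<in> U} ?f"
    by (intro smooth_on_sum smooth_on_scaleR smooth_on_inner W smooth_on_const smooth_on_frechet sm_chart[OF Y c]
        smooth_on_subset[OF c.smooth_K]) auto
  moreover have "mD Y (\<psi> x) u = ?f x" if "x \<in> V" "\<psi> x \<in> U" for x
    using mD_chart[OF c that(1) Y that(2), of u] frechet_coord[OF c that Y, of "c.coord x u"]
    by (simp add: c.coord_def)
  ultimately show "smooth_on {x \<in> V. \<psi> x \<in> U} (\<lambda>x. mD Y (\<psi> x) u)"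
    using smooth_on_cong[OF W, of ?f "\<lambda>x. mD Y (\<psi> x) u"] by simp
qed

section \<open>The second fundamental form as the derivative of the projection\<close>

text \<open>For tangent vectors this is the second fundamental form.\<close>

definition dT :: "'a \<Rightarrow> real^'m \<Rightarrow> real^'m \<Rightarrow> real^'m" where
  "dT p u v = mD (\<lambda>q. tproj q v) p u"

text \<open>The constant vectors \<open>u\<close> and \<open>v\<close> project to tangential fields
  with Lie bracket \<open>dT p u v - dT p v u\<close>. In a chart the second derivatives of
  \<open>Y\<close> cancel by symmetry; what remains is a first derivative in a coordinate vector
  that does not depend on \<open>Y\<close>. The case \<open>Y = F\<close> gives the symmetry of the
  second fundamental form, the case of a unit normal the Codazzi equation.\<close>

lemma mD_commutator:
  fixes Y :: "'a \<Rightarrow> 'b::euclidean_space"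
  assumes Y: "sm U Y" and p: "p \<in> U"
  shows "mD (\<lambda>q. mD Y q v) p u - mD (\<lambda>q. mD Y q u) p v = mD Y p (dT p u v - dT p v u)"
proof -
  obtain V \<psi> x where c: "(V, \<psi>) \<in> A" and x: "x \<in> V" "\<psi> x = p" using sm_chart_cover[OF assms] .
  interpret c: local_immersion V "F \<circ> \<psi>" by (rule chart_immersion[OF c])
  have pX: "p \<in> \<M>" using openin_subset[OF sm_open[OF Y]] p by blast
  define k where "k = (\<lambda>v y. c.coord y v)"
  have smk: "smooth_on V (k v)" for v
    unfolding k_def c.coord_def
    by (rule smooth_on_vecI[OF c.open_V]) (simp add: smooth_on_inner c.open_V c.smooth_K smooth_on_const)
  define dk where "dk = (\<lambda>v u. Df (k v) x (k u x))"
  have comm: "mD (\<lambda>q. mD Z q v) p u - mD (\<lambda>q. mD Z q u) p v = Df (Z \<circ> \<psi>) x (dk v u - dk u v)"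
    if Z: "sm W Z" and pW: "p \<in> W" for Z :: "'a \<Rightarrow> 'c::euclidean_space" and W
  proof -
    let ?N = "{y \<in> V. \<psi> y \<in> W}"
    have N: "open ?N" "x \<in> ?N" using chart_preimage_open[OF c sm_open[OF Z]] x pW by auto
    define d where "d = (\<lambda>j y. Df (Z \<circ> \<psi>) y (axis j 1))"
    have smd: "smooth_on ?N (d j)" for j
      unfolding d_def by (rule smooth_on_frechet[OF sm_chart[OF Z c]])
    have dd: "Df (Z \<circ> \<psi>) y a = (\<Sum>j\<in>UNIV. a $ j *\<^sub>R d j y)" if "y \<in> ?N" for y a
      unfolding d_def using frechet_coord[OF c _ _ Z, of y a] that by simp
    have expand: "mD (\<lambda>q. mD Z q v) p u =
       (\<Sum>j\<in>UNIV. k v x $ j *\<^sub>R Df (d j) x (k u x) + dk v u $ j *\<^sub>R d j x)" for u v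
    proof -
      have kj: "((\<lambda>y. k v y $ j) has_derivative (\<lambda>a. Df (k v) x a $ j)) (at x)" for j
        using bounded_linear.has_derivative[OF bounded_linear_vec_nth smooth_on_has_derivative[OF smk x(1)]] .
      have "((\<lambda>y. \<Sum>j\<in>UNIV. k v y $ j *\<^sub>R d j y) has_derivative
         (\<lambda>a. \<Sum>j\<in>UNIV. k v x $ j *\<^sub>R Df (d j) x a + Df (k v) x a $ j *\<^sub>R d j x)) (at x)"
        by (intro has_derivative_sum has_derivative_scaleR kj smooth_on_has_derivative[OF smd N(2)])
      then have "(((\<lambda>q. mD Z q v) \<circ> \<psi>) has_derivative
         (\<lambda>a. \<Sum>j\<in>UNIV. k v x $ j *\<^sub>R Df (d j) x a + Df (k v) x a $ j *\<^sub>R d j x)) (at x)"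
      proof (rule has_derivative_transform_within_open[OF _ N])
        fix y assume y: "y \<in> ?N"
        then show "(\<Sum>j\<in>UNIV. k v y $ j *\<^sub>R d j y) = ((\<lambda>q. mD Z q v) \<circ> \<psi>) y"
          using mD_chart[OF c _ Z, of y v] dd[OF y] by (simp add: k_def)
      qed
      from mD_eqI[OF sm_mD[OF Z] pW c x this, of u] show ?thesis
        by (simp add: dk_def k_def)
    qed
    have sym: "(\<Sum>j\<in>UNIV. k v x $ j *\<^sub>R Df (d j) x (k u x)) =
       (\<Sum>j\<in>UNIV. k u x $ j *\<^sub>R Df (d j) x (k v x))"
    proof -
      have e: "(\<Sum>j\<in>UNIV. k v x $ j *\<^sub>R Df (d j) x (k u x)) =
        (\<Sum>j\<in>UNIV. \<Sum>i\<in>UNIV. (k v x $ j * k u x $ i) *\<^sub>R Df (d j) x (axis i 1))" for u v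
        by (subst linear_axis_expansion[OF has_derivative_linear[OF smooth_on_has_derivative[OF smd N(2)]]])
          (simp add: scaleR_sum_right)
      have s: "Df (d j) x (axis i 1) = Df (d i) x (axis j 1)" for i j
        unfolding d_def by (rule frechet_derivative_symmetric[OF N(1) sm_chart[OF Z c] N(2)])
      show ?thesis
        unfolding e by (subst sum.swap) (simp add: s mult.commute)
    qed
    show ?thesis
      unfolding expand dd[OF N(2)] sum.distrib sym by (simp add: sum_subtractf scaleR_diff_left)
  qed
  \<comment> \<open>The coordinate formula is applied to \<open>F\<close>, whose first derivatives
    are the projection itself. This identifies the coordinate vector as that of the bracket.\<close>
  have "dT p u v - dT p v u = Df (F \<circ> \<psi>) x (dk v u - dk u v)"
  proof -
    have "mD (\<lambda>q. mD F q v) p u = dT p u v" for u v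
      unfolding dT_def by (rule mD_cong(1)[OF sm_mD[OF sm_F] pX]) (rule mD_F)
    then show ?thesis using comm[OF sm_F pX] by simp
  qed
  then have "mD Y p (dT p u v - dT p v u) = Df (Y \<circ> \<psi>) x (dk v u - dk u v)"
    using mD_chart_dG[OF c x(1) Y] x p by simp
  then show ?thesis using comm[OF Y p] by simp
qed

text \<open>Smoothness of the projection and the meaning of \<open>dT\<close> concern fixed vectors,
  while \<open>Y q\<close> moves; hence the expansion in the ambient basis and the product rule for
  each term.\<close>

lemma sm_tproj_field: assumes Y: "sm U Y" shows "sm U (\<lambda>q. tproj q (Y q))"
  and mD_tproj_field: "p \<in> U \<Longrightarrow> mD (\<lambda>q. tproj q (Y q)) p u = dT p u (Y p) + tproj p (mD Y p u)"
proof -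
  have U: "U \<subseteq> \<M>" using openin_subset[OF sm_open[OF Y]] .
  have t: "sm U (\<lambda>q. tproj q b)" for b by (rule sm_subset[OF sm_tproj sm_open[OF Y] U])
  have i: "sm U (\<lambda>q. Y q \<bullet> b)" for b by (rule sm_inner[OF Y sm_const[OF sm_open[OF Y]]])
  let ?s = "\<lambda>q. \<Sum>b\<in>Basis. (Y q \<bullet> b) *\<^sub>R tproj q b"
  have e: "?s q = tproj q (Y q)" for q
    by (rule linear_basis_expansion[OF tproj_linear, symmetric])
  have s: "sm U ?s" by (rule sm_sum[OF sm_open[OF Y]]) (rule sm_scaleR[OF i t])
  then show "sm U (\<lambda>q. tproj q (Y q))" by (simp only: e)
  assume p: "p \<in> U"
  have pX: "p \<in> \<M>" using p U by auto
  have "mD ?s p u = (\<Sum>b\<in>Basis. (Y p \<bullet> b) *\<^sub>R dT p u b + (mD Y p u \<bullet> b) *\<^sub>R tproj p b)"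
    by (subst mD_sum[OF sm_open[OF Y] p sm_scaleR[OF i t]])
      (simp add: mD_scaleR[OF i t p] mD_inner[OF Y sm_const[OF sm_open[OF Y]] p] mD_const[OF pX] dT_def)
  moreover have "(\<Sum>b\<in>Basis. (Y p \<bullet> b) *\<^sub>R dT p u b) = dT p u (Y p)"
  proof -
    have c: "sm U (\<lambda>q. Y p \<bullet> b)" for b by (rule sm_const[OF sm_open[OF Y]])
    have "dT p u (Y p) = mD (\<lambda>q. \<Sum>b\<in>Basis. (Y p \<bullet> b) *\<^sub>R tproj q b) p u"
      unfolding dT_def by (rule mD_cong(1)[OF t p]) (rule linear_basis_expansion[OF tproj_linear])
    also have "\<dots> = (\<Sum>b\<in>Basis. (Y p \<bullet> b) *\<^sub>R dT p u b)"
      by (subst mD_sum[OF sm_open[OF Y] p sm_scaleR[OF c t]])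
        (simp add: mD_scaleR[OF c t p] mD_const[OF pX] dT_def)
    finally show ?thesis ..
  qed
  moreover have "(\<Sum>b\<in>Basis. (mD Y p u \<bullet> b) *\<^sub>R tproj p b) = tproj p (mD Y p u)"
    by (rule linear_basis_expansion[OF tproj_linear, symmetric])
  ultimately show "mD (\<lambda>q. tproj q (Y q)) p u = dT p u (Y p) + tproj p (mD Y p u)"
    by (simp add: sum.distrib e)
qed

lemma dT_linear_left: "p \<in> \<M> \<Longrightarrow> linear (\<lambda>u. dT p u v)"
  unfolding dT_def using mD_linear[OF sm_tproj] by simp

lemma dT_linear_right: assumes "p \<in> \<M>" shows "linear (dT p u)"
proof (rule linearI)
  show "dT p u (v + w) = dT p u v + dT p u w" for v w
  proof -
    have "dT p u (v + w) = mD (\<lambda>q. tproj q v + tproj q w) p u"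
      unfolding dT_def by (rule mD_cong(1)[OF sm_tproj assms]) (rule linear_add[OF tproj_linear])
    then show ?thesis by (simp add: dT_def mD_add[OF sm_tproj sm_tproj assms])
  qed
  show "dT p u (c *\<^sub>R v) = c *\<^sub>R dT p u v" for c v
  proof -
    have "dT p u (c *\<^sub>R v) = mD (\<lambda>q. c *\<^sub>R tproj q v) p u"
      unfolding dT_def by (rule mD_cong(1)[OF sm_tproj assms]) (rule linear_cmul[OF tproj_linear])
    then show ?thesis using mD_scaleR[OF sm_const sm_tproj assms] by (simp add: dT_def mD_const assms)
  qed
qed

lemma dT_tproj_left: "p \<in> \<M> \<Longrightarrow> dT p (tproj p u) v = dT p u v"
  unfolding dT_def by (rule mD_tproj_arg)

text \<open>Differentiate the identity T T = T for the projection. As a consequence its derivative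
  maps tangent vectors to normal ones.\<close>

lemma dT_idem: assumes "p \<in> \<M>" shows "dT p u (tproj p v) + tproj p (dT p u v) = dT p u v"
proof -
  have "mD (\<lambda>q. tproj q (tproj q v)) p u = mD (\<lambda>q. tproj q v) p u"
    by (rule mD_cong(1)[OF sm_tproj_field(1)[OF sm_tproj] assms]) (rule tproj_idem)
  then show ?thesis using mD_tproj_field[OF sm_tproj assms] by (simp add: dT_def)
qed

lemma tproj_dT: assumes "p \<in> \<M>" "v \<in> tangent_space A F p" shows "tproj p (dT p u v) = 0"
  using dT_idem[OF assms(1), of u v] tproj_id[OF assms] by simp

lemma dT_selfadjoint: assumes p: "p \<in> \<M>" shows "dT p u v \<bullet> w = v \<bullet> dT p u w"
proof -
  have "mD (\<lambda>q. tproj q v \<bullet> w) p u = mD (\<lambda>q. v \<bullet> tproj q w) p u"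
    by (rule mD_cong(1)[OF sm_inner[OF sm_tproj sm_const] p]) (auto simp: tproj_selfadjoint)
  then show ?thesis
    using mD_inner[OF sm_tproj sm_const p, of v w u] mD_inner[OF sm_const sm_tproj p, of v w u]
    by (simp add: dT_def mD_const[OF p])
qed

text \<open>By the commutator formula for \<open>F\<close> the difference of the two sides is
  tangential, and by \<open>tproj_dT\<close> it is normal.\<close>

lemma dT_symmetric:
  assumes p: "p \<in> \<M>" and u: "u \<in> tangent_space A F p" and v: "v \<in> tangent_space A F p"
  shows "dT p u v = dT p v u"
proof -
  have "mD (\<lambda>q. mD F q v) p u = dT p u v" for u v
    unfolding dT_def by (rule mD_cong(1)[OF sm_mD[OF sm_F] p]) (rule mD_F)
  then have "dT p u v - dT p v u = tproj p (dT p u v - dT p v u)"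
    using mD_commutator[OF sm_F p, of v u] mD_F[OF p] by simp
  also have "\<dots> = 0" by (simp add: linear_diff[OF tproj_linear] tproj_dT[OF p] u v)
  finally show ?thesis by simp
qed

lemma normal_part_eq: assumes "p \<in> \<M>" shows "normal_part A F p w = w - tproj p w"
  unfolding normal_part_def
proof (rule the_equality)
  show "w - tproj p w \<in> (tangent_space A F p)\<^sup>\<bottom> \<and> w - (w - tproj p w) \<in> tangent_space A F p"
    using tproj_orthogonal[OF assms] tproj_in[OF assms]
    by (auto simp: orthogonal_comp_def orthogonal_def inner_commute)
  fix n assume n: "n \<in> (tangent_space A F p)\<^sup>\<bottom> \<and> w - n \<in> tangent_space A F p"
  have "tproj p w = w - n"
    by (rule tproj_eqI[OF assms]) (use n in \<open>auto simp: orthogonal_comp_def orthogonal_def inner_commute\<close>)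
  then show "n = w - tproj p w" by simp
qed

text \<open>A tangential field satisfies Y = T Y. Differentiating this, all dependence on the choice
  of extension sits in the tangential term, which the normal part discards. The projected constant
  field is an admissible extension, so the description is satisfied.\<close>

lemma second_ff_eq:
  assumes p: "p \<in> \<M>" and u: "u \<in> tangent_space A F p" and v: "v \<in> tangent_space A F p"
  shows "second_ff X A F p u v = dT p u v"
  unfolding second_ff_def
proof (rule the_equality)
  have key: "normal_part A F p (dir_deriv A F Y p u) = dT p u v"
    if U: "openin X U" "p \<in> U" "smooth_map A U Y" "\<forall>q\<in>U. Y q \<in> tangent_space A F q" "Y p = v" for U Y
  proof -
    have Y: "sm U Y" using U by (simp add: sm_def)
    have "dir_deriv A F Y p u = mD Y p u" by (simp add: mD_def tproj_id[OF p u])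
    also have "\<dots> = mD (\<lambda>q. tproj q (Y q)) p u"
      by (rule mD_cong(1)[OF Y U(2)]) (use U openin_subset[OF U(1)] in \<open>auto simp: tproj_id\<close>)
    also have "\<dots> = dT p u v + tproj p (mD Y p u)" using mD_tproj_field[OF Y U(2)] U(5) by simp
    finally show ?thesis
      by (simp add: normal_part_eq[OF p] linear_add[OF tproj_linear] tproj_dT[OF p v] tproj_idem[OF p])
  qed
  have sp: "smooth_map A \<M> (\<lambda>q. tproj q v)" using sm_tproj by (simp add: sm_topspace)
  show "\<exists>U Y. openin X U \<and> p \<in> U \<and> smooth_map A U Y \<and> (\<forall>q\<in>U. Y q \<in> tangent_space A F q) \<and> Y p = v \<and>
    dT p u v = normal_part A F p (dir_deriv A F Y p u)"
    by (intro exI[of _ "\<M>"] exI[of _ "\<lambda>q. tproj q v"] conjI sp key[symmetric])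
      (auto simp: p tproj_id[OF p v] tproj_in sp)
  show "w = dT p u v" if "\<exists>U Y. openin X U \<and> p \<in> U \<and> smooth_map A U Y \<and> (\<forall>q\<in>U. Y q \<in> tangent_space A F q) \<and> Y p = v \<and>
    w = normal_part A F p (dir_deriv A F Y p u)" for w
    using that key by blast
qed

lemma sum_onb:
  fixes Q :: "real^'m \<Rightarrow> real^'m \<Rightarrow> 'b::real_vector"
  assumes p: "p \<in> \<M>" and lin: "\<And>v. linear (\<lambda>u. Q u v)" "\<And>u. linear (Q u)"
  shows "(\<Sum>e\<in>tangent_onb A F p. Q e e) = (\<Sum>i\<in>Basis. Q (tproj p i) (tproj p i))"
  by (rule sum_bilinear_dual_frames[symmetric, OF tangent_onb(5)[OF p] lin])
    (auto simp: onb_inner[OF p] tproj_def)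

lemma mean_curv_vector_eq:
  assumes p: "p \<in> \<M>"
  shows "mean_curv_vector X A F p = (\<Sum>i\<in>Basis. dT p (tproj p i) (tproj p i))"
proof -
  have "mean_curv_vector X A F p = (\<Sum>e\<in>tangent_onb A F p. dT p e e)"
    unfolding mean_curv_vector_def using tangent_onb(1)[OF p]
    by (intro sum.cong refl second_ff_eq[OF p]) auto
  then show ?thesis using sum_onb[OF p dT_linear_left[OF p] dT_linear_right[OF p]] by simp
qed

text \<open>The two sums over the chosen orthonormal basis are converted one after the other. No
  projection remains in the first slot because \<open>dT\<close> projects its direction
  anyway.\<close>

lemma second_ff_sq_eq:
  assumes p: "p \<in> \<M>"
  shows "second_ff_sq X A F p = (\<Sum>i\<in>Basis. \<Sum>j\<in>Basis. (norm (dT p i (tproj p j)))\<^sup>2)"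
proof -
  let ?B = "tangent_onb A F p"
  have "second_ff_sq X A F p = (\<Sum>e\<in>?B. \<Sum>e'\<in>?B. dT p e e' \<bullet> dT p e e')"
    unfolding second_ff_sq_def power2_norm_eq_inner using tangent_onb(1)[OF p]
    by (intro sum.cong refl) (simp add: second_ff_eq[OF p] subset_iff)
  also have "\<dots> = (\<Sum>e\<in>?B. \<Sum>j\<in>Basis. dT p e (tproj p j) \<bullet> dT p e (tproj p j))"
  proof (rule sum.cong[OF refl])
    fix e
    have "linear (\<lambda>u. dT p e u \<bullet> dT p e v)" "linear (\<lambda>v. dT p e u \<bullet> dT p e v)" for u v
      by (auto intro!: linearI simp: linear_add[OF dT_linear_right[OF p]] linear_cmul[OF dT_linear_right[OF p]]
          inner_add_left inner_add_right)
    then show "(\<Sum>e'\<in>?B. dT p e e' \<bullet> dT p e e') = (\<Sum>j\<in>Basis. dT p e (tproj p j) \<bullet> dT p e (tproj p j))"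
      by (rule sum_onb[OF p])
  qed
  also have "\<dots> = (\<Sum>j\<in>Basis. \<Sum>e\<in>?B. dT p e (tproj p j) \<bullet> dT p e (tproj p j))"
    by (rule sum.swap)
  also have "\<dots> = (\<Sum>j\<in>Basis. \<Sum>i\<in>Basis. dT p (tproj p i) (tproj p j) \<bullet> dT p (tproj p i) (tproj p j))"
  proof (rule sum.cong[OF refl])
    fix w :: "real^'m"
    have "linear (\<lambda>u. dT p u w \<bullet> dT p v w)" "linear (\<lambda>v. dT p u w \<bullet> dT p v w)" for u v
      by (auto intro!: linearI simp: linear_add[OF dT_linear_left[OF p]] linear_cmul[OF dT_linear_left[OF p]]
          inner_add_left inner_add_right)
    then show "(\<Sum>e\<in>?B. dT p e (tproj p w) \<bullet> dT p e (tproj p w)) =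
        (\<Sum>i\<in>Basis. dT p (tproj p i) (tproj p w) \<bullet> dT p (tproj p i) (tproj p w))"
      by (intro sum_onb[OF p]) (auto intro!: linearI simp: linear_add[OF dT_linear_left[OF p]]
          linear_cmul[OF dT_linear_left[OF p]] inner_add_left inner_add_right)
  qed
  also have "\<dots> = (\<Sum>j\<in>Basis. \<Sum>i\<in>Basis. (norm (dT p i (tproj p j)))\<^sup>2)"
    by (simp add: dT_tproj_left[OF p] power2_norm_eq_inner)
  finally show ?thesis by (subst sum.swap)
qed

lemma sm_dT: "sm \<M> (\<lambda>p. dT p u v)"
  unfolding dT_def by (rule sm_mD[OF sm_tproj])

lemma sm_second_ff_sq: "sm \<M> (second_ff_sq X A F)"
proof -
  \<comment> \<open>The vector \<open>tproj p j\<close> moves with \<open>p\<close>, and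
    \<open>dT\<close> is known to be smooth only for fixed vectors, so it is expanded in the
    basis.\<close>
  let ?g = "\<lambda>i j p. \<Sum>b\<in>Basis. (tproj p j \<bullet> b) *\<^sub>R dT p i b"
  have g: "sm \<M> (?g i j)" for i j
    by (intro sm_sum sm_scaleR sm_inner sm_tproj sm_dT sm_const openin_topspace)
  have "sm \<M> (\<lambda>p. \<Sum>i\<in>Basis. \<Sum>j\<in>Basis. ?g i j p \<bullet> ?g i j p)"
    by (intro sm_sum sm_inner[OF g g] openin_topspace)
  moreover obtain q where q: "q \<in> \<M>" using nonempty by blast
  ultimately show ?thesis
  proof (rule mD_cong(2))
    show "(\<Sum>i\<in>Basis. \<Sum>j\<in>Basis. ?g i j p \<bullet> ?g i j p) = second_ff_sq X A F p" if p: "p \<in> \<M>" for p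
      unfolding second_ff_sq_eq[OF p] power2_norm_eq_inner linear_basis_expansion[OF dT_linear_right[OF p], symmetric] ..
  qed
qed

section \<open>Gradient and divergence\<close>

definition grad :: "('a \<Rightarrow> real) \<Rightarrow> 'a \<Rightarrow> real^'m" where
  "grad \<phi> p = (\<Sum>i\<in>Basis. mD \<phi> p i *\<^sub>R i)"

lemma grad_inner: assumes "sm U \<phi>" "p \<in> U" shows "grad \<phi> p \<bullet> u = mD \<phi> p u"
proof -
  have "mD \<phi> p u = (\<Sum>i\<in>Basis. (u \<bullet> i) *\<^sub>R mD \<phi> p i)"
    by (rule linear_basis_expansion[OF mD_linear[OF assms]])
  then show ?thesis by (simp add: grad_def inner_sum_left inner_commute[of u] mult.commute)
qed

lemma sm_grad: assumes "sm U \<phi>" shows "sm U (grad \<phi>)"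
  unfolding grad_def by (intro sm_sum sm_scaleR sm_mD assms sm_const sm_open[OF assms])

lemma sm_in_topspace: "sm U Y \<Longrightarrow> p \<in> U \<Longrightarrow> p \<in> \<M>"
  using openin_subset[OF sm_open] by blast

text \<open>\<open>mD\<close> projects its direction, so the ambient vector that represents it is
  tangential automatically.\<close>

lemma tproj_grad: assumes "sm U \<phi>" "p \<in> U" shows "tproj p (grad \<phi> p) = grad \<phi> p"
proof (rule vector_eq_rdot[THEN iffD1], rule allI)
  fix u
  show "tproj p (grad \<phi> p) \<bullet> u = grad \<phi> p \<bullet> u"
    by (simp add: tproj_selfadjoint grad_inner[OF assms] mD_tproj_arg[OF sm_in_topspace[OF assms]])
qed

lemma gradient_eq: assumes "sm U \<phi>" "p \<in> U" shows "gradient A F \<phi> p = grad \<phi> p"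
  unfolding gradient_def
proof (rule the_equality)
  have p: "p \<in> \<M>" by (rule sm_in_topspace[OF assms])
  have dd: "dir_deriv A F \<phi> p u = grad \<phi> p \<bullet> u" if "u \<in> tangent_space A F p" for u
    by (simp add: grad_inner[OF assms] mD_def tproj_id[OF p that])
  have t: "grad \<phi> p \<in> tangent_space A F p" using tproj_in[OF p] tproj_grad[OF assms] by metis
  then show "grad \<phi> p \<in> tangent_space A F p \<and> (\<forall>u\<in>tangent_space A F p. grad \<phi> p \<bullet> u = dir_deriv A F \<phi> p u)"
    using dd by simp
  fix g assume g: "g \<in> tangent_space A F p \<and> (\<forall>u\<in>tangent_space A F p. g \<bullet> u = dir_deriv A F \<phi> p u)"
  have d: "g - grad \<phi> p \<in> tangent_space A F p" using subspace_diff[OF tangent_subspace[OF p]] g t by blast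
  have "(g - grad \<phi> p) \<bullet> (g - grad \<phi> p) = 0"
    using g dd[OF d] d by (simp add: inner_diff_left)
  then show "g = grad \<phi> p" by simp
qed

lemma chart_derivative_bound:
  assumes c: "(V, \<psi>) \<in> A" and x: "x \<in> V" and Y: "sm U \<phi>" "\<psi> x \<in> U"
  shows "\<bar>Df (\<phi> \<circ> \<psi>) x a\<bar> \<le> norm (grad \<phi> (\<psi> x)) * norm (Df (F \<circ> \<psi>) x a)"
  unfolding mD_chart_dG[OF assms, symmetric] grad_inner[OF Y, symmetric] by (rule Cauchy_Schwarz_ineq2)

text \<open>The tangential divergence: the projection inside \<open>mD\<close> turns the ambient
  trace into a trace over the tangent space. The field itself may have a normal part.\<close>

definition divS :: "('a \<Rightarrow> real^'m) \<Rightarrow> 'a \<Rightarrow> real" where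
  "divS Y p = (\<Sum>i\<in>Basis. i \<bullet> mD Y p i)"

lemma divS_chart:
  assumes c: "(V, \<psi>) \<in> A" and x: "x \<in> V" and Y: "sm U Y" "\<psi> x \<in> U"
  shows "divS Y (\<psi> x) =
    (\<Sum>j\<in>UNIV. local_immersion.K (F \<circ> \<psi>) x j \<bullet> Df (Y \<circ> \<psi>) x (axis j 1))"
proof -
  interpret c: local_immersion V "F \<circ> \<psi>" by (rule chart_immersion[OF c])
  let ?d = "\<lambda>j. Df (Y \<circ> \<psi>) x (axis j 1)"
  have "mD Y (\<psi> x) i = (\<Sum>j\<in>UNIV. (c.K x j \<bullet> i) *\<^sub>R ?d j)" for i
    unfolding mD_chart[OF assms] by (subst frechet_coord[OF c x Y(2,1)]) (simp add: c.coord_def)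
  then have "divS Y (\<psi> x) = (\<Sum>i\<in>Basis. \<Sum>j\<in>UNIV. (c.K x j \<bullet> i) * (?d j \<bullet> i))"
    by (simp add: divS_def inner_sum_right inner_commute)
  also have "\<dots> = (\<Sum>j\<in>UNIV. \<Sum>i\<in>Basis. (c.K x j \<bullet> i) * (?d j \<bullet> i))" by (rule sum.swap)
  finally show ?thesis by (simp add: euclidean_inner[symmetric])
qed

text \<open>The chart expression is a trace in the dual frames \<open>J\<close> and
  \<open>K\<close>, the invariant one a trace in the projected ambient basis. It transfers the
  coordinate divergence formula to the manifold.\<close>

lemma Hv_chart:
  assumes c: "(V, \<psi>) \<in> A" and x: "x \<in> V"
  shows "local_immersion.Hv (F \<circ> \<psi>) x = mean_curv_vector X A F (\<psi> x)"
proof -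
  interpret c: local_immersion V "F \<circ> \<psi>" by (rule chart_immersion[OF c])
  have p: "\<psi> x \<in> \<M>" by (rule chart_topspace[OF c x])
  have "Df (\<lambda>y. c.P y u) x (axis j 1) = dT (\<psi> x) (c.J x j) u" for u j
  proof -
    have "dT (\<psi> x) (c.J x j) u = Df ((\<lambda>q. tproj q u) \<circ> \<psi>) x (axis j 1)"
      unfolding dT_def c.J_def by (rule mD_chart_dG[OF c x sm_tproj p])
    also have "\<dots> = Df (\<lambda>y. c.P y u) x (axis j 1)"
      by (rule fun_cong[OF frechet_derivative_transform_within_open[OF _ c.open_V x]])
        (use smooth_on_differentiable[OF sm_topspace_chart[OF sm_tproj c] x] in \<open>auto simp: tproj_chart[OF c] o_def\<close>)
    finally show ?thesis ..
  qed
  then have "c.Hv x = (\<Sum>j\<in>UNIV. dT (\<psi> x) (c.J x j) (c.K x j))" by (simp add: c.Hv_def)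
  also have "\<dots> = (\<Sum>i\<in>Basis. dT (\<psi> x) (tproj (\<psi> x) i) (tproj (\<psi> x) i))"
    by (rule sum_bilinear_dual_frames[symmetric, OF _ dT_linear_left[OF p] dT_linear_right[OF p]])
      (auto simp: c.K_J[OF x] tproj_chart[OF c x] c.sum_K_J[OF x, symmetric] c.P_def[symmetric])
  finally show ?thesis by (simp add: mean_curv_vector_eq[OF p])
qed

lemma divS_scaleR:
  assumes "sm U \<phi>" "sm U Y" "p \<in> U"
  shows "divS (\<lambda>q. \<phi> q *\<^sub>R Y q) p = grad \<phi> p \<bullet> Y p + \<phi> p * divS Y p"
proof -
  have "divS (\<lambda>q. \<phi> q *\<^sub>R Y q) p = (\<Sum>i\<in>Basis. \<phi> p * (i \<bullet> mD Y p i) + mD \<phi> p i * (i \<bullet> Y p))"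
    by (simp add: divS_def mD_scaleR[OF assms] inner_add_right)
  then show ?thesis
    by (simp add: sum.distrib sum_distrib_left divS_def grad_def inner_sum_left)
qed

lemma divS_F: assumes "p \<in> \<M>" shows "divS F p = real CARD('n)"
proof -
  obtain V \<psi> x where c: "(V, \<psi>) \<in> A" "x \<in> V" "\<psi> x = p" using chart_cover[OF assms] .
  interpret c: local_immersion V "F \<circ> \<psi>" by (rule chart_immersion[OF c(1)])
  have "divS F p = (\<Sum>j\<in>UNIV. c.K x j \<bullet> c.J x j)"
    using divS_chart[OF c(1,2) sm_F] c(3) assms by (simp add: c.J_def)
  then show ?thesis by (simp add: c.K_J[OF c(2)])
qed

end

section \<open>Self-expanders\<close>

locale expander = immersed X A F for X :: "'a topology" and A :: "('n::finite, 'a) atlas" and F :: "'a \<Rightarrow> real^'m::finite" +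
  assumes codim: "CARD('m) = CARD('n) + 1" and self_exp: "self_expander X A F"
begin

lemma dim_tangent: assumes "p \<in> \<M>" shows "dim (tangent_space A F p) = CARD('n)"
proof -
  obtain V \<psi> x where c: "(V, \<psi>) \<in> A" "x \<in> V" "\<psi> x = p" using chart_cover[OF assms] .
  interpret c: local_immersion V "F \<circ> \<psi>" by (rule chart_immersion[OF c(1)])
  have "dim (range (Df (F \<circ> \<psi>) x)) = dim (UNIV :: (real^'n) set)"
    using c.inj_G[OF c(2)] by (intro dim_image_eq[OF c.dG_linear[OF c(2)]]) simp
  then show ?thesis using tangent_space_chart[OF c(1,2)] c(3) by simp
qed

lemma unit_normal_exists: assumes p: "p \<in> \<M>" obtains \<nu> where "unit_normal_at A F p \<nu>"
proof -
  have "dim (tangent_space A F p) < DIM(real^'m)" using dim_tangent[OF p] codim by simp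
  then obtain v where v: "v \<noteq> 0" "\<And>y. y \<in> span (tangent_space A F p) \<Longrightarrow> orthogonal v y"
    using orthogonal_to_subspace_exists by blast
  have "unit_normal_at A F p ((1 / norm v) *\<^sub>R v)"
    using v span_base[of _ "tangent_space A F p"]
    by (auto simp: unit_normal_at_def orthogonal_comp_def orthogonal_def inner_commute)
  then show ?thesis by (rule that)
qed

lemma unit_normalD: assumes "unit_normal_at A F p \<nu>"
  shows "\<nu> \<bullet> \<nu> = 1" "t \<in> tangent_space A F p \<Longrightarrow> \<nu> \<bullet> t = 0" "t \<in> tangent_space A F p \<Longrightarrow> t \<bullet> \<nu> = 0"
  using assms by (auto simp: unit_normal_at_def orthogonal_comp_def orthogonal_def norm_eq_1 inner_commute)

text \<open>Codimension one: an orthonormal tangent basis, \<open>\<nu>\<close> and one more nonzero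
  vector orthogonal to all of them would be n + 2 independent vectors in a space of dimension n +
  1.\<close>

lemma normal_multiple:
  assumes p: "p \<in> \<M>" and nu: "unit_normal_at A F p \<nu>"
    and w: "\<And>t. t \<in> tangent_space A F p \<Longrightarrow> w \<bullet> t = 0"
  shows "w = (w \<bullet> \<nu>) *\<^sub>R \<nu>"
proof (rule ccontr)
  let ?w = "w - (w \<bullet> \<nu>) *\<^sub>R \<nu>" and ?B = "tangent_onb A F p"
  assume "\<not> ?thesis"
  then have w0: "?w \<noteq> 0" by simp
  note B = tangent_onb[OF p]
  note n = unit_normalD[OF nu]
  have wn: "?w \<bullet> \<nu> = 0" using n(1) by (simp add: inner_diff_left)
  have wB: "?w \<bullet> e = 0" "\<nu> \<bullet> e = 0" if "e \<in> ?B" for e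
    using that w n(2) B(1) by (auto simp: inner_diff_left subset_iff)
  have "?w \<notin> insert \<nu> ?B" "\<nu> \<notin> ?B"
    using wB[of ?w] wB[of \<nu>] wn w0 n(1) by auto
  then have card: "card (insert ?w (insert \<nu> ?B)) = card ?B + 2" using B(5) by simp
  have "pairwise orthogonal (insert ?w (insert \<nu> ?B))"
    using B(2) wB wn by (auto simp: pairwise_insert orthogonal_def inner_commute)
  moreover have "0 \<notin> insert ?w (insert \<nu> ?B)" using w0 n(1) B(3)[of 0] by auto
  ultimately have "independent (insert ?w (insert \<nu> ?B))" by (rule pairwise_orthogonal_independent)
  then have "card (insert ?w (insert \<nu> ?B)) \<le> CARD('m)" using independent_bound by force
  moreover have "0 \<notin> ?B" using B(3)[of 0] by auto
  then have "independent ?B" using B(2) pairwise_orthogonal_independent by blast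
  then have "card ?B = CARD('n)" using dim_span_eq_card_independent B(4) dim_tangent[OF p] by metis
  ultimately show False using card codim by simp
qed

lemma tproj_unit_normal:
  assumes p: "p \<in> \<M>" and nu: "unit_normal_at A F p \<nu>" shows "tproj p v = v - (v \<bullet> \<nu>) *\<^sub>R \<nu>"
proof -
  have "v - tproj p v = ((v - tproj p v) \<bullet> \<nu>) *\<^sub>R \<nu>"
    by (rule normal_multiple[OF p nu]) (rule tproj_orthogonal[OF p])
  also have "(v - tproj p v) \<bullet> \<nu> = v \<bullet> \<nu>"
    using unit_normalD(3)[OF nu tproj_in[OF p]] by (simp add: inner_diff_left)
  finally show ?thesis by (simp add: algebra_simps)
qed

lemma mean_curv_vector_normal:
  assumes p: "p \<in> \<M>" and t: "t \<in> tangent_space A F p" shows "mean_curv_vector X A F p \<bullet> t = 0"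
proof -
  have "dT p (tproj p i) (tproj p i) \<bullet> t = 0" for i
    using tproj_selfadjoint[of p "dT p (tproj p i) (tproj p i)" t] tproj_dT[OF p tproj_in[OF p]] tproj_id[OF p t] by simp
  then show ?thesis by (simp add: mean_curv_vector_eq[OF p] inner_sum_left)
qed

lemma mean_curv_eq:
  assumes p: "p \<in> \<M>" and nu: "unit_normal_at A F p \<nu>"
  shows "mean_curv X A F p \<nu> = - (mean_curv_vector X A F p \<bullet> \<nu>)"
  unfolding mean_curv_def
proof (rule the_equality)
  show "mean_curv_vector X A F p = - (- (mean_curv_vector X A F p \<bullet> \<nu>) *\<^sub>R \<nu>)"
    using normal_multiple[OF p nu mean_curv_vector_normal[OF p]] by simp
  show "h = - (mean_curv_vector X A F p \<bullet> \<nu>)" if "mean_curv_vector X A F p = - (h *\<^sub>R \<nu>)" for h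
    using that unit_normalD(1)[OF nu] by simp
qed

lemma mean_curv_expander:
  "p \<in> \<M> \<Longrightarrow> unit_normal_at A F p \<nu> \<Longrightarrow> mean_curv X A F p \<nu> = - (1/2) * (F p \<bullet> \<nu>)"
  using self_exp by (simp add: self_expander_def)

text \<open>The self-expander equation without a choice of normal, since a change of sign of
  \<open>\<nu>\<close> cancels. Hence the first variation formula and the equality case work without
  an orientation.\<close>

lemma mean_curv_vector_expander:
  assumes p: "p \<in> \<M>" shows "mean_curv_vector X A F p = (1/2) *\<^sub>R (F p - tproj p (F p))"
proof -
  obtain \<nu> where nu: "unit_normal_at A F p \<nu>" using unit_normal_exists[OF p] .
  have "mean_curv_vector X A F p = (mean_curv_vector X A F p \<bullet> \<nu>) *\<^sub>R \<nu>"
    by (rule normal_multiple[OF p nu mean_curv_vector_normal[OF p]])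
  also have "mean_curv_vector X A F p \<bullet> \<nu> = (1/2) * (F p \<bullet> \<nu>)"
    using mean_curv_eq[OF p nu] mean_curv_expander[OF p nu] by simp
  finally show ?thesis using tproj_unit_normal[OF p nu, of "F p"] by simp
qed

end

section \<open>Shape operator and support function of an oriented self-expander\<close>

locale oriented_expander = expander X A F for X :: "'a topology" and A :: "('n::finite, 'a) atlas" and F :: "'a \<Rightarrow> real^'m::finite" +
  fixes N :: "'a \<Rightarrow> real^'m"
  assumes smN: "sm (topspace X) N" and N: "\<And>p. p \<in> topspace X \<Longrightarrow> unit_normal_at A F p (N p)"
begin

abbreviation "W \<equiv> mD N"

text \<open>The support function. By the self-expander equation it is -2 times the mean curvature
  with respect to \<open>N\<close>.\<close>

definition f :: "'a \<Rightarrow> real" where "f p = F p \<bullet> N p"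

definition dW :: "'a \<Rightarrow> real^'m \<Rightarrow> real^'m \<Rightarrow> real^'m" where
  "dW p u v = mD (\<lambda>q. W q v) p u"

lemma tproj_eq: "p \<in> \<M> \<Longrightarrow> tproj p v = v - (v \<bullet> N p) *\<^sub>R N p"
  using tproj_unit_normal N by blast

lemma NN: "p \<in> \<M> \<Longrightarrow> N p \<bullet> N p = 1"
  using unit_normalD(1) N by blast

lemma tproj_N: "p \<in> \<M> \<Longrightarrow> tproj p (N p) = 0"
  by (simp add: tproj_eq NN)

lemma W_linear: "p \<in> \<M> \<Longrightarrow> linear (W p)"
  by (rule mD_linear[OF smN])

lemma W_tproj: "p \<in> \<M> \<Longrightarrow> W p (tproj p v) = W p v"
  by (rule mD_tproj_arg)

lemma W_N: "p \<in> \<M> \<Longrightarrow> W p (N p) = 0"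
  using W_tproj[of p "N p"] linear_0[OF W_linear] by (simp add: tproj_N)

lemma W_orth_N: assumes p: "p \<in> \<M>" shows "W p v \<bullet> N p = 0"
proof -
  have "mD (\<lambda>q. N q \<bullet> N q) p v = mD (\<lambda>q. 1) p v"
    by (rule mD_cong(1)[OF sm_inner[OF smN smN] p]) (rule NN)
  then show ?thesis using mD_inner[OF smN smN p] by (simp add: mD_const[OF p] inner_commute)
qed

lemma tproj_W: "p \<in> \<M> \<Longrightarrow> tproj p (W p v) = W p v"
  by (simp add: tproj_eq W_orth_N)

text \<open>In codimension one the projection removes the component along \<open>N\<close>;
  differentiate that formula.\<close>

lemma dT_N: assumes p: "p \<in> \<M>" shows "dT p u v = - (v \<bullet> W p u) *\<^sub>R N p - (v \<bullet> N p) *\<^sub>R W p u"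
proof -
  have c: "sm \<M> (\<lambda>q. v)" by (rule sm_const) simp
  have i: "sm \<M> (\<lambda>q. v \<bullet> N q)" by (rule sm_inner[OF c smN])
  have "dT p u v = mD (\<lambda>q. v - (v \<bullet> N q) *\<^sub>R N q) p u"
    unfolding dT_def by (rule mD_cong(1)[OF sm_tproj p]) (rule tproj_eq)
  also have "\<dots> = - ((v \<bullet> N p) *\<^sub>R W p u + (v \<bullet> W p u) *\<^sub>R N p)"
    by (simp add: mD_diff[OF c sm_scaleR[OF i smN] p] mD_scaleR[OF i smN p] mD_inner[OF c smN p] mD_const[OF p])
  finally show ?thesis by simp
qed

text \<open>Paired with \<open>N p\<close>, \<open>dT\<close> on tangent vectors is the negative of
  the bilinear form of the shape operator, so symmetry is inherited from
  \<open>dT_symmetric\<close>.\<close>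

lemma W_selfadjoint: assumes p: "p \<in> \<M>" shows "W p u \<bullet> v = u \<bullet> W p v"
proof -
  have 1: "dT p (tproj p u) (tproj p v) \<bullet> N p = - (W p u \<bullet> v)" for u v
    using NN[OF p] unit_normalD(2,3)[OF N[OF p] tproj_in[OF p], of v]
    by (simp add: dT_N[OF p] inner_diff_left W_orth_N[OF p] W_tproj[OF p] tproj_W[OF p]
        tproj_selfadjoint inner_commute[of v])
  show ?thesis
    using 1[of u v] 1[of v u] dT_symmetric[OF p tproj_in[OF p] tproj_in[OF p], of u v] by (simp add: inner_commute)
qed

lemma mD_W_field:
  assumes Y: "sm \<M> Y" shows "sm \<M> (\<lambda>q. W q (Y q))"
    and "p \<in> \<M> \<Longrightarrow> mD (\<lambda>q. W q (Y q)) p u = dW p u (Y p) + W p (mD Y p u)"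
proof -
  let ?X = "\<M>"
  have t: "sm ?X (\<lambda>q. W q b)" for b by (rule sm_mD[OF smN])
  have c: "sm ?X (\<lambda>q. v)" for v :: "real^'m" by (rule sm_const) simp
  have i: "sm ?X (\<lambda>q. Y q \<bullet> b)" for b by (rule sm_inner[OF Y c])
  let ?s = "\<lambda>q. \<Sum>b\<in>Basis. (Y q \<bullet> b) *\<^sub>R W q b"
  have e: "?s q = W q (Y q)" if "q \<in> ?X" for q
    by (rule linear_basis_expansion[OF W_linear[OF that], symmetric])
  have s: "sm ?X ?s" by (rule sm_sum) (auto intro: sm_scaleR[OF i t])
  obtain q where "q \<in> ?X" using nonempty by blast
  then show "sm ?X (\<lambda>q. W q (Y q))" by (rule mD_cong(2)[OF s _ e])
  assume p: "p \<in> ?X"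
  have "mD ?s p u = (\<Sum>b\<in>Basis. (Y p \<bullet> b) *\<^sub>R dW p u b + (mD Y p u \<bullet> b) *\<^sub>R W p b)"
    by (subst mD_sum[OF openin_topspace p sm_scaleR[OF i t]])
      (simp add: mD_scaleR[OF i t p] mD_inner[OF Y c p] mD_const[OF p] dW_def)
  moreover have "(\<Sum>b\<in>Basis. (Y p \<bullet> b) *\<^sub>R dW p u b) = dW p u (Y p)"
  proof -
    have cc: "sm ?X (\<lambda>q. Y p \<bullet> b)" for b by (rule sm_const) simp
    have "dW p u (Y p) = mD (\<lambda>q. \<Sum>b\<in>Basis. (Y p \<bullet> b) *\<^sub>R W q b) p u"
      unfolding dW_def by (rule mD_cong(1)[OF t p]) (rule linear_basis_expansion[OF W_linear])
    also have "\<dots> = (\<Sum>b\<in>Basis. (Y p \<bullet> b) *\<^sub>R dW p u b)"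
      by (subst mD_sum[OF openin_topspace p sm_scaleR[OF cc t]])
        (simp add: mD_scaleR[OF cc t p] mD_const[OF p] dW_def)
    finally show ?thesis ..
  qed
  moreover have "(\<Sum>b\<in>Basis. (mD Y p u \<bullet> b) *\<^sub>R W p b) = W p (mD Y p u)"
    by (rule linear_basis_expansion[OF W_linear[OF p], symmetric])
  moreover have "mD (\<lambda>q. W q (Y q)) p u = mD ?s p u"
    by (rule mD_cong(1)[OF s p e, symmetric])
  ultimately show "mD (\<lambda>q. W q (Y q)) p u = dW p u (Y p) + W p (mD Y p u)"
    by (simp add: sum.distrib)
qed

lemma dW_linear_left: "p \<in> \<M> \<Longrightarrow> linear (\<lambda>u. dW p u v)"
  unfolding dW_def using mD_linear[OF sm_mD[OF smN]] by simp

lemma dW_tproj: "p \<in> \<M> \<Longrightarrow> dW p (tproj p u) v = dW p u v"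
  unfolding dW_def by (rule mD_tproj_arg)

lemma dW_selfadjoint: assumes p: "p \<in> \<M>" shows "dW p u v \<bullet> w = v \<bullet> dW p u w"
proof -
  have c: "sm \<M> (\<lambda>q. v)" for v :: "real^'m" by (rule sm_const) simp
  have "mD (\<lambda>q. W q v \<bullet> w) p u = mD (\<lambda>q. v \<bullet> W q w) p u"
    by (rule mD_cong(1)[OF sm_inner[OF sm_mD[OF smN] c] p]) (rule W_selfadjoint)
  then show ?thesis
    by (simp add: mD_inner[OF sm_mD[OF smN] c p] mD_inner[OF c sm_mD[OF smN] p] dW_def mD_const[OF p])
qed

text \<open>Read off from self-adjointness, which moves the second argument to the other side of the
  inner product.\<close>

lemma dW_linear_right: assumes p: "p \<in> \<M>" shows "linear (dW p u)"
proof (rule linearI)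
  show "dW p u (v + w) = dW p u v + dW p u w" for v w
    by (rule vector_eq_rdot[THEN iffD1]) (simp add: dW_selfadjoint[OF p] inner_add_left)
  show "dW p u (c *\<^sub>R v) = c *\<^sub>R dW p u v" for c v
    by (rule vector_eq_rdot[THEN iffD1]) (simp add: dW_selfadjoint[OF p])
qed

text \<open>The commutator formula for \<open>N\<close>: its right-hand side vanishes on tangent
  vectors, where \<open>dT\<close> is symmetric.\<close>

lemma codazzi:
  assumes p: "p \<in> \<M>" and u: "u \<in> tangent_space A F p" and v: "v \<in> tangent_space A F p"
  shows "dW p u v = dW p v u"
  using mD_commutator[OF smN p, of v u] dT_symmetric[OF p u v] linear_0[OF W_linear[OF p]] by (simp add: dW_def)

lemma dW_N: assumes p: "p \<in> \<M>" shows "dW p u (N p) = - W p (W p u)"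
proof -
  have "mD (\<lambda>q. W q (N q)) p u = mD (\<lambda>q. 0) p u"
    by (rule mD_cong(1)[OF mD_W_field(1)[OF smN] p]) (rule W_N)
  then show ?thesis using mD_W_field(2)[OF smN p, of u] by (simp add: mD_const[OF p] eq_neg_iff_add_eq_0)
qed

text \<open>The mean curvature vector is minus the trace of \<open>W\<close> times \<open>N\<close>,
  and on a self-expander it is also half the normal part of \<open>F\<close>.\<close>

lemma trace_W: assumes p: "p \<in> \<M>" shows "(\<Sum>i\<in>Basis. i \<bullet> W p i) = - f p / 2"
proof -
  have "dT p (tproj p i) (tproj p i) = - (i \<bullet> W p i) *\<^sub>R N p" for i
    using unit_normalD(3)[OF N[OF p] tproj_in[OF p]]
    by (simp add: dT_N[OF p] W_tproj[OF p] tproj_selfadjoint tproj_W[OF p])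
  then have "mean_curv_vector X A F p = - (\<Sum>i\<in>Basis. i \<bullet> W p i) *\<^sub>R N p"
    by (simp add: mean_curv_vector_eq[OF p] scaleR_sum_left sum_negf)
  then have "- (\<Sum>i\<in>Basis. i \<bullet> W p i) *\<^sub>R N p \<bullet> N p = (1/2) *\<^sub>R (F p - tproj p (F p)) \<bullet> N p"
    by (simp add: mean_curv_vector_expander[OF p])
  then show ?thesis using NN[OF p] by (simp add: tproj_eq[OF p] f_def)
qed

lemma sm_f: "sm \<M> f"
  unfolding f_def by (rule sm_inner[OF sm_F smN])

lemma mD_f: assumes p: "p \<in> \<M>" shows "mD f p u = W p (F p) \<bullet> u"
  unfolding f_def mD_inner[OF sm_F smN p] mD_F[OF p]
  using tproj_selfadjoint[of p u "N p"] by (simp add: tproj_N[OF p] W_selfadjoint[OF p])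

lemma grad_f: assumes p: "p \<in> \<M>" shows "grad f p = W p (F p)"
  by (rule vector_eq_rdot[THEN iffD1]) (simp add: grad_inner[OF sm_f p] mD_f[OF p])

definition \<alpha> :: "'a \<Rightarrow> real" where "\<alpha> p = (\<Sum>i\<in>Basis. W p i \<bullet> W p i)"

lemma sm_alpha: "sm \<M> \<alpha>"
  unfolding \<alpha>_def by (intro sm_sum sm_inner sm_mD smN) simp

lemma second_ff_sq_alpha: assumes p: "p \<in> \<M>" shows "second_ff_sq X A F p = \<alpha> p"
proof -
  have "(norm (dT p i (tproj p j)))\<^sup>2 = (j \<bullet> W p i) * (j \<bullet> W p i)" for i j
    using unit_normalD(3)[OF N[OF p] tproj_in[OF p]] NN[OF p]
    unfolding power2_norm_eq_inner by (simp add: dT_N[OF p] tproj_selfadjoint tproj_W[OF p])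
  then show ?thesis
    unfolding second_ff_sq_eq[OF p] \<alpha>_def by (simp add: euclidean_inner[of "W p _"] inner_commute)
qed

lemma decomp: "p \<in> \<M> \<Longrightarrow> v = tproj p v + (v \<bullet> N p) *\<^sub>R N p"
  by (simp add: tproj_eq)

lemma sum_basis_inner_scaleR: "(\<Sum>i\<in>Basis. (i \<bullet> w) *\<^sub>R i) = (w :: real^'m)"
  by (simp add: inner_commute[of _ w] euclidean_representation)

text \<open>The divergence of the shape operator. On tangent vectors the Codazzi equation makes it
  the derivative of the trace of \<open>W\<close>, which the self-expander equation determines; on
  the normal, differentiating W N = 0 gives -|A|^2.\<close>

lemma trace_dW:
  assumes p: "p \<in> \<M>"
  shows "(\<Sum>i\<in>Basis. i \<bullet> dW p i w) = - (W p (F p) \<bullet> w) / 2 - \<alpha> p * (w \<bullet> N p)"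
proof -
  have lin: "(\<Sum>i\<in>Basis. i \<bullet> dW p i (a + c *\<^sub>R b)) = (\<Sum>i\<in>Basis. i \<bullet> dW p i a) + c * (\<Sum>i\<in>Basis. i \<bullet> dW p i b)" for a b c
    by (simp add: linear_add[OF dW_linear_right[OF p]] linear_cmul[OF dW_linear_right[OF p]]
        inner_add_right sum.distrib sum_distrib_left)
  have N: "(\<Sum>i\<in>Basis. i \<bullet> dW p i (N p)) = - \<alpha> p"
    by (simp add: dW_N[OF p] \<alpha>_def W_selfadjoint[OF p] sum_negf)
  have T: "(\<Sum>i\<in>Basis. i \<bullet> dW p i w) = - (W p (F p) \<bullet> w) / 2" if w: "w \<in> tangent_space A F p" for w
  proof -
    let ?n = "N p"
    have "(\<Sum>i\<in>Basis. i \<bullet> dW p i w) = (\<Sum>i\<in>Basis. tproj p i \<bullet> dW p i w) + (\<Sum>i\<in>Basis. (i \<bullet> ?n) * (?n \<bullet> dW p i w))"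
    proof -
      have "i \<bullet> dW p i w = tproj p i \<bullet> dW p i w + (i \<bullet> ?n) * (?n \<bullet> dW p i w)" for i
        using arg_cong[OF decomp[OF p, of i], of "\<lambda>v. v \<bullet> dW p i w"] by (simp add: inner_add_left)
      then show ?thesis by (simp add: sum.distrib)
    qed
    also have "(\<Sum>i\<in>Basis. (i \<bullet> ?n) * (?n \<bullet> dW p i w)) = ?n \<bullet> dW p (\<Sum>i\<in>Basis. (i \<bullet> ?n) *\<^sub>R i) w"
      by (simp add: linear_sum[OF dW_linear_left[OF p]] linear_cmul[OF dW_linear_left[OF p]] inner_sum_right)
    also have "\<dots> = 0"
      using dW_tproj[OF p, of ?n w] linear_0[OF dW_linear_left[OF p]]
      by (simp add: sum_basis_inner_scaleR tproj_N[OF p])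
    \<comment> \<open>Codazzi exchanges the summation vector, along which \<open>W\<close> was
      differentiated, with \<open>w\<close>.\<close>
    also have "(\<Sum>i\<in>Basis. tproj p i \<bullet> dW p i w) = (\<Sum>i\<in>Basis. tproj p i \<bullet> dW p w (tproj p i))"
      using codazzi[OF p tproj_in[OF p] w] by (simp add: dW_tproj[OF p])
    \<comment> \<open>Dropping the projections costs only multiples of
      \<open>?n \<bullet> dW p w ?n\<close>, which is 0 because \<open>W\<close> takes tangential
      values.\<close>
    also have "\<dots> = (\<Sum>i\<in>Basis. i \<bullet> dW p w i - (i \<bullet> ?n) * (?n \<bullet> dW p w i) - (i \<bullet> ?n) * (i \<bullet> dW p w ?n) + (i \<bullet> ?n) * (i \<bullet> ?n) * (?n \<bullet> dW p w ?n))"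
      by (simp add: tproj_eq[OF p] linear_diff[OF dW_linear_right[OF p]] linear_cmul[OF dW_linear_right[OF p]]
          inner_diff_left inner_diff_right algebra_simps)
    also have "\<dots> = (\<Sum>i\<in>Basis. i \<bullet> dW p w i)"
    proof -
      have z: "?n \<bullet> dW p w ?n = 0"
        using W_orth_N[OF p] by (simp add: dW_N[OF p] inner_commute)
      have "(\<Sum>i\<in>Basis. (i \<bullet> ?n) * (i \<bullet> dW p w ?n)) = ?n \<bullet> dW p w ?n"
        by (simp add: euclidean_inner[of ?n] inner_commute)
      moreover have "(\<Sum>i\<in>Basis. (i \<bullet> ?n) * (?n \<bullet> dW p w i)) = ?n \<bullet> dW p w ?n"
        by (subst (2) sum_basis_inner_scaleR[of ?n, symmetric])
          (simp only: linear_sum[OF dW_linear_right[OF p]] linear_cmul[OF dW_linear_right[OF p]] inner_sum_right inner_scaleR_right)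
      ultimately show ?thesis using z by (simp add: sum.distrib sum_subtractf)
    qed
    also have "\<dots> = - (W p (F p) \<bullet> w) / 2"
    proof -
      have c: "sm \<M> (\<lambda>q. i)" for i :: "real^'m" by (rule sm_const) simp
      have "mD (\<lambda>q. \<Sum>i\<in>Basis. i \<bullet> W q i) p w = mD (\<lambda>q. (- 1 / 2) * f q) p w"
        by (rule mD_cong(1)[OF sm_sum[OF openin_topspace sm_inner[OF c sm_mD[OF smN]]] p]) (simp add: trace_W)
      moreover have "mD (\<lambda>q. (- 1 / 2) * f q) p w = - (W p (F p) \<bullet> w) / 2"
        using mD_mult[OF sm_const[OF openin_topspace] sm_f p, of "- 1 / 2" w] by (simp add: mD_const[OF p] mD_f[OF p])
      moreover have "mD (\<lambda>q. \<Sum>i\<in>Basis. i \<bullet> W q i) p w = (\<Sum>i\<in>Basis. mD (\<lambda>q. i \<bullet> W q i) p w)"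
        by (rule mD_sum[OF openin_topspace p]) (rule sm_inner[OF c sm_mD[OF smN]])
      ultimately show ?thesis
        by (simp add: mD_inner[OF c sm_mD[OF smN] p] mD_const[OF p] dW_def)
    qed
    finally show ?thesis by simp
  qed
  have WFN: "W p (F p) \<bullet> tproj p w = W p (F p) \<bullet> w"
    using tproj_selfadjoint[of p "W p (F p)" w] by (simp add: tproj_W[OF p])
  have "(\<Sum>i\<in>Basis. i \<bullet> dW p i w) = (\<Sum>i\<in>Basis. i \<bullet> dW p i (tproj p w + (w \<bullet> N p) *\<^sub>R N p))"
    using decomp[OF p, of w] by simp
  also have "\<dots> = - (W p (F p) \<bullet> w) / 2 - (w \<bullet> N p) * \<alpha> p"
    unfolding lin using T[OF tproj_in[OF p]] N WFN by simp
  finally show ?thesis by (simp add: mult.commute)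
qed

text \<open>The field is the gradient of \<open>f\<close>. Its divergence splits into
  \<open>trace_dW\<close> at \<open>F p\<close>, which contains exactly minus the drift term, and
  the trace of \<open>W\<close>, which contributes \<open>- f p / 2\<close>; so only terms of order
  zero survive.\<close>

lemma drift_laplacian_f:
  assumes p: "p \<in> \<M>"
  shows "divS (\<lambda>q. W q (F q)) p + (1/2) * (F p \<bullet> W p (F p)) = - (\<alpha> p + 1/2) * f p"
proof -
  have "divS (\<lambda>q. W q (F q)) p = (\<Sum>i\<in>Basis. i \<bullet> dW p i (F p)) + (\<Sum>i\<in>Basis. i \<bullet> W p i)"
    by (simp add: divS_def mD_W_field(2)[OF sm_F p] mD_F[OF p] W_tproj[OF p] inner_add_right sum.distrib)
  then show ?thesis
    by (simp add: trace_dW[OF p] trace_W[OF p] f_def inner_commute algebra_simps)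
qed

text \<open>If \<open>f = 0\<close>, the hypersurface is a cone and \<open>|A|\<^sup>2\<close> is homogeneous of degree -2.\<close>

lemma cone_alpha_derivative:
  assumes f0: "\<And>q. q \<in> \<M> \<Longrightarrow> f q = 0" and p: "p \<in> \<M>"
  shows "F p \<in> tangent_space A F p" "mD \<alpha> p (F p) = - 2 * \<alpha> p"
proof -
  have WF: "W q (F q) = 0" if q: "q \<in> \<M>" for q
  proof -
    have "mD f q u = mD (\<lambda>q. 0) q u" for u by (rule mD_cong(1)[OF sm_f q]) (rule f0)
    then have "W q (F q) \<bullet> u = 0" for u using mD_f[OF q, of u] by (simp add: mD_const[OF q])
    from this[of "W q (F q)"] show ?thesis by simp
  qed
  have tF: "tproj p (F p) = F p" using f0[OF p] by (simp add: tproj_eq[OF p] f_def)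
  then show FT: "F p \<in> tangent_space A F p" using tproj_in[OF p] by metis
  \<comment> \<open>Differentiate W F = 0, where the derivative of \<open>F\<close> is the
    projection.\<close>
  have dWF: "dW p e (F p) = - W p e" for e
  proof -
    have "mD (\<lambda>q. W q (F q)) p e = mD (\<lambda>q. 0) p e"
      by (rule mD_cong(1)[OF mD_W_field(1)[OF sm_F] p]) (rule WF)
    then show ?thesis
      using mD_W_field(2)[OF sm_F p, of e] by (simp add: mD_const[OF p] mD_F[OF p] W_tproj[OF p] eq_neg_iff_add_eq_0)
  qed
  \<comment> \<open>Codazzi exchanges \<open>F p\<close>, here a tangent vector, with the tangential
    part of \<open>i\<close>. The normal part contributes nothing because W F = 0.\<close>
  have "dW p (F p) i = - W p i" for i
  proof -
    have "dW p (F p) i = dW p (F p) (tproj p i) + (i \<bullet> N p) *\<^sub>R dW p (F p) (N p)"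
      using arg_cong[OF decomp[OF p, of i], of "dW p (F p)"]
      by (simp add: linear_add[OF dW_linear_right[OF p]] linear_cmul[OF dW_linear_right[OF p]])
    also have "\<dots> = dW p (tproj p i) (F p)"
      using codazzi[OF p FT tproj_in[OF p]] linear_0[OF W_linear[OF p]] by (simp add: dW_N[OF p] WF[OF p])
    finally show ?thesis by (simp add: dWF W_tproj[OF p])
  qed
  then have "mD (\<lambda>q. W q i \<bullet> W q i) p (F p) = - 2 * (W p i \<bullet> W p i)" for i
    by (simp add: mD_inner[OF sm_mD[OF smN] sm_mD[OF smN] p] dW_def[symmetric])
  then show "mD \<alpha> p (F p) = - 2 * \<alpha> p"
    unfolding \<alpha>_def
    by (subst mD_sum[OF openin_topspace p sm_inner[OF sm_mD[OF smN] sm_mD[OF smN]]])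
      (simp add: sum_distrib_left)
qed

end

section \<open>Integration\<close>

text \<open>
  The change of variables theorem of the library requires a well-ordered index type. The type \<open>'n idx\<close>
  provides one of the same cardinality as \<open>'n\<close>.
\<close>

typedef ('n::finite) idx = "{..<CARD('n)}"
  by (auto intro!: exI[of _ 0])

instantiation idx :: (finite) linorder
begin
definition less_eq_idx :: "'a idx \<Rightarrow> 'a idx \<Rightarrow> bool" where "x \<le> y \<longleftrightarrow> Rep_idx x \<le> Rep_idx y"
definition less_idx :: "'a idx \<Rightarrow> 'a idx \<Rightarrow> bool" where "x < y \<longleftrightarrow> Rep_idx x < Rep_idx y"
instance by standard (auto simp: less_eq_idx_def less_idx_def Rep_idx_inject)
end

instance idx :: (finite) wellorder
proof
  fix Q :: "'a idx \<Rightarrow> bool" and x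
  assume step: "\<And>x. (\<And>y. y < x \<Longrightarrow> Q y) \<Longrightarrow> Q x"
  show "Q x"
  proof (induction "Rep_idx x" arbitrary: x rule: less_induct)
    case less
    show ?case by (rule step, rule less) (simp add: less_idx_def)
  qed
qed

lemma bij_betw_Rep_idx: "bij_betw Rep_idx (UNIV :: 'n::finite idx set) {..<CARD('n)}"
  by (simp add: bij_betw_def inj_on_def Rep_idx_inject type_definition.Rep_range[OF type_definition_idx])

instance idx :: (finite) finite
  by standard (use bij_betw_finite[OF bij_betw_Rep_idx] in blast)

lemma ex_bij_idx: "\<exists>\<pi> :: 'n::finite \<Rightarrow> 'n idx. bij \<pi>"
proof -
  have "card (UNIV :: 'n idx set) = CARD('n)" using bij_betw_same_card[OF bij_betw_Rep_idx] by simp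
  then show ?thesis using finite_same_card_bij[of "UNIV :: 'n set" "UNIV :: 'n idx set"] by auto
qed

section \<open>Change of variables for an arbitrary finite index type\<close>

lemma sign_conjugate:
  fixes \<pi> :: "'n::finite \<Rightarrow> 'k::finite"
  assumes \<pi>: "bij \<pi>" and p: "p permutes UNIV"
  shows "(\<pi> \<circ> p \<circ> inv \<pi>) permutes UNIV \<and> sign (\<pi> \<circ> p \<circ> inv \<pi>) = sign p"
  using p finite_class.finite_UNIV
proof (induction rule: permutes_induct)
  case id
  have "\<pi> \<circ> id \<circ> inv \<pi> = id" using surj_iff[THEN iffD1, OF bij_is_surj[OF \<pi>]] by simp
  then show ?case using permutes_id by (metis sign_id)
next
  case (swap a b p)
  have "\<pi> \<circ> (Transposition.transpose a b \<circ> p) \<circ> inv \<pi> = Transposition.transpose (\<pi> a) (\<pi> b) \<circ> (\<pi> \<circ> p \<circ> inv \<pi>)"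
    using \<pi> by (auto simp: fun_eq_iff Transposition.transpose_def bij_def inj_eq)
  note eq = this
  have ab: "\<pi> a \<noteq> \<pi> b" using swap \<pi> by (simp add: bij_def inj_eq)
  have q: "\<pi> \<circ> p \<circ> inv \<pi> permutes UNIV" "sign (\<pi> \<circ> p \<circ> inv \<pi>) = sign p"
    using swap.IH by (rule conjunct1, rule conjunct2)
  have perm: "permutation (\<pi> \<circ> p \<circ> inv \<pi>)" "permutation p"
    using permutes_imp_permutation[OF finite_class.finite_UNIV] q(1) swap by blast+
  show ?case
    unfolding eq sign_compose[OF permutation_swap_id perm(1)] sign_compose[OF permutation_swap_id perm(2)] q(2)
    by (rule conjI[OF permutes_compose[OF q(1) permutes_swap_id[OF UNIV_I UNIV_I]]])
      (use ab swap.hyps in \<open>simp add: sign_swap_id\<close>)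
qed

lemma det_reindex:
  fixes M :: "real^'n::finite^'n" and \<pi> :: "'n \<Rightarrow> 'k::finite"
  assumes \<pi>: "bij \<pi>"
  shows "det (\<chi> k l. M $ inv \<pi> k $ inv \<pi> l) = det M"
proof -
  let ?c = "\<lambda>p. \<pi> \<circ> p \<circ> inv \<pi>" and ?d = "\<lambda>q. inv \<pi> \<circ> q \<circ> \<pi>"
  have i: "inv \<pi> (\<pi> x) = x" "\<pi> (inv \<pi> y) = y" for x y
    using \<pi> by (auto simp: bij_def surj_f_inv_f)
  have "det M = (\<Sum>p | p permutes UNIV. of_int (sign (?c p)) * (\<Prod>k\<in>UNIV. M $ inv \<pi> k $ inv \<pi> (?c p k)))"
    unfolding det_def
  proof (rule sum.cong[OF refl])
    fix p :: "'n \<Rightarrow> 'n" assume "p \<in> {p. p permutes UNIV}"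
    then have p: "p permutes UNIV" by simp
    have "(\<Prod>k\<in>UNIV. M $ inv \<pi> k $ p (inv \<pi> k)) = (\<Prod>i\<in>UNIV. M $ i $ p i)"
      by (rule prod.reindex_bij_betw[OF bij_imp_bij_inv[OF \<pi>]])
    then show "of_int (sign p) * (\<Prod>i\<in>UNIV. M $ i $ p i) =
      of_int (sign (?c p)) * (\<Prod>k\<in>UNIV. M $ inv \<pi> k $ inv \<pi> (?c p k))"
      using sign_conjugate[OF \<pi> p] by (simp add: i)
  qed
  also have "\<dots> = (\<Sum>q | q permutes UNIV. of_int (sign q) * (\<Prod>k\<in>UNIV. M $ inv \<pi> k $ inv \<pi> (q k)))"
  proof (rule sum.reindex_bij_witness[where i="?d" and j="?c"])
    show "?d q \<in> {p. p permutes UNIV}" if "q \<in> {q. q permutes UNIV}" for q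
    proof -
      have "inv (inv \<pi>) = \<pi>" using \<pi> by (simp add: inv_inv_eq)
      then show ?thesis using sign_conjugate[OF bij_imp_bij_inv[OF \<pi>], of q] that by simp
    qed
    show "?c p \<in> {q. q permutes UNIV}" if "p \<in> {p. p permutes UNIV}" for p
      using sign_conjugate[OF \<pi>, of p] that by simp
  qed (auto simp: fun_eq_iff i)
  finally show ?thesis by (simp add: det_def)
qed

text \<open>The underlying theorem says that one integral is finite with value \<open>r\<close> iff
  the other is. Used for every \<open>r \<ge> 0\<close>, it also covers the infinite case, in which
  neither side can be finite alone. The scalar function passes through the vector-valued theorem as
  a map into \<open>real^1\<close>.\<close>

lemma nn_integral_change_of_variables_wellorder:
  fixes g :: "real^'k::{finite,wellorder} \<Rightarrow> real^'k::_" and h :: "real^'k::_ \<Rightarrow> real"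
  assumes S: "S \<in> sets lebesgue"
    and der: "\<And>x. x \<in> S \<Longrightarrow> (g has_derivative g' x) (at x within S)" and inj: "inj_on g S"
    and h: "\<And>y. 0 \<le> h y"
    and m1: "(\<lambda>x. indicator S x * (\<bar>det (matrix (g' x))\<bar> * h (g x))) \<in> borel_measurable lebesgue"
    and m2: "(\<lambda>y. indicator (g ` S) y * h y) \<in> borel_measurable lebesgue"
  shows "(\<integral>\<^sup>+x. ennreal (indicator S x * (\<bar>det (matrix (g' x))\<bar> * h (g x))) \<partial>lebesgue) =
    (\<integral>\<^sup>+y. ennreal (indicator (g ` S) y * h y) \<partial>lebesgue)" (is "?L = ?R")
proof -
  let ?a = "\<lambda>x. \<bar>det (matrix (g' x))\<bar> * h (g x)"
  have ind: "((\<lambda>x. indicator T x * q x) has_integral r) UNIV \<longleftrightarrow> q absolutely_integrable_on T \<and> integral T q = r"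
    if "\<And>x. 0 \<le> q x" for T and q :: "real^'k::_ \<Rightarrow> real" and r
  proof -
    have "((\<lambda>x. indicator T x * q x) has_integral r) UNIV \<longleftrightarrow> (q has_integral r) T"
    proof -
      have "(\<lambda>x. indicator T x * q x) = (\<lambda>x. if x \<in> T then q x else 0)" by (auto simp: indicator_def)
      then show ?thesis using has_integral_restrict_UNIV[of T q r] by simp
    qed
    also have "\<dots> \<longleftrightarrow> q absolutely_integrable_on T \<and> integral T q = r"
      using that by (auto simp: absolutely_integrable_on_iff_nonneg has_integral_iff)
    finally show ?thesis .
  qed
  have "?L = ennreal r \<longleftrightarrow> ?R = ennreal r" if r: "0 \<le> r" for r
  proof -
    have "?L = ennreal r \<longleftrightarrow> ((\<lambda>x. indicator S x * ?a x) has_integral r) UNIV"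
      using m1 r h by (subst has_integral_iff_nn_integral_lebesgue) auto
    also have "\<dots> \<longleftrightarrow> ?a absolutely_integrable_on S \<and> integral S ?a = r"
      by (rule ind) (simp add: h)
    also have "\<dots> \<longleftrightarrow> h absolutely_integrable_on (g ` S) \<and> integral (g ` S) h = r"
      using has_absolute_integral_change_of_variables[where S=S and g=g and g'=g' and f="\<lambda>y. vec (h y) :: real^1" and b="vec r", OF S der inj]
      by (simp add: absolutely_integrable_on_1_iff integral_on_1_eq)
    also have "\<dots> \<longleftrightarrow> ((\<lambda>y. indicator (g ` S) y * h y) has_integral r) UNIV"
      by (rule ind[symmetric]) (rule h)
    also have "\<dots> \<longleftrightarrow> ?R = ennreal r"
      using m2 r h by (subst has_integral_iff_nn_integral_lebesgue) auto
    finally show ?thesis .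
  qed
  note eq = this
  show ?thesis
  proof (cases ?L rule: ennreal_cases)
    case (real r)
    then show ?thesis using eq[of r] by simp
  next
    case L: top
    show ?thesis
    proof (cases ?R rule: ennreal_cases)
      case (real r)
      then show ?thesis using eq[of r] by simp
    next
      case top
      then show ?thesis using L by simp
    qed
  qed
qed

text \<open>Lebesgue measure is determined by its values on boxes, and relabelling the coordinates
  maps boxes to boxes with the same edge lengths.\<close>

lemma lborel_reindex:
  fixes \<pi> :: "'n::finite \<Rightarrow> 'k::finite"
  assumes \<pi>: "bij \<pi>"
  shows "distr lborel borel (\<lambda>y::real^'k. (\<chi> i. y $ \<pi> i) :: real^'n) = lborel"
proof (rule lborel_eqI[symmetric])
  let ?e = "\<lambda>y::real^'k. (\<chi> i. y $ \<pi> i) :: real^'n"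
  have i: "inv \<pi> (\<pi> x) = x" "\<pi> (inv \<pi> y) = y" for x y
    using \<pi> by (auto simp: bij_def surj_f_inv_f)
  have m: "?e \<in> measurable lborel borel"
  proof -
    have "continuous_on UNIV ?e"
      by (rule continuous_on_vec_lambda) (intro continuous_on_component continuous_on_id)
    from borel_measurable_continuous_onI[OF this] show ?thesis by simp
  qed
  have nth: "(\<Prod>b\<in>Basis. (w :: real^'j::finite) \<bullet> b) = (\<Prod>i\<in>UNIV. w $ i)" for w
    by (simp add: Basis_vec_def UNION_singleton_eq_range inner_axis prod.reindex axis_eq_axis inj_on_def)
  show "emeasure (distr lborel borel ?e) (box l u) = (\<Prod>b\<in>Basis. (u - l) \<bullet> b)"
    if le: "\<And>b. b \<in> Basis \<Longrightarrow> l \<bullet> b \<le> u \<bullet> b" for l u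
  proof -
    let ?l = "(\<chi> k. l $ inv \<pi> k) :: real^'k" and ?u = "(\<chi> k. u $ inv \<pi> k) :: real^'k"
    have le': "l $ i \<le> u $ i" for i using le[of "axis i 1"] by (simp add: inner_axis)
    have "?e -` box l u = box ?l ?u"
    proof (intro set_eqI iffI)
      fix y assume "y \<in> ?e -` box l u"
      then have a: "l $ i < y $ \<pi> i \<and> y $ \<pi> i < u $ i" for i by (simp add: mem_box_cart)
      show "y \<in> box ?l ?u" using a[of "inv \<pi> _"] by (simp add: mem_box_cart i)
    next
      fix y assume "y \<in> box ?l ?u"
      then have a: "l $ inv \<pi> k < y $ k \<and> y $ k < u $ inv \<pi> k" for k by (simp add: mem_box_cart)
      show "y \<in> ?e -` box l u" using a[of "\<pi> _"] by (simp add: mem_box_cart i)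
    qed
    then have "emeasure (distr lborel borel ?e) (box l u) = emeasure lborel (box ?l ?u)"
      using m by (simp add: emeasure_distr)
    also have "\<dots> = (\<Prod>b\<in>Basis. (?u - ?l) \<bullet> b)"
      by (rule emeasure_lborel_box) (use le' in \<open>auto simp: Basis_vec_def inner_axis\<close>)
    also have "\<dots> = (\<Prod>b\<in>Basis. (u - l) \<bullet> b)"
      unfolding nth using prod.reindex_bij_betw[OF bij_imp_bij_inv[OF \<pi>], of "\<lambda>i. u $ i - l $ i"] by simp
    finally show ?thesis .
  qed
qed simp

text \<open>Conjugation with the relabelling \<open>e\<close>, which preserves Lebesgue measure and
  Jacobian determinants, moves the problem to \<open>'n idx\<close>.\<close>

lemma nn_integral_change_of_variables:
  fixes g :: "real^'n::finite \<Rightarrow> real^'n" and h :: "real^'n \<Rightarrow> real"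
  assumes S: "S \<in> sets borel"
    and der: "\<And>x. x \<in> S \<Longrightarrow> (g has_derivative g' x) (at x)" and inj: "inj_on g S"
    and h: "\<And>y. 0 \<le> h y"
    and m1: "(\<lambda>x. indicator S x * (\<bar>det (matrix (g' x))\<bar> * h (g x))) \<in> borel_measurable borel"
    and m2: "(\<lambda>y. indicator (g ` S) y * h y) \<in> borel_measurable borel"
  shows "(\<integral>\<^sup>+x. ennreal (indicator S x * (\<bar>det (matrix (g' x))\<bar> * h (g x))) \<partial>lborel) =
    (\<integral>\<^sup>+y. ennreal (indicator (g ` S) y * h y) \<partial>lborel)"
proof -
  obtain \<pi> :: "'n \<Rightarrow> 'n idx" where \<pi>: "bij \<pi>" using ex_bij_idx by blast
  have i: "inv \<pi> (\<pi> x) = x" "\<pi> (inv \<pi> y) = y" for x y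
    using \<pi> by (auto simp: bij_def surj_f_inv_f)
  define e where "e = (\<lambda>y::real^'n idx. (\<chi> i. y $ \<pi> i) :: real^'n)"
  define e' where "e' = (\<lambda>x::real^'n. (\<chi> k. x $ inv \<pi> k) :: real^'n idx)"
  have ee': "e (e' x) = x" "e' (e y) = y" for x y by (auto simp: e_def e'_def vec_eq_iff i)
  have be: "bounded_linear e" "bounded_linear e'"
    unfolding e_def e'_def by (auto intro!: linear_conv_bounded_linear[THEN iffD1] linearI simp: vec_eq_iff)
  have me: "e \<in> measurable lborel borel" "e \<in> measurable borel borel"
    using borel_measurable_continuous_onI[OF linear_continuous_on[OF be(1)]] by auto
  have le: "distr lborel borel e = lborel" unfolding e_def by (rule lborel_reindex[OF \<pi>])
  define S' where "S' = e -` S"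
  define q where "q = (\<lambda>y. e' (g (e y)))"
  define q' where "q' = (\<lambda>y v. e' (g' (e y) (e v)))"
  have S': "S' \<in> sets borel" using measurable_sets[OF me(2) S] by (simp add: S'_def)
  have der': "(q has_derivative q' y) (at y within S')" if "y \<in> S'" for y
  proof -
    have "(g \<circ> e has_derivative g' (e y) \<circ> e) (at y)"
      by (rule diff_chain_at[OF bounded_linear_imp_has_derivative[OF be(1)] der]) (use that in \<open>simp add: S'_def\<close>)
    from bounded_linear.has_derivative[OF be(2) this] show ?thesis
      unfolding q_def q'_def o_def by (rule has_derivative_at_withinI)
  qed
  have inj': "inj_on q S'"
  proof (rule inj_onI)
    fix x y assume xy: "x \<in> S'" "y \<in> S'" "q x = q y"
    then have "g (e x) = g (e y)" using ee'(1) unfolding q_def by metis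
    then have "e x = e y" using xy inj by (auto simp: S'_def dest: inj_onD)
    then show "x = y" using ee'(2) by metis
  qed
  have det: "det (matrix (q' y)) = det (matrix (g' (e y)))" for y
  proof -
    have ax: "e (axis l 1) = axis (inv \<pi> l) 1" for l
      by (auto simp: e_def axis_def vec_eq_iff i)
    have "matrix (q' y) = (\<chi> k l. matrix (g' (e y)) $ inv \<pi> k $ inv \<pi> l)"
      unfolding matrix_def q'_def ax by (simp add: vec_eq_iff e'_def)
    then show ?thesis using det_reindex[OF \<pi>] by simp
  qed
  have img: "indicator (q ` S') y = (indicator (g ` S) (e y) :: real)" for y
  proof -
    have "y \<in> q ` S' \<longleftrightarrow> e y \<in> g ` S"
    proof
      assume "y \<in> q ` S'"
      then show "e y \<in> g ` S" by (auto simp: q_def S'_def ee')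
    next
      assume "e y \<in> g ` S"
      then obtain x where x: "x \<in> S" "e y = g x" by auto
      then have "e' x \<in> S'" "y = q (e' x)" using ee' by (auto simp: S'_def q_def) (metis ee'(2))
      then show "y \<in> q ` S'" by blast
    qed
    then show ?thesis by (simp add: indicator_def)
  qed
  have indS: "indicator S' y = (indicator S (e y) :: real)" for y by (simp add: S'_def indicator_def)
  let ?a = "\<lambda>x. indicator S x * (\<bar>det (matrix (g' x))\<bar> * h (g x))" and ?b = "\<lambda>y. indicator (g ` S) y * h y"
  have eqa: "indicator S' y * (\<bar>det (matrix (q' y))\<bar> * h (e (q y))) = ?a (e y)" for y
    by (simp add: indS det q_def ee')
  have eqb: "indicator (q ` S') y * h (e y) = ?b (e y)" for y by (simp add: img)
  have mea: "(\<lambda>y. ?a (e y)) \<in> borel_measurable lebesgue" "(\<lambda>y. ?b (e y)) \<in> borel_measurable lebesgue"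
    using measurable_compose[OF me(1) m1] measurable_compose[OF me(1) m2] by (auto intro: measurable_completion)
  have key: "(\<integral>\<^sup>+y. ennreal (?a (e y)) \<partial>lebesgue) = (\<integral>\<^sup>+y. ennreal (?b (e y)) \<partial>lebesgue)"
    using nn_integral_change_of_variables_wellorder[where S=S' and g=q and g'=q' and h="\<lambda>y. h (e y)", OF _ der' inj' h]
      S' mea unfolding eqa eqb by (simp add: sets_completionI_sets)
  have tr: "(\<integral>\<^sup>+x. ennreal (c x) \<partial>lborel) = (\<integral>\<^sup>+y. ennreal (c (e y)) \<partial>lebesgue)"
    if "c \<in> borel_measurable borel" for c
  proof -
    have "(\<integral>\<^sup>+x. ennreal (c x) \<partial>lborel) = (\<integral>\<^sup>+x. ennreal (c x) \<partial>distr lborel borel e)" by (simp add: le)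
    also have "\<dots> = (\<integral>\<^sup>+y. ennreal (c (e y)) \<partial>lborel)"
      using that by (intro nn_integral_distr me) simp
    finally show ?thesis by (simp add: nn_integral_completion)
  qed
  show ?thesis using key tr[OF m1] tr[OF m2] by simp
qed

section \<open>The Riemannian volume measure\<close>

context immersed
begin

definition bX :: "'a measure" where "bX = sigma \<M> {U. openin X U}"

lemma open_Pow: "{U. openin X U} \<subseteq> Pow \<M>"
  using openin_subset by blast

lemma space_bX: "space bX = \<M>"
  by (simp add: bX_def space_measure_of open_Pow)

lemma sets_bX: "sets bX = sigma_sets \<M> {U. openin X U}"
  by (simp add: bX_def sets_measure_of open_Pow)

lemma openin_sets: "openin X U \<Longrightarrow> U \<in> sets bX"
  by (simp add: sets_bX sigma_sets.Basic)

lemma closedin_sets: assumes "closedin X C" shows "C \<in> sets bX"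
proof -
  have "\<M> - (\<M> - C) \<in> sets bX"
    using assms openin_sets[of "\<M> - C"] sets.compl_sets[of "\<M> - C" bX]
    by (simp add: space_bX openin_diff)
  then show ?thesis using closedin_subset[OF assms] by (simp add: double_diff)
qed

lemma continuous_measurable:
  assumes "continuous_map X euclidean g" shows "g \<in> borel_measurable bX"
proof (rule borel_measurableI)
  fix S :: "'b set" assume "open S"
  then have "openin X {p \<in> \<M>. g p \<in> S}"
    using assms openin_continuous_map_preimage by fastforce
  moreover have "g -` S \<inter> space bX = {p \<in> \<M>. g p \<in> S}" by (auto simp: space_bX)
  ultimately show "g -` S \<inter> space bX \<in> sets bX" using openin_sets by simp
qed

lemma continuous_map_charts:
  assumes "\<And>V \<psi>. (V, \<psi>) \<in> A \<Longrightarrow> continuous_on V (\<lambda>x. g (\<psi> x))"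
  shows "continuous_map X euclidean g"
  unfolding continuous_map_def
proof (intro conjI allI impI)
  fix S :: "'b set" assume "openin euclidean S"
  then have S: "open S" by simp
  show "openin X {p \<in> \<M>. g p \<in> S}"
  proof (subst openin_subopen, rule ballI)
    fix p assume "p \<in> {p \<in> \<M>. g p \<in> S}"
    then have p: "p \<in> \<M>" "g p \<in> S" by auto
    obtain V \<psi> x where c: "(V, \<psi>) \<in> A" "x \<in> V" "\<psi> x = p" using chart_cover[OF p(1)] .
    let ?W = "V \<inter> (\<lambda>x. g (\<psi> x)) -` S"
    have "open ?W" by (rule continuous_open_preimage[OF assms[OF c(1)] chart_open[OF c(1)] S])
    then have "openin X (\<psi> ` ?W)" using chart_image_open[OF c(1)] by blast
    moreover have "p \<in> \<psi> ` ?W" using c p by auto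
    moreover have "\<psi> ` ?W \<subseteq> {p \<in> \<M>. g p \<in> S}" using chart_topspace[OF c(1)] by auto
    ultimately show "\<exists>T. openin X T \<and> p \<in> T \<and> T \<subseteq> {p \<in> \<M>. g p \<in> S}" by blast
  qed
qed simp

lemma sm_continuous: "sm \<M> Y \<Longrightarrow> continuous_map X euclidean Y"
  by (rule continuous_map_charts) (use smooth_on_imp_continuous_on[OF sm_topspace_chart] in \<open>auto simp: o_def\<close>)

lemma chart_measurable:
  assumes c: "(V, \<psi>) \<in> A" shows "\<psi> \<in> measurable (restrict_space lborel V) bX"
proof (rule measurable_sigma_sets[OF sets_bX open_Pow])
  show "\<psi> \<in> space (restrict_space lborel V) \<rightarrow> \<M>"
    using chart_topspace[OF c] by (auto simp: space_restrict_space)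
  fix U assume "U \<in> {U. openin X U}"
  then have "open {x \<in> V. \<psi> x \<in> U}" using chart_preimage_open[OF c] by simp
  moreover have "\<psi> -` U \<inter> space (restrict_space lborel V) = {x \<in> V. \<psi> x \<in> U}"
    by (auto simp: space_restrict_space)
  ultimately show "\<psi> -` U \<inter> space (restrict_space lborel V) \<in> sets (restrict_space lborel V)"
    using chart_open[OF c] by (simp add: sets_restrict_space_iff)
qed

lemma chart_preimage_borel:
  assumes c: "(V, \<psi>) \<in> A" and E: "E \<in> sets bX" shows "{x \<in> V. \<psi> x \<in> E} \<in> sets borel"
proof -
  have "\<psi> -` E \<inter> space (restrict_space lborel V) = {x \<in> V. \<psi> x \<in> E}"
    by (auto simp: space_restrict_space)
  then show ?thesis
    using measurable_sets[OF chart_measurable[OF c] E] chart_open[OF c] by (simp add: sets_restrict_space_iff)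
qed

abbreviation dens :: "(real^'n \<Rightarrow> 'a) \<Rightarrow> real^'n \<Rightarrow> real" where
  "dens \<psi> x \<equiv> sqrt (gram_det (F \<circ> \<psi>) x)"

lemma dens_continuous: assumes c: "(V, \<psi>) \<in> A" shows "continuous_on V (dens \<psi>)"
proof -
  interpret c: local_immersion V "F \<circ> \<psi>" by (rule chart_immersion[OF c])
  have e: "dens \<psi> = c.\<rho>" by (simp add: c.\<rho>_def[abs_def] c.gram_det_eq)
  show "continuous_on V (dens \<psi>)" unfolding e by (rule smooth_on_imp_continuous_on[OF c.smooth_rho])
qed

lemma dens_eq_rho: assumes c: "(V, \<psi>) \<in> A" shows "dens \<psi> x = local_immersion.\<rho> (F \<circ> \<psi>) x"
proof -
  interpret c: local_immersion V "F \<circ> \<psi>" by (rule chart_immersion[OF c])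
  show ?thesis by (simp add: c.\<rho>_def c.gram_det_eq)
qed

lemma dens_pos: assumes c: "(V, \<psi>) \<in> A" and x: "x \<in> V" shows "dens \<psi> x > 0"
proof -
  interpret c: local_immersion V "F \<circ> \<psi>" by (rule chart_immersion[OF c])
  show ?thesis using c.rho_pos[OF x] dens_eq_rho[OF c, of x] by simp
qed

definition \<nu> :: "(real^'n) set \<Rightarrow> (real^'n \<Rightarrow> 'a) \<Rightarrow> 'a set \<Rightarrow> ennreal" where
  "\<nu> V \<psi> E = (\<integral>\<^sup>+ x\<in>{x\<in>V. \<psi> x \<in> E}. ennreal (dens \<psi> x) \<partial>lborel)"

lemma dens_measurable: assumes c: "(V, \<psi>) \<in> A"
  shows "(\<lambda>x. ennreal (dens \<psi> x)) \<in> borel_measurable (restrict_space lborel V)"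
proof -
  have "dens \<psi> \<in> borel_measurable (restrict_space borel V)"
    by (rule borel_measurable_continuous_on_restrict[OF dens_continuous[OF c]])
  then have "dens \<psi> \<in> borel_measurable (restrict_space lborel V)"
    by (simp cong: measurable_cong_sets[OF sets_restrict_space_cong[OF sets_lborel] refl])
  then show ?thesis by simp
qed

lemma nu_emeasure:
  assumes c: "(V, \<psi>) \<in> A" and E: "E \<in> sets bX"
  shows "emeasure (distr (density (restrict_space lborel V) (\<lambda>x. ennreal (dens \<psi> x))) bX \<psi>) E = \<nu> V \<psi> E"
proof -
  let ?R = "restrict_space lborel V"
  have m: "\<psi> \<in> measurable (density ?R (\<lambda>x. ennreal (dens \<psi> x))) bX" using chart_measurable[OF c] by simp
  have E': "\<psi> -` E \<inter> space ?R \<in> sets ?R" by (rule measurable_sets[OF chart_measurable[OF c] E])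
  have "emeasure (distr (density ?R (\<lambda>x. ennreal (dens \<psi> x))) bX \<psi>) E =
      emeasure (density ?R (\<lambda>x. ennreal (dens \<psi> x))) (\<psi> -` E \<inter> space ?R)"
    by (subst emeasure_distr[OF m E]) simp
  also have "\<dots> = (\<integral>\<^sup>+x. ennreal (dens \<psi> x) * indicator (\<psi> -` E \<inter> space ?R) x \<partial>?R)"
    by (rule emeasure_density[OF dens_measurable[OF c] E'])
  also have "\<dots> = (\<integral>\<^sup>+x. ennreal (dens \<psi> x) * indicator (\<psi> -` E \<inter> space ?R) x * indicator V x \<partial>lborel)"
    using chart_open[OF c] by (intro nn_integral_restrict_space) simp
  also have "\<dots> = \<nu> V \<psi> E"
    unfolding \<nu>_def by (intro nn_integral_cong) (auto simp: indicator_def space_restrict_space)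
  finally show ?thesis .
qed

text \<open>If M is the Jacobian matrix of the transition map, the Gram matrices are related by
  congruence with M. Hence the densities differ by the factor |det M|, precisely the one in the
  change of variables.\<close>

lemma nu_consistent:
  assumes c: "(V, \<psi>) \<in> A" "(W, \<phi>) \<in> A" and E: "E \<in> sets bX" "E \<subseteq> \<psi> ` V" "E \<subseteq> \<phi> ` W"
  shows "\<nu> V \<psi> E = \<nu> W \<phi> E"
proof -
  interpret v: local_immersion V "F \<circ> \<psi>" by (rule chart_immersion[OF c(1)])
  interpret w: local_immersion W "F \<circ> \<phi>" by (rule chart_immersion[OF c(2)])
  let ?S = "{x \<in> V. \<psi> x \<in> E}" and ?T = "{y \<in> W. \<phi> y \<in> E}"
  let ?\<tau> = "inv_into W \<phi> \<circ> \<psi>"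
  let ?\<tau>' = "\<lambda>x. Df ?\<tau> x"
  \<comment> \<open>The value 0 off \<open>W\<close> makes the density nonnegative everywhere, as
    the change of variables requires.\<close>
  let ?h = "\<lambda>y. if y \<in> W then dens \<phi> y else 0"
  note t = transition[OF c]
  have img: "?\<tau> ` ?S = ?T"
  proof (intro set_eqI iffI)
    fix y assume "y \<in> ?\<tau> ` ?S"
    then obtain x where x: "x \<in> V" "\<psi> x \<in> E" "y = ?\<tau> x" by auto
    then show "y \<in> ?T" using t(1,2)[of x] E(3) by auto
  next
    fix y assume "y \<in> ?T"
    then have y: "y \<in> W" "\<phi> y \<in> E" by auto
    then obtain x where x: "x \<in> V" "\<psi> x = \<phi> y" using E(2) by auto
    then have "?\<tau> x = y" using t(3)[of x y] y by simp
    then show "y \<in> ?\<tau> ` ?S" using x y by (intro image_eqI[of _ _ x]) auto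
  qed
  have der: "(?\<tau> has_derivative ?\<tau>' x) (at x)" if "x \<in> ?S" for x
    by (rule smooth_on_has_derivative[OF transition_smooth[OF c]]) (use that E(3) in auto)
  have inj: "inj_on ?\<tau> ?S"
  proof (rule inj_onI)
    fix x y assume xy: "x \<in> ?S" "y \<in> ?S" "?\<tau> x = ?\<tau> y"
    then have "\<psi> x = \<psi> y" using t(2)[of x] t(2)[of y] subsetD[OF E(3)] by auto
    then show "x = y" using xy chart_inj[OF c(1)] by (auto dest: inj_onD)
  qed
  have jac: "\<bar>det (matrix (?\<tau>' x))\<bar> * ?h (?\<tau> x) = dens \<psi> x" if x: "x \<in> ?S" for x
  proof -
    have xx: "x \<in> V" "?\<tau> x \<in> W" "\<psi> x = \<phi> (?\<tau> x)" "\<psi> x \<in> E" using x t(1,2)[of x] E(3) by auto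
    let ?M = "matrix (?\<tau>' x)"
    have lin: "linear (?\<tau>' x)" using has_derivative_linear[OF der[OF x]] .
    have pX: "\<phi> (?\<tau> x) \<in> \<M>" by (rule chart_topspace[OF c(2) xx(2)])
    have J: "v.J x j = (\<Sum>k\<in>UNIV. ?M $ k $ j *\<^sub>R w.J (?\<tau> x) k)" for j
    proof -
      have "v.J x j = Df (F \<circ> \<phi>) (?\<tau> x) (?\<tau>' x (axis j 1))"
        unfolding v.J_def by (rule frechet_transition[OF c(2,1) xx(2,1,3) sm_F pX])
      then show ?thesis unfolding w.dG_eq[OF xx(2)] by (simp add: matrix_def)
    qed
    have "v.gram x = transpose ?M ** w.gram (?\<tau> x) ** ?M"
      unfolding vec_eq_iff
      by (simp add: v.gram_def w.gram_def J inner_sum_left inner_sum_right matrix_matrix_mult_def transpose_def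
          sum_distrib_left sum_distrib_right mult_ac)
    then have "gram_det (F \<circ> \<psi>) x = (det ?M)\<^sup>2 * gram_det (F \<circ> \<phi>) (?\<tau> x)"
      by (simp add: v.gram_det_eq w.gram_det_eq det_mul det_transpose power2_eq_square)
    then show ?thesis using xx(2) by (simp add: real_sqrt_mult)
  qed
  have eq1: "indicator ?S x * (\<bar>det (matrix (?\<tau>' x))\<bar> * ?h (?\<tau> x)) = indicator ?S x *\<^sub>R dens \<psi> x" for x
    using jac[of x] by (cases "x \<in> ?S") auto
  have eq2: "indicator ?T y * ?h y = indicator ?T y *\<^sub>R dens \<phi> y" for y
    by (auto simp: indicator_def)
  have Sb: "?S \<in> sets borel" and Tb: "?T \<in> sets borel" using chart_preimage_borel c E(1) by auto
  have m1: "(\<lambda>x. indicator ?S x * (\<bar>det (matrix (?\<tau>' x))\<bar> * ?h (?\<tau> x))) \<in> borel_measurable borel"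
    unfolding eq1
    by (rule borel_measurable_continuous_on_indicator[OF Sb continuous_on_subset[OF dens_continuous[OF c(1)]]]) auto
  have m2: "(\<lambda>y. indicator (?\<tau> ` ?S) y * ?h y) \<in> borel_measurable borel"
    unfolding img eq2
    by (rule borel_measurable_continuous_on_indicator[OF Tb continuous_on_subset[OF dens_continuous[OF c(2)]]]) auto
  have h0: "0 \<le> ?h y" for y using dens_pos[OF c(2), of y] by auto
  have "(\<integral>\<^sup>+x. ennreal (indicator ?S x * (\<bar>det (matrix (?\<tau>' x))\<bar> * ?h (?\<tau> x))) \<partial>lborel) =
      (\<integral>\<^sup>+y. ennreal (indicator (?\<tau> ` ?S) y * ?h y) \<partial>lborel)"
    by (rule nn_integral_change_of_variables[OF Sb der inj h0 m1 m2])
  moreover have "(\<integral>\<^sup>+x. ennreal (indicator ?S x *\<^sub>R dens \<psi> x) \<partial>lborel) = \<nu> V \<psi> E"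
    unfolding \<nu>_def by (intro nn_integral_cong) (auto simp: indicator_def)
  moreover have "(\<integral>\<^sup>+x. ennreal (indicator ?T x *\<^sub>R dens \<phi> x) \<partial>lborel) = \<nu> W \<phi> E"
    unfolding \<nu>_def by (intro nn_integral_cong) (auto simp: indicator_def)
  ultimately show ?thesis unfolding img eq1 eq2 by simp
qed

text \<open>Every base set that fits into some chart selects one such chart. Enumerating these base
  sets may repeat charts, which is harmless.\<close>

lemma countable_atlas:
  "\<exists>c :: nat \<Rightarrow> (real^'n) set \<times> (real^'n \<Rightarrow> 'a).
     (\<forall>i. c i \<in> A) \<and> (\<Union>i. snd (c i) ` fst (c i)) = \<M>"
proof -
  have "second_countable X" using mfd unfolding connected_manifold_def by simp
  then obtain \<B> where B: "countable \<B>" and base: "\<forall>U x. openin X U \<and> x \<in> U \<longrightarrow> (\<exists>B\<in>\<B>. x \<in> B \<and> B \<subseteq> U)"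
    unfolding second_countable_def by (elim exE conjE) (rule that)
  define \<C> where "\<C> = {B \<in> \<B>. \<exists>c\<in>A. B \<subseteq> snd c ` fst c}"
  define k where "k = (\<lambda>B. SOME c. c \<in> A \<and> B \<subseteq> snd c ` fst c)"
  have k: "k B \<in> A \<and> B \<subseteq> snd (k B) ` fst (k B)" if "B \<in> \<C>" for B
  proof -
    have "\<exists>c. c \<in> A \<and> B \<subseteq> snd c ` fst c" using that by (simp only: \<C>_def mem_Collect_eq Bex_def)
    from someI_ex[OF this] show ?thesis unfolding k_def .
  qed
  have cov: "\<exists>B\<in>\<C>. p \<in> B" if p: "p \<in> \<M>" for p
  proof -
    obtain V \<psi> x where c: "(V, \<psi>) \<in> A" "x \<in> V" "\<psi> x = p" using chart_cover[OF p] .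
    then have "openin X (\<psi> ` V) \<and> p \<in> \<psi> ` V" using chart_openin[OF c(1)] by auto
    then obtain B where "B \<in> \<B>" "p \<in> B" "B \<subseteq> \<psi> ` V" using base by meson
    then show ?thesis unfolding \<C>_def using c(1) by force
  qed
  have "countable \<C>" "\<C> \<noteq> {}"
    using B countable_subset[of \<C> \<B>] cov nonempty unfolding \<C>_def by blast+
  then have r: "range (from_nat_into \<C>) = \<C>" by (simp add: range_from_nat_into)
  show ?thesis
  proof (intro exI[of _ "\<lambda>i. k (from_nat_into \<C> i)"] conjI allI)
    show "k (from_nat_into \<C> i) \<in> A" for i using k r by blast
    show "(\<Union>i. snd (k (from_nat_into \<C> i)) ` fst (k (from_nat_into \<C> i))) = \<M>"
    proof
      show "(\<Union>i. snd (k (from_nat_into \<C> i)) ` fst (k (from_nat_into \<C> i))) \<subseteq> \<M>"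
      proof
        fix p assume "p \<in> (\<Union>i. snd (k (from_nat_into \<C> i)) ` fst (k (from_nat_into \<C> i)))"
        then obtain i where i: "p \<in> snd (k (from_nat_into \<C> i)) ` fst (k (from_nat_into \<C> i))" by blast
        have "k (from_nat_into \<C> i) \<in> A" using k r by blast
        then show "p \<in> \<M>"
          using i chart_topspace[of "fst (k (from_nat_into \<C> i))" "snd (k (from_nat_into \<C> i))"] by auto
      qed
      show "\<M> \<subseteq> (\<Union>i. snd (k (from_nat_into \<C> i)) ` fst (k (from_nat_into \<C> i)))"
      proof
        fix p assume "p \<in> \<M>"
        then obtain B where B': "B \<in> \<C>" "p \<in> B" using cov by blast
        then obtain i where "B = from_nat_into \<C> i" using r by blast
        then show "p \<in> (\<Union>i. snd (k (from_nat_into \<C> i)) ` fst (k (from_nat_into \<C> i)))"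
          using k[OF B'(1)] B'(2) by blast
      qed
    qed
  qed
qed

definition is_volume :: "'a measure \<Rightarrow> bool" where
  "is_volume \<sigma> \<longleftrightarrow> space \<sigma> = \<M> \<and> sets \<sigma> = sigma_sets \<M> {U. openin X U} \<and>
        (\<forall>(V,\<psi>)\<in>A. \<forall>E\<in>sets \<sigma>. E \<subseteq> \<psi> ` V \<longrightarrow>
           emeasure \<sigma> E = (\<integral>\<^sup>+ x\<in>{x\<in>V. \<psi> x \<in> E}. ennreal (sqrt (gram_det (F \<circ> \<psi>) x)) \<partial>lborel))"

lemma is_volume_iff: "is_volume \<sigma> \<longleftrightarrow> space \<sigma> = \<M> \<and> sets \<sigma> = sets bX \<and>
    (\<forall>(V,\<psi>)\<in>A. \<forall>E\<in>sets bX. E \<subseteq> \<psi> ` V \<longrightarrow> emeasure \<sigma> E = \<nu> V \<psi> E)"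
  unfolding is_volume_def \<nu>_def sets_bX by auto

text \<open>The definite description in \<open>volume_measure\<close> needs existence and
  uniqueness. The space is cut into countably many disjoint Borel pieces, each inside one chart, and
  the chart measures of the pieces are added. The same cutting determines any other candidate on
  every Borel set.\<close>

lemma ex1_volume: "\<exists>!\<sigma>. is_volume \<sigma>"
proof -
  obtain c :: "nat \<Rightarrow> (real^'n) set \<times> (real^'n \<Rightarrow> 'a)"
    where cc: "(\<forall>i. c i \<in> A) \<and> (\<Union>i. snd (c i) ` fst (c i)) = \<M>"
    using countable_atlas ..
  then have c: "\<And>i. c i \<in> A" "(\<Union>i. snd (c i) ` fst (c i)) = \<M>" by auto
  define V where "V = (\<lambda>i. fst (c i))"
  define \<psi> where "\<psi> = (\<lambda>i. snd (c i))"
  have c': "(V i, \<psi> i) \<in> A" for i using c(1)[of i] by (simp add: V_def \<psi>_def)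
  define D where "D = disjointed (\<lambda>i. \<psi> i ` V i)"
  have img: "range (\<lambda>i. \<psi> i ` V i) \<subseteq> sets bX" using chart_openin[OF c'] openin_sets by auto
  have D: "D i \<in> sets bX" for i
    using sets.range_disjointed_sets[OF img] by (auto simp: D_def)
  have Dd: "disjoint_family D" unfolding D_def by (rule disjoint_family_disjointed)
  have DU: "(\<Union>i. D i) = \<M>" unfolding D_def UN_disjointed_eq using c(2) by (simp add: V_def \<psi>_def)
  have Ds: "D i \<subseteq> \<psi> i ` V i" for i unfolding D_def by (rule disjointed_subset)
  let ?\<mu> = "\<lambda>E. \<Sum>i. \<nu> (V i) (\<psi> i) (E \<inter> D i)"
  let ?m = "\<lambda>i. distr (density (restrict_space lborel (V i)) (\<lambda>x. ennreal (dens (\<psi> i) x))) bX (\<psi> i)"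
  have split: "emeasure M E = (\<Sum>i. emeasure M (E \<inter> D i))" if M: "sets M = sets bX" and E: "E \<in> sets bX" for M E
  proof -
    have "(\<Sum>i. emeasure M (E \<inter> D i)) = emeasure M (\<Union>i. E \<inter> D i)"
    proof (rule suminf_emeasure)
      show "range (\<lambda>i. E \<inter> D i) \<subseteq> sets M" using M E D by auto
      show "disjoint_family (\<lambda>i. E \<inter> D i)" using Dd by (auto simp: disjoint_family_on_def)
    qed
    moreover have "(\<Union>i. E \<inter> D i) = E" using DU sets.sets_into_space[OF E] by (auto simp: space_bX)
    ultimately show ?thesis by simp
  qed
  \<comment> \<open>On a set inside one chart, consistency replaces every summand by the measure of
    that chart, and countable additivity reassembles the set.\<close>
  have key: "(\<Sum>i. \<nu> (V i) (\<psi> i) (E \<inter> D i)) = \<nu> W \<phi> E" if w: "(W, \<phi>) \<in> A" and E: "E \<in> sets bX" "E \<subseteq> \<phi> ` W" for W \<phi> E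
  proof -
    have "\<nu> (V i) (\<psi> i) (E \<inter> D i) = \<nu> W \<phi> (E \<inter> D i)" for i
      by (rule nu_consistent[OF c' w]) (use E D Ds[of i] in auto)
    then have "(\<Sum>i. \<nu> (V i) (\<psi> i) (E \<inter> D i)) = (\<Sum>i. \<nu> W \<phi> (E \<inter> D i))" by simp
    also have "\<dots> = \<nu> W \<phi> E"
      using split[of "distr (density (restrict_space lborel W) (\<lambda>x. ennreal (dens \<phi> x))) bX \<phi>" E] E D
      by (simp add: nu_emeasure[OF w] E sets.Int)
    finally show ?thesis .
  qed
  let ?\<sigma> = "measure_of \<M> (sets bX) ?\<mu>"
  have sp: "sets bX \<subseteq> Pow \<M>" using sets.space_closed[of bX] by (simp add: space_bX)
  have sa: "sigma_sets \<M> (sets bX) = sets bX" using sets.sigma_sets_eq[of bX] by (simp add: space_bX)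
  have em: "emeasure ?\<sigma> E = ?\<mu> E" if E: "E \<in> sets bX" for E
  proof (rule emeasure_measure_of)
    show "positive (sets ?\<sigma>) ?\<mu>" by (simp add: positive_def \<nu>_def)
    show "countably_additive (sets ?\<sigma>) ?\<mu>"
    proof (rule countably_additiveI)
      fix B :: "nat \<Rightarrow> 'a set" assume "range B \<subseteq> sets ?\<sigma>" and dB: "disjoint_family B" and "\<Union> (range B) \<in> sets ?\<sigma>"
      then have B: "B k \<in> sets bX" for k using sp sa by (auto simp: sets_measure_of)
      have "(\<Sum>k. \<Sum>i. \<nu> (V i) (\<psi> i) (B k \<inter> D i)) =
          (\<Sum>k. \<integral>\<^sup>+i. \<nu> (V i) (\<psi> i) (B k \<inter> D i) \<partial>count_space UNIV)"
        by (simp add: nn_integral_count_space_nat)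
      also have "\<dots> = (\<integral>\<^sup>+i. (\<Sum>k. \<nu> (V i) (\<psi> i) (B k \<inter> D i)) \<partial>count_space UNIV)"
        by (rule nn_integral_suminf[symmetric]) simp
      also have "\<dots> = (\<Sum>i. \<Sum>k. \<nu> (V i) (\<psi> i) (B k \<inter> D i))" by (simp add: nn_integral_count_space_nat)
      also have "\<dots> = (\<Sum>i. \<nu> (V i) (\<psi> i) ((\<Union>k. B k) \<inter> D i))"
      proof (rule suminf_cong)
        fix i
        have "(\<Sum>k. emeasure (?m i) (B k \<inter> D i)) = emeasure (?m i) (\<Union>k. B k \<inter> D i)"
        proof (rule suminf_emeasure)
          show "range (\<lambda>k. B k \<inter> D i) \<subseteq> sets (?m i)" using B D by auto
          show "disjoint_family (\<lambda>k. B k \<inter> D i)" using dB by (auto simp: disjoint_family_on_def)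
        qed
        moreover have "(\<Union>k. B k) \<inter> D i \<in> sets bX" using B D by auto
        ultimately show "(\<Sum>k. \<nu> (V i) (\<psi> i) (B k \<inter> D i)) = \<nu> (V i) (\<psi> i) ((\<Union>k. B k) \<inter> D i)"
          using B D by (simp add: nu_emeasure[OF c'] sets.Int)
      qed
      finally show "(\<Sum>k. ?\<mu> (B k)) = ?\<mu> (\<Union> (range B))" by simp
    qed
  qed (use sp sa E in \<open>auto simp: sets_measure_of\<close>)
  have ex: "is_volume ?\<sigma>"
    unfolding is_volume_iff using sp sa em key by (auto simp: space_measure_of sets_measure_of)
  moreover have "\<sigma> = ?\<sigma>" if "is_volume \<sigma>" for \<sigma>
  proof (rule measure_eqI)
    have s: "sets \<sigma> = sets bX" "sets ?\<sigma> = sets bX" using that ex unfolding is_volume_iff by auto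
    then show "sets \<sigma> = sets ?\<sigma>" by simp
    fix E assume "E \<in> sets \<sigma>"
    then have E: "E \<in> sets bX" using s by simp
    have pc: "emeasure \<sigma> (E \<inter> D i) = emeasure ?\<sigma> (E \<inter> D i)" for i
    proof -
      have "E \<inter> D i \<in> sets bX" "E \<inter> D i \<subseteq> \<psi> i ` V i" using E D Ds by auto
      then show ?thesis using that ex c'[of i] unfolding is_volume_iff by fastforce
    qed
    show "emeasure \<sigma> E = emeasure ?\<sigma> E"
      unfolding split[OF s(1) E] split[OF s(2) E] by (simp only: pc)
  qed
  ultimately show ?thesis by blast
qed

abbreviation "vol \<equiv> volume_measure X A F"

lemma is_volume_vol: "is_volume vol"
  using theI'[OF ex1_volume] unfolding volume_measure_def is_volume_def .

lemma space_vol: "space vol = \<M>" and sets_vol: "sets vol = sets bX"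
  and emeasure_vol: "(V, \<psi>) \<in> A \<Longrightarrow> E \<in> sets bX \<Longrightarrow> E \<subseteq> \<psi> ` V \<Longrightarrow> emeasure vol E = \<nu> V \<psi> E"
  using is_volume_vol unfolding is_volume_iff by auto

lemma measurable_vol: "f \<in> borel_measurable vol \<longleftrightarrow> f \<in> borel_measurable bX"
  by (rule measurable_cong_sets[OF sets_vol refl, THEN arg_cong[of _ _ "(\<in>) f"]])

text \<open>The chart formula for sets, recast as an equality of measures, so that integrals are
  transported by the rules for image measures and densities.\<close>

lemma restrict_vol_chart:
  assumes c: "(V, \<psi>) \<in> A"
  shows "restrict_space vol (\<psi> ` V) =
    distr (density (restrict_space lborel V) (\<lambda>x. ennreal (dens \<psi> x))) (restrict_space vol (\<psi> ` V)) \<psi>"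
    (is "?R = ?D") and "\<psi> \<in> measurable (restrict_space lborel V) (restrict_space vol (\<psi> ` V))"
proof -
  have m: "\<psi> \<in> measurable (restrict_space lborel V) vol"
    using chart_measurable[OF c] measurable_cong_sets[OF refl sets_vol] by blast
  show m': "\<psi> \<in> measurable (restrict_space lborel V) (restrict_space vol (\<psi> ` V))"
    by (rule measurable_restrict_space2[OF _ m]) (auto simp: space_restrict_space)
  have img: "\<psi> ` V \<in> sets bX" using openin_sets[OF chart_openin[OF c]] .
  show "?R = ?D"
  proof (rule measure_eqI)
    show "sets ?R = sets ?D" by simp
    fix E assume E: "E \<in> sets ?R"
    then have E': "E \<in> sets bX" "E \<subseteq> \<psi> ` V"
      using img by (auto simp: sets_restrict_space_iff sets_vol)
    have "emeasure ?R E = emeasure vol E"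
      using img E' openin_subset[OF chart_openin[OF c]]
      by (intro emeasure_restrict_space) (auto simp: sets_vol space_vol Int_absorb2)
    also have "\<dots> = emeasure (distr (density (restrict_space lborel V) (\<lambda>x. ennreal (dens \<psi> x))) bX \<psi>) E"
      by (simp add: emeasure_vol[OF c E'] nu_emeasure[OF c E'(1)])
    also have "\<dots> = emeasure ?D E"
      using E E' m' chart_measurable[OF c] by (simp add: emeasure_distr)
    finally show "emeasure ?R E = emeasure ?D E" .
  qed
qed

lemma integral_vol_chart:
  fixes f :: "'a \<Rightarrow> real"
  assumes c: "(V, \<psi>) \<in> A" and f: "f \<in> borel_measurable bX" and f0: "\<And>p. p \<in> \<M> \<Longrightarrow> p \<notin> \<psi> ` V \<Longrightarrow> f p = 0"
  shows "integrable vol f \<longleftrightarrow> integrable lborel (\<lambda>x. if x \<in> V then dens \<psi> x * f (\<psi> x) else 0)"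
    and "(LINT p|vol. f p) = (LINT x|lborel. (if x \<in> V then dens \<psi> x * f (\<psi> x) else 0))"
proof -
  let ?R = "restrict_space vol (\<psi> ` V)" and ?L = "restrict_space lborel V"
  have img: "\<psi> ` V \<inter> space vol \<in> sets vol"
    using openin_sets[OF chart_openin[OF c]] openin_subset[OF chart_openin[OF c]]
    by (simp add: sets_vol space_vol Int_absorb2)
  have fm: "f \<in> borel_measurable ?R"
    using f by (intro measurable_restrict_space1) (simp add: measurable_vol)
  have fm': "(\<lambda>x. f (\<psi> x)) \<in> borel_measurable ?L"
    by (rule measurable_compose[OF restrict_vol_chart(2)[OF c] fm])
  have fv: "f \<in> borel_measurable vol" using f by (simp add: measurable_vol)
  have dm: "dens \<psi> \<in> borel_measurable ?L"
    using borel_measurable_continuous_on_restrict[OF dens_continuous[OF c]]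
    by (simp cong: measurable_cong_sets[OF sets_restrict_space_cong[OF sets_lborel] refl])
  have d0: "AE x in ?L. 0 \<le> dens \<psi> x"
    using dens_pos[OF c] by (intro AE_I2) (auto simp: space_restrict_space intro: less_imp_le)
  have ind: "f p = indicator (\<psi> ` V) p *\<^sub>R f p" if "p \<in> space vol" for p
    using f0[of p] that by (auto simp: indicator_def space_vol)
  have V: "V \<inter> space lborel \<in> sets lborel" using chart_open[OF c] by simp
  have e: "(\<lambda>x. indicator V x *\<^sub>R (dens \<psi> x *\<^sub>R f (\<psi> x))) = (\<lambda>x. if x \<in> V then dens \<psi> x * f (\<psi> x) else 0)"
    by (auto simp: indicator_def fun_eq_iff)
  have "integrable vol f \<longleftrightarrow> integrable ?R f"
    unfolding integrable_restrict_space[OF img] by (rule Bochner_Integration.integrable_cong[OF refl ind])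
  also have "\<dots> \<longleftrightarrow> integrable (density ?L (\<lambda>x. ennreal (dens \<psi> x))) (\<lambda>x. f (\<psi> x))"
    by (subst restrict_vol_chart(1)[OF c], rule integrable_distr_eq) (use restrict_vol_chart(2)[OF c] fm in auto)
  also have "\<dots> \<longleftrightarrow> integrable ?L (\<lambda>x. dens \<psi> x *\<^sub>R f (\<psi> x))"
    by (rule integrable_density[OF fm' dm d0])
  also have "\<dots> \<longleftrightarrow> integrable lborel (\<lambda>x. if x \<in> V then dens \<psi> x * f (\<psi> x) else 0)"
    unfolding integrable_restrict_space[OF V] e ..
  finally show "integrable vol f \<longleftrightarrow> integrable lborel (\<lambda>x. if x \<in> V then dens \<psi> x * f (\<psi> x) else 0)" .
  have "(LINT p|vol. f p) = (LINT p|?R. f p)"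
    unfolding integral_restrict_space[OF img] by (rule Bochner_Integration.integral_cong[OF refl ind])
  also have "\<dots> = (LINT x|density ?L (\<lambda>x. ennreal (dens \<psi> x)). f (\<psi> x))"
    by (subst restrict_vol_chart(1)[OF c], rule integral_distr) (use restrict_vol_chart(2)[OF c] fm in auto)
  also have "\<dots> = (LINT x|?L. dens \<psi> x *\<^sub>R f (\<psi> x))"
    by (rule integral_density[OF fm' dm d0])
  also have "\<dots> = (LINT x|lborel. (if x \<in> V then dens \<psi> x * f (\<psi> x) else 0))"
    unfolding integral_restrict_space[OF V] e ..
  finally show "(LINT p|vol. f p) = (LINT x|lborel. (if x \<in> V then dens \<psi> x * f (\<psi> x) else 0))" .
qed

section \<open>Compactly supported functions and weighted integrals\<close>

definition ccs :: "('a \<Rightarrow> real) \<Rightarrow> bool" where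
  "ccs f \<longleftrightarrow> continuous_map X euclidean f \<and> (\<exists>C. compactin X C \<and> (\<forall>p\<in>\<M> - C. f p = 0))"

lemma ccsI: "continuous_map X euclidean f \<Longrightarrow> compactin X C \<Longrightarrow> (\<And>p. p \<in> \<M> \<Longrightarrow> p \<notin> C \<Longrightarrow> f p = 0) \<Longrightarrow> ccs f"
  unfolding ccs_def by blast

lemma ccs_continuous: "ccs f \<Longrightarrow> continuous_map X euclidean f"
  by (simp add: ccs_def)

lemma ccs_mult: assumes "ccs f" "continuous_map X euclidean g" shows "ccs (\<lambda>p. f p * g p)"
proof -
  obtain C where C: "compactin X C" "\<And>p. p \<in> \<M> - C \<Longrightarrow> f p = 0" using assms(1) unfolding ccs_def by blast
  show ?thesis
    by (rule ccsI[OF _ C(1)]) (use assms C(2) ccs_continuous in \<open>auto intro!: continuous_map_real_mult\<close>)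
qed

lemma ccs_add: assumes "ccs f" "ccs g" shows "ccs (\<lambda>p. f p + g p)"
proof -
  obtain C where C: "compactin X C" "\<And>p. p \<in> \<M> - C \<Longrightarrow> f p = 0" using assms(1) unfolding ccs_def by blast
  obtain D where D: "compactin X D" "\<And>p. p \<in> \<M> - D \<Longrightarrow> g p = 0" using assms(2) unfolding ccs_def by blast
  show ?thesis
    by (rule ccsI[OF _ compactin_Un[OF C(1) D(1)]])
      (use assms C(2) D(2) ccs_continuous in \<open>auto intro!: continuous_map_add\<close>)
qed

lemma ccs_cmult: "ccs f \<Longrightarrow> ccs (\<lambda>p. c * f p)"
  using ccs_mult[of f "\<lambda>p. c"] by (simp add: mult.commute)

lemma ccs_diff: "ccs f \<Longrightarrow> ccs g \<Longrightarrow> ccs (\<lambda>p. f p - g p)"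
  using ccs_add[of f "\<lambda>p. - 1 * g p"] ccs_cmult[of g "- 1"] by simp

lemma chart_ball: assumes "p \<in> \<M>"
  obtains V \<psi> x r where "(V, \<psi>) \<in> A" "r > 0" "cball x r \<subseteq> V" "\<psi> x = p"
proof -
  obtain V \<psi> x where c: "(V, \<psi>) \<in> A" "x \<in> V" "\<psi> x = p" using chart_cover[OF assms] .
  then obtain r where "r > 0" "cball x r \<subseteq> V" using open_contains_cball chart_open[OF c(1)] by meson
  then show ?thesis using that c by blast
qed

lemma chart_preimage_image:
  assumes c: "(V, \<psi>) \<in> A" and C: "C \<subseteq> V" shows "{x \<in> V. \<psi> x \<in> \<psi> ` C} = C"
  using inj_on_image_mem_iff[OF chart_inj[OF c] _ C] C by auto

lemma compactin_cover:
  "compactin X C \<Longrightarrow> (\<And>U. U \<in> \<U> \<Longrightarrow> openin X U) \<Longrightarrow> C \<subseteq> \<Union>\<U> \<Longrightarrow>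
    \<exists>\<F>. finite \<F> \<and> \<F> \<subseteq> \<U> \<and> C \<subseteq> \<Union>\<F>"
  by (simp add: compactin_def)

lemma emeasure_vol_cball:
  assumes c: "(V, \<psi>) \<in> A" and r: "cball x r \<subseteq> V" shows "emeasure vol (\<psi> ` cball x r) < \<infinity>"
proof -
  have cp: "compactin X (\<psi> ` cball x r)" by (rule chart_compact_image[OF c compact_cball r])
  have "compact (dens \<psi> ` cball x r)"
    by (rule compact_continuous_image[OF continuous_on_subset[OF dens_continuous[OF c] r] compact_cball])
  then obtain M where M: "\<And>y. y \<in> cball x r \<Longrightarrow> dens \<psi> y \<le> M"
    using compact_imp_bounded[THEN bounded_imp_bdd_above] unfolding bdd_above_def by (metis image_eqI)
  have "emeasure vol (\<psi> ` cball x r) = \<nu> V \<psi> (\<psi> ` cball x r)"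
    by (rule emeasure_vol[OF c closedin_sets[OF compactin_closed[OF cp]]]) (use r in auto)
  also have "\<dots> = (\<integral>\<^sup>+ y\<in>cball x r. ennreal (dens \<psi> y) \<partial>lborel)"
    unfolding \<nu>_def chart_preimage_image[OF c r] ..
  also have "\<dots> \<le> (\<integral>\<^sup>+ y. ennreal M * indicator (cball x r) y \<partial>lborel)"
    by (rule nn_integral_mono) (auto simp: indicator_def intro!: ennreal_leI M)
  also have "\<dots> = ennreal M * emeasure lborel (cball x r)"
    by (rule nn_integral_cmult_indicator) simp
  also have "\<dots> < \<infinity>"
    using emeasure_bounded_finite[of "cball x r"] by (simp add: ennreal_mult_less_top)
  finally show ?thesis .
qed

lemma emeasure_vol_compact: assumes C: "compactin X C" shows "emeasure vol C < \<infinity>"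
proof -
  let ?\<U> = "{U. openin X U \<and> emeasure vol U < \<infinity>}"
  have "C \<subseteq> \<Union>?\<U>"
  proof
    fix p assume "p \<in> C"
    then have pX: "p \<in> \<M>" using compactin_subset_topspace[OF C] by auto
    obtain V \<psi> x r where c: "(V, \<psi>) \<in> A" "r > 0" "cball x r \<subseteq> V" "\<psi> x = p" using chart_ball[OF pX] .
    have o: "openin X (\<psi> ` ball x r)" using chart_image_open[OF c(1) open_ball] c(3) ball_subset_cball by blast
    have "emeasure vol (\<psi> ` ball x r) \<le> emeasure vol (\<psi> ` cball x r)"
      using closedin_sets[OF compactin_closed[OF chart_compact_image[OF c(1) compact_cball c(3)]]]
      by (intro emeasure_mono image_mono ball_subset_cball) (simp add: sets_vol)
    then have "\<psi> ` ball x r \<in> ?\<U>" using o emeasure_vol_cball[OF c(1,3)] by (auto simp: less_top[symmetric] top_unique)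
    then show "p \<in> \<Union>?\<U>" using c(2,4) by (intro UnionI[of "\<psi> ` ball x r"]) auto
  qed
  then have "\<exists>\<F>. finite \<F> \<and> \<F> \<subseteq> ?\<U> \<and> C \<subseteq> \<Union>\<F>"
    by (rule compactin_cover[OF C, rotated]) simp
  then obtain \<F> where FF: "finite \<F> \<and> \<F> \<subseteq> ?\<U> \<and> C \<subseteq> \<Union>\<F>" ..
  note F = FF[THEN conjunct1] FF[THEN conjunct2, THEN conjunct1] FF[THEN conjunct2, THEN conjunct2]
  have m: "U \<in> sets vol" if "U \<in> \<F>" for U using F(2) that openin_sets by (auto simp: sets_vol)
  have "emeasure vol C \<le> emeasure vol (\<Union>\<F>)"
    using F m by (intro emeasure_mono sets.finite_Union) auto
  also have "\<dots> \<le> (\<Sum>U\<in>\<F>. emeasure vol U)"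
    using emeasure_subadditive_finite[OF F(1), of "\<lambda>U. U" vol] m by auto
  also have "\<dots> < \<infinity>" using F by (auto simp: less_top[symmetric])
  finally show ?thesis .
qed

lemma integrable_ccs: assumes "ccs f" shows "integrable vol f"
proof -
  obtain C where C: "compactin X C" "\<And>p. p \<in> \<M> - C \<Longrightarrow> f p = 0" using assms unfolding ccs_def by blast
  have "compact (f ` C)" using image_compactin[OF C(1) ccs_continuous[OF assms]] by simp
  then obtain B where B: "\<And>p. p \<in> C \<Longrightarrow> norm (f p) \<le> B"
    using compact_imp_bounded bounded_iff by (metis image_eqI)
  show ?thesis
  proof (rule integrableI_bounded_set[where A=C and B=B])
    show "C \<in> sets vol" using closedin_sets[OF compactin_closed[OF C(1)]] by (simp add: sets_vol)
    show "f \<in> borel_measurable vol" using continuous_measurable[OF ccs_continuous[OF assms]] by (simp add: measurable_vol)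
    show "emeasure vol C < \<infinity>" by (rule emeasure_vol_compact[OF C(1)])
  qed (use B C(2) in \<open>auto simp: space_vol\<close>)
qed

definition wgt :: "'a \<Rightarrow> real" where "wgt p = exp ((norm (F p))\<^sup>2 / 4)"

lemma wgt_pos: "0 < wgt p" by (simp add: wgt_def)

lemma wgt_continuous: "continuous_map X euclidean wgt"
proof -
  have "continuous_map X euclidean F" by (rule sm_continuous[OF sm_F])
  then have "continuous_map X euclidean ((\<lambda>v. exp ((norm v)\<^sup>2 / 4)) \<circ> F)"
    by (rule continuous_map_compose) (auto intro!: continuous_intros)
  then show ?thesis by (simp add: wgt_def[abs_def] o_def)
qed

abbreviation "wint \<equiv> weighted_integral X A F"

lemma wint_eq: "wint f = (LINT p|vol. f p * wgt p)"
  by (simp add: weighted_integral_def wgt_def)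

lemma integrable_wgt: "ccs f \<Longrightarrow> integrable vol (\<lambda>p. f p * wgt p)"
  by (intro integrable_ccs ccs_mult wgt_continuous)

lemma wint_add: "ccs f \<Longrightarrow> ccs g \<Longrightarrow> wint (\<lambda>p. f p + g p) = wint f + wint g"
  by (simp add: wint_eq distrib_right integrable_wgt)

lemma wint_diff: "ccs f \<Longrightarrow> ccs g \<Longrightarrow> wint (\<lambda>p. f p - g p) = wint f - wint g"
  by (simp add: wint_eq left_diff_distrib integrable_wgt)

lemma wint_cmult: "wint (\<lambda>p. c * f p) = c * wint f"
  by (simp add: wint_eq mult.assoc)

lemma wint_cong: "(\<And>p. p \<in> \<M> \<Longrightarrow> f p = g p) \<Longrightarrow> wint f = wint g"
  unfolding wint_eq by (rule Bochner_Integration.integral_cong) (auto simp: space_vol)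

lemma wint_mono: "ccs f \<Longrightarrow> ccs g \<Longrightarrow> (\<And>p. p \<in> \<M> \<Longrightarrow> f p \<le> g p) \<Longrightarrow> wint f \<le> wint g"
  unfolding wint_eq
  by (rule integral_mono) (auto simp: space_vol integrable_wgt intro: mult_right_mono less_imp_le[OF wgt_pos])

lemma wint_nonneg: "(\<And>p. p \<in> \<M> \<Longrightarrow> 0 \<le> f p) \<Longrightarrow> 0 \<le> wint f"
  unfolding wint_eq
  by (rule Bochner_Integration.integral_nonneg) (auto simp: space_vol intro!: mult_nonneg_nonneg less_imp_le[OF wgt_pos])

text \<open>Vanishing off some compact set is easier to preserve under sums and products than
  compactness of the closed support; \<open>test_functions_eq\<close> shows that the two
  agree.\<close>

definition tf :: "('a \<Rightarrow> real) \<Rightarrow> bool" where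
  "tf \<phi> \<longleftrightarrow> sm \<M> \<phi> \<and> (\<exists>C. compactin X C \<and> (\<forall>p\<in>\<M> - C. \<phi> p = 0))"

lemma test_functions_eq: "test_functions X A = {\<phi>. tf \<phi>}"
proof (intro set_eqI iffI)
  fix \<phi> assume "\<phi> \<in> test_functions X A"
  then have t: "sm \<M> \<phi>" "compactin X (X closure_of {p\<in>\<M>. \<phi> p \<noteq> 0})"
    by (auto simp: test_functions_def sm_topspace)
  have "\<phi> p = 0" if "p \<in> \<M> - X closure_of {p\<in>\<M>. \<phi> p \<noteq> 0}" for p
    using that closure_of_subset[of "{p\<in>\<M>. \<phi> p \<noteq> 0}" X] by auto
  then show "\<phi> \<in> {\<phi>. tf \<phi>}" using t unfolding tf_def by blast
next
  fix \<phi> assume "\<phi> \<in> {\<phi>. tf \<phi>}"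
  then obtain C where t: "sm \<M> \<phi>" and C: "compactin X C" "\<And>p. p \<in> \<M> - C \<Longrightarrow> \<phi> p = 0"
    unfolding tf_def by blast
  have "X closure_of {p\<in>\<M>. \<phi> p \<noteq> 0} \<subseteq> C"
    by (rule closure_of_minimal[OF _ compactin_closed[OF C(1)]]) (use C(2) in auto)
  then have "compactin X (X closure_of {p\<in>\<M>. \<phi> p \<noteq> 0})"
    using closed_compactin[OF C(1)] by simp
  then show "\<phi> \<in> test_functions X A" using t by (simp add: test_functions_def sm_topspace)
qed

lemma tf_sm: "tf \<phi> \<Longrightarrow> sm \<M> \<phi>" by (simp add: tf_def)

lemma tf_mult: assumes "tf \<phi>" "sm \<M> g" shows "tf (\<lambda>p. \<phi> p * g p)"
proof -
  have "sm \<M> (\<lambda>p. \<phi> p * g p)" using sm_mult assms(2) tf_sm[OF assms(1)] by blast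
  then show ?thesis using assms(1) unfolding tf_def by (metis mult_zero_left)
qed

text \<open>Compact sets are closed in a Hausdorff space, so \<open>Y\<close> is 0 on an open
  neighbourhood of \<open>p\<close>.\<close>

lemma mD_vanish:
  assumes Y: "sm \<M> Y" and C: "compactin X C" "\<And>p. p \<in> \<M> - C \<Longrightarrow> Y p = 0"
    and p: "p \<in> \<M>" "p \<notin> C"
  shows "mD Y p u = 0"
proof -
  have U: "openin X (\<M> - C)" using compactin_closed[OF C(1)] by blast
  have "mD Y p u = mD (\<lambda>q. 0) p u"
    by (rule mD_cong(1)[OF sm_subset[OF Y U]]) (use p C(2) in auto)
  then show ?thesis by (simp add: mD_const[OF p(1)])
qed

lemma tf_grad_ccs:
  assumes "tf \<phi>" "sm \<M> Y" shows "ccs (\<lambda>p. grad \<phi> p \<bullet> Y p)"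
proof -
  obtain C where t: "sm \<M> \<phi>" and C: "compactin X C" "\<And>p. p \<in> \<M> - C \<Longrightarrow> \<phi> p = 0"
    using assms(1) unfolding tf_def by blast
  have "grad \<phi> p = 0" if "p \<in> \<M>" "p \<notin> C" for p
    unfolding grad_def using mD_vanish[OF t C that] by simp
  then show ?thesis
    by (intro ccsI[OF sm_continuous[OF sm_inner[OF sm_grad[OF t] assms(2)]] C(1)]) simp
qed

lemma tf_ccs: "tf \<phi> \<Longrightarrow> ccs \<phi>"
  unfolding tf_def ccs_def using sm_continuous by blast

lemma tf_grad_sq_ccs: "tf \<phi> \<Longrightarrow> ccs (\<lambda>p. (norm (grad \<phi> p))\<^sup>2)"
  unfolding power2_norm_eq_inner by (intro tf_grad_ccs sm_grad tf_sm)

lemma tf_sq_ccs: "tf \<phi> \<Longrightarrow> ccs (\<lambda>p. (\<phi> p)\<^sup>2)"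
  unfolding power2_eq_square by (intro ccs_mult tf_ccs sm_continuous tf_sm)

lemma grad_mult:
  assumes "sm U \<phi>" "sm U \<xi>" "p \<in> U"
  shows "grad (\<lambda>q. \<phi> q * \<xi> q) p = \<phi> p *\<^sub>R grad \<xi> p + \<xi> p *\<^sub>R grad \<phi> p"
  by (rule vector_eq_rdot[THEN iffD1])
    (simp add: grad_inner[OF sm_mult[OF assms(1,2)] assms(3)] mD_mult[OF assms] inner_add_left
      grad_inner[OF assms(1,3)] grad_inner[OF assms(2,3)])

lemma bump:
  assumes c: "(V, \<psi>) \<in> A" and r: "0 < r" "r < s" "cball x s \<subseteq> V"
  obtains \<eta> :: "'a \<Rightarrow> real" where "sm \<M> \<eta>" "\<And>p. 0 \<le> \<eta> p" "\<And>p. \<eta> p \<le> 1"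
    "\<And>y. y \<in> cball x r \<Longrightarrow> \<eta> (\<psi> y) = 1" "\<And>p. p \<notin> \<psi> ` cball x s \<Longrightarrow> \<eta> p = 0" "tf \<eta>"
proof -
  obtain b where b: "smooth_on UNIV b" "\<And>x. 0 \<le> b x" "\<And>x. b x \<le> (1::real)"
    "\<And>y. y \<in> cball x r \<Longrightarrow> b y = 1" "\<And>y. y \<notin> ball x s \<Longrightarrow> b y = 0"
    using smooth_bump[OF r(1,2)] by blast
  \<comment> \<open>Extended by 0 off the chart. The image of the closed ball is compact, hence
    closed, so \<open>\<eta>\<close> is 0 on an open set around every point outside the chart and
    stays smooth there.\<close>
  define \<eta> where "\<eta> = (\<lambda>p. if p \<in> \<psi> ` V then b (inv_into V \<psi> p) else 0)"
  have inv: "inv_into V \<psi> (\<psi> y) = y" if "y \<in> V" for y using chart_inj[OF c] that by simp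
  have off: "\<eta> p = 0" if "p \<notin> \<psi> ` cball x s" for p
  proof (cases "p \<in> \<psi> ` V")
    case True
    then obtain y where y: "y \<in> V" "p = \<psi> y" by auto
    then have "y \<notin> ball x s" using that ball_subset_cball by blast
    then show ?thesis using y b(5) inv by (simp add: \<eta>_def)
  qed (simp add: \<eta>_def)
  have "sm \<M> \<eta>"
  proof (rule smI_local)
    fix p assume p: "p \<in> \<M>"
    show "\<exists>V \<psi> W. (V, \<psi>) \<in> A \<and> open W \<and> W \<subseteq> V \<and> p \<in> \<psi> ` W \<and> smooth_on W (\<lambda>x. \<eta> (\<psi> x))"
    proof (cases "p \<in> \<psi> ` V")
      case True
      have "smooth_on V (\<lambda>y. \<eta> (\<psi> y))"
        using smooth_on_cong[OF chart_open[OF c], of "\<lambda>y. \<eta> (\<psi> y)" b] smooth_on_subset[OF b(1), of V]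
        by (simp add: \<eta>_def inv)
      then show ?thesis using c True chart_open[OF c] by blast
    next
      case False
      have "openin X (\<M> - \<psi> ` cball x s)"
        using compactin_closed[OF chart_compact_image[OF c compact_cball r(3)]] by blast
      moreover have "p \<in> \<M> - \<psi> ` cball x s" using p False r(3) by auto
      moreover obtain V' \<psi>' y where c': "(V', \<psi>') \<in> A" "y \<in> V'" "\<psi>' y = p" using chart_cover[OF p] .
      ultimately have W: "open {z \<in> V'. \<psi>' z \<in> \<M> - \<psi> ` cball x s}" "y \<in> {z \<in> V'. \<psi>' z \<in> \<M> - \<psi> ` cball x s}"
        using chart_preimage_open[OF c'(1), of "\<M> - \<psi> ` cball x s"] by simp_all
      have "smooth_on {z \<in> V'. \<psi>' z \<in> \<M> - \<psi> ` cball x s} (\<lambda>z. \<eta> (\<psi>' z))"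
        using smooth_on_cong[OF W(1), of "\<lambda>z. \<eta> (\<psi>' z)" "\<lambda>z. 0"] smooth_on_const off by auto
      then show ?thesis using c' W
        by (intro exI[of _ V'] exI[of _ \<psi>'] exI[of _ "{z \<in> V'. \<psi>' z \<in> \<M> - \<psi> ` cball x s}"]) auto
    qed
  qed simp
  moreover have "\<eta> (\<psi> y) = 1" if "y \<in> cball x r" for y
  proof -
    have "y \<in> V" using that r by (auto simp: subset_iff)
    then show ?thesis using b(4)[OF that] inv by (simp add: \<eta>_def)
  qed
  moreover have "sm \<M> \<eta> \<Longrightarrow> tf \<eta>"
    unfolding tf_def using off chart_compact_image[OF c compact_cball r(3)] by blast
  ultimately show ?thesis using that[of \<eta>] off b(2,3) by (auto simp: \<eta>_def)
qed

lemma sm_divS: "sm \<M> Y \<Longrightarrow> sm \<M> (divS Y)"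
  unfolding divS_def[abs_def] by (intro sm_sum sm_inner sm_const sm_mD) auto

text \<open>For tangential \<open>Y\<close> this is the divergence with respect to the weighted
  volume.\<close>

abbreviation (input) "fv Y p \<equiv> divS Y p + 1/2 * (F p \<bullet> Y p)"

lemma fv_continuous: assumes Y: "sm \<M> Y" shows "continuous_map X euclidean (\<lambda>p. fv Y p)"
  by (intro sm_continuous sm_add sm_divS Y sm_mult sm_inner sm_F sm_const) auto

lemma fv_ccs:
  assumes Y: "sm \<M> Y" and C: "compactin X C" "\<And>p. p \<in> \<M> - C \<Longrightarrow> Y p = 0"
  shows "ccs (\<lambda>p. fv Y p)"
  by (rule ccsI[OF fv_continuous[OF Y] C(1)]) (use mD_vanish[OF Y C] C(2) in \<open>simp add: divS_def\<close>)

lemma fv_add: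
  assumes "sm \<M> Y" "sm \<M> Z" "p \<in> \<M>"
  shows "fv (\<lambda>p. Y p + Z p) p = fv Y p + fv Z p"
  by (simp add: divS_def mD_add[OF assms] inner_add_right sum.distrib algebra_simps)

end

section \<open>The first variation formula and the position field\<close>

context expander
begin

text \<open>The weight contributes half the tangential part of \<open>F\<close>, and on a
  self-expander the mean curvature vector is half its normal part. Together they form the single
  term F / 2, valid for fields with an arbitrary normal part.\<close>

lemma first_variation_chart:
  assumes c: "(V, \<psi>) \<in> A" and Y: "sm \<M> Y" and C: "compact C" "C \<subseteq> V"
    and Y0: "\<And>p. p \<in> \<M> \<Longrightarrow> p \<notin> \<psi> ` C \<Longrightarrow> Y p = 0"
  shows "wint (\<lambda>p. fv Y p) = 0"
proof -
  interpret c: local_immersion V "F \<circ> \<psi>" by (rule chart_immersion[OF c])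
  have cp: "compactin X (\<psi> ` C)" by (rule chart_compact_image[OF c C])
  let ?f = "\<lambda>p. fv Y p * wgt p"
  have cc: "ccs (\<lambda>p. fv Y p)" by (rule fv_ccs[OF Y cp]) (use Y0 in auto)
  have "wint (\<lambda>p. fv Y p) = (LINT x|lborel. (if x \<in> V then dens \<psi> x * ?f (\<psi> x) else 0))"
    unfolding wint_eq
  proof (rule integral_vol_chart(2)[OF c])
    show "?f \<in> borel_measurable bX"
      by (rule continuous_measurable[OF ccs_continuous[OF ccs_mult[OF cc wgt_continuous]]])
    show "?f p = 0" if "p \<in> \<M>" "p \<notin> \<psi> ` V" for p
    proof -
      have "p \<notin> \<psi> ` C" using that C(2) by auto
      then show ?thesis using mD_vanish[OF Y cp _ that(1)] Y0 that(1) by (simp add: divS_def)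
    qed
  qed
  also have "\<dots> = (LINT x|lborel. (if x \<in> V then c.\<rho> x * c.\<omega> x * ((\<Sum>j\<in>UNIV. c.K x j \<bullet> Df (Y \<circ> \<psi>) x (axis j 1)) +
    (c.Hv x + (1/2) *\<^sub>R c.P x ((F \<circ> \<psi>) x)) \<bullet> (Y \<circ> \<psi>) x) else 0))"
  proof (rule Bochner_Integration.integral_cong[OF refl])
    fix x
    have "c.Hv x + (1/2) *\<^sub>R c.P x (F (\<psi> x)) = (1/2) *\<^sub>R F (\<psi> x)" if "x \<in> V"
      unfolding Hv_chart[OF c that] mean_curv_vector_expander[OF chart_topspace[OF c that]] tproj_chart[OF c that]
      by (simp add: algebra_simps)
    then show "(if x \<in> V then dens \<psi> x * ?f (\<psi> x) else 0) =
      (if x \<in> V then c.\<rho> x * c.\<omega> x * ((\<Sum>j\<in>UNIV. c.K x j \<bullet> Df (Y \<circ> \<psi>) x (axis j 1)) +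
        (c.Hv x + (1/2) *\<^sub>R c.P x ((F \<circ> \<psi>) x)) \<bullet> (Y \<circ> \<psi>) x) else 0)"
      using divS_chart[OF c _ Y chart_topspace[OF c]]
      by (simp add: dens_eq_rho[OF c] c.\<omega>_def wgt_def)
  qed
  also have "\<dots> = 0"
    by (rule c.divergence_theorem_chart[OF sm_topspace_chart[OF Y c] C])
      (use Y0 chart_inj[OF c] chart_topspace[OF c] C(2) in \<open>auto dest: inj_onD\<close>)
  finally show ?thesis .
qed

text \<open>The localization uses bump functions \<open>\<eta>\<close> one at a time, splitting \<open>Y = \<eta> Y + (1 - \<eta>) Y\<close>.\<close>

lemma first_variation:
  assumes Y: "sm \<M> Y" and C: "compactin X C" "\<And>p. p \<in> \<M> - C \<Longrightarrow> Y p = 0"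
  shows "wint (\<lambda>p. divS Y p + 1/2 * (F p \<bullet> Y p)) = 0"
proof -
  let ?\<U> = "{U. openin X U \<and> (\<exists>V \<psi> D \<eta>. (V, \<psi>) \<in> A \<and> compact D \<and> D \<subseteq> V \<and> sm \<M> \<eta> \<and>
     (\<forall>p\<in>\<M>. p \<notin> \<psi> ` D \<longrightarrow> \<eta> p = 0) \<and> (\<forall>p\<in>U. \<eta> p = (1::real)))}"
  have "C \<subseteq> \<Union>?\<U>"
  proof
    fix p assume "p \<in> C"
    then have pX: "p \<in> \<M>" using compactin_subset_topspace[OF C(1)] by auto
    obtain V \<psi> x r where c: "(V, \<psi>) \<in> A" "r > 0" "cball x r \<subseteq> V" "\<psi> x = p" using chart_ball[OF pX] .
    have rr: "0 < r/2" "r/2 < r" using c(2) by auto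
    obtain \<eta> :: "'a \<Rightarrow> real" where \<eta>: "sm \<M> \<eta>" "\<And>p. 0 \<le> \<eta> p" "\<And>p. \<eta> p \<le> 1"
      "\<And>y. y \<in> cball x (r/2) \<Longrightarrow> \<eta> (\<psi> y) = 1" "\<And>p. p \<notin> \<psi> ` cball x r \<Longrightarrow> \<eta> p = 0" "tf \<eta>"
      using bump[OF c(1) rr c(3)] by blast
    have sub: "ball x (r/2) \<subseteq> V" using c(2,3) by (auto simp: subset_iff)
    have "\<psi> ` ball x (r/2) \<in> ?\<U>"
      using chart_image_open[OF c(1) open_ball sub] c \<eta>
      by (intro CollectI conjI exI[of _ V] exI[of _ \<psi>] exI[of _ "cball x r"] exI[of _ \<eta>]) auto
    moreover have "p \<in> \<psi> ` ball x (r/2)" using c(2,4) by auto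
    ultimately show "p \<in> \<Union>?\<U>" by blast
  qed
  then have "\<exists>\<F>. finite \<F> \<and> \<F> \<subseteq> ?\<U> \<and> C \<subseteq> \<Union>\<F>"
    by (rule compactin_cover[OF C(1), rotated]) simp
  then obtain \<F> where FF: "finite \<F> \<and> \<F> \<subseteq> ?\<U> \<and> C \<subseteq> \<Union>\<F>" ..
  note F = FF[THEN conjunct1] FF[THEN conjunct2, THEN conjunct1] FF[THEN conjunct2, THEN conjunct2]
  \<comment> \<open>The induction over the subcover is for all fields at once, since the remainder
    \<open>?Y2\<close> is a new field, vanishing off the remaining sets.\<close>
  have "wint (\<lambda>p. fv Y p) = 0" if "sm \<M> Y" "\<And>p. p \<in> \<M> - C \<Longrightarrow> Y p = 0"
    "\<And>p. p \<in> \<M> \<Longrightarrow> p \<notin> \<Union>\<F> \<Longrightarrow> Y p = 0" for Y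
    using F(1,2) that
  proof (induction \<F> arbitrary: Y rule: finite_induct)
    case empty
    have "fv Y p = 0" if p: "p \<in> \<M>" for p
      using mD_vanish[OF empty(2) compactin_empty _ p] empty(4) p by (simp add: divS_def)
    then have "wint (\<lambda>p. fv Y p) = wint (\<lambda>p. 0)" by (rule wint_cong)
    then show ?case by (simp add: wint_eq)
  next
    case (insert U \<F>)
    have "U \<in> ?\<U>" using insert.prems(1) by blast
    then obtain V \<psi> D \<eta> where w: "(V, \<psi>) \<in> A \<and> compact D \<and> D \<subseteq> V \<and> sm \<M> \<eta> \<and>
      (\<forall>p\<in>\<M>. p \<notin> \<psi> ` D \<longrightarrow> \<eta> p = 0) \<and> (\<forall>p\<in>U. \<eta> p = (1::real))" by blast
    then have c: "(V, \<psi>) \<in> A" "compact D" "D \<subseteq> V" by simp_all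
    have \<eta>: "sm \<M> \<eta>" "\<And>p. p \<in> \<M> \<Longrightarrow> p \<notin> \<psi> ` D \<Longrightarrow> \<eta> p = 0" "\<And>p. p \<in> U \<Longrightarrow> \<eta> p = 1"
      using w by simp_all
    let ?Y1 = "\<lambda>p. \<eta> p *\<^sub>R Y p" and ?Y2 = "\<lambda>p. (1 - \<eta> p) *\<^sub>R Y p"
    have s1: "sm \<M> ?Y1" by (rule sm_scaleR[OF \<eta>(1) insert.prems(2)])
    have s2: "sm \<M> ?Y2"
      by (rule sm_scaleR[OF sm_diff[OF sm_const[OF openin_topspace] \<eta>(1)] insert.prems(2)])
    have "wint (\<lambda>p. fv ?Y1 p) = 0"
      by (rule first_variation_chart[OF c(1) s1 c(2,3)]) (simp add: \<eta>(2))
    moreover have "wint (\<lambda>p. fv ?Y2 p) = 0"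
    proof (rule insert.IH[OF _ s2])
      show "\<F> \<subseteq> ?\<U>" using insert.prems(1) by blast
      show "?Y2 p = 0" if "p \<in> \<M> - C" for p using insert.prems(3)[OF that] by simp
      show "?Y2 p = 0" if "p \<in> \<M>" "p \<notin> \<Union>\<F>" for p
        using insert.prems(4)[of p] \<eta>(3)[of p] that by (cases "p \<in> U") auto
    qed
    moreover have "wint (\<lambda>p. fv Y p) = wint (\<lambda>p. fv ?Y1 p + fv ?Y2 p)"
    proof (rule wint_cong)
      fix p assume p: "p \<in> \<M>"
      have e: "(\<lambda>p. ?Y1 p + ?Y2 p) = Y" by (auto simp: algebra_simps)
      have e': "?Y1 p + ?Y2 p = Y p" by (simp add: algebra_simps)
      show "fv Y p = fv ?Y1 p + fv ?Y2 p" using fv_add[OF s1 s2 p] unfolding e e' .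
    qed
    moreover have "wint (\<lambda>p. fv ?Y1 p + fv ?Y2 p) = wint (\<lambda>p. fv ?Y1 p) + wint (\<lambda>p. fv ?Y2 p)"
      by (rule wint_add[OF fv_ccs[OF s1 C(1)] fv_ccs[OF s2 C(1)]]) (simp_all add: insert.prems(3))
    ultimately show ?case by simp
  qed
  then show ?thesis using Y C(2) F(3) by blast
qed

definition En :: "('a \<Rightarrow> real) \<Rightarrow> real" where "En \<phi> = wint (\<lambda>p. (norm (grad \<phi> p))\<^sup>2)"
definition L2 :: "('a \<Rightarrow> real) \<Rightarrow> real" where "L2 \<phi> = wint (\<lambda>p. (\<phi> p)\<^sup>2)"

lemma position_identity:
  assumes t: "tf \<phi>"
  shows "wint (\<lambda>p. (\<phi> p)\<^sup>2 * (real CARD('n) + 1/2 * (norm (F p))\<^sup>2) + 2 * \<phi> p * (grad \<phi> p \<bullet> F p)) = 0"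
proof -
  obtain C where C: "compactin X C" "\<And>p. p \<in> \<M> - C \<Longrightarrow> \<phi> p = 0" using t unfolding tf_def by blast
  note s = tf_sm[OF t]
  have sq: "sm \<M> (\<lambda>p. \<phi> p * \<phi> p)" by (rule sm_mult[OF s s])
  have "wint (\<lambda>p. divS (\<lambda>q. (\<phi> q * \<phi> q) *\<^sub>R F q) p + 1/2 * (F p \<bullet> ((\<phi> p * \<phi> p) *\<^sub>R F p))) = 0"
    by (rule first_variation[OF sm_scaleR[OF sq sm_F] C(1)]) (simp add: C(2))
  moreover have "divS (\<lambda>q. (\<phi> q * \<phi> q) *\<^sub>R F q) p + 1/2 * (F p \<bullet> ((\<phi> p * \<phi> p) *\<^sub>R F p)) =
    (\<phi> p)\<^sup>2 * (real CARD('n) + 1/2 * (norm (F p))\<^sup>2) + 2 * \<phi> p * (grad \<phi> p \<bullet> F p)" if "p \<in> \<M>" for p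
  proof -
    have "grad (\<lambda>q. \<phi> q * \<phi> q) p \<bullet> F p = 2 * \<phi> p * (grad \<phi> p \<bullet> F p)"
      by (simp only: grad_mult[OF s s that] inner_add_left inner_scaleR_left)
    then show ?thesis
      by (simp add: divS_scaleR[OF sq sm_F that] divS_F[OF that] power2_eq_square[of "\<phi> p"] power2_norm_eq_inner
          distrib_left mult_ac)
  qed
  ultimately show ?thesis using wint_cong by (metis (no_types, lifting))
qed

lemma F_continuous: "continuous_map X euclidean (\<lambda>p. (norm (F p))\<^sup>2)"
  unfolding power2_norm_eq_inner by (rule sm_continuous[OF sm_inner[OF sm_F sm_F]])

text \<open>The cross term in \<open>position_identity\<close> is absorbed by Young's inequality
  with a parameter. With parameter 1 it uses up the whole term 1/2 |F|^2 and leaves the lower bound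
  n/2 for the spectrum; with parameter 1/2 half of that term survives and controls the mass far from
  the origin.\<close>

lemma position_bounds:
  assumes t: "tf \<phi>"
  shows "real CARD('n) * L2 \<phi> \<le> 2 * En \<phi>" "wint (\<lambda>p. (\<phi> p)\<^sup>2 * (norm (F p))\<^sup>2) \<le> 16 * En \<phi>"
proof -
  let ?a = "\<lambda>p. (\<phi> p)\<^sup>2" and ?b = "\<lambda>p. (\<phi> p)\<^sup>2 * (norm (F p))\<^sup>2" and ?c = "\<lambda>p. \<phi> p * (grad \<phi> p \<bullet> F p)"
    and ?e = "\<lambda>p. (norm (grad \<phi> p))\<^sup>2"
  have ca: "ccs ?a" by (rule tf_sq_ccs[OF t])
  have cb: "ccs ?b" by (rule ccs_mult[OF ca F_continuous])
  have cc: "ccs ?c"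
    by (rule ccs_mult[OF tf_ccs[OF t] sm_continuous[OF sm_inner[OF sm_grad[OF tf_sm[OF t]] sm_F]]])
  have ce: "ccs ?e" by (rule tf_grad_sq_ccs[OF t])
  have eq: "real CARD('n) * wint ?a + 1/2 * wint ?b + 2 * wint ?c = 0"
  proof -
    have "0 = wint (\<lambda>p. (real CARD('n) * ?a p + 1/2 * ?b p) + 2 * ?c p)"
      using position_identity[OF t] by (simp add: algebra_simps)
    also have "\<dots> = wint (\<lambda>p. real CARD('n) * ?a p + 1/2 * ?b p) + wint (\<lambda>p. 2 * ?c p)"
      by (rule wint_add[OF ccs_add[OF ccs_cmult[OF ca] ccs_cmult[OF cb]] ccs_cmult[OF cc]])
    also have "wint (\<lambda>p. real CARD('n) * ?a p + 1/2 * ?b p) = wint (\<lambda>p. real CARD('n) * ?a p) + wint (\<lambda>p. 1/2 * ?b p)"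
      by (rule wint_add[OF ccs_cmult[OF ca] ccs_cmult[OF cb]])
    finally show ?thesis by (simp only: wint_cmult)
  qed
  have young: "- 2 * wint ?c \<le> s / 2 * wint ?b + 2 / s * wint ?e" if s: "s > 0" for s
  proof -
    have "wint (\<lambda>p. - 2 * ?c p) \<le> wint (\<lambda>p. s / 2 * ?b p + 2 / s * ?e p)"
    proof (rule wint_mono[OF ccs_cmult[OF cc] ccs_add[OF ccs_cmult[OF cb] ccs_cmult[OF ce]]])
      fix p
      have "0 \<le> (norm ((s * \<phi> p) *\<^sub>R F p + 2 *\<^sub>R grad \<phi> p))\<^sup>2" by simp
      also have "\<dots> = (s * \<phi> p)\<^sup>2 * (norm (F p))\<^sup>2 + 4 * s * ?c p + 4 * ?e p"
        unfolding power2_norm_eq_inner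
        by (simp add: inner_add_left inner_add_right inner_commute power2_eq_square algebra_simps)
      finally have "0 \<le> ((s * \<phi> p)\<^sup>2 * (norm (F p))\<^sup>2 + 4 * s * ?c p + 4 * ?e p) / (2 * s)"
        using s by simp
      also have "\<dots> = s / 2 * ?b p + 2 / s * ?e p + 2 * ?c p"
        using s by (simp add: power2_eq_square add_divide_distrib)
      finally have "0 \<le> s / 2 * ?b p + 2 / s * ?e p + 2 * ?c p" .
      then show "- 2 * ?c p \<le> s / 2 * ?b p + 2 / s * ?e p" by simp
    qed
    then show ?thesis
      by (simp only: wint_add[OF ccs_cmult[OF cb] ccs_cmult[OF ce]] wint_cmult)
  qed
  have b0: "0 \<le> wint ?b" and a0: "0 \<le> wint ?a" by (rule wint_nonneg, simp)+
  show "real CARD('n) * L2 \<phi> \<le> 2 * En \<phi>" unfolding L2_def En_def using eq young[of 1] by simp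
  have "0 \<le> real CARD('n) * wint ?a" using a0 by simp
  then show "wint ?b \<le> 16 * En \<phi>" unfolding En_def using eq young[of "1/2"] by simp
qed

end

context oriented_expander
begin

text \<open>First variation with \<open>\<xi>\<close> times \<open>W p (F p)\<close>, the gradient
  of \<open>f\<close>, combined with the pointwise equation for \<open>f\<close>.\<close>

lemma weak_equation_f:
  assumes t: "tf \<xi>"
  shows "wint (\<lambda>p. grad \<xi> p \<bullet> grad f p) = wint (\<lambda>p. (\<alpha> p + 1/2) * f p * \<xi> p)"
proof -
  obtain C where C: "compactin X C" "\<And>p. p \<in> \<M> - C \<Longrightarrow> \<xi> p = 0" using t unfolding tf_def by blast
  have WF: "sm \<M> (\<lambda>q. W q (F q))" by (rule mD_W_field(1)[OF sm_F])
  have c1: "ccs (\<lambda>p. grad \<xi> p \<bullet> grad f p)" by (rule tf_grad_ccs[OF t sm_grad[OF sm_f]])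
  have s2: "sm \<M> (\<lambda>p. (\<alpha> p + 1/2) * f p)"
    by (intro sm_mult sm_add sm_alpha sm_f sm_const openin_topspace)
  have c2: "ccs (\<lambda>p. (\<alpha> p + 1/2) * f p * \<xi> p)"
    using ccs_mult[OF tf_ccs[OF t] sm_continuous[OF s2]] by (simp add: mult.commute)
  have "wint (\<lambda>p. divS (\<lambda>q. \<xi> q *\<^sub>R W q (F q)) p + 1/2 * (F p \<bullet> (\<xi> p *\<^sub>R W p (F p)))) = 0"
    by (rule first_variation[OF sm_scaleR[OF tf_sm[OF t] WF] C(1)]) (simp add: C(2))
  moreover have "divS (\<lambda>q. \<xi> q *\<^sub>R W q (F q)) p + 1/2 * (F p \<bullet> (\<xi> p *\<^sub>R W p (F p))) =
     grad \<xi> p \<bullet> grad f p - (\<alpha> p + 1/2) * f p * \<xi> p" if p: "p \<in> \<M>" for p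
  proof -
    have "divS (\<lambda>q. \<xi> q *\<^sub>R W q (F q)) p + 1/2 * (F p \<bullet> (\<xi> p *\<^sub>R W p (F p))) =
      grad \<xi> p \<bullet> W p (F p) + \<xi> p * (divS (\<lambda>q. W q (F q)) p + (1/2) * (F p \<bullet> W p (F p)))"
      by (simp add: divS_scaleR[OF tf_sm[OF t] WF p] algebra_simps)
    then show ?thesis by (simp only: drift_laplacian_f[OF p] grad_f[OF p]) (simp add: algebra_simps)
  qed
  ultimately have "wint (\<lambda>p. grad \<xi> p \<bullet> grad f p - (\<alpha> p + 1/2) * f p * \<xi> p) = 0"
    using wint_cong by (metis (no_types, lifting))
  then show ?thesis by (simp add: wint_diff[OF c1 c2])
qed

end

section \<open>Propagation of smallness\<close>

lemma square_increment_le: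
  fixes g :: "real \<Rightarrow> real"
  assumes der: "\<And>t. t \<in> {0..1} \<Longrightarrow> (g has_real_derivative g' t) (at t)" and cont: "continuous_on {0..1} g'"
  shows "ennreal ((g 1 - g 0)\<^sup>2) \<le> (\<integral>\<^sup>+t. indicator {0..1} t * ennreal ((g' t)\<^sup>2) \<partial>lborel)"
proof -
  let ?c = "g 1 - g 0"
  have I: "(g' has_integral ?c) {0..1}"
    by (rule fundamental_theorem_of_calculus)
      (auto intro!: has_field_derivative_at_within der simp: has_real_derivative_iff_has_vector_derivative[symmetric])
  have int2: "(\<lambda>t. (g' t)\<^sup>2) integrable_on {0..1}"
    by (intro integrable_continuous_interval continuous_intros cont)
  then obtain J where J: "((\<lambda>t. (g' t)\<^sup>2) has_integral J) {0..1}" by blast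
  \<comment> \<open>Cauchy-Schwarz on the unit interval, obtained by integrating the square of
    \<open>g' t - ?c\<close>.\<close>
  have "((\<lambda>t. (g' t)\<^sup>2 - 2 * ?c * g' t + ?c\<^sup>2) has_integral (J - 2 * ?c * ?c + ?c\<^sup>2)) {0..1}"
    using has_integral_const_real[of "?c\<^sup>2" 0 1]
    by (intro has_integral_add has_integral_diff J has_integral_mult_right I) simp
  then have "0 \<le> J - 2 * ?c * ?c + ?c\<^sup>2"
  proof (rule has_integral_nonneg)
    fix t
    have "(g' t)\<^sup>2 - 2 * ?c * g' t + ?c\<^sup>2 = (g' t - ?c)\<^sup>2" by (simp add: power2_eq_square algebra_simps)
    then show "0 \<le> (g' t)\<^sup>2 - 2 * ?c * g' t + ?c\<^sup>2" by simp
  qed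
  moreover have "J - 2 * ?c * ?c + ?c\<^sup>2 = J - ?c\<^sup>2" by (simp add: power2_eq_square algebra_simps)
  ultimately have "?c\<^sup>2 \<le> J" by linarith
  moreover have "(\<integral>\<^sup>+t. ennreal (indicator {0..1} t * (g' t)\<^sup>2) \<partial>lborel) = ennreal J"
    by (rule nn_integral_has_integral_lebesgue[OF _ J]) simp
  moreover have "(\<lambda>t. ennreal (indicator {0..1} t * (g' t)\<^sup>2)) = (\<lambda>t. indicator {0..1} t * ennreal ((g' t)\<^sup>2))"
    by (auto simp: indicator_def)
  ultimately show ?thesis by (simp add: ennreal_leI)
qed

lemma nn_integral_translation:
  fixes q :: "'e::euclidean_space \<Rightarrow> ennreal"
  assumes "q \<in> borel_measurable borel"
  shows "(\<integral>\<^sup>+x. q (x + a) \<partial>lborel) = (\<integral>\<^sup>+x. q x \<partial>lborel)"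
proof -
  have "(\<integral>\<^sup>+x. q x \<partial>lborel) = (\<integral>\<^sup>+x. q x \<partial>distr lborel borel ((+) a))" by (simp add: lborel_distr_plus)
  also have "\<dots> = (\<integral>\<^sup>+x. q (a + x) \<partial>lborel)" using assms by (intro nn_integral_distr) auto
  finally show ?thesis by (simp add: add.commute)
qed

lemma nn_integral_lborel_swap:
  fixes q :: "'e::euclidean_space \<Rightarrow> 'f::euclidean_space \<Rightarrow> ennreal"
  assumes "(\<lambda>(x, y). q x y) \<in> borel_measurable (borel \<Otimes>\<^sub>M borel)"
  shows "(\<integral>\<^sup>+x. \<integral>\<^sup>+y. q x y \<partial>lborel \<partial>lborel) = (\<integral>\<^sup>+y. \<integral>\<^sup>+x. q x y \<partial>lborel \<partial>lborel)"
proof -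
  have ps: "pair_sigma_finite (lborel :: 'e measure) (lborel :: 'f measure)" ..
  have "sets (lborel \<Otimes>\<^sub>M lborel) = sets (borel \<Otimes>\<^sub>M borel :: ('e \<times> 'f) measure)"
    by (intro sets_pair_measure_cong) simp_all
  then have "(\<lambda>(x, y). q x y) \<in> borel_measurable (lborel \<Otimes>\<^sub>M lborel)"
    using assms measurable_cong_sets[OF _ refl] by blast
  from pair_sigma_finite.Fubini'[OF ps this] show ?thesis by simp
qed

lemma borel_measurable_ennreal_indicator:
  fixes g :: "'e::topological_space \<Rightarrow> real"
  assumes "S \<in> sets borel" "continuous_on S g"
  shows "(\<lambda>y. ennreal (g y) * indicator S y) \<in> borel_measurable borel"
proof -
  have "(\<lambda>y. ennreal (indicator S y *\<^sub>R g y)) \<in> borel_measurable borel"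
    using borel_measurable_continuous_on_indicator[OF assms] by simp
  moreover have "ennreal (indicator S y *\<^sub>R g y) = ennreal (g y) * indicator S y" for y
    by (simp add: indicator_def)
  ultimately show ?thesis by (simp only:)
qed

lemma emeasure_bounded_eq: "bounded S \<Longrightarrow> emeasure lborel S = ennreal (measure lborel S)"
  using emeasure_bounded_finite[of S] by (intro emeasure_eq_ennreal_measure) (auto simp: less_top)

lemma emeasure_ball_subset: "S \<subseteq> ball x s \<Longrightarrow> emeasure lborel S = ennreal (measure lborel S)"
  using emeasure_bounded_eq bounded_subset[OF bounded_ball] by blast

lemma norm_add_sq_le: "(norm (x + y))\<^sup>2 \<le> 2 * (norm x)\<^sup>2 + 2 * (norm y)\<^sup>2" for x y :: "'e::real_inner"
proof -
  have "(norm (x - y))\<^sup>2 + (norm (x + y))\<^sup>2 = 2 * (norm x)\<^sup>2 + 2 * (norm y)\<^sup>2"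
    unfolding power2_norm_eq_inner by (simp add: inner_add_left inner_add_right inner_diff_left inner_diff_right)
  then show ?thesis using zero_le_power2[of "norm (x - y)"] by linarith
qed

text \<open>Convexity keeps the segment from \<open>x\<close> to \<open>x + h\<close> inside
  \<open>U\<close>. After exchanging the integral over \<open>x\<close> with the one along the
  segment, translation invariance turns every inner integral into that of \<open>Q\<close> over
  \<open>U\<close>.\<close>

lemma translation_estimate:
  fixes w Q :: "'e::euclidean_space \<Rightarrow> real"
  assumes U: "open U" "convex U" and der: "\<And>y. y \<in> U \<Longrightarrow> (w has_derivative w' y) (at y)"
    and cont: "\<And>a. continuous_on U (\<lambda>y. w' y a)"
    and bound: "\<And>y a. y \<in> U \<Longrightarrow> (w' y a)\<^sup>2 \<le> Q y * (norm a)\<^sup>2"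
    and Q0: "\<And>y. 0 \<le> Q y"
    and Qm: "(\<lambda>y. indicator U y * ennreal (Q y)) \<in> borel_measurable borel"
  shows "(\<integral>\<^sup>+x. indicator U x * indicator U (x + h) * ennreal ((w (x + h) - w x)\<^sup>2) \<partial>lborel)
    \<le> ennreal ((norm h)\<^sup>2) * (\<integral>\<^sup>+y. indicator U y * ennreal (Q y) \<partial>lborel)"
proof -
  let ?R = "\<lambda>y. indicator U y * ennreal (Q y)"
  have "indicator U x * indicator U (x + h) * ennreal ((w (x + h) - w x)\<^sup>2) \<le>
      (\<integral>\<^sup>+t. indicator {0..1::real} t * (ennreal ((norm h)\<^sup>2) * ?R (x + t *\<^sub>R h)) \<partial>lborel)" for x
  proof (cases "x \<in> U \<and> x + h \<in> U")
    case True
    have seg: "x + t *\<^sub>R h \<in> U" if "t \<in> {0..1}" for t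
    proof -
      have "x + t *\<^sub>R h = (1 - t) *\<^sub>R x + t *\<^sub>R (x + h)" by (simp add: algebra_simps)
      then show ?thesis using convexD_alt[OF U(2), of x "x + h" t] True that by auto
    qed
    let ?g = "\<lambda>t. w (x + t *\<^sub>R h)" and ?g' = "\<lambda>t. w' (x + t *\<^sub>R h) h"
    have d: "(?g has_real_derivative ?g' t) (at t)" if "t \<in> {0..1}" for t
    proof -
      have "((\<lambda>t. x + t *\<^sub>R h) has_derivative (\<lambda>s. s *\<^sub>R h)) (at t)" by (auto intro!: derivative_eq_intros)
      from diff_chain_at[OF this der[OF seg[OF that]]]
      have "(?g has_derivative (\<lambda>s. w' (x + t *\<^sub>R h) (s *\<^sub>R h))) (at t)" by (simp add: o_def)
      moreover have "w' (x + t *\<^sub>R h) (s *\<^sub>R h) = ?g' t * s" for s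
        using linear_cmul[OF has_derivative_linear[OF der[OF seg[OF that]]]] by simp
      ultimately show ?thesis by (simp add: has_field_derivative_def)
    qed
    have "continuous_on {0..1} ?g'"
      by (rule continuous_on_compose2[OF cont]) (use seg in \<open>auto intro!: continuous_intros\<close>)
    from square_increment_le[of ?g ?g', OF d this]
    have "ennreal ((w (x + h) - w x)\<^sup>2) \<le> (\<integral>\<^sup>+t. indicator {0..1} t * ennreal ((?g' t)\<^sup>2) \<partial>lborel)" by simp
    also have "\<dots> \<le> (\<integral>\<^sup>+t. indicator {0..1::real} t * (ennreal ((norm h)\<^sup>2) * ?R (x + t *\<^sub>R h)) \<partial>lborel)"
    proof (rule nn_integral_mono)
      fix t :: real
      show "indicator {0..1} t * ennreal ((?g' t)\<^sup>2) \<le> indicator {0..1::real} t * (ennreal ((norm h)\<^sup>2) * ?R (x + t *\<^sub>R h))"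
      proof (cases "t \<in> {0..1}")
        case True
        have "ennreal ((?g' t)\<^sup>2) \<le> ennreal ((norm h)\<^sup>2 * Q (x + t *\<^sub>R h))"
          using bound[OF seg[OF True], of h] by (intro ennreal_leI) (simp add: mult.commute)
        then show ?thesis using True seg[OF True] Q0 by (simp add: ennreal_mult)
      qed simp
    qed
    finally show ?thesis using True by simp
  qed auto
  then have "(\<integral>\<^sup>+x. indicator U x * indicator U (x + h) * ennreal ((w (x + h) - w x)\<^sup>2) \<partial>lborel) \<le>
    (\<integral>\<^sup>+x. \<integral>\<^sup>+t. indicator {0..1::real} t * (ennreal ((norm h)\<^sup>2) * ?R (x + t *\<^sub>R h)) \<partial>lborel \<partial>lborel)"
    by (intro nn_integral_mono)
  also have "\<dots> = (\<integral>\<^sup>+t. \<integral>\<^sup>+x. indicator {0..1::real} t * (ennreal ((norm h)\<^sup>2) * ?R (x + t *\<^sub>R h)) \<partial>lborel \<partial>lborel)"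
  proof (rule nn_integral_lborel_swap)
    have "(\<lambda>z. ?R (fst z + snd z *\<^sub>R h)) \<in> borel_measurable (borel \<Otimes>\<^sub>M borel)"
      by (rule measurable_compose[OF _ Qm]) measurable
    then show "(\<lambda>(x, t). indicator {0..1::real} t * (ennreal ((norm h)\<^sup>2) * ?R (x + t *\<^sub>R h))) \<in> borel_measurable (borel \<Otimes>\<^sub>M borel)"
      unfolding case_prod_beta by measurable
  qed
  also have "\<dots> = (\<integral>\<^sup>+t. indicator {0..1::real} t * (ennreal ((norm h)\<^sup>2) * (\<integral>\<^sup>+y. ?R y \<partial>lborel)) \<partial>lborel)"
  proof (rule nn_integral_cong)
    fix t :: real
    have m: "(\<lambda>x. ?R (x + t *\<^sub>R h)) \<in> borel_measurable lborel"
      by (simp, rule measurable_compose[OF _ Qm]) measurable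
    have "(\<integral>\<^sup>+x. indicator {0..1::real} t * (ennreal ((norm h)\<^sup>2) * ?R (x + t *\<^sub>R h)) \<partial>lborel) =
      indicator {0..1::real} t * (ennreal ((norm h)\<^sup>2) * (\<integral>\<^sup>+x. ?R (x + t *\<^sub>R h) \<partial>lborel))"
      using m by (simp add: nn_integral_cmult)
    then show "(\<integral>\<^sup>+x. indicator {0..1::real} t * (ennreal ((norm h)\<^sup>2) * ?R (x + t *\<^sub>R h)) \<partial>lborel) =
      indicator {0..1::real} t * (ennreal ((norm h)\<^sup>2) * (\<integral>\<^sup>+y. ?R y \<partial>lborel))"
      by (simp add: nn_integral_translation[OF Qm])
  qed
  also have "\<dots> = ennreal ((norm h)\<^sup>2) * (\<integral>\<^sup>+y. ?R y \<partial>lborel)"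
    by (simp add: nn_integral_multc)
  finally show ?thesis .
qed

text \<open>Put y = x + h and apply the translation estimate for each fixed \<open>h\<close>; only
  \<open>norm h < 2 * r\<close> contributes. The double integral form is suited to comparing values
  of \<open>w\<close> on a subset with those on the whole ball, without mean values.\<close>

lemma poincare_double_integral:
  fixes w Q :: "'e::euclidean_space \<Rightarrow> real"
  assumes U: "open U" "convex U" and r: "U \<subseteq> ball x0 r" and der: "\<And>y. y \<in> U \<Longrightarrow> (w has_derivative w' y) (at y)"
    and cont: "\<And>a. continuous_on U (\<lambda>y. w' y a)"
    and bound: "\<And>y a. y \<in> U \<Longrightarrow> (w' y a)\<^sup>2 \<le> Q y * (norm a)\<^sup>2"
    and Q0: "\<And>y. 0 \<le> Q y"
    and Qm: "(\<lambda>y. indicator U y * ennreal (Q y)) \<in> borel_measurable borel"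
  shows "(\<integral>\<^sup>+x. \<integral>\<^sup>+y. indicator U x * indicator U y * ennreal ((w y - w x)\<^sup>2) \<partial>lborel \<partial>lborel)
    \<le> ennreal ((2 * r)\<^sup>2) * emeasure lborel (ball (0::'e) (2 * r)) * (\<integral>\<^sup>+y. indicator U y * ennreal (Q y) \<partial>lborel)"
proof -
  let ?q = "\<integral>\<^sup>+y. indicator U y * ennreal (Q y) \<partial>lborel"
  define W where "W = (\<lambda>y. indicator U y *\<^sub>R w y)"
  have cw: "continuous_on U w"
    by (intro continuous_at_imp_continuous_on ballI has_derivative_continuous[OF der])
  have Wm[measurable]: "W \<in> borel_measurable borel"
    unfolding W_def using borel_measurable_continuous_on_indicator[OF _ cw] U(1) by simp
  have Um[measurable]: "U \<in> sets borel" using U(1) by simp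
  let ?d = "\<lambda>x y. indicator U x * indicator U y * ennreal ((W y - W x)\<^sup>2)"
  have dW: "indicator U x * indicator U y * ennreal ((w y - w x)\<^sup>2) = ?d x y" for x y
    by (auto simp: W_def indicator_def)
  have dm: "(\<lambda>z. ?d (fst z) (snd z)) \<in> borel_measurable (borel \<Otimes>\<^sub>M borel)"
    using Wm Um by measurable
  have "(\<integral>\<^sup>+x. \<integral>\<^sup>+y. ?d x y \<partial>lborel \<partial>lborel) = (\<integral>\<^sup>+x. \<integral>\<^sup>+h. ?d x (x + h) \<partial>lborel \<partial>lborel)"
  proof (rule nn_integral_cong)
    fix x
    have "(\<lambda>y. ?d x y) \<in> borel_measurable borel" using Wm Um by measurable
    from nn_integral_translation[OF this, of x]
    show "(\<integral>\<^sup>+y. ?d x y \<partial>lborel) = (\<integral>\<^sup>+h. ?d x (x + h) \<partial>lborel)" by (simp add: add.commute)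
  qed
  also have "\<dots> = (\<integral>\<^sup>+h. \<integral>\<^sup>+x. ?d x (x + h) \<partial>lborel \<partial>lborel)"
  proof (rule nn_integral_lborel_swap)
    have "(\<lambda>z. (fst z, fst z + snd z)) \<in> measurable (borel \<Otimes>\<^sub>M borel) ((borel \<Otimes>\<^sub>M borel) :: ('e \<times> 'e) measure)"
      by measurable
    from measurable_compose[OF this dm]
    show "(\<lambda>(x, h). ?d x (x + h)) \<in> borel_measurable (borel \<Otimes>\<^sub>M borel)" by (simp add: case_prod_beta)
  qed
  also have "\<dots> \<le> (\<integral>\<^sup>+h. (ennreal ((2 * r)\<^sup>2) * ?q) * indicator (ball (0::'e) (2 * r)) h \<partial>lborel)"
  proof (rule nn_integral_mono)
    fix h :: 'e
    show "(\<integral>\<^sup>+x. ?d x (x + h) \<partial>lborel) \<le> (ennreal ((2 * r)\<^sup>2) * ?q) * indicator (ball (0::'e) (2 * r)) h"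
    proof (cases "norm h < 2 * r")
      case True
      have "(\<integral>\<^sup>+x. ?d x (x + h) \<partial>lborel) \<le> ennreal ((norm h)\<^sup>2) * ?q"
        using translation_estimate[OF U der cont bound Q0 Qm, of h] by (simp add: dW)
      also have "\<dots> \<le> ennreal ((2 * r)\<^sup>2) * ?q"
        using True by (intro mult_right_mono ennreal_leI power_mono) auto
      finally show ?thesis using True by simp
    next
      case False
      have "?d x (x + h) = 0" for x
      proof (rule ccontr)
        assume "?d x (x + h) \<noteq> 0"
        then have "x \<in> U" "x + h \<in> U" by (auto simp: indicator_def split: if_splits)
        then have "dist x0 x < r" "dist x0 (x + h) < r" using r by auto
        then have "dist x (x + h) < 2 * r" using dist_triangle3[of x "x + h" x0] by simp
        then show False using False by (simp add: dist_norm)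
      qed
      then have "(\<integral>\<^sup>+x. ?d x (x + h) \<partial>lborel) = (\<integral>\<^sup>+x. 0 \<partial>(lborel :: 'e measure))"
        by (intro nn_integral_cong)
      then show ?thesis by (simp only: nn_integral_const mult_zero_left zero_le)
    qed
  qed
  also have "\<dots> = (ennreal ((2 * r)\<^sup>2) * ?q) * emeasure lborel (ball (0::'e) (2 * r))"
    by (rule nn_integral_cmult_indicator) simp
  finally show ?thesis by (simp only: dW) (simp only: mult_ac)
qed

text \<open>
  An \<open>L\<^sup>2\<close> bound from smallness in measure: comparing \<open>w x\<close> with \<open>w (x + z)\<close> for those
  \<open>z\<close>, at least half of a ball of radius \<open>h\<close>, at which \<open>w (x + z) < \<sigma>\<close>.
\<close>

lemma square_integral_le_of_small_measure:
  fixes w Q :: "'e::euclidean_space \<Rightarrow> real"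
  assumes der: "\<And>y. (w has_derivative w' y) (at y)"
    and cont: "\<And>a. continuous_on UNIV (\<lambda>y. w' y a)"
    and bound: "\<And>y a. (w' y a)\<^sup>2 \<le> Q y * (norm a)\<^sup>2"
    and Q0: "\<And>y. 0 \<le> Q y" and Qm: "Q \<in> borel_measurable borel"
    and w0: "\<And>y. 0 \<le> w y" and B: "B \<in> sets borel" "\<And>y. y \<notin> B \<Longrightarrow> w y = 0"
    and h: "0 < h" and \<sigma>: "0 < \<sigma>"
    and small: "emeasure lborel {y. \<sigma> \<le> w y} \<le> ennreal (measure lborel (ball (0::'e) h) / 2)"
    and q: "(\<integral>\<^sup>+y. ennreal (Q y) \<partial>lborel) \<le> ennreal q" and q0: "0 \<le> q" and b: "emeasure lborel B \<le> ennreal b" and b0: "0 \<le> b"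
  shows "(\<integral>\<^sup>+x. ennreal ((w x)\<^sup>2) \<partial>lborel) \<le> ennreal (4 * h\<^sup>2 * q + 4 * \<sigma>\<^sup>2 * b)"
proof -
  let ?Bh = "ball (0::'e) h"
  define m where "m = measure lborel ?Bh"
  have em: "emeasure lborel ?Bh = ennreal m"
    unfolding m_def using emeasure_bounded_finite[of ?Bh] by (intro emeasure_eq_ennreal_measure) (auto simp: less_top)
  have m: "m > 0" unfolding m_def using content_ball_pos[OF h, of 0] by simp
  have cw: "continuous_on UNIV w"
    by (intro continuous_at_imp_continuous_on ballI has_derivative_continuous[OF der])
  have wm[measurable]: "w \<in> borel_measurable borel" by (rule borel_measurable_continuous_onI[OF cw])
  have [measurable]: "?Bh \<in> sets borel" by simp
  let ?g = "\<lambda>x z. indicator ?Bh z * ennreal ((w (x + z) - w x)\<^sup>2)"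
  have gm: "(\<lambda>(x, z). ?g x z) \<in> borel_measurable (borel \<Otimes>\<^sub>M borel)"
    unfolding case_prod_beta using wm by measurable
  have gm1: "(\<lambda>z. ?g x z) \<in> borel_measurable borel" for x using wm by measurable
  have gmx: "(\<lambda>x. \<integral>\<^sup>+z. ?g x z \<partial>lborel) \<in> borel_measurable borel"
    by (rule lborel.borel_measurable_nn_integral) 
      (use gm in \<open>simp cong: measurable_cong_sets[OF sets_pair_measure_cong[OF refl sets_lborel] refl]\<close>)
  \<comment> \<open>The error term is needed only where \<open>w\<close> may be nonzero, which
    confines it to \<open>B\<close>, a set of finite measure.\<close>
  have pt: "ennreal (m / 2) * ennreal ((w x)\<^sup>2) \<le> 2 * (\<integral>\<^sup>+z. ?g x z \<partial>lborel) + ennreal (2 * \<sigma>\<^sup>2 * m) * indicator B x" for x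
  proof (cases "x \<in> B")
    case True
    let ?S = "{z \<in> ?Bh. w (x + z) < \<sigma>}" and ?T = "{z \<in> ?Bh. \<sigma> \<le> w (x + z)}"
    have Sm: "?S \<in> sets borel" and Tm: "?T \<in> sets borel" using wm by measurable
    have "emeasure lborel ?T = (\<integral>\<^sup>+z. indicator ?T z \<partial>lborel)"
      using Tm by (simp del: mem_ball)
    also have "\<dots> \<le> (\<integral>\<^sup>+z. indicator {y. \<sigma> \<le> w y} (z + x) \<partial>lborel)"
      by (intro nn_integral_mono) (auto simp: indicator_def add.commute)
    also have "\<dots> = emeasure lborel {y. \<sigma> \<le> w y}"
      using wm by (subst nn_integral_translation) (auto simp: borel_measurable_indicator_iff)
    finally have T: "emeasure lborel ?T \<le> ennreal (m / 2)" using small by (simp add: m_def)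
    have "ennreal m = emeasure lborel (?S \<union> ?T)"
      unfolding em[symmetric] by (rule arg_cong[of _ _ "emeasure lborel"]) auto
    also have "\<dots> \<le> emeasure lborel ?S + emeasure lborel ?T"
      using Sm Tm by (intro emeasure_subadditive) auto
    also have "\<dots> \<le> emeasure lborel ?S + ennreal (m / 2)" using T by (rule add_left_mono)
    finally have "ennreal (m / 2) + ennreal (m / 2) \<le> emeasure lborel ?S + ennreal (m / 2)"
      using m by (simp add: ennreal_plus[symmetric] del: ennreal_plus)
    then have S: "ennreal (m / 2) \<le> emeasure lborel ?S"
      by (simp add: ennreal_add_left_cancel_le add.commute)
    have "ennreal (m / 2) * ennreal ((w x)\<^sup>2) \<le> emeasure lborel ?S * ennreal ((w x)\<^sup>2)"
      using S by (rule mult_right_mono) simp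
    also have "\<dots> = (\<integral>\<^sup>+z. ennreal ((w x)\<^sup>2) * indicator ?S z \<partial>lborel)"
      using Sm by (subst nn_integral_cmult_indicator) (auto simp: mult.commute)
    also have "\<dots> \<le> (\<integral>\<^sup>+z. 2 * ?g x z + ennreal (2 * \<sigma>\<^sup>2) * indicator ?Bh z \<partial>lborel)"
    proof (rule nn_integral_mono)
      fix z
      show "ennreal ((w x)\<^sup>2) * indicator ?S z \<le> 2 * ?g x z + ennreal (2 * \<sigma>\<^sup>2) * indicator ?Bh z"
      proof (cases "z \<in> ?S")
        case True
        have "(w (x + z))\<^sup>2 \<le> \<sigma>\<^sup>2" using True w0 \<sigma> by (intro power_mono) auto
        moreover have "0 \<le> (w (x + z) - w x + w (x + z))\<^sup>2" by simp
        then have "(w x)\<^sup>2 \<le> 2 * (w (x + z) - w x)\<^sup>2 + 2 * (w (x + z))\<^sup>2"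
          by (simp add: power2_eq_square algebra_simps)
        ultimately have "(w x)\<^sup>2 \<le> 2 * (w (x + z) - w x)\<^sup>2 + 2 * \<sigma>\<^sup>2" by linarith
        then have "ennreal ((w x)\<^sup>2) \<le> ennreal (2 * (w (x + z) - w x)\<^sup>2 + 2 * \<sigma>\<^sup>2)" by (rule ennreal_leI)
        also have "\<dots> = 2 * ennreal ((w (x + z) - w x)\<^sup>2) + ennreal (2 * \<sigma>\<^sup>2)"
          by (simp add: ennreal_mult)
        finally show ?thesis using True by simp
      qed simp
    qed
    also have "\<dots> = 2 * (\<integral>\<^sup>+z. ?g x z \<partial>lborel) + ennreal (2 * \<sigma>\<^sup>2) * ennreal m"
      using gm1[of x] by (simp add: nn_integral_add nn_integral_cmult nn_integral_cmult_indicator em)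
    finally show ?thesis using True m by (simp add: ennreal_mult)
  qed (simp add: B(2))
  have "ennreal (m / 2) * (\<integral>\<^sup>+x. ennreal ((w x)\<^sup>2) \<partial>lborel) = (\<integral>\<^sup>+x. ennreal (m / 2) * ennreal ((w x)\<^sup>2) \<partial>lborel)"
    using wm by (intro nn_integral_cmult[symmetric]) measurable
  also have "\<dots> \<le> (\<integral>\<^sup>+x. 2 * (\<integral>\<^sup>+z. ?g x z \<partial>lborel) + ennreal (2 * \<sigma>\<^sup>2 * m) * indicator B x \<partial>lborel)"
    by (rule nn_integral_mono) (rule pt)
  also have "\<dots> = 2 * (\<integral>\<^sup>+x. \<integral>\<^sup>+z. ?g x z \<partial>lborel \<partial>lborel) + ennreal (2 * \<sigma>\<^sup>2 * m) * emeasure lborel B"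
    using gmx B(1) by (simp add: nn_integral_add nn_integral_cmult nn_integral_cmult_indicator)
  also have "(\<integral>\<^sup>+x. \<integral>\<^sup>+z. ?g x z \<partial>lborel \<partial>lborel) = (\<integral>\<^sup>+z. \<integral>\<^sup>+x. ?g x z \<partial>lborel \<partial>lborel)"
    by (rule nn_integral_lborel_swap[OF gm])
  also have "\<dots> \<le> (\<integral>\<^sup>+z. ennreal (h\<^sup>2 * q) * indicator ?Bh z \<partial>lborel)"
  proof (rule nn_integral_mono)
    fix z :: 'e
    show "(\<integral>\<^sup>+x. ?g x z \<partial>lborel) \<le> ennreal (h\<^sup>2 * q) * indicator ?Bh z"
    proof (cases "z \<in> ?Bh")
      case True
      have "(\<integral>\<^sup>+x. ?g x z \<partial>lborel) = (\<integral>\<^sup>+x. indicator UNIV x * indicator UNIV (x + z) * ennreal ((w (x + z) - w x)\<^sup>2) \<partial>lborel)"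
        using True by simp
      also have "\<dots> \<le> ennreal ((norm z)\<^sup>2) * (\<integral>\<^sup>+y. indicator UNIV y * ennreal (Q y) \<partial>lborel)"
        by (rule translation_estimate[OF open_UNIV convex_UNIV der cont bound Q0]) (use Qm in simp_all)
      also have "\<dots> \<le> ennreal (h\<^sup>2) * ennreal q"
        using q True by (intro mult_mono ennreal_leI power_mono) auto
      finally show ?thesis using True q0 by (simp add: ennreal_mult)
    qed simp
  qed
  also have "\<dots> = ennreal (h\<^sup>2 * q) * ennreal m"
    by (simp add: nn_integral_cmult_indicator em)
  finally have "ennreal (m / 2) * (\<integral>\<^sup>+x. ennreal ((w x)\<^sup>2) \<partial>lborel) \<le>
      2 * (ennreal (h\<^sup>2 * q) * ennreal m) + ennreal (2 * \<sigma>\<^sup>2 * m) * emeasure lborel B"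
    by (simp add: add_mono mult_left_mono)
  also have "\<dots> \<le> 2 * (ennreal (h\<^sup>2 * q) * ennreal m) + ennreal (2 * \<sigma>\<^sup>2 * m) * ennreal b"
    using b by (intro add_left_mono mult_left_mono) auto
  \<comment> \<open>Both terms carry the volume \<open>m\<close> of the ball, so dividing by
    \<open>m / 2\<close> leaves constants that do not involve it.\<close>
  also have "\<dots> = ennreal (m / 2) * ennreal (4 * h\<^sup>2 * q + 4 * \<sigma>\<^sup>2 * b)"
  proof -
    have "2 * (ennreal (h\<^sup>2 * q) * ennreal m) + ennreal (2 * \<sigma>\<^sup>2 * m) * ennreal b =
        ennreal (2 * (h\<^sup>2 * q * m) + 2 * \<sigma>\<^sup>2 * m * b)"
      using m q0 b0 by (simp add: ennreal_mult)
    also have "2 * (h\<^sup>2 * q * m) + 2 * \<sigma>\<^sup>2 * m * b = (m / 2) * (4 * h\<^sup>2 * q + 4 * \<sigma>\<^sup>2 * b)"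
      by (simp add: algebra_simps)
    also have "ennreal \<dots> = ennreal (m / 2) * ennreal (4 * h\<^sup>2 * q + 4 * \<sigma>\<^sup>2 * b)"
      using m q0 b0 by (intro ennreal_mult) auto
    finally show ?thesis .
  qed
  finally show ?thesis using m by (simp add: ennreal_mult_le_mult_iff)
qed

section \<open>Comparison of chart integrals with the weighted volume\<close>

context immersed
begin

lemma nn_integral_vol_chart:
  assumes c: "(V, \<psi>) \<in> A" and f: "f \<in> borel_measurable bX"
  shows "(\<integral>\<^sup>+p\<in>\<psi> ` V. f p \<partial>vol) = (\<integral>\<^sup>+x\<in>V. ennreal (dens \<psi> x) * f (\<psi> x) \<partial>lborel)"
proof -
  let ?R = "restrict_space vol (\<psi> ` V)" and ?L = "restrict_space lborel V"
  have img: "\<psi> ` V \<inter> space vol \<in> sets vol"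
    using openin_sets[OF chart_openin[OF c]] openin_subset[OF chart_openin[OF c]]
    by (simp add: sets_vol space_vol Int_absorb2)
  have fv: "f \<in> borel_measurable vol" using f measurable_cong_sets[OF sets_vol refl] by blast
  have fm: "f \<in> borel_measurable ?R" by (rule measurable_restrict_space1[OF fv])
  have fm': "(\<lambda>x. f (\<psi> x)) \<in> borel_measurable ?L"
    by (rule measurable_compose[OF restrict_vol_chart(2)[OF c] fm])
  have V: "V \<inter> space lborel \<in> sets lborel" using chart_open[OF c] by simp
  have "(\<integral>\<^sup>+p\<in>\<psi> ` V. f p \<partial>vol) = (\<integral>\<^sup>+p. f p \<partial>?R)"
    by (rule nn_integral_restrict_space[OF img, symmetric])
  also have "\<dots> = (\<integral>\<^sup>+x. f (\<psi> x) \<partial>density ?L (\<lambda>x. ennreal (dens \<psi> x)))"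
    by (subst restrict_vol_chart(1)[OF c], rule nn_integral_distr) (use restrict_vol_chart(2)[OF c] fm in auto)
  also have "\<dots> = (\<integral>\<^sup>+x. ennreal (dens \<psi> x) * f (\<psi> x) \<partial>?L)"
    by (rule nn_integral_density[OF dens_measurable[OF c] fm'])
  also have "\<dots> = (\<integral>\<^sup>+x\<in>V. ennreal (dens \<psi> x) * f (\<psi> x) \<partial>lborel)"
    by (rule nn_integral_restrict_space[OF V])
  finally show ?thesis .
qed

lemma ennreal_wint:
  assumes "ccs g" "\<And>p. p \<in> \<M> \<Longrightarrow> 0 \<le> g p"
  shows "(\<integral>\<^sup>+p. ennreal (g p * wgt p) \<partial>vol) = ennreal (wint g)"
  unfolding wint_eq
  by (rule nn_integral_eq_integral[OF integrable_wgt[OF assms(1)]])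
    (auto simp: space_vol assms(2) intro!: AE_I2 mult_nonneg_nonneg less_imp_le[OF wgt_pos])

lemma continuous_chart: "continuous_map X euclidean g \<Longrightarrow> (V, \<psi>) \<in> A \<Longrightarrow> continuous_on V (\<lambda>x. g (\<psi> x))"
  using continuous_map_compose[OF chart_continuous, of V \<psi> euclidean g] by (simp add: o_def)

lemma continuous_pos_one: "continuous_map X euclideanreal (\<lambda>p. 1)" "0 < (1::real)"
  by simp_all

text \<open>On a compact ball the density lies between positive constants, so smallness passes
  between Lebesgue measure in the chart and the volume. It is used with \<open>g = wgt\<close> for
  weighted integrals and with \<open>g = 1\<close> for unweighted ones.\<close>

lemma chart_density_bounds:
  assumes c: "(V, \<psi>) \<in> A" and s: "0 \<le> s" "cball x s \<subseteq> V" and g: "continuous_map X euclidean g" "\<And>p. 0 < g p"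
  obtains m M where "0 < m" "0 < M" "\<And>y. y \<in> cball x s \<Longrightarrow> m \<le> dens \<psi> y * g (\<psi> y)" "\<And>y. y \<in> cball x s \<Longrightarrow> dens \<psi> y * g (\<psi> y) \<le> M"
proof -
  let ?d = "\<lambda>y. dens \<psi> y * g (\<psi> y)"
  have cont: "continuous_on (cball x s) ?d"
    by (rule continuous_on_subset[OF continuous_on_mult[OF dens_continuous[OF c] continuous_chart[OF g(1) c]] s(2)])
  have pos: "0 < ?d y" if "y \<in> cball x s" for y using dens_pos[OF c] g(2) that s(2) by auto
  have ne: "cball x s \<noteq> {}" using s(1) by simp
  obtain a where a: "a \<in> cball x s" "\<And>y. y \<in> cball x s \<Longrightarrow> ?d a \<le> ?d y"
    using continuous_attains_inf[OF compact_cball ne cont] by blast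
  obtain b where b: "b \<in> cball x s" "\<And>y. y \<in> cball x s \<Longrightarrow> ?d y \<le> ?d b"
    using continuous_attains_sup[OF compact_cball ne cont] by blast
  show ?thesis by (rule that[of "?d a" "?d b"]) (use a b pos in auto)
qed

lemma chart_differential_bound:
  assumes c: "(V, \<psi>) \<in> A" and s: "cball x s \<subseteq> V"
  obtains \<Lambda> where "0 \<le> \<Lambda>" "\<And>y a. y \<in> cball x s \<Longrightarrow> norm (Df (F \<circ> \<psi>) y a) \<le> \<Lambda> * norm a"
proof -
  interpret c: local_immersion V "F \<circ> \<psi>" by (rule chart_immersion[OF c])
  have "continuous_on (cball x s) (\<lambda>y. \<Sum>j\<in>UNIV. norm (c.J y j))"
    by (intro continuous_intros continuous_on_subset[OF smooth_on_imp_continuous_on[OF c.smooth_J] s])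
  then have "compact ((\<lambda>y. \<Sum>j\<in>UNIV. norm (c.J y j)) ` cball x s)" by (intro compact_continuous_image) auto
  then have "bdd_above ((\<lambda>y. \<Sum>j\<in>UNIV. norm (c.J y j)) ` cball x s)"
    by (intro bounded_imp_bdd_above compact_imp_bounded)
  then obtain L where "\<forall>z\<in>(\<lambda>y. \<Sum>j\<in>UNIV. norm (c.J y j)) ` cball x s. z \<le> L"
    unfolding bdd_above_def ..
  then have L: "(\<Sum>j\<in>UNIV. norm (c.J y j)) \<le> L" if "y \<in> cball x s" for y using that by blast
  show ?thesis
  proof (rule that[of "max L 0"])
    fix y a assume y: "y \<in> cball x s"
    have "norm (Df (F \<circ> \<psi>) y a) \<le> (\<Sum>j\<in>UNIV. norm (a $ j *\<^sub>R c.J y j))"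
      unfolding c.dG_eq[OF subsetD[OF s y]] by (rule norm_sum)
    also have "\<dots> \<le> (\<Sum>j\<in>UNIV. norm a * norm (c.J y j))"
      by (intro sum_mono) (simp add: mult_right_mono component_le_norm_cart)
    also have "\<dots> = (\<Sum>j\<in>UNIV. norm (c.J y j)) * norm a" by (simp add: sum_distrib_left mult.commute)
    also have "\<dots> \<le> max L 0 * norm a" using L[OF y] by (intro mult_right_mono) auto
    finally show "norm (Df (F \<circ> \<psi>) y a) \<le> max L 0 * norm a" .
  qed simp
qed

lemma chart_integral_le_wint:
  assumes c: "(V, \<psi>) \<in> A" and s: "S \<subseteq> V" "S \<in> sets borel" and m: "0 < m" "\<And>y. y \<in> S \<Longrightarrow> m \<le> dens \<psi> y * wgt (\<psi> y)"
    and g: "ccs g" "\<And>p. p \<in> \<M> \<Longrightarrow> 0 \<le> g p"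
  shows "(\<integral>\<^sup>+y\<in>S. ennreal (g (\<psi> y)) \<partial>lborel) \<le> ennreal (wint g / m)"
proof -
  have gm: "(\<lambda>y. ennreal (g (\<psi> y)) * indicator S y) \<in> borel_measurable borel"
    by (rule borel_measurable_ennreal_indicator[OF s(2) continuous_on_subset[OF continuous_chart[OF ccs_continuous[OF g(1)] c] s(1)]])
  have wm: "(\<lambda>p. ennreal (g p * wgt p)) \<in> borel_measurable bX"
    using continuous_measurable[OF ccs_continuous[OF ccs_mult[OF g(1) wgt_continuous]]] by simp
  have "ennreal m * (\<integral>\<^sup>+y\<in>S. ennreal (g (\<psi> y)) \<partial>lborel) = (\<integral>\<^sup>+y. ennreal m * (ennreal (g (\<psi> y)) * indicator S y) \<partial>lborel)"
    using gm by (intro nn_integral_cmult[symmetric]) simp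
  also have "\<dots> \<le> (\<integral>\<^sup>+y\<in>V. ennreal (dens \<psi> y) * ennreal (g (\<psi> y) * wgt (\<psi> y)) \<partial>lborel)"
  proof (rule nn_integral_mono)
    fix y
    show "ennreal m * (ennreal (g (\<psi> y)) * indicator S y) \<le> ennreal (dens \<psi> y) * ennreal (g (\<psi> y) * wgt (\<psi> y)) * indicator V y"
    proof (cases "y \<in> S")
      case True
      then have y: "y \<in> V" using s(1) by auto
      have g0: "0 \<le> g (\<psi> y)" by (rule g(2)[OF chart_topspace[OF c y]])
      have "m * g (\<psi> y) \<le> dens \<psi> y * wgt (\<psi> y) * g (\<psi> y)" using m(2)[OF True] g0 by (rule mult_right_mono)
      also have "\<dots> = dens \<psi> y * (g (\<psi> y) * wgt (\<psi> y))" by simp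
      finally have "ennreal (m * g (\<psi> y)) \<le> ennreal (dens \<psi> y * (g (\<psi> y) * wgt (\<psi> y)))" by (rule ennreal_leI)
      then show ?thesis
        using True y m(1) g0 less_imp_le[OF dens_pos[OF c y]] less_imp_le[OF wgt_pos[of "\<psi> y"]] by (simp add: ennreal_mult)
    qed simp
  qed
  also have "\<dots> = (\<integral>\<^sup>+p\<in>\<psi> ` V. ennreal (g p * wgt p) \<partial>vol)" by (rule nn_integral_vol_chart[OF c wm, symmetric])
  also have "\<dots> \<le> (\<integral>\<^sup>+p. ennreal (g p * wgt p) \<partial>vol)" by (intro nn_integral_mono) (simp add: indicator_def)
  also have "\<dots> = ennreal (wint g)" by (rule ennreal_wint[OF g])
  also have "\<dots> = ennreal m * ennreal (wint g / m)"
    using m(1) wint_nonneg[of g] g(2) by (simp add: ennreal_mult[symmetric])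
  finally show ?thesis using m(1) by (simp add: ennreal_mult_le_mult_iff)
qed

lemma grad_chain:
  assumes "sm U \<phi>" "sm U (\<lambda>p. h (\<phi> p))" "p \<in> U" "(h has_real_derivative h') (at (\<phi> p))"
  shows "grad (\<lambda>p. h (\<phi> p)) p = h' *\<^sub>R grad \<phi> p"
  by (rule vector_eq_rdot[THEN iffD1])
    (simp add: grad_inner[OF assms(1,3)] grad_inner[OF assms(2,3)] mD_real_chain[OF assms])

text \<open>With c = \<eta> / (f + \<epsilon>) the gradient is 2 c grad \<eta> - c^2 grad f. Pairing
  it with grad f produces minus \<eta>^2 times the squared gradient of ln (f + \<epsilon>). Both the
  logarithmic estimate and Barta's trick rest on this identity.\<close>

lemma quotient_test_function:
  assumes sf: "sm \<M> f" and pos: "\<forall>p\<in>\<M>. 0 < f p + \<epsilon>" and t: "tf \<eta>"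
  shows "sm \<M> (\<lambda>p. 1 / (f p + \<epsilon>))" "tf (\<lambda>p. (\<eta> p * \<eta> p) * (1 / (f p + \<epsilon>)))"
    "p \<in> \<M> \<Longrightarrow> grad (\<lambda>p. (\<eta> p * \<eta> p) * (1 / (f p + \<epsilon>))) p =
      (2 * (\<eta> p * (1 / (f p + \<epsilon>)))) *\<^sub>R grad \<eta> p - ((\<eta> p * (1 / (f p + \<epsilon>)))\<^sup>2) *\<^sub>R grad f p"
proof -
  let ?u = "\<lambda>p. 1 / (f p + \<epsilon>)"
  show su: "sm \<M> ?u"
    by (rule sm_divide[OF sm_const[OF openin_topspace] sm_add[OF sf sm_const[OF openin_topspace]]])
      (use pos in force)
  have ee: "tf (\<lambda>p. \<eta> p * \<eta> p)" by (rule tf_mult[OF t tf_sm[OF t]])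
  show "tf (\<lambda>p. (\<eta> p * \<eta> p) * ?u p)" by (rule tf_mult[OF ee su])
  assume p: "p \<in> \<M>"
  have gu: "grad ?u p = (- 1 / (f p + \<epsilon>)\<^sup>2) *\<^sub>R grad f p"
    by (rule grad_chain[where h="\<lambda>t. 1 / (t + \<epsilon>)", OF sf su p])
      (use bspec[OF pos p] in \<open>auto intro!: derivative_eq_intros simp: power2_eq_square\<close>)
  have "grad (\<lambda>p. (\<eta> p * \<eta> p) * ?u p) p = (\<eta> p * \<eta> p) *\<^sub>R grad ?u p + ?u p *\<^sub>R (\<eta> p *\<^sub>R grad \<eta> p + \<eta> p *\<^sub>R grad \<eta> p)"
    unfolding grad_mult[OF tf_sm[OF ee] su p] grad_mult[OF tf_sm[OF t] tf_sm[OF t] p] ..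
  moreover have "?u p *\<^sub>R (\<eta> p *\<^sub>R grad \<eta> p + \<eta> p *\<^sub>R grad \<eta> p) = (2 * (\<eta> p * ?u p)) *\<^sub>R grad \<eta> p"
    by (simp only: scaleR_add_left[symmetric] scaleR_scaleR) (simp add: mult_ac)
  moreover have "(\<eta> p * \<eta> p) *\<^sub>R grad ?u p = - (((\<eta> p * ?u p)\<^sup>2) *\<^sub>R grad f p)"
    unfolding gu by (simp add: power2_eq_square)
  ultimately show "grad (\<lambda>p. (\<eta> p * \<eta> p) * ?u p) p = (2 * (\<eta> p * ?u p)) *\<^sub>R grad \<eta> p - ((\<eta> p * ?u p)\<^sup>2) *\<^sub>R grad f p"
    by simp
qed

end

section \<open>The logarithmic gradient estimate\<close>

context expander
begin

text \<open>Weak superharmonicity for the drifted Laplacian up to an error. The error is measured by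
  the energy of the test function because this is what the Cauchy-Schwarz inequality yields for
  almost minimizers; \<open>\<delta> = 0\<close> is the exact notion.\<close>

definition super :: "('a \<Rightarrow> real) \<Rightarrow> real \<Rightarrow> bool" where
  "super f \<delta> \<longleftrightarrow> sm \<M> f \<and> (\<forall>p\<in>\<M>. 0 \<le> f p) \<and>
    (\<forall>\<xi>. tf \<xi> \<longrightarrow> (\<forall>p\<in>\<M>. 0 \<le> \<xi> p) \<longrightarrow> - \<delta> * sqrt (En \<xi>) \<le> wint (\<lambda>p. grad f p \<bullet> grad \<xi> p))"

text \<open>\<open>T\<close> is \<eta>^2 times the squared gradient of ln (f + \<epsilon>). The root
  of the energy of the test function is of order 1 / \<epsilon>, so for
  \<open>\<delta> \<le> \<epsilon>\<close> the error term is bounded uniformly, and the final bound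
  involves only \<open>\<eta>\<close>.\<close>

lemma log_estimate:
  assumes f: "super f \<delta>" and \<delta>: "0 \<le> \<delta>" "\<delta> \<le> \<epsilon>" "0 < \<epsilon>"
    and t: "tf \<eta>" and \<eta>: "\<And>p. p \<in> \<M> \<Longrightarrow> 0 \<le> \<eta> p" "\<And>p. p \<in> \<M> \<Longrightarrow> \<eta> p \<le> 1"
  defines "T \<equiv> \<lambda>p. (\<eta> p)\<^sup>2 * ((norm (grad f p))\<^sup>2 / (f p + \<epsilon>)\<^sup>2)"
  shows "wint T \<le> 12 * En \<eta> + 8" "ccs T"
proof -
  have sf: "sm \<M> f" and f0: "\<And>p. p \<in> \<M> \<Longrightarrow> 0 \<le> f p" using f by (auto simp: super_def)
  have pos: "0 < f p + \<epsilon>" if "p \<in> \<M>" for p using f0[OF that] \<delta>(3) by simp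
  let ?u = "\<lambda>p. 1 / (f p + \<epsilon>)"
  define \<xi> where "\<xi> = (\<lambda>p. (\<eta> p * \<eta> p) * ?u p)"
  have ee: "tf (\<lambda>p. \<eta> p * \<eta> p)" by (rule tf_mult[OF t tf_sm[OF t]])
  have pos': "\<forall>p\<in>\<M>. 0 < f p + \<epsilon>" using pos by blast
  note quotient = quotient_test_function[OF sf pos' t]
  have su: "sm \<M> ?u" by (rule quotient(1))
  have tx: "tf \<xi>" unfolding \<xi>_def by (rule quotient(2))
  have gx: "grad \<xi> p = (2 * \<eta> p * ?u p) *\<^sub>R grad \<eta> p - ((\<eta> p)\<^sup>2 * (?u p)\<^sup>2) *\<^sub>R grad f p" if p: "p \<in> \<M>" for p
    unfolding \<xi>_def quotient(3)[OF p] by (simp only: power_mult_distrib mult.assoc)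
  have Tu: "T p = (\<eta> p)\<^sup>2 * (?u p)\<^sup>2 * (norm (grad f p))\<^sup>2" for p
    unfolding T_def by (simp add: power_divide)
  have sT: "sm \<M> (\<lambda>p. (?u p * ?u p) * (grad f p \<bullet> grad f p))"
    by (rule sm_mult[OF sm_mult[OF su su] sm_inner[OF sm_grad[OF sf] sm_grad[OF sf]]])
  have "ccs (\<lambda>p. (\<eta> p * \<eta> p) * ((?u p * ?u p) * (grad f p \<bullet> grad f p)))"
    by (rule ccs_mult[OF tf_ccs[OF ee] sm_continuous[OF sT]])
  moreover have "(\<lambda>p. (\<eta> p * \<eta> p) * ((?u p * ?u p) * (grad f p \<bullet> grad f p))) = T"
    by (rule ext, unfold Tu power2_norm_eq_inner) (simp add: power2_eq_square)
  ultimately show cT: "ccs T" by simp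
  let ?e = "\<lambda>p. (norm (grad \<eta> p))\<^sup>2"
  have ce: "ccs ?e" by (rule tf_grad_sq_ccs[OF t])
  have I0: "0 \<le> wint T" by (rule wint_nonneg) (simp add: T_def)
  have E0: "0 \<le> En \<eta>" unfolding En_def by (rule wint_nonneg) simp
  \<comment> \<open>As \<open>f \<ge> 0\<close> and \<open>\<eta> \<le> 1\<close>, the factor
    \<eta>^2 / (f + \<epsilon>)^2 is at most 1 / \<epsilon>^2.\<close>
  have Ex: "En \<xi> \<le> (8 * En \<eta> + 2 * wint T) / \<epsilon>\<^sup>2"
  proof -
    have "En \<xi> \<le> wint (\<lambda>p. (8 / \<epsilon>\<^sup>2) * ?e p + (2 / \<epsilon>\<^sup>2) * T p)"
      unfolding En_def
    proof (rule wint_mono[OF tf_grad_sq_ccs[OF tx] ccs_add[OF ccs_cmult[OF ce] ccs_cmult[OF cT]]])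
      fix p assume p: "p \<in> \<M>"
      let ?a = "\<eta> p" and ?v = "?u p"
      have v: "0 < ?v" "?v \<le> 1 / \<epsilon>" using pos[OF p] f0[OF p] \<delta>(3) by (auto simp: field_simps)
      have v2: "?v\<^sup>2 \<le> 1 / \<epsilon>\<^sup>2" using power_mono[OF v(2), of 2] v(1) by (simp add: power_divide)
      have a2: "?a\<^sup>2 \<le> 1" using \<eta>[OF p] by (simp add: power_le_one)
      have "(norm (grad \<xi> p))\<^sup>2 \<le> 2 * (norm ((2 * ?a * ?v) *\<^sub>R grad \<eta> p))\<^sup>2 + 2 * (norm ((?a\<^sup>2 * ?v\<^sup>2) *\<^sub>R grad f p))\<^sup>2"
        unfolding gx[OF p] using norm_add_sq_le[of "(2 * ?a * ?v) *\<^sub>R grad \<eta> p" "- ((?a\<^sup>2 * ?v\<^sup>2) *\<^sub>R grad f p)"]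
        by (simp only: diff_conv_add_uminus norm_minus_cancel)
      also have "\<dots> = 8 * (?a\<^sup>2 * ?v\<^sup>2 * ?e p) + 2 * (?a\<^sup>2 * ?v\<^sup>2 * T p)"
      proof -
        have n: "(norm (c *\<^sub>R x))\<^sup>2 = c\<^sup>2 * (norm x)\<^sup>2" for c and x :: "real^'m"
          by (simp add: power_mult_distrib)
        show ?thesis unfolding Tu n by (simp add: power2_eq_square)
      qed
      also have "\<dots> \<le> 8 * (1 / \<epsilon>\<^sup>2 * ?e p) + 2 * (1 / \<epsilon>\<^sup>2 * T p)"
      proof -
        have "?a\<^sup>2 * ?v\<^sup>2 \<le> 1 * (1 / \<epsilon>\<^sup>2)" by (intro mult_mono a2 v2) auto
        then show ?thesis by (intro add_mono mult_left_mono mult_right_mono) (auto simp: T_def)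
      qed
      finally show "(norm (grad \<xi> p))\<^sup>2 \<le> (8 / \<epsilon>\<^sup>2) * ?e p + (2 / \<epsilon>\<^sup>2) * T p" by simp
    qed
    also have "\<dots> = (8 / \<epsilon>\<^sup>2) * En \<eta> + (2 / \<epsilon>\<^sup>2) * wint T"
      unfolding En_def by (simp only: wint_add[OF ccs_cmult[OF ce] ccs_cmult[OF cT]] wint_cmult)
    finally show ?thesis by (simp add: add_divide_distrib)
  qed
  have "\<forall>p\<in>\<M>. 0 \<le> \<xi> p"
  proof
    fix p assume p: "p \<in> \<M>"
    show "0 \<le> \<xi> p" unfolding \<xi>_def using \<eta>(1)[OF p] pos[OF p] by simp
  qed
  then have "- \<delta> * sqrt (En \<xi>) \<le> wint (\<lambda>p. grad f p \<bullet> grad \<xi> p)"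
    using f tx unfolding super_def by blast
  also have "\<dots> \<le> wint (\<lambda>p. 2 * ?e p - (1/2) * T p)"
  proof (rule wint_mono[OF _ ccs_diff[OF ccs_cmult[OF ce] ccs_cmult[OF cT]]])
    show "ccs (\<lambda>p. grad f p \<bullet> grad \<xi> p)" using tf_grad_ccs[OF tx sm_grad[OF sf]] by (simp add: inner_commute)
    fix p assume p: "p \<in> \<M>"
    let ?c = "\<eta> p * ?u p"
    have "0 \<le> (norm (2 *\<^sub>R grad \<eta> p - ?c *\<^sub>R grad f p))\<^sup>2" by simp
    also have "\<dots> = 4 * ?e p - 4 * ?c * (grad f p \<bullet> grad \<eta> p) + T p"
    proof -
      have "(norm (2 *\<^sub>R x - c *\<^sub>R y))\<^sup>2 = 4 * (norm x)\<^sup>2 - 4 * c * (y \<bullet> x) + c\<^sup>2 * (norm y)\<^sup>2" for c and x y :: "real^'m"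
        unfolding power2_norm_eq_inner
        by (simp add: inner_diff_left inner_diff_right inner_commute[of x y] power2_eq_square algebra_simps)
      from this[of "grad \<eta> p" ?c "grad f p"] show ?thesis unfolding Tu power_mult_distrib .
    qed
    finally have "2 * ?c * (grad f p \<bullet> grad \<eta> p) \<le> 2 * ?e p + (1/2) * T p" by simp
    moreover have "grad f p \<bullet> grad \<xi> p = 2 * ?c * (grad f p \<bullet> grad \<eta> p) - T p"
      unfolding gx[OF p] Tu power2_norm_eq_inner by (simp only: inner_diff_right inner_scaleR_right mult.assoc)
    ultimately show "grad f p \<bullet> grad \<xi> p \<le> 2 * ?e p - (1/2) * T p" by simp
  qed
  also have "\<dots> = 2 * En \<eta> - (1/2) * wint T"
    unfolding En_def by (simp only: wint_diff[OF ccs_cmult[OF ce] ccs_cmult[OF cT]] wint_cmult)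
  finally have main: "(1/2) * wint T \<le> 2 * En \<eta> + \<delta> * sqrt (En \<xi>)" by simp
  let ?y = "8 * En \<eta> + 2 * wint T"
  have y0: "0 \<le> ?y" using E0 I0 by simp
  have "\<delta> * sqrt (En \<xi>) \<le> \<epsilon> * sqrt (?y / \<epsilon>\<^sup>2)"
    using \<delta> Ex by (intro mult_mono real_sqrt_le_mono) (auto simp: En_def intro!: wint_nonneg)
  also have "\<dots> = sqrt ?y" using \<delta>(3) by (simp add: real_sqrt_divide)
  \<comment> \<open>The factor 1/8 leaves a quarter of \<open>wint T\<close> on the right, against
    the half on the left of \<open>main\<close>, so it can be absorbed.\<close>
  also have "\<dots> \<le> ?y / 8 + 2"
  proof -
    have sq: "sqrt y \<le> y / 8 + 2" if "0 \<le> y" for y :: real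
    proof -
      have "0 \<le> (sqrt y - 4)\<^sup>2" by simp
      also have "\<dots> = y - 8 * sqrt y + 16" using that by (simp add: power2_diff)
      finally show ?thesis by simp
    qed
    show ?thesis by (rule sq[OF y0])
  qed
  finally show "wint T \<le> 12 * En \<eta> + 8" using main by (simp add: add_divide_distrib)
qed

end

section \<open>Propagation of smallness along a sequence\<close>

locale super_seq = expander X A F for X :: "'a topology" and A :: "('n::finite, 'a) atlas" and F :: "'a \<Rightarrow> real^'m::finite" +
  fixes fs :: "nat \<Rightarrow> 'a \<Rightarrow> real" and \<delta> :: "nat \<Rightarrow> real"
  assumes super: "\<And>k. super (fs k) (\<delta> k)" and delta_nonneg: "\<And>k. 0 \<le> \<delta> k" and delta_lim: "\<delta> \<longlonglongrightarrow> 0"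
    and energy: "\<And>\<eta>. tf \<eta> \<Longrightarrow> \<exists>C. \<forall>k. En (\<lambda>p. \<eta> p * fs k p) \<le> C"
begin

lemma sm_fs: "sm \<M> (fs k)" and fs_nonneg: "p \<in> \<M> \<Longrightarrow> 0 \<le> fs k p"
  using super[of k] by (auto simp: super_def)

text \<open>Convergence to 0 in L^2 over the set. The volume is unweighted; on compact sets the
  weight would only change constants.\<close>

definition vanishes :: "'a set \<Rightarrow> bool" where
  "vanishes U \<longleftrightarrow> (\<forall>e>0. \<forall>\<^sub>F k in sequentially. (\<integral>\<^sup>+p\<in>U. ennreal ((fs k p)\<^sup>2) \<partial>vol) \<le> ennreal e)"

text \<open>Let w = ln (1 + f / \<epsilon>). Its integral over \<open>Z\<close> is at most 1,
  because ln (1 + t) \<le> t; its variation between \<open>Z\<close> and the ball is controlled by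
  the Poincare inequality and \<open>log_estimate\<close>. The point is that \<open>C\<close>
  depends on neither \<open>k\<close> nor \<open>\<epsilon>\<close>.\<close>

lemma log_mean_bound:
  assumes c: "(V, \<psi>) \<in> A" and r: "0 < r" "cball x0 (2 * r) \<subseteq> V"
    and Z: "Z \<in> sets borel" "Z \<subseteq> ball x0 r"
  shows "\<exists>C. 0 \<le> C \<and> (\<forall>k \<epsilon>. 0 < \<epsilon> \<longrightarrow> \<delta> k \<le> \<epsilon> \<longrightarrow> (\<integral>\<^sup>+y\<in>Z. ennreal (fs k (\<psi> y)) \<partial>lborel) \<le> ennreal \<epsilon> \<longrightarrow>
    emeasure lborel Z * (\<integral>\<^sup>+y\<in>ball x0 r. ennreal (ln (1 + fs k (\<psi> y) / \<epsilon>)) \<partial>lborel) \<le> ennreal C)"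
proof -
  let ?U = "ball x0 r"
  have UV: "?U \<subseteq> V" and cV: "cball x0 r \<subseteq> V" using r by (auto simp: subset_iff)
  have Um[measurable]: "?U \<in> sets borel" by simp
  note Z(1)[measurable]
  obtain \<eta> :: "'a \<Rightarrow> real" where \<eta>: "sm \<M> \<eta>" "\<And>p. 0 \<le> \<eta> p" "\<And>p. \<eta> p \<le> 1"
    "\<And>y. y \<in> cball x0 r \<Longrightarrow> \<eta> (\<psi> y) = 1" "\<And>p. p \<notin> \<psi> ` cball x0 (2 * r) \<Longrightarrow> \<eta> p = 0" and t: "tf \<eta>"
    using bump[OF c r(1) _ r(2)] r(1) by auto
  obtain m M where m: "0 < m" "\<And>y. y \<in> cball x0 r \<Longrightarrow> m \<le> dens \<psi> y * wgt (\<psi> y)"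
    by (rule chart_density_bounds[OF c less_imp_le[OF r(1)] cV wgt_continuous wgt_pos]) (rule that; blast)
  obtain \<Lambda> where \<Lambda>: "0 \<le> \<Lambda>" "\<And>y a. y \<in> cball x0 r \<Longrightarrow> norm (Df (F \<circ> \<psi>) y a) \<le> \<Lambda> * norm a"
    by (rule chart_differential_bound[OF c cV]) (rule that; blast)
  define b where "b = measure lborel (ball (0::real^'n) (2 * r))"
  define u where "u = measure lborel ?U"
  define z where "z = measure lborel Z"
  have eb: "emeasure lborel (ball (0::real^'n) (2 * r)) = ennreal b" unfolding b_def by (rule emeasure_ball_subset[OF order_refl])
  have eu: "emeasure lborel ?U = ennreal u" unfolding u_def by (rule emeasure_ball_subset[OF order_refl])
  have ez: "emeasure lborel Z = ennreal z" unfolding z_def by (rule emeasure_ball_subset[OF Z(2)])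
  have nn: "0 \<le> b" "0 \<le> u" "0 \<le> z" by (auto simp: b_def u_def z_def)
  have E0: "0 \<le> En \<eta>" unfolding En_def by (rule wint_nonneg) simp
  define q where "q = \<Lambda>\<^sup>2 * (12 * En \<eta> + 8) / m"
  have q0: "0 \<le> q" using E0 m(1) by (simp add: q_def)
  \<comment> \<open>The three terms bound the integrals, over \<open>Z\<close> times the ball, of 1,
    of the squared difference of \<open>w\<close>, and of \<open>w x\<close>.\<close>
  define C where "C = z * u + (2 * r)\<^sup>2 * b * q + u"
  have C0: "0 \<le> C" using nn q0 by (simp add: C_def)
  show ?thesis
  proof (rule exI[of _ C], rule conjI[OF C0], intro allI impI)
    fix k and \<epsilon> :: real
    assume \<epsilon>: "0 < \<epsilon>" "\<delta> k \<le> \<epsilon>" and small: "(\<integral>\<^sup>+y\<in>Z. ennreal (fs k (\<psi> y)) \<partial>lborel) \<le> ennreal \<epsilon>"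
    let ?f = "fs k"
    define T where "T = (\<lambda>p. (\<eta> p)\<^sup>2 * ((norm (grad ?f p))\<^sup>2 / (?f p + \<epsilon>)\<^sup>2))"
    have T: "wint T \<le> 12 * En \<eta> + 8" "ccs T"
      unfolding T_def using log_estimate[OF super delta_nonneg \<epsilon>(2,1) t \<eta>(2,3)] by auto
    have T0: "0 \<le> T p" for p by (simp add: T_def)
    define w where "w = (\<lambda>y. ln (1 + ?f (\<psi> y) / \<epsilon>))"
    define w' where "w' = (\<lambda>y a. Df (?f \<circ> \<psi>) y a / (?f (\<psi> y) + \<epsilon>))"
    define Q where "Q = (\<lambda>y. \<Lambda>\<^sup>2 * T (\<psi> y))"
    have f0: "0 \<le> ?f (\<psi> y)" if "y \<in> V" for y using fs_nonneg chart_topspace[OF c that] by blast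
    have sf: "smooth_on V (?f \<circ> \<psi>)" by (rule sm_topspace_chart[OF sm_fs c])
    have der: "(w has_derivative w' y) (at y)" if "y \<in> ?U" for y
    proof -
      have y: "y \<in> V" using UV that by auto
      have d: "((\<lambda>y. ?f (\<psi> y)) has_derivative Df (?f \<circ> \<psi>) y) (at y)"
        using smooth_on_has_derivative[OF sf y] by (simp add: o_def)
      have pos: "0 < 1 + ?f (\<psi> y) / \<epsilon>" "0 < ?f (\<psi> y) + \<epsilon>" using f0[OF y] \<epsilon>(1) by (simp_all add: add_pos_nonneg)
      have e: "(a / \<epsilon>) / (1 + ?f (\<psi> y) / \<epsilon>) = a / (?f (\<psi> y) + \<epsilon>)" for a
      proof -
        have "1 + ?f (\<psi> y) / \<epsilon> = (?f (\<psi> y) + \<epsilon>) / \<epsilon>" using \<epsilon>(1) by (simp add: add_divide_distrib)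
        then show ?thesis using \<epsilon>(1) by simp
      qed
      have "((\<lambda>y. ln (1 + ?f (\<psi> y) / \<epsilon>)) has_derivative
          (\<lambda>a. (Df (?f \<circ> \<psi>) y a / \<epsilon>) / (1 + ?f (\<psi> y) / \<epsilon>))) (at y)"
        using pos(1) \<epsilon>(1) by (auto intro!: derivative_eq_intros d simp: divide_inverse)
      then show ?thesis unfolding w_def w'_def e .
    qed
    have cont: "continuous_on ?U (\<lambda>y. w' y a)" for a
      unfolding w'_def
    proof (rule continuous_on_divide)
      show "continuous_on ?U (\<lambda>y. Df (?f \<circ> \<psi>) y a)"
        by (rule continuous_on_subset[OF smooth_on_imp_continuous_on[OF smooth_on_frechet[OF sf]] UV])
      show "continuous_on ?U (\<lambda>y. ?f (\<psi> y) + \<epsilon>)"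
        using continuous_on_subset[OF smooth_on_imp_continuous_on[OF sf] UV] by (auto intro!: continuous_intros simp: o_def)
      show "\<forall>y\<in>?U. ?f (\<psi> y) + \<epsilon> \<noteq> 0" using f0 \<epsilon>(1) UV by (force simp: add_nonneg_pos[THEN less_imp_neq, THEN not_sym])
    qed
    have bound: "(w' y a)\<^sup>2 \<le> Q y * (norm a)\<^sup>2" if y: "y \<in> ?U" for y a
    proof -
      have yV: "y \<in> V" and yc: "y \<in> cball x0 r" using UV y by auto
      have "\<bar>Df (?f \<circ> \<psi>) y a\<bar> \<le> norm (grad ?f (\<psi> y)) * (\<Lambda> * norm a)"
        using chart_derivative_bound[OF c yV sm_fs chart_topspace[OF c yV], of k a] mult_left_mono[OF \<Lambda>(2)[OF yc, of a] norm_ge_zero[of "grad ?f (\<psi> y)"]]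
        by linarith
      then have "(Df (?f \<circ> \<psi>) y a)\<^sup>2 \<le> (norm (grad ?f (\<psi> y)) * (\<Lambda> * norm a))\<^sup>2"
        by (metis abs_ge_zero power2_abs power_mono)
      then have "(w' y a)\<^sup>2 \<le> (norm (grad ?f (\<psi> y)) * (\<Lambda> * norm a))\<^sup>2 / (?f (\<psi> y) + \<epsilon>)\<^sup>2"
        unfolding w'_def power_divide by (rule divide_right_mono) simp
      also have "\<dots> = Q y * (norm a)\<^sup>2"
        unfolding Q_def T_def \<eta>(4)[OF yc] by (simp add: power_mult_distrib mult_ac)
      finally show ?thesis .
    qed
    have Q0: "0 \<le> Q y" for y by (simp add: Q_def T0)
    have cQ: "continuous_on ?U Q"
      unfolding Q_def using continuous_on_subset[OF continuous_chart[OF ccs_continuous[OF T(2)] c] UV]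
      by (auto intro!: continuous_intros)
    have Qm: "(\<lambda>y. indicator ?U y * ennreal (Q y)) \<in> borel_measurable borel"
      using borel_measurable_ennreal_indicator[OF Um cQ] by (simp add: mult.commute)
    have "(\<integral>\<^sup>+y. indicator ?U y * ennreal (Q y) \<partial>lborel) = (\<integral>\<^sup>+y\<in>?U. ennreal (\<Lambda>\<^sup>2 * T (\<psi> y)) \<partial>lborel)"
      by (simp add: Q_def mult.commute)
    also have "\<dots> \<le> ennreal (wint (\<lambda>p. \<Lambda>\<^sup>2 * T p) / m)"
      by (rule chart_integral_le_wint[OF c UV Um m(1) _ ccs_cmult[OF T(2)]]) (use m(2) T0 in auto)
    also have "\<dots> \<le> ennreal q"
      unfolding wint_cmult q_def using T(1) m(1) by (intro ennreal_leI divide_right_mono mult_left_mono) auto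
    finally have Qq: "(\<integral>\<^sup>+y. indicator ?U y * ennreal (Q y) \<partial>lborel) \<le> ennreal q" .
    let ?D = "\<lambda>x y. indicator ?U x * indicator ?U y * ennreal ((w y - w x)\<^sup>2)"
    have "(\<integral>\<^sup>+x. \<integral>\<^sup>+y. ?D x y \<partial>lborel \<partial>lborel) \<le>
      ennreal ((2 * r)\<^sup>2) * emeasure lborel (ball (0::real^'n) (2 * r)) * (\<integral>\<^sup>+y. indicator ?U y * ennreal (Q y) \<partial>lborel)"
      by (rule poincare_double_integral[OF open_ball convex_ball order_refl der cont bound Q0 Qm])
    also have "\<dots> \<le> ennreal ((2 * r)\<^sup>2) * ennreal b * ennreal q" unfolding eb using Qq by (intro mult_left_mono) auto
    also have "\<dots> = ennreal ((2 * r)\<^sup>2 * b * q)" using nn q0 by (simp add: ennreal_mult)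
    finally have DI: "(\<integral>\<^sup>+x. \<integral>\<^sup>+y. ?D x y \<partial>lborel \<partial>lborel) \<le> ennreal ((2 * r)\<^sup>2 * b * q)" .
    have w0: "0 \<le> w y" if "y \<in> ?U" for y
      unfolding w_def using f0 UV that \<epsilon>(1) by (intro ln_ge_zero) auto
    define W where "W = (\<lambda>y. indicator ?U y *\<^sub>R w y)"
    have "continuous_on ?U w"
      by (intro continuous_at_imp_continuous_on ballI has_derivative_continuous[OF der])
    then have Wm[measurable]: "W \<in> borel_measurable borel"
      unfolding W_def by (rule borel_measurable_continuous_on_indicator[OF Um])
    let ?w = "\<integral>\<^sup>+y\<in>?U. ennreal (w y) \<partial>lborel"
    have DW: "?D x y = indicator ?U x * indicator ?U y * ennreal ((W y - W x)\<^sup>2)" for x y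
      by (auto simp: W_def indicator_def)
    have wW: "?w = (\<integral>\<^sup>+y. ennreal (W y) \<partial>lborel)"
      by (intro nn_integral_cong) (auto simp: W_def indicator_def)
    have zw: "(\<integral>\<^sup>+x. indicator Z x * ennreal (W x) \<partial>lborel) \<le> 1"
    proof -
      have fm: "(\<lambda>x. ennreal (?f (\<psi> x)) * indicator Z x) \<in> borel_measurable borel"
        by (rule borel_measurable_ennreal_indicator[OF Z(1)])
          (use continuous_on_subset[OF smooth_on_imp_continuous_on[OF sf], of Z] Z(2) UV in \<open>auto simp: o_def\<close>)
      have "(\<integral>\<^sup>+x. indicator Z x * ennreal (W x) \<partial>lborel) \<le> (\<integral>\<^sup>+x. ennreal (1 / \<epsilon>) * (ennreal (?f (\<psi> x)) * indicator Z x) \<partial>lborel)"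
      proof (rule nn_integral_mono)
        fix x
        show "indicator Z x * ennreal (W x) \<le> ennreal (1 / \<epsilon>) * (ennreal (?f (\<psi> x)) * indicator Z x)"
        proof (cases "x \<in> Z")
          case True
          then have x: "x \<in> ?U" "x \<in> V" using Z(2) UV by auto
          have "w x \<le> ?f (\<psi> x) / \<epsilon>" unfolding w_def using f0[OF x(2)] \<epsilon>(1) by (intro ln_add_one_self_le_self) auto
          then have "ennreal (w x) \<le> ennreal (1 / \<epsilon> * ?f (\<psi> x))" by (intro ennreal_leI) simp
          then show ?thesis using True x f0[OF x(2)] \<epsilon>(1) by (simp add: W_def ennreal_mult[symmetric])
        qed simp
      qed
      also have "\<dots> = ennreal (1 / \<epsilon>) * (\<integral>\<^sup>+x\<in>Z. ennreal (?f (\<psi> x)) \<partial>lborel)"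
        using fm by (intro nn_integral_cmult) simp
      also have "\<dots> \<le> ennreal (1 / \<epsilon>) * ennreal \<epsilon>" using small by (rule mult_left_mono) simp
      also have "\<dots> = 1" using \<epsilon>(1) by (simp add: ennreal_mult[symmetric])
      finally show ?thesis .
    qed
    have "emeasure lborel Z * ?w = (\<integral>\<^sup>+x. ?w * indicator Z x \<partial>lborel)"
      using nn_integral_cmult_indicator[of Z lborel ?w] Z(1) by (simp add: mult.commute)
    also have "\<dots> = (\<integral>\<^sup>+x. \<integral>\<^sup>+y. indicator Z x * ennreal (W y) \<partial>lborel \<partial>lborel)"
      unfolding wW
    proof (rule nn_integral_cong)
      fix x
      have "(\<integral>\<^sup>+y. indicator Z x * ennreal (W y) \<partial>lborel) = indicator Z x * (\<integral>\<^sup>+y. ennreal (W y) \<partial>lborel)"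
        by (rule nn_integral_cmult) simp
      then show "(\<integral>\<^sup>+y. ennreal (W y) \<partial>lborel) * indicator Z x = (\<integral>\<^sup>+y. indicator Z x * ennreal (W y) \<partial>lborel)"
        by (simp only: mult.commute)
    qed
    also have "\<dots> \<le> (\<integral>\<^sup>+x. \<integral>\<^sup>+y. (indicator Z x * indicator ?U y +
        indicator ?U x * indicator ?U y * ennreal ((W y - W x)\<^sup>2)) + indicator Z x * ennreal (W x) * indicator ?U y \<partial>lborel \<partial>lborel)"
    proof (intro nn_integral_mono)
      fix x y
      show "indicator Z x * ennreal (W y) \<le> (indicator Z x * indicator ?U y +
        indicator ?U x * indicator ?U y * ennreal ((W y - W x)\<^sup>2)) + indicator Z x * ennreal (W x) * indicator ?U y"
      proof (cases "x \<in> Z \<and> y \<in> ?U")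
        case True
        then have xy: "x \<in> ?U" "y \<in> ?U" "x \<in> Z" using Z(2) by auto
        \<comment> \<open>This passes from the quadratic quantity in the Poincare inequality to
          \<open>w\<close> itself.\<close>
        have "w y - w x \<le> 1 + (w y - w x)\<^sup>2"
        proof -
          have "0 \<le> (w y - w x - 1/2)\<^sup>2" by simp
          then show ?thesis by (simp add: power2_eq_square algebra_simps)
        qed
        then have "ennreal (w y) \<le> ennreal (1 + (w y - w x)\<^sup>2 + w x)" by (intro ennreal_leI) simp
        also have "\<dots> = 1 + ennreal ((w y - w x)\<^sup>2) + ennreal (w x)" using w0[OF xy(1)] by simp
        finally show ?thesis using xy by (simp add: W_def)
      qed (auto simp: W_def indicator_def)
    qed
    also have "\<dots> = (\<integral>\<^sup>+x. indicator Z x * emeasure lborel ?U \<partial>lborel) + (\<integral>\<^sup>+x. \<integral>\<^sup>+y. ?D x y \<partial>lborel \<partial>lborel)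
       + (\<integral>\<^sup>+x. indicator Z x * ennreal (W x) * emeasure lborel ?U \<partial>lborel)"
    proof -
      have m1: "(\<lambda>x. \<integral>\<^sup>+y. indicator ?U x * indicator ?U y * ennreal ((W y - W x)\<^sup>2) \<partial>lborel) \<in> borel_measurable lborel"
        by measurable
      show ?thesis
        unfolding DW using m1
        by (simp add: nn_integral_add nn_integral_cmult nn_integral_cmult_indicator)
    qed
    also have "\<dots> \<le> ennreal (z * u) + ennreal ((2 * r)\<^sup>2 * b * q) + ennreal u"
    proof (intro add_mono DI)
      show "(\<integral>\<^sup>+x. indicator Z x * emeasure lborel ?U \<partial>lborel) \<le> ennreal (z * u)"
        using nn by (simp add: nn_integral_multc eu ez ennreal_mult)
      have "(\<integral>\<^sup>+x. indicator Z x * ennreal (W x) * emeasure lborel ?U \<partial>lborel) = (\<integral>\<^sup>+x. indicator Z x * ennreal (W x) \<partial>lborel) * ennreal u"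
        unfolding eu by (rule nn_integral_multc) measurable
      also have "\<dots> \<le> 1 * ennreal u" using zw by (rule mult_right_mono) simp
      finally show "(\<integral>\<^sup>+x. indicator Z x * ennreal (W x) * emeasure lborel ?U \<partial>lborel) \<le> ennreal u" by simp
    qed
    also have "\<dots> = ennreal C" using nn q0 by (simp add: C_def ennreal_plus[symmetric] del: ennreal_plus)
    finally show "emeasure lborel Z * (\<integral>\<^sup>+y\<in>?U. ennreal (ln (1 + ?f (\<psi> y) / \<epsilon>)) \<partial>lborel) \<le> ennreal C"
      unfolding w_def .
  qed
qed

lemma superlevel_measurable:
  assumes c: "(V, \<psi>) \<in> A" and U: "ball x0 r \<subseteq> V"
  shows "{y \<in> ball x0 r. \<sigma> \<le> fs k (\<psi> y)} \<in> sets borel"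
proof -
  have "{p \<in> \<M>. \<sigma> \<le> fs k p} \<in> sets bX"
    using continuous_measurable[OF sm_continuous[OF sm_fs[of k]]] borel_measurable_le[of "\<lambda>p. \<sigma>" bX "fs k"]
    by (simp add: space_bX)
  from chart_preimage_borel[OF c this] have "{x \<in> V. \<psi> x \<in> {p \<in> \<M>. \<sigma> \<le> fs k p}} \<inter> ball x0 r \<in> sets borel" by simp
  moreover have "{x \<in> V. \<psi> x \<in> {p \<in> \<M>. \<sigma> \<le> fs k p}} \<inter> ball x0 r = {y \<in> ball x0 r. \<sigma> \<le> fs k (\<psi> y)}"
    using U chart_topspace[OF c] by auto
  ultimately show ?thesis by simp
qed

text \<open>Chebyshev's inequality for the logarithm: where f \<ge> \<sigma> it is at least ln (1 +
  \<sigma> / \<epsilon>), which is as large as desired for small \<epsilon>, whereas its integral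
  over the ball stays bounded.\<close>

lemma measure_small:
  assumes c: "(V, \<psi>) \<in> A" and r: "0 < r" "cball x0 (2 * r) \<subseteq> V"
    and Z: "Z \<in> sets borel" "Z \<subseteq> ball x0 r" "0 < emeasure lborel Z"
    and lim: "\<And>e. 0 < e \<Longrightarrow> \<forall>\<^sub>F k in sequentially. (\<integral>\<^sup>+y\<in>Z. ennreal (fs k (\<psi> y)) \<partial>lborel) \<le> ennreal e"
    and st: "0 < \<sigma>" "0 < \<tau>"
  shows "\<forall>\<^sub>F k in sequentially. emeasure lborel {y \<in> ball x0 r. \<sigma> \<le> fs k (\<psi> y)} \<le> ennreal \<tau>"
proof -
  let ?U = "ball x0 r"
  have UV: "?U \<subseteq> V" using r by (auto simp: subset_iff)
  obtain C where CC: "0 \<le> C \<and> (\<forall>k \<epsilon>. 0 < \<epsilon> \<longrightarrow> \<delta> k \<le> \<epsilon> \<longrightarrow> (\<integral>\<^sup>+y\<in>Z. ennreal (fs k (\<psi> y)) \<partial>lborel) \<le> ennreal \<epsilon> \<longrightarrow>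
    emeasure lborel Z * (\<integral>\<^sup>+y\<in>?U. ennreal (ln (1 + fs k (\<psi> y) / \<epsilon>)) \<partial>lborel) \<le> ennreal C)"
    using log_mean_bound[OF c r Z(1,2)] ..
  note C = CC[THEN conjunct1] CC[THEN conjunct2, rule_format]
  define z where "z = measure lborel Z"
  have ez: "emeasure lborel Z = ennreal z"
    unfolding z_def by (rule emeasure_ball_subset[OF Z(2)])
  have z: "0 < z" using Z(3) ez by (simp add: z_def)
  \<comment> \<open>\<open>L\<close> is a height at which Chebyshev's bound
    \<open>C / (z * L)\<close> is at most \<open>\<tau>\<close>; the \<open>\<epsilon>\<close>
    defined next solves ln (1 + \<sigma> / \<epsilon>) = L.\<close>
  define L where "L = C / (z * \<tau>) + 1"
  have L: "0 < L" using C(1) z st by (simp add: L_def add_nonneg_pos)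
  define \<epsilon> where "\<epsilon> = \<sigma> / (exp L - 1)"
  have eL: "exp L - 1 > 0" using L by simp
  have \<epsilon>: "0 < \<epsilon>" using st eL by (simp add: \<epsilon>_def)
  have "\<sigma> / \<epsilon> = exp L - 1" using st eL by (simp add: \<epsilon>_def)
  then have lnL: "ln (1 + \<sigma> / \<epsilon>) = L" by simp
  have ev: "\<forall>\<^sub>F k in sequentially. \<delta> k \<le> \<epsilon>"
    using order_tendstoD(2)[OF delta_lim \<epsilon>] by (rule eventually_mono) simp
  show ?thesis
    using ev lim[OF \<epsilon>]
  proof eventually_elim
    case (elim k)
    let ?S = "{y \<in> ?U. \<sigma> \<le> fs k (\<psi> y)}"
    have Sm: "?S \<in> sets borel" by (rule superlevel_measurable[OF c UV])
    have "ennreal L * emeasure lborel ?S = (\<integral>\<^sup>+y. ennreal L * indicator ?S y \<partial>lborel)"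
      using Sm by (simp add: nn_integral_cmult_indicator)
    also have "\<dots> \<le> (\<integral>\<^sup>+y\<in>?U. ennreal (ln (1 + fs k (\<psi> y) / \<epsilon>)) \<partial>lborel)"
    proof (rule nn_integral_mono)
      fix y
      show "ennreal L * indicator ?S y \<le> ennreal (ln (1 + fs k (\<psi> y) / \<epsilon>)) * indicator ?U y"
      proof (cases "y \<in> ?S")
        case True
        have "ln (1 + \<sigma> / \<epsilon>) \<le> ln (1 + fs k (\<psi> y) / \<epsilon>)"
        proof -
          have "\<sigma> / \<epsilon> \<le> fs k (\<psi> y) / \<epsilon>" using True \<epsilon> by (intro divide_right_mono) auto
          moreover have "0 < \<sigma> / \<epsilon>" using st \<epsilon> by simp
          ultimately show ?thesis by (intro ln_mono) auto
        qed
        then show ?thesis using True by (simp add: lnL ennreal_leI)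
      qed simp
    qed
    finally have "ennreal z * (ennreal L * emeasure lborel ?S) \<le>
        ennreal z * (\<integral>\<^sup>+y\<in>?U. ennreal (ln (1 + fs k (\<psi> y) / \<epsilon>)) \<partial>lborel)"
      by (rule mult_left_mono) simp
    also have "\<dots> \<le> ennreal C" using C(2)[OF \<epsilon> elim] unfolding ez .
    also have "\<dots> \<le> ennreal (z * L * \<tau>)"
      using z st by (intro ennreal_leI) (simp add: L_def field_simps)
    also have "\<dots> = ennreal (z * L) * ennreal \<tau>" using z L st by (simp add: ennreal_mult)
    finally have "ennreal (z * L) * emeasure lborel ?S \<le> ennreal (z * L) * ennreal \<tau>"
      using z L by (simp add: ennreal_mult mult.assoc)
    then show ?case using z L by (simp add: ennreal_mult_le_mult_iff)
  qed
qed

lemma fs_sq_measurable: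
  assumes "U \<in> sets bX" shows "(\<lambda>p. ennreal ((fs k p)\<^sup>2) * indicator U p) \<in> borel_measurable bX"
  using continuous_measurable[OF sm_continuous[OF sm_fs[of k]]] assms by measurable

text \<open>Smallness in measure alone does not give smallness in L^2. The uniform energy bound for
  the cut-off functions excludes concentration on small sets, by way of
  \<open>square_integral_le_of_small_measure\<close>.\<close>

lemma local_vanish:
  assumes c: "(V, \<psi>) \<in> A" and r: "0 < r" "cball x0 (2 * r) \<subseteq> V"
    and Z: "Z \<in> sets borel" "Z \<subseteq> ball x0 r" "0 < emeasure lborel Z"
    and lim: "\<And>e. 0 < e \<Longrightarrow> \<forall>\<^sub>F k in sequentially. (\<integral>\<^sup>+y\<in>Z. ennreal (fs k (\<psi> y)) \<partial>lborel) \<le> ennreal e"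
  shows "vanishes (\<psi> ` ball x0 (r / 2))"
  unfolding vanishes_def
proof (intro allI impI)
  fix e :: real assume e: "0 < e"
  interpret c: local_immersion V "F \<circ> \<psi>" by (rule chart_immersion[OF c])
  \<comment> \<open>Nested balls: the cutoff is 1 on radius \<open>r / 2\<close> and supported in
    radius \<open>3 * r / 4\<close>, while smallness in measure is available on radius
    \<open>r\<close>.\<close>
  let ?S = "cball x0 (3 * r / 4)" and ?B = "ball x0 r"
  have SV: "?S \<subseteq> V" and HV: "cball x0 (r / 2) \<subseteq> V" and BV: "?B \<subseteq> V" and SB: "?S \<subseteq> ?B"
    using r by (auto simp: subset_iff)
  have rr: "0 < r / 2" "r / 2 < 3 * r / 4" using r(1) by auto
  obtain \<eta> :: "'a \<Rightarrow> real" where \<eta>: "sm \<M> \<eta>" "\<And>p. 0 \<le> \<eta> p" "\<And>p. \<eta> p \<le> 1"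
    "\<And>y. y \<in> cball x0 (r / 2) \<Longrightarrow> \<eta> (\<psi> y) = 1" "\<And>p. p \<notin> \<psi> ` ?S \<Longrightarrow> \<eta> p = 0" and t: "tf \<eta>"
    using bump[OF c rr SV] by blast
  have r3: "0 \<le> 3 * r / 4" using r(1) by simp
  obtain m where m: "0 < m" "\<And>y. y \<in> ?S \<Longrightarrow> m \<le> dens \<psi> y * wgt (\<psi> y)"
    by (rule chart_density_bounds[OF c r3 SV wgt_continuous wgt_pos]) (rule that; blast)
  obtain M where M: "0 < M" "\<And>y. y \<in> cball x0 (r / 2) \<Longrightarrow> dens \<psi> y * 1 \<le> M"
    by (rule chart_density_bounds[where g="\<lambda>p. 1", OF c less_imp_le[OF rr(1)] HV continuous_pos_one]) (rule that; blast)
  obtain \<Lambda> where \<Lambda>: "0 \<le> \<Lambda>" "\<And>y a. y \<in> ?S \<Longrightarrow> norm (Df (F \<circ> \<psi>) y a) \<le> \<Lambda> * norm a"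
    by (rule chart_differential_bound[OF c SV]) (rule that; blast)
  define G where "G = (\<lambda>k p. \<eta> p * fs k p)"
  have tG: "tf (G k)" for k unfolding G_def by (rule tf_mult[OF t sm_fs])
  obtain Cb where Cb: "\<And>k. En (G k) \<le> Cb" using energy[OF t] unfolding G_def by blast
  have Cb0: "0 \<le> Cb"
  proof -
    have "0 \<le> En (G 0)" unfolding En_def by (rule wint_nonneg) simp
    then show ?thesis using Cb[of 0] by linarith
  qed
  define q where "q = \<Lambda>\<^sup>2 * Cb / m"
  have q0: "0 \<le> q" using Cb0 m(1) by (simp add: q_def)
  define b where "b = measure lborel ?B"
  have eb: "emeasure lborel ?B = ennreal b" unfolding b_def by (rule emeasure_ball_subset[OF order_refl])
  have b0: "0 \<le> b" by (simp add: b_def)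
  define e' where "e' = e / M"
  have e': "0 < e'" using e M by (simp add: e'_def)
  \<comment> \<open>\<open>h\<close> and \<open>\<sigma>\<close> make each of the two terms of the
    L^2 bound at most \<open>e' / 2\<close>. The division by \<open>M\<close> in \<open>e'\<close>
    pays for the passage from Lebesgue measure to the volume.\<close>
  define h where "h = sqrt (e' / (8 * (q + 1)))"
  define \<sigma> where "\<sigma> = sqrt (e' / (8 * (b + 1)))"
  have h: "0 < h" "h\<^sup>2 = e' / (8 * (q + 1))" using e' q0 by (auto simp: h_def)
  have \<sigma>: "0 < \<sigma>" "\<sigma>\<^sup>2 = e' / (8 * (b + 1))" using e' b0 by (auto simp: \<sigma>_def)
  have total: "4 * h\<^sup>2 * q + 4 * \<sigma>\<^sup>2 * b \<le> e'"
  proof -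
    have "4 * (e' / (8 * (t + 1))) * t \<le> e' / 2" if "0 \<le> t" for t
      using that e' by (simp add: field_simps)
    from this[OF q0] this[OF b0] show ?thesis unfolding h(2) \<sigma>(2) by linarith
  qed
  define \<tau> where "\<tau> = measure lborel (ball (0::real^'n) h) / 2"
  have \<tau>: "0 < \<tau>" using content_ball_pos[OF h(1), of "0::real^'n"] by (simp add: \<tau>_def)
  have ms: "\<forall>\<^sub>F k in sequentially. emeasure lborel {y \<in> ball x0 r. \<sigma> \<le> fs k (\<psi> y)} \<le> ennreal \<tau>"
    by (rule measure_small[OF c r Z _ \<sigma>(1) \<tau>]) (rule lim)
  show "\<forall>\<^sub>F k in sequentially. (\<integral>\<^sup>+p\<in>\<psi> ` ball x0 (r / 2). ennreal ((fs k p)\<^sup>2) \<partial>vol) \<le> ennreal e"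
    using ms
  proof eventually_elim
    case (elim k)
    define w where "w = (\<lambda>y. if y \<in> V then (G k \<circ> \<psi>) y else 0)"
    define w' where "w' = (\<lambda>y a. if y \<in> V then Df (G k \<circ> \<psi>) y a else 0)"
    define Q where "Q = (\<lambda>y. indicator ?S y *\<^sub>R (\<Lambda>\<^sup>2 * (norm (grad (G k) (\<psi> y)))\<^sup>2))"
    have sG: "smooth_on V (G k \<circ> \<psi>)" by (rule sm_topspace_chart[OF tf_sm[OF tG] c])
    have G0: "(G k \<circ> \<psi>) y = 0" if "y \<in> V - ?S" for y
    proof -
      have "\<psi> y \<notin> \<psi> ` ?S" using that SV chart_inj[OF c] by (auto dest: inj_onD)
      then show ?thesis using \<eta>(5) by (simp add: G_def)
    qed
    note ze = c.has_derivative_zero_extension[OF sG compact_cball SV G0]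
    have der: "(w has_derivative w' y) (at y)" for y unfolding w_def w'_def by (rule ze(1))
    have cont: "continuous_on UNIV (\<lambda>y. w' y a)" for a unfolding w'_def by (rule ze(2))
    have gradG0: "grad (G k) (\<psi> y) = 0" if "y \<in> V - ?S" for y
    proof -
      have y: "\<psi> y \<notin> \<psi> ` ?S" using that SV chart_inj[OF c] by (auto dest: inj_onD)
      have "mD (G k) (\<psi> y) u = 0" for u
        by (rule mD_vanish[OF tf_sm[OF tG] chart_compact_image[OF c compact_cball SV] _ _ y])
          (use \<eta>(5) that chart_topspace[OF c] in \<open>auto simp: G_def\<close>)
      then show ?thesis by (simp add: grad_def)
    qed
    have bound: "(w' y a)\<^sup>2 \<le> Q y * (norm a)\<^sup>2" for y a
    proof (cases "y \<in> ?S")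
      case True
      have y: "y \<in> V" using True SV by auto
      have "\<bar>Df (G k \<circ> \<psi>) y a\<bar> \<le> norm (grad (G k) (\<psi> y)) * (\<Lambda> * norm a)"
        using chart_derivative_bound[OF c y tf_sm[OF tG[of k]] chart_topspace[OF c y], of a]
          mult_left_mono[OF \<Lambda>(2)[OF True, of a] norm_ge_zero[of "grad (G k) (\<psi> y)"]]
        by linarith
      then have "\<bar>Df (G k \<circ> \<psi>) y a\<bar>\<^sup>2 \<le> (norm (grad (G k) (\<psi> y)) * (\<Lambda> * norm a))\<^sup>2"
        by (rule power_mono) simp
      then show ?thesis using True y by (simp add: w'_def Q_def power_mult_distrib mult_ac)
    next
      case False
      have "w' y a = 0"
      proof (cases "y \<in> V")
        case y: True
        show ?thesis
          using chart_derivative_bound[OF c y tf_sm[OF tG[of k]] chart_topspace[OF c y], of a] gradG0[of y] False y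
          by (auto simp: w'_def)
      qed (simp add: w'_def)
      then show ?thesis using False by (simp add: Q_def)
    qed
    have Q0: "0 \<le> Q y" for y by (simp add: Q_def)
    have cg: "ccs (\<lambda>p. \<Lambda>\<^sup>2 * (norm (grad (G k) p))\<^sup>2)" by (rule ccs_cmult[OF tf_grad_sq_ccs[OF tG]])
    have Qm: "Q \<in> borel_measurable borel"
      unfolding Q_def
      by (rule borel_measurable_continuous_on_indicator[OF _ continuous_on_subset[OF continuous_chart[OF ccs_continuous[OF cg] c] SV]]) simp
    have "(\<integral>\<^sup>+y. ennreal (Q y) \<partial>lborel) = (\<integral>\<^sup>+y\<in>?S. ennreal (\<Lambda>\<^sup>2 * (norm (grad (G k) (\<psi> y)))\<^sup>2) \<partial>lborel)"
      by (intro nn_integral_cong) (simp add: Q_def indicator_def)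
    also have "\<dots> \<le> ennreal (wint (\<lambda>p. \<Lambda>\<^sup>2 * (norm (grad (G k) p))\<^sup>2) / m)"
      by (rule chart_integral_le_wint[OF c SV _ m(1) m(2) cg]) auto
    also have "\<dots> \<le> ennreal q"
      unfolding wint_cmult q_def using Cb[of k] m(1)
      by (intro ennreal_leI divide_right_mono mult_left_mono) (auto simp: En_def)
    finally have Qq: "(\<integral>\<^sup>+y. ennreal (Q y) \<partial>lborel) \<le> ennreal q" .
    have f0: "0 \<le> fs k (\<psi> y)" if "y \<in> V" for y using fs_nonneg chart_topspace[OF c that] by blast
    have w0: "0 \<le> w y" for y using f0 \<eta>(2) by (simp add: w_def G_def)
    have wB: "w y = 0" if "y \<notin> ?B" for y
    proof -
      have "y \<notin> ?S" using that SB by blast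
      then show ?thesis using G0[of y] by (auto simp: w_def)
    qed
    have small: "emeasure lborel {y. \<sigma> \<le> w y} \<le> ennreal (measure lborel (ball (0::real^'n) h) / 2)"
    proof -
      have "{y. \<sigma> \<le> w y} \<subseteq> {y \<in> ?B. \<sigma> \<le> fs k (\<psi> y)}"
      proof
        fix y assume "y \<in> {y. \<sigma> \<le> w y}"
        then have y: "\<sigma> \<le> w y" by simp
        then have yB: "y \<in> ?B" using wB[of y] \<sigma>(1) by (cases "y \<in> ?B") auto
        then have yV: "y \<in> V" using BV by auto
        have "w y \<le> 1 * fs k (\<psi> y)"
          unfolding w_def G_def using yV f0[OF yV] \<eta>(3) by (simp add: mult_left_le_one_le \<eta>(2))
        then show "y \<in> {y \<in> ?B. \<sigma> \<le> fs k (\<psi> y)}" using y yB by simp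
      qed
      moreover have "{y \<in> ?B. \<sigma> \<le> fs k (\<psi> y)} \<in> sets lborel" using superlevel_measurable[OF c BV] by simp
      ultimately have "emeasure lborel {y. \<sigma> \<le> w y} \<le> emeasure lborel {y \<in> ?B. \<sigma> \<le> fs k (\<psi> y)}"
        by (rule emeasure_mono)
      also have "\<dots> \<le> ennreal \<tau>" by (rule elim)
      finally show ?thesis by (simp add: \<tau>_def)
    qed
    have "(\<integral>\<^sup>+y. ennreal ((w y)\<^sup>2) \<partial>lborel) \<le> ennreal (4 * h\<^sup>2 * q + 4 * \<sigma>\<^sup>2 * b)"
      by (rule square_integral_le_of_small_measure[where B="?B", OF der cont bound Q0 Qm w0 _ _ h(1) \<sigma>(1) small Qq q0 _ b0])
        (simp_all add: eb wB)
    also have "\<dots> \<le> ennreal e'" by (rule ennreal_leI[OF total])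
    finally have wint: "(\<integral>\<^sup>+y. ennreal ((w y)\<^sup>2) \<partial>lborel) \<le> ennreal e'" .
    let ?H = "\<psi> ` ball x0 (r / 2)"
    have HX: "?H \<in> sets bX"
      using openin_sets[OF chart_image_open[OF c open_ball]] HV ball_subset_cball by blast
    have fm: "(\<lambda>p. ennreal ((fs k p)\<^sup>2) * indicator ?H p) \<in> borel_measurable bX"
      by (rule fs_sq_measurable[OF HX])
    have "(\<integral>\<^sup>+p\<in>?H. ennreal ((fs k p)\<^sup>2) \<partial>vol) = (\<integral>\<^sup>+p\<in>\<psi> ` V. (ennreal ((fs k p)\<^sup>2) * indicator ?H p) \<partial>vol)"
    proof (rule nn_integral_cong)
      fix p
      have "?H \<subseteq> \<psi> ` V" using HV ball_subset_cball by blast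
      then show "ennreal ((fs k p)\<^sup>2) * indicator ?H p = ennreal ((fs k p)\<^sup>2) * indicator ?H p * indicator (\<psi> ` V) p"
        by (auto simp: indicator_def)
    qed
    also have "\<dots> = (\<integral>\<^sup>+y\<in>V. ennreal (dens \<psi> y) * (ennreal ((fs k (\<psi> y))\<^sup>2) * indicator ?H (\<psi> y)) \<partial>lborel)"
      by (rule nn_integral_vol_chart[OF c fm])
    also have "\<dots> \<le> (\<integral>\<^sup>+y. ennreal M * ennreal ((w y)\<^sup>2) \<partial>lborel)"
    proof (rule nn_integral_mono)
      fix y
      show "ennreal (dens \<psi> y) * (ennreal ((fs k (\<psi> y))\<^sup>2) * indicator ?H (\<psi> y)) * indicator V y \<le> ennreal M * ennreal ((w y)\<^sup>2)"
      proof (cases "y \<in> V \<and> \<psi> y \<in> ?H")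
        case True
        then have "y \<in> ball x0 (r / 2)" using chart_inj[OF c] HV by (auto dest!: inj_onD) 
        then have y: "y \<in> cball x0 (r / 2)" by simp
        have "w y = fs k (\<psi> y)" using True \<eta>(4)[OF y] by (simp add: w_def G_def)
        then show ?thesis using True M(2)[OF y] by (simp add: mult_right_mono ennreal_leI)
      qed auto
    qed
    also have "\<dots> = ennreal M * (\<integral>\<^sup>+y. ennreal ((w y)\<^sup>2) \<partial>lborel)"
    proof (rule nn_integral_cmult)
      have "continuous_on UNIV w"
        by (intro continuous_at_imp_continuous_on ballI has_derivative_continuous[OF der])
      then have "w \<in> borel_measurable borel" by (rule borel_measurable_continuous_onI)
      then show "(\<lambda>y. ennreal ((w y)\<^sup>2)) \<in> borel_measurable lborel" by simp
    qed
    also have "\<dots> \<le> ennreal M * ennreal e'" by (rule mult_left_mono[OF wint]) simp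
    also have "\<dots> = ennreal e" using M(1) e by (simp add: e'_def ennreal_mult[symmetric])
    finally show ?case .
  qed
qed

text \<open>On the open overlap, which has positive measure, L^2 smallness gives the L^1 smallness
  that \<open>local_vanish\<close> starts from, through f \<le> t + f^2 / (4 t).\<close>

lemma vanish_step:
  assumes c: "(V, \<psi>) \<in> A" and r: "0 < r" "cball x0 (2 * r) \<subseteq> V"
    and U: "openin X U" "vanishes U" "U \<inter> \<psi> ` ball x0 r \<noteq> {}"
  shows "vanishes (\<psi> ` ball x0 (r / 2))"
proof -
  let ?B = "ball x0 r"
  define Z where "Z = {y \<in> V. \<psi> y \<in> U} \<inter> ?B"
  have BV: "?B \<subseteq> V" and cV: "cball x0 r \<subseteq> V" using r by (auto simp: subset_iff)
  have Zo: "open Z" unfolding Z_def using chart_preimage_open[OF c U(1)] by auto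
  have Zb: "Z \<in> sets borel" "Z \<subseteq> ?B" using Zo by (auto simp: Z_def)
  obtain y where "y \<in> ?B" "\<psi> y \<in> U" using U(3) by blast
  then have y: "y \<in> Z" using BV by (auto simp: Z_def)
  have Zpos: "0 < emeasure lborel Z"
  proof -
    obtain s where s: "0 < s" "ball y s \<subseteq> Z" using Zo y openE by blast
    have "0 < emeasure lborel (ball y s)" using content_ball_pos[OF s(1), of y]
      by (simp add: emeasure_ball_subset[OF order_refl])
    also have "\<dots> \<le> emeasure lborel Z" using s(2) Zb by (intro emeasure_mono) auto
    finally show ?thesis .
  qed
  define b where "b = measure lborel Z"
  have eb: "emeasure lborel Z = ennreal b" unfolding b_def by (rule emeasure_ball_subset[OF Zb(2)])
  have b0: "0 \<le> b" by (simp add: b_def)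
  obtain m where m: "0 < m" "\<And>y. y \<in> cball x0 r \<Longrightarrow> m \<le> dens \<psi> y * 1"
    by (rule chart_density_bounds[where g="\<lambda>p. 1", OF c less_imp_le[OF r(1)] cV continuous_pos_one]) (rule that; blast)
  show ?thesis
  proof (rule local_vanish[OF c r Zb Zpos])
    fix e :: real assume e: "0 < e"
    \<comment> \<open>\<open>t\<close> and \<open>e'\<close> are chosen so that the constant and the
      quadratic term contribute at most \<open>e / 2\<close> each.\<close>
    define t where "t = e / (2 * (b + 1))"
    have t: "0 < t" using e b0 by (simp add: t_def)
    define e' where "e' = e / 2 * (4 * t) * m"
    have e': "0 < e'" using e t m by (simp add: e'_def)
    have "\<forall>\<^sub>F k in sequentially. (\<integral>\<^sup>+p\<in>U. ennreal ((fs k p)\<^sup>2) \<partial>vol) \<le> ennreal e'"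
      using U(2) e' unfolding vanishes_def by blast
    then show "\<forall>\<^sub>F k in sequentially. (\<integral>\<^sup>+y\<in>Z. ennreal (fs k (\<psi> y)) \<partial>lborel) \<le> ennreal e"
    proof eventually_elim
      case (elim k)
      have UX: "U \<in> sets bX" by (rule openin_sets[OF U(1)])
      have fm: "(\<lambda>p. ennreal ((fs k p)\<^sup>2) * indicator U p) \<in> borel_measurable bX"
        by (rule fs_sq_measurable[OF UX])
      have cf: "continuous_on Z (\<lambda>y. fs k (\<psi> y))"
        by (rule continuous_on_subset[OF continuous_chart[OF sm_continuous[OF sm_fs] c]]) (auto simp: Z_def)
      have sqm: "(\<lambda>y. ennreal ((fs k (\<psi> y))\<^sup>2) * indicator Z y) \<in> borel_measurable borel"
        by (rule borel_measurable_ennreal_indicator[OF Zb(1) continuous_on_power[OF cf]])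
      have "ennreal m * (\<integral>\<^sup>+y\<in>Z. ennreal ((fs k (\<psi> y))\<^sup>2) \<partial>lborel) = (\<integral>\<^sup>+y. ennreal m * (ennreal ((fs k (\<psi> y))\<^sup>2) * indicator Z y) \<partial>lborel)"
        using sqm by (intro nn_integral_cmult[symmetric]) simp
      also have "\<dots> \<le> (\<integral>\<^sup>+y\<in>V. ennreal (dens \<psi> y) * (ennreal ((fs k (\<psi> y))\<^sup>2) * indicator U (\<psi> y)) \<partial>lborel)"
      proof (rule nn_integral_mono)
        fix y
        show "ennreal m * (ennreal ((fs k (\<psi> y))\<^sup>2) * indicator Z y) \<le>
          ennreal (dens \<psi> y) * (ennreal ((fs k (\<psi> y))\<^sup>2) * indicator U (\<psi> y)) * indicator V y"
        proof (cases "y \<in> Z")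
          case True
          then have "y \<in> V" "\<psi> y \<in> U" "y \<in> cball x0 r" by (auto simp: Z_def)
          then show ?thesis using True m(2)[of y] by (simp add: mult_right_mono ennreal_leI)
        qed simp
      qed
      also have "\<dots> = (\<integral>\<^sup>+p\<in>\<psi> ` V. (ennreal ((fs k p)\<^sup>2) * indicator U p) \<partial>vol)"
        by (rule nn_integral_vol_chart[OF c fm, symmetric])
      also have "\<dots> \<le> (\<integral>\<^sup>+p\<in>U. ennreal ((fs k p)\<^sup>2) \<partial>vol)"
        by (intro nn_integral_mono) (simp add: indicator_def)
      also have "\<dots> \<le> ennreal e'" by (rule elim)
      also have "\<dots> = ennreal m * ennreal (e' / m)" using m(1) e' by (simp add: ennreal_mult[symmetric])
      finally have sq: "(\<integral>\<^sup>+y\<in>Z. ennreal ((fs k (\<psi> y))\<^sup>2) \<partial>lborel) \<le> ennreal (e' / m)"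
        using m(1) by (simp add: ennreal_mult_le_mult_iff)
      have "(\<integral>\<^sup>+y\<in>Z. ennreal (fs k (\<psi> y)) \<partial>lborel) \<le>
          (\<integral>\<^sup>+y. ennreal t * indicator Z y + ennreal (1 / (4 * t)) * (ennreal ((fs k (\<psi> y))\<^sup>2) * indicator Z y) \<partial>lborel)"
      proof (rule nn_integral_mono)
        fix y
        have "fs k (\<psi> y) \<le> t + 1 / (4 * t) * (fs k (\<psi> y))\<^sup>2"
        proof -
          have "0 \<le> (fs k (\<psi> y) - 2 * t)\<^sup>2 / (4 * t)" using t by simp
          also have "\<dots> = t + 1 / (4 * t) * (fs k (\<psi> y))\<^sup>2 - fs k (\<psi> y)"
            using t by (simp add: power2_eq_square field_simps)
          finally show ?thesis by simp
        qed
        then have "ennreal (fs k (\<psi> y)) \<le> ennreal (t + 1 / (4 * t) * (fs k (\<psi> y))\<^sup>2)" by (rule ennreal_leI)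
        also have "\<dots> = ennreal t + ennreal (1 / (4 * t)) * ennreal ((fs k (\<psi> y))\<^sup>2)" using t by (simp add: ennreal_mult[symmetric])
        finally show "ennreal (fs k (\<psi> y)) * indicator Z y \<le>
          ennreal t * indicator Z y + ennreal (1 / (4 * t)) * (ennreal ((fs k (\<psi> y))\<^sup>2) * indicator Z y)"
          by (simp add: indicator_def)
      qed
      also have "\<dots> = ennreal t * ennreal b + ennreal (1 / (4 * t)) * (\<integral>\<^sup>+y\<in>Z. ennreal ((fs k (\<psi> y))\<^sup>2) \<partial>lborel)"
        using sqm Zb(1) by (simp add: nn_integral_add nn_integral_cmult nn_integral_cmult_indicator eb)
      also have "\<dots> \<le> ennreal t * ennreal b + ennreal (1 / (4 * t)) * ennreal (e' / m)"
        using sq by (intro add_left_mono mult_left_mono) auto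
      also have "\<dots> = ennreal (t * b + 1 / (4 * t) * (e' / m))"
      proof -
        have "ennreal t * ennreal b = ennreal (t * b)" using t b0 by (simp add: ennreal_mult)
        moreover have "ennreal (1 / (4 * t)) * ennreal (e' / m) = ennreal (1 / (4 * t) * (e' / m))"
          using t e' m(1) by (intro ennreal_mult[symmetric]) auto
        moreover have "ennreal (t * b) + ennreal (1 / (4 * t) * (e' / m)) = ennreal (t * b + 1 / (4 * t) * (e' / m))"
          using t e' m(1) b0 by (intro ennreal_plus[symmetric]) auto
        ultimately show ?thesis by simp
      qed
      also have "\<dots> \<le> ennreal e"
      proof (rule ennreal_leI)
        have "1 / (4 * t) * (e' / m) = e / 2" using t m(1) by (simp add: e'_def)
        moreover have "t * b \<le> e / 2" using e b0 by (simp add: t_def field_simps)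
        ultimately show "t * b + 1 / (4 * t) * (e' / m) \<le> e" by linarith
      qed
      finally show ?case .
    qed
  qed
qed

text \<open>The union of all vanishing open sets is also closed: if a small ball around
  \<open>q\<close> meets it, \<open>vanish_step\<close> makes the ball of half the radius vanish,
  and that ball contains \<open>q\<close>. Connectedness does the rest.\<close>

lemma vanish_everywhere:
  assumes U0: "openin X U0" "vanishes U0" "U0 \<noteq> {}" and p: "p \<in> \<M>"
  obtains U where "openin X U" "p \<in> U" "vanishes U"
proof -
  let ?G = "\<Union>{U. openin X U \<and> vanishes U}"
  have o: "openin X ?G" by (rule openin_Union) auto
  have "closedin X ?G"
    unfolding closedin_def
  proof
    show "?G \<subseteq> \<M>" using openin_subset by blast
    show "openin X (\<M> - ?G)"
    proof (subst openin_subopen, rule ballI)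
      fix q assume q: "q \<in> \<M> - ?G"
      then have qX: "q \<in> \<M>" by simp
      obtain V \<psi> x s where c: "(V, \<psi>) \<in> A" "s > 0" "cball x s \<subseteq> V" "\<psi> x = q" using chart_ball[OF qX] .
      define r where "r = s / 2"
      have r: "0 < r" "cball x (2 * r) \<subseteq> V" using c(2,3) by (auto simp: r_def)
      have sub: "ball x r \<subseteq> V" "ball x (r / 2) \<subseteq> V" using r by (auto simp: subset_iff)
      have oB: "openin X (\<psi> ` ball x r)" "openin X (\<psi> ` ball x (r / 2))"
        using chart_image_open[OF c(1) open_ball] sub by auto
      have "\<psi> ` ball x r \<subseteq> \<M> - ?G"
      proof
        fix z assume z: "z \<in> \<psi> ` ball x r"
        have "z \<notin> ?G"
        proof
          assume "z \<in> ?G"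
          then obtain U where U: "openin X U" "vanishes U" "z \<in> U" by blast
          have "vanishes (\<psi> ` ball x (r / 2))"
            by (rule vanish_step[OF c(1) r U(1,2)]) (use z U(3) in auto)
          moreover have "q \<in> \<psi> ` ball x (r / 2)" using c(4) r(1) by auto
          ultimately show False using q oB(2) by blast
        qed
        then show "z \<in> \<M> - ?G" using z openin_subset[OF oB(1)] by blast
      qed
      moreover have "q \<in> \<psi> ` ball x r" using c(4) r(1) by auto
      ultimately show "\<exists>T. openin X T \<and> q \<in> T \<and> T \<subseteq> \<M> - ?G" using oB(1) by blast
    qed
  qed
  then have "?G = {} \<or> ?G = \<M>"
    using o connected unfolding connected_space_clopen_in by blast
  then have "p \<in> ?G" using U0 p by blast
  then show ?thesis using that by blast
qed

lemma vanishes_Un: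
  assumes "openin X U" "openin X V" "vanishes U" "vanishes V" shows "vanishes (U \<union> V)"
  unfolding vanishes_def
proof (intro allI impI)
  fix e :: real assume e: "0 < e"
  have "\<forall>\<^sub>F k in sequentially. (\<integral>\<^sup>+p\<in>U. ennreal ((fs k p)\<^sup>2) \<partial>vol) \<le> ennreal (e / 2)"
    "\<forall>\<^sub>F k in sequentially. (\<integral>\<^sup>+p\<in>V. ennreal ((fs k p)\<^sup>2) \<partial>vol) \<le> ennreal (e / 2)"
    using assms(3,4) e unfolding vanishes_def by (meson half_gt_zero)+
  then show "\<forall>\<^sub>F k in sequentially. (\<integral>\<^sup>+p\<in>U \<union> V. ennreal ((fs k p)\<^sup>2) \<partial>vol) \<le> ennreal e"
  proof eventually_elim
    case (elim k)
    have m: "(\<lambda>p. ennreal ((fs k p)\<^sup>2) * indicator W p) \<in> borel_measurable vol" if "openin X W" for W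
    proof -
      show ?thesis unfolding measurable_vol by (rule fs_sq_measurable[OF openin_sets[OF that]])
    qed
    have "(\<integral>\<^sup>+p\<in>U \<union> V. ennreal ((fs k p)\<^sup>2) \<partial>vol) \<le>
      (\<integral>\<^sup>+p. ennreal ((fs k p)\<^sup>2) * indicator U p + ennreal ((fs k p)\<^sup>2) * indicator V p \<partial>vol)"
      by (intro nn_integral_mono) (auto simp: indicator_def)
    also have "\<dots> = (\<integral>\<^sup>+p\<in>U. ennreal ((fs k p)\<^sup>2) \<partial>vol) + (\<integral>\<^sup>+p\<in>V. ennreal ((fs k p)\<^sup>2) \<partial>vol)"
      by (rule nn_integral_add[OF m[OF assms(1)] m[OF assms(2)]])
    also have "\<dots> \<le> ennreal (e / 2) + ennreal (e / 2)" using elim by (rule add_mono)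
    also have "\<dots> = ennreal e" using e by (simp add: ennreal_plus[symmetric] del: ennreal_plus)
    finally show ?case .
  qed
qed

lemma vanishes_mono: assumes "vanishes U" "S \<subseteq> U" shows "vanishes S"
  unfolding vanishes_def
proof (intro allI impI)
  fix e :: real assume "0 < e"
  then have "\<forall>\<^sub>F k in sequentially. (\<integral>\<^sup>+p\<in>U. ennreal ((fs k p)\<^sup>2) \<partial>vol) \<le> ennreal e"
    using assms(1) unfolding vanishes_def by blast
  then show "\<forall>\<^sub>F k in sequentially. (\<integral>\<^sup>+p\<in>S. ennreal ((fs k p)\<^sup>2) \<partial>vol) \<le> ennreal e"
  proof eventually_elim
    case (elim k)
    have "(\<integral>\<^sup>+p\<in>S. ennreal ((fs k p)\<^sup>2) \<partial>vol) \<le> (\<integral>\<^sup>+p\<in>U. ennreal ((fs k p)\<^sup>2) \<partial>vol)"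
      using assms(2) by (intro nn_integral_mono) (auto simp: indicator_def)
    then show ?case using elim by (rule order_trans)
  qed
qed

lemma vanish_compact:
  assumes U0: "openin X U0" "vanishes U0" "U0 \<noteq> {}" and C: "compactin X C"
  shows "vanishes C"
proof -
  let ?\<U> = "{U. openin X U \<and> vanishes U}"
  have "C \<subseteq> \<Union>?\<U>"
  proof
    fix p assume "p \<in> C"
    then have p: "p \<in> \<M>" using compactin_subset_topspace[OF C] by auto
    obtain U where "openin X U" "p \<in> U" "vanishes U" using vanish_everywhere[OF U0 p] .
    then show "p \<in> \<Union>?\<U>" by blast
  qed
  then have "\<exists>\<F>. finite \<F> \<and> \<F> \<subseteq> ?\<U> \<and> C \<subseteq> \<Union>\<F>"
    by (rule compactin_cover[OF C, rotated]) simp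
  then obtain \<F> where F: "finite \<F> \<and> \<F> \<subseteq> ?\<U> \<and> C \<subseteq> \<Union>\<F>" ..
  have "openin X (\<Union>\<F>) \<and> vanishes (\<Union>\<F>)"
    using F[THEN conjunct1] F[THEN conjunct2, THEN conjunct1]
  proof (induction \<F> rule: finite_induct)
    case empty
    show ?case by (simp add: vanishes_def)
  next
    case (insert U \<F>)
    then show ?case using vanishes_Un[of U "\<Union>\<F>"] by (auto intro: openin_Un)
  qed
  then show ?thesis using vanishes_mono F by blast
qed

end

section \<open>The bottoms of the spectra\<close>

context immersed
begin

lemma ccs_bounded: assumes "ccs f" obtains B where "0 \<le> B" "\<And>p. p \<in> \<M> \<Longrightarrow> \<bar>f p\<bar> \<le> B"
proof -
  obtain C where C: "compactin X C" "\<And>p. p \<in> \<M> - C \<Longrightarrow> f p = 0" using assms unfolding ccs_def by blast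
  have "compact (f ` C)" using image_compactin[OF C(1) ccs_continuous[OF assms]] by simp
  then obtain B where B: "\<And>p. p \<in> C \<Longrightarrow> norm (f p) \<le> B"
    using compact_imp_bounded bounded_iff by (metis image_eqI)
  show ?thesis
  proof (rule that[of "max B 0"])
    fix p assume p: "p \<in> \<M>"
    show "\<bar>f p\<bar> \<le> max B 0" using B[of p] C(2)[of p] p by (cases "p \<in> C") auto
  qed simp
qed

lemma ccs_abs: assumes "ccs f" shows "ccs (\<lambda>p. \<bar>f p\<bar>)"
proof -
  obtain C where C: "compactin X C" "\<And>p. p \<in> \<M> - C \<Longrightarrow> f p = 0" using assms unfolding ccs_def by blast
  show ?thesis by (rule ccsI[OF continuous_map_real_abs[OF ccs_continuous[OF assms]] C(1)]) (use C(2) in auto)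
qed

lemma grad_add: "sm U \<phi> \<Longrightarrow> sm U \<xi> \<Longrightarrow> p \<in> U \<Longrightarrow> grad (\<lambda>q. \<phi> q + \<xi> q) p = grad \<phi> p + grad \<xi> p"
  by (rule vector_eq_rdot[THEN iffD1]) (simp add: grad_inner[OF sm_add, of U \<phi> \<xi>] grad_inner[of U] mD_add[of U] inner_add_left)

lemma grad_cmult: assumes "sm U \<phi>" "p \<in> U" shows "grad (\<lambda>q. c * \<phi> q) p = c *\<^sub>R grad \<phi> p"
  by (rule grad_chain[where h="\<lambda>t. c * t", OF assms(1) sm_mult[OF sm_const[OF sm_open[OF assms(1)]] assms(1)] assms(2)])
    (auto intro!: derivative_eq_intros)

lemma tf_cmult: "tf \<phi> \<Longrightarrow> tf (\<lambda>p. c * \<phi> p)"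
  using tf_mult[OF _ sm_const[OF openin_topspace], of \<phi> c] by (simp add: mult.commute)

lemma tf_add: assumes "tf \<phi>" "tf \<xi>" shows "tf (\<lambda>p. \<phi> p + \<xi> p)"
proof -
  obtain C where C: "compactin X C" "\<And>p. p \<in> \<M> - C \<Longrightarrow> \<phi> p = 0" using assms(1) unfolding tf_def by blast
  obtain D where D: "compactin X D" "\<And>p. p \<in> \<M> - D \<Longrightarrow> \<xi> p = 0" using assms(2) unfolding tf_def by blast
  have "compactin X (C \<union> D) \<and> (\<forall>p\<in>\<M> - (C \<union> D). \<phi> p + \<xi> p = 0)"
    using compactin_Un[OF C(1) D(1)] C(2) D(2) by auto
  then show ?thesis unfolding tf_def using sm_add[OF tf_sm[OF assms(1)] tf_sm[OF assms(2)]] by blast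
qed

lemma vol_open_pos: assumes U: "openin X U" "U \<noteq> {}" shows "0 < emeasure vol U"
proof -
  obtain p where p: "p \<in> U" using U(2) by blast
  then have pX: "p \<in> \<M>" using openin_subset[OF U(1)] by auto
  obtain V \<psi> x where c: "(V, \<psi>) \<in> A" "x \<in> V" "\<psi> x = p" using chart_cover[OF pX] .
  have "open {y \<in> V. \<psi> y \<in> U}" "x \<in> {y \<in> V. \<psi> y \<in> U}" using chart_preimage_open[OF c(1) U(1)] c p by auto
  then obtain r where r: "0 < r" "cball x r \<subseteq> {y \<in> V. \<psi> y \<in> U}" using open_contains_cball by meson
  have rV: "cball x r \<subseteq> V" "\<psi> ` ball x r \<subseteq> U" "ball x r \<subseteq> V" using r(2) ball_subset_cball by blast+
  obtain m where m: "0 < m" "\<And>y. y \<in> cball x r \<Longrightarrow> m \<le> dens \<psi> y * 1"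
    by (rule chart_density_bounds[where g="\<lambda>p. 1", OF c(1) less_imp_le[OF r(1)] rV(1) continuous_pos_one]) (rule that; blast)
  have E: "\<psi> ` ball x r \<in> sets bX" by (rule openin_sets[OF chart_image_open[OF c(1) open_ball rV(3)]])
  have eb: "0 < emeasure lborel (ball x r)"
    using content_ball_pos[OF r(1), of x] by (simp add: measure_def enn2real_positive_iff)
  have "0 < ennreal m * emeasure lborel (ball x r)"
    using eb m(1) by (simp add: ennreal_zero_less_mult_iff)
  also have "\<dots> = (\<integral>\<^sup>+y. ennreal m * indicator (ball x r) y \<partial>lborel)" by (simp add: nn_integral_cmult_indicator)
  also have "\<dots> \<le> \<nu> V \<psi> (\<psi> ` ball x r)"
    unfolding \<nu>_def
  proof (rule nn_integral_mono)
    fix y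
    show "ennreal m * indicator (ball x r) y \<le> ennreal (dens \<psi> y) * indicator {y \<in> V. \<psi> y \<in> \<psi> ` ball x r} y"
    proof (cases "y \<in> ball x r")
      case True
      then have "y \<in> {y \<in> V. \<psi> y \<in> \<psi> ` ball x r}" "y \<in> cball x r" using rV(3) by auto
      then show ?thesis using True m(2)[of y] by (simp add: ennreal_leI)
    qed simp
  qed
  also have "\<dots> = emeasure vol (\<psi> ` ball x r)"
    by (rule emeasure_vol[OF c(1) E, symmetric]) (use rV in auto)
  also have "\<dots> \<le> emeasure vol U"
    using rV(2) openin_sets[OF U(1)] by (intro emeasure_mono) (auto simp: sets_vol)
  finally show ?thesis .
qed

end

section \<open>Rayleigh quotients\<close>

context expander
begin

abbreviation "asq \<equiv> second_ff_sq X A F"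

definition Asq :: "('a \<Rightarrow> real) \<Rightarrow> real" where "Asq \<phi> = wint (\<lambda>p. asq p * (\<phi> p)\<^sup>2)"

lemma asq_nonneg: "0 \<le> asq p" unfolding second_ff_sq_def by (intro sum_nonneg) simp

lemma Asq_ccs: "tf \<phi> \<Longrightarrow> ccs (\<lambda>p. asq p * (\<phi> p)\<^sup>2)"
  using ccs_mult[OF tf_sq_ccs sm_continuous[OF sm_second_ff_sq], of \<phi>] by (simp add: mult.commute)

lemma En_nonneg: "0 \<le> En \<phi>" and L2_nonneg: "0 \<le> L2 \<phi>" and Asq_nonneg: "0 \<le> Asq \<phi>"
  unfolding En_def L2_def Asq_def by (rule wint_nonneg; simp add: asq_nonneg)+

definition adm :: "('a \<Rightarrow> real) set" where "adm = {\<phi>. tf \<phi> \<and> L2 \<phi> \<noteq> 0}"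

lemma adm_pos: "\<phi> \<in> adm \<Longrightarrow> 0 < L2 \<phi>" using L2_nonneg[of \<phi>] by (simp add: adm_def)

lemma adm_tf: "\<phi> \<in> adm \<Longrightarrow> tf \<phi>" by (simp add: adm_def)

lemma adm_eq: "{\<phi> \<in> test_functions X A. wint (\<lambda>p. (\<phi> p)\<^sup>2) \<noteq> 0} = adm"
  by (auto simp: test_functions_eq adm_def L2_def)

lemma En_gradient: "tf \<phi> \<Longrightarrow> wint (\<lambda>p. (norm (gradient A F \<phi> p))\<^sup>2) = En \<phi>"
  unfolding En_def by (rule wint_cong) (simp add: gradient_eq[OF tf_sm])

lemma lambda1_eq: "lambda1 X A F = (INF \<phi>\<in>adm. ereal (En \<phi> / L2 \<phi>))"
  unfolding lambda1_def adm_eq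
  by (rule INF_cong[OF refl]) (simp add: adm_tf En_gradient L2_def)

lemma mu1_eq: "mu1 X A F = (INF \<phi>\<in>adm. ereal ((En \<phi> - Asq \<phi>) / L2 \<phi> + 1/2))"
  unfolding mu1_def adm_eq
proof (rule INF_cong[OF refl])
  fix \<phi> assume a: "\<phi> \<in> adm"
  then have t: "tf \<phi>" and l: "L2 \<phi> \<noteq> 0" by (auto simp: adm_def)
  have "wint (\<lambda>p. (norm (gradient A F \<phi> p))\<^sup>2 - (asq p - 1/2) * (\<phi> p)\<^sup>2) =
      wint (\<lambda>p. ((norm (grad \<phi> p))\<^sup>2 - asq p * (\<phi> p)\<^sup>2) + (1/2) * (\<phi> p)\<^sup>2)"
    by (rule wint_cong) (simp add: gradient_eq[OF tf_sm[OF t]] left_diff_distrib)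
  also have "\<dots> = En \<phi> - Asq \<phi> + 1/2 * L2 \<phi>"
    unfolding En_def Asq_def L2_def
    by (simp only: wint_add[OF ccs_diff[OF tf_grad_sq_ccs[OF t] Asq_ccs[OF t]] ccs_cmult[OF tf_sq_ccs[OF t]]]
        wint_diff[OF tf_grad_sq_ccs[OF t] Asq_ccs[OF t]] wint_cmult)
  finally show "ereal (wint (\<lambda>p. (norm (gradient A F \<phi> p))\<^sup>2 - (asq p - 1/2) * (\<phi> p)\<^sup>2) / wint (\<lambda>p. (\<phi> p)\<^sup>2)) =
      ereal ((En \<phi> - Asq \<phi>) / L2 \<phi> + 1/2)"
    using l unfolding L2_def[symmetric] by (simp add: add_divide_distrib)
qed

text \<open>Ensures that the infima are not taken over the empty set; a bump function has positive
  weighted norm.\<close>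

lemma adm_nonempty: "adm \<noteq> {}"
proof -
  obtain p where p: "p \<in> \<M>" using nonempty by blast
  obtain V \<psi> x r where c: "(V, \<psi>) \<in> A" "0 < r" "cball x r \<subseteq> V" "\<psi> x = p" using chart_ball[OF p] .
  have rr: "0 < r / 2" "r / 2 < r" using c(2) by auto
  obtain \<eta> :: "'a \<Rightarrow> real" where \<eta>: "sm \<M> \<eta>" "\<And>p. 0 \<le> \<eta> p" "\<And>p. \<eta> p \<le> 1"
    "\<And>y. y \<in> cball x (r / 2) \<Longrightarrow> \<eta> (\<psi> y) = 1" "\<And>p. p \<notin> \<psi> ` cball x r \<Longrightarrow> \<eta> p = 0" and t: "tf \<eta>"
    using bump[OF c(1) rr c(3)] by blast
  have o: "openin X (\<psi> ` ball x (r / 2))" by (rule chart_image_open[OF c(1) open_ball]) (use c in auto)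
  have "0 < emeasure vol (\<psi> ` ball x (r / 2))" by (rule vol_open_pos[OF o]) (use rr in auto)
  also have "\<dots> = (\<integral>\<^sup>+q. indicator (\<psi> ` ball x (r / 2)) q \<partial>vol)"
    using openin_sets[OF o] by (simp add: sets_vol)
  also have "\<dots> \<le> (\<integral>\<^sup>+q. ennreal ((\<eta> q)\<^sup>2 * wgt q) \<partial>vol)"
  proof (rule nn_integral_mono)
    fix q
    have "1 \<le> wgt q" by (simp add: wgt_def)
    then show "indicator (\<psi> ` ball x (r / 2)) q \<le> ennreal ((\<eta> q)\<^sup>2 * wgt q)"
      using \<eta>(4) by (auto simp: indicator_def)
  qed
  also have "\<dots> = ennreal (L2 \<eta>)" unfolding L2_def by (rule ennreal_wint[OF tf_sq_ccs[OF t]]) simp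
  finally have "0 < L2 \<eta>" by simp
  then show ?thesis using t by (force simp: adm_def)
qed

text \<open>The bottom of the drifted spectrum is finite and nonnegative, so it is handled as a real
  number. The other one may be -\<infinity> and stays in \<open>ereal\<close>.\<close>

definition lam :: real where "lam = (INF \<phi>\<in>adm. En \<phi> / L2 \<phi>)"

lemma lam_bdd: "bdd_below ((\<lambda>\<phi>. En \<phi> / L2 \<phi>) ` adm)"
  by (rule bdd_belowI2[of _ 0]) (simp add: En_nonneg L2_nonneg)

lemma lam_nonneg: "0 \<le> lam"
  unfolding lam_def by (rule cINF_greatest[OF adm_nonempty]) (simp add: En_nonneg L2_nonneg)

lemma lam_le: assumes "tf \<phi>" shows "lam * L2 \<phi> \<le> En \<phi>"
proof (cases "L2 \<phi> = 0")
  case True then show ?thesis by (simp add: En_nonneg)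
next
  case False
  then have a: "\<phi> \<in> adm" using assms by (simp add: adm_def)
  have "lam \<le> En \<phi> / L2 \<phi>" unfolding lam_def by (rule cINF_lower[OF lam_bdd a])
  then show ?thesis using adm_pos[OF a] by (simp add: pos_le_divide_eq)
qed

lemma lam_approx: assumes "0 < e" obtains \<phi> where "\<phi> \<in> adm" "En \<phi> < (lam + e) * L2 \<phi>"
proof -
  have "\<exists>\<phi>\<in>adm. En \<phi> / L2 \<phi> < lam + e"
    using cINF_less_iff[OF adm_nonempty lam_bdd, of "lam + e"] assms unfolding lam_def[symmetric] by simp
  then obtain \<phi> where "\<phi> \<in> adm" "En \<phi> / L2 \<phi> < lam + e" by blast
  then show ?thesis using that adm_pos[of \<phi>] by (simp add: pos_divide_less_eq)
qed

lemma lambda1_lam: "lambda1 X A F = ereal lam"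
proof (rule antisym)
  show "lambda1 X A F \<le> ereal lam"
  proof (rule ereal_le_epsilon2)
    fix e :: real assume e: "0 < e"
    obtain \<phi> where a: "\<phi> \<in> adm" "En \<phi> < (lam + e) * L2 \<phi>" using lam_approx[OF e] .
    have "lambda1 X A F \<le> ereal (En \<phi> / L2 \<phi>)" unfolding lambda1_eq by (rule INF_lower[OF a(1)])
    also have "\<dots> \<le> ereal lam + ereal e" using a(2) adm_pos[OF a(1)] by (simp add: pos_divide_le_eq)
    finally show "lambda1 X A F \<le> ereal lam + ereal e" .
  qed
  show "ereal lam \<le> lambda1 X A F"
    unfolding lambda1_eq
    by (rule INF_greatest) (use lam_le adm_pos adm_tf in \<open>force simp: pos_le_divide_eq\<close>)
qed

lemma mu1_le: "mu1 X A F \<le> lambda1 X A F + ereal (1/2)"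
  unfolding lambda1_lam
proof (rule ereal_le_epsilon2)
  fix e :: real assume e: "0 < e"
  obtain \<phi> where a: "\<phi> \<in> adm" "En \<phi> < (lam + e) * L2 \<phi>" using lam_approx[OF e] .
  have "mu1 X A F \<le> ereal ((En \<phi> - Asq \<phi>) / L2 \<phi> + 1/2)" unfolding mu1_eq by (rule INF_lower[OF a(1)])
  also have "\<dots> \<le> ereal lam + ereal (1/2) + ereal e"
    using a(2) adm_pos[OF a(1)] Asq_nonneg[of \<phi>] by (simp add: pos_divide_le_eq)
  finally show "mu1 X A F \<le> ereal lam + ereal (1/2) + ereal e" .
qed

lemma mu1_ge: 
  assumes "\<And>\<phi>. tf \<phi> \<Longrightarrow> Asq \<phi> + (c - 1/2) * L2 \<phi> \<le> En \<phi>" shows "ereal c \<le> mu1 X A F"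
  unfolding mu1_eq
proof (rule INF_greatest)
  fix \<phi> assume a: "\<phi> \<in> adm"
  have "(c - 1/2) * L2 \<phi> \<le> En \<phi> - Asq \<phi>" using assms[OF adm_tf[OF a]] by simp
  then have "c - 1/2 \<le> (En \<phi> - Asq \<phi>) / L2 \<phi>" using adm_pos[OF a] by (simp add: pos_le_divide_eq)
  then show "ereal c \<le> ereal ((En \<phi> - Asq \<phi>) / L2 \<phi> + 1/2)" by simp
qed

lemma mu1_eq_flat: 
  assumes "\<And>p. p \<in> \<M> \<Longrightarrow> asq p = 0" shows "mu1 X A F = lambda1 X A F + ereal (1/2)"
proof (rule antisym[OF mu1_le])
  have "Asq \<phi> = 0" for \<phi> unfolding Asq_def using wint_cong[of "\<lambda>p. asq p * (\<phi> p)\<^sup>2" "\<lambda>p. 0 * 0"] assms wint_cmult[of 0 "\<lambda>p. 0"] by simp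
  then have "ereal (lam + 1/2) \<le> mu1 X A F" by (intro mu1_ge) (simp add: lam_le)
  then show "lambda1 X A F + ereal (1/2) \<le> mu1 X A F" by (simp add: lambda1_lam)
qed

text \<open>Insert \<open>\<phi>\<close> into the infimum for \<open>mu1\<close>, whose value is now
  \<open>lam + 1/2\<close>: the curvature term is bounded by how far \<open>\<phi>\<close> is from
  minimizing the energy.\<close>

lemma mu1_eq_bound: 
  assumes "mu1 X A F = lambda1 X A F + ereal (1/2)" and t: "tf \<phi>" "L2 \<phi> = 1"
  shows "Asq \<phi> \<le> En \<phi> - lam"
proof -
  have a: "\<phi> \<in> adm" using t by (simp add: adm_def)
  have "ereal lam + ereal (1/2) \<le> ereal ((En \<phi> - Asq \<phi>) / L2 \<phi> + 1/2)"
    using INF_lower[OF a, of "\<lambda>\<phi>. ereal ((En \<phi> - Asq \<phi>) / L2 \<phi> + 1/2)"] assms(1)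
    unfolding mu1_eq lambda1_lam by simp
  then show ?thesis using t(2) by simp
qed

end

text \<open>The discriminant of a nonnegative quadratic polynomial. In the degenerate case
  \<open>a = 0\<close> a nonzero \<open>b\<close> would produce the value -1.\<close>

lemma discriminant_le:
  fixes a b c :: real
  assumes a: "0 \<le> a" and nonneg: "\<And>t. 0 \<le> c + 2 * t * b + t\<^sup>2 * a" shows "b\<^sup>2 \<le> a * c"
proof (cases "a = 0")
  case True
  have "b = 0"
  proof (rule ccontr)
    assume "b \<noteq> 0"
    then show False using nonneg[of "- (c + 1) / (2 * b)"] True
      by (simp add: field_simps)
  qed
  then show ?thesis using True by simp
next
  case False
  then have a: "0 < a" using assms(1) by simp
  have "0 \<le> a * (c + 2 * (- b / a) * b + (- b / a)\<^sup>2 * a)" using nonneg[of "- b / a"] a by simp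
  also have "\<dots> = a * c - b\<^sup>2" using a by (simp add: power2_eq_square field_simps)
  finally show ?thesis by simp
qed

section \<open>Almost minimizers and the equality case\<close>

context expander
begin

lemma En_combination:
  assumes t: "tf \<phi>" "tf \<xi>"
  shows "En (\<lambda>p. \<xi> p + s * \<phi> p) = En \<xi> + 2 * s * wint (\<lambda>p. grad \<phi> p \<bullet> grad \<xi> p) + s\<^sup>2 * En \<phi>"
proof -
  note sp = tf_sm[OF t(1)] and sx = tf_sm[OF t(2)]
  have c1: "ccs (\<lambda>p. (norm (grad \<xi> p))\<^sup>2)" and c3: "ccs (\<lambda>p. (norm (grad \<phi> p))\<^sup>2)" by (intro tf_grad_sq_ccs t)+
  have c2: "ccs (\<lambda>p. grad \<phi> p \<bullet> grad \<xi> p)" by (rule tf_grad_ccs[OF t(1) sm_grad[OF sx]])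
  have "En (\<lambda>p. \<xi> p + s * \<phi> p) =
      wint (\<lambda>p. ((norm (grad \<xi> p))\<^sup>2 + (2 * s) * (grad \<phi> p \<bullet> grad \<xi> p)) + s\<^sup>2 * (norm (grad \<phi> p))\<^sup>2)"
    unfolding En_def
  proof (rule wint_cong)
    fix p assume p: "p \<in> \<M>"
    have g: "grad (\<lambda>p. \<xi> p + s * \<phi> p) p = grad \<xi> p + s *\<^sub>R grad \<phi> p"
      using grad_add[OF sx tf_sm[OF tf_cmult[OF t(1)]] p] grad_cmult[OF sp p] by simp
    show "(norm (grad (\<lambda>p. \<xi> p + s * \<phi> p) p))\<^sup>2 =
      ((norm (grad \<xi> p))\<^sup>2 + (2 * s) * (grad \<phi> p \<bullet> grad \<xi> p)) + s\<^sup>2 * (norm (grad \<phi> p))\<^sup>2"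
      unfolding g power2_norm_eq_inner
      by (simp only: inner_add_left inner_add_right inner_scaleR_left inner_scaleR_right inner_commute[of "grad \<xi> p" "grad \<phi> p"])
        (simp add: power2_eq_square distrib_left)
  qed
  also have "\<dots> = En \<xi> + 2 * s * wint (\<lambda>p. grad \<phi> p \<bullet> grad \<xi> p) + s\<^sup>2 * En \<phi>"
    unfolding En_def
    by (simp only: wint_add[OF ccs_add[OF c1 ccs_cmult[OF c2]] ccs_cmult[OF c3]] wint_add[OF c1 ccs_cmult[OF c2]] wint_cmult)
  finally show ?thesis .
qed

lemma L2_combination:
  assumes t: "tf \<phi>" "tf \<xi>"
  shows "L2 (\<lambda>p. \<xi> p + s * \<phi> p) = L2 \<xi> + 2 * s * wint (\<lambda>p. \<phi> p * \<xi> p) + s\<^sup>2 * L2 \<phi>"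
proof -
  have c1: "ccs (\<lambda>p. (\<xi> p)\<^sup>2)" and c3: "ccs (\<lambda>p. (\<phi> p)\<^sup>2)" by (intro tf_sq_ccs t)+
  have c2: "ccs (\<lambda>p. \<phi> p * \<xi> p)" by (rule tf_ccs[OF tf_mult[OF t(1) tf_sm[OF t(2)]]])
  have "L2 (\<lambda>p. \<xi> p + s * \<phi> p) = wint (\<lambda>p. ((\<xi> p)\<^sup>2 + (2 * s) * (\<phi> p * \<xi> p)) + s\<^sup>2 * (\<phi> p)\<^sup>2)"
    unfolding L2_def by (rule wint_cong) (simp add: power2_eq_square algebra_simps)
  also have "\<dots> = L2 \<xi> + 2 * s * wint (\<lambda>p. \<phi> p * \<xi> p) + s\<^sup>2 * L2 \<phi>"
    unfolding L2_def
    by (simp only: wint_add[OF ccs_add[OF c1 ccs_cmult[OF c2]] ccs_cmult[OF c3]] wint_add[OF c1 ccs_cmult[OF c2]] wint_cmult)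
  finally show ?thesis .
qed

text \<open>An almost minimizer of the Rayleigh quotient is almost superharmonic, by the Cauchy--Schwarz
  inequality for the nonnegative quadratic form \<open>En - lam * L2\<close>.\<close>

lemma super_minimizer:
  assumes t: "tf \<phi>" and nn: "\<And>p. p \<in> \<M> \<Longrightarrow> 0 \<le> \<phi> p" and \<delta>: "En \<phi> - lam * L2 \<phi> \<le> \<delta>"
  shows "super \<phi> (sqrt \<delta>)"
  unfolding super_def
proof (intro conjI allI impI ballI tf_sm[OF t] nn)
  fix \<xi> assume x: "tf \<xi>" and x0: "\<forall>p\<in>\<M>. 0 \<le> \<xi> p"
  let ?I = "wint (\<lambda>p. grad \<phi> p \<bullet> grad \<xi> p)" and ?J = "wint (\<lambda>p. \<phi> p * \<xi> p)"
  let ?b = "?I - lam * ?J" and ?a = "En \<phi> - lam * L2 \<phi>" and ?c = "En \<xi> - lam * L2 \<xi>"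
  have a0: "0 \<le> ?a" and c0: "0 \<le> ?c" using lam_le[OF t] lam_le[OF x] by simp_all
  have "?b\<^sup>2 \<le> ?a * ?c"
  proof (rule discriminant_le[OF a0])
    fix s
    have "lam * L2 (\<lambda>p. \<xi> p + s * \<phi> p) \<le> En (\<lambda>p. \<xi> p + s * \<phi> p)"
      by (rule lam_le[OF tf_add[OF x tf_cmult[OF t]]])
    then show "0 \<le> ?c + 2 * s * ?b + s\<^sup>2 * ?a"
      unfolding En_combination[OF t x] L2_combination[OF t x] by (simp add: algebra_simps)
  qed
  also have "\<dots> \<le> \<delta> * En \<xi>"
    using a0 c0 \<delta> lam_nonneg L2_nonneg[of \<xi>] by (intro mult_mono) auto
  finally have "\<bar>?b\<bar> \<le> sqrt \<delta> * sqrt (En \<xi>)"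
    by (metis real_sqrt_abs real_sqrt_le_mono real_sqrt_mult)
  \<comment> \<open>The zeroth-order part of \<open>?b\<close> has a sign because both functions are
    nonnegative. Dropping it leaves superharmonicity in place of the eigenvalue equation.\<close>
  moreover have "0 \<le> lam * ?J"
    by (intro mult_nonneg_nonneg lam_nonneg wint_nonneg nn) (use x0 in auto)
  ultimately show "- sqrt \<delta> * sqrt (En \<xi>) \<le> ?I" by linarith
qed

text \<open>The natural nonnegative competitor |\<phi>| is not smooth. The function sqrt (\<phi>^2 +
  \<epsilon>^2) - \<epsilon> is smooth and nonnegative, vanishes where \<phi> does and has no larger
  energy; its loss of L^2 norm is at most linear in \<epsilon> and fits into the slack of a strict
  inequality.\<close>

lemma minimizing:
  assumes e: "0 < e"
  shows "\<exists>\<phi>. tf \<phi> \<and> (\<forall>p\<in>\<M>. 0 \<le> \<phi> p) \<and> L2 \<phi> = 1 \<and> En \<phi> < lam + e"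
proof -
  obtain \<phi> where a: "\<phi> \<in> adm" "En \<phi> < (lam + e) * L2 \<phi>" using lam_approx[OF e] .
  note t = adm_tf[OF a(1)]
  obtain C where C: "compactin X C" "\<And>p. p \<in> \<M> - C \<Longrightarrow> \<phi> p = 0" using t unfolding tf_def by blast
  define D where "D = (lam + e) * L2 \<phi> - En \<phi>"
  define K where "K = wint (\<lambda>p. \<bar>\<phi> p\<bar>)"
  define l where "l = lam + e"
  have D: "0 < D" using a(2) by (simp add: D_def)
  have K: "0 \<le> K" unfolding K_def by (rule wint_nonneg) simp
  have l: "0 < l" using e lam_nonneg by (simp add: l_def)
  \<comment> \<open>\<open>l\<close> times the loss \<open>2 * \<epsilon> * K\<close> has to stay
    below the slack \<open>D\<close>; using \<open>K + 1\<close> makes this strict and covers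
    \<open>K = 0\<close>.\<close>
  define \<epsilon> where "\<epsilon> = D / (2 * l * (K + 1))"
  have \<epsilon>: "0 < \<epsilon>" using D K l by (simp add: \<epsilon>_def)
  have \<epsilon>K: "l * (2 * \<epsilon> * K) < D"
  proof -
    have "l * (2 * \<epsilon> * K) = D * (K / (K + 1))" using l by (simp add: \<epsilon>_def)
    also have "\<dots> < D * 1" using D K by (intro mult_strict_left_mono) auto
    finally show ?thesis by simp
  qed
  define u where "u = (\<lambda>p. sqrt ((\<phi> p)\<^sup>2 + \<epsilon>\<^sup>2))"
  define \<psi> where "\<psi> = (\<lambda>p. u p - \<epsilon>)"
  have pos: "0 < (\<phi> p)\<^sup>2 + \<epsilon>\<^sup>2" for p using \<epsilon> by (simp add: add_nonneg_pos)
  have u: "\<bar>\<phi> p\<bar> \<le> u p" "\<epsilon> \<le> u p" "u p \<le> \<bar>\<phi> p\<bar> + \<epsilon>" "(u p)\<^sup>2 = (\<phi> p)\<^sup>2 + \<epsilon>\<^sup>2" for p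
  proof -
    show "\<bar>\<phi> p\<bar> \<le> u p" unfolding u_def by simp
    show "\<epsilon> \<le> u p" unfolding u_def using \<epsilon> by (intro real_le_rsqrt) simp
    show "u p \<le> \<bar>\<phi> p\<bar> + \<epsilon>" unfolding u_def using sqrt_sum_squares_le_sum_abs[of "\<phi> p" \<epsilon>] \<epsilon> by simp
    show "(u p)\<^sup>2 = (\<phi> p)\<^sup>2 + \<epsilon>\<^sup>2" unfolding u_def using pos[of p] by simp
  qed
  have sc: "sm \<M> (\<lambda>p. c)" for c :: real by (rule sm_const) simp
  have "sm \<M> (\<lambda>p. sqrt (\<phi> p * \<phi> p + \<epsilon>\<^sup>2))"
    by (rule sm_sqrt[OF sm_add[OF sm_mult[OF tf_sm[OF t] tf_sm[OF t]] sc]]) (use pos in \<open>simp add: power2_eq_square\<close>)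
  then have su: "sm \<M> u" by (simp add: u_def power2_eq_square)
  have s\<psi>: "sm \<M> \<psi>" unfolding \<psi>_def by (rule sm_diff[OF su sc])
  have t\<psi>: "tf \<psi>"
  proof -
    have "\<psi> p = 0" if "p \<in> \<M> - C" for p using C(2)[OF that] \<epsilon> by (simp add: \<psi>_def u_def)
    then show ?thesis unfolding tf_def using s\<psi> C(1) by blast
  qed
  have E: "En \<psi> \<le> En \<phi>"
    unfolding En_def
  proof (rule wint_mono[OF tf_grad_sq_ccs[OF t\<psi>] tf_grad_sq_ccs[OF t]])
    fix p assume p: "p \<in> \<M>"
    have up: "0 < u p" using u(2)[of p] \<epsilon> by linarith
    have "((\<lambda>x. sqrt (x\<^sup>2 + \<epsilon>\<^sup>2) - \<epsilon>) has_real_derivative \<phi> p / u p) (at (\<phi> p))"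
      using pos[of p] up unfolding u_def by (auto intro!: derivative_eq_intros simp: field_simps)
    then have g: "grad \<psi> p = (\<phi> p / u p) *\<^sub>R grad \<phi> p"
      unfolding \<psi>_def u_def
      by (rule grad_chain[where h="\<lambda>x. sqrt (x\<^sup>2 + \<epsilon>\<^sup>2) - \<epsilon>", OF tf_sm[OF t] s\<psi>[unfolded \<psi>_def u_def] p])
    have "\<bar>\<phi> p / u p\<bar> \<le> 1" using u(1)[of p] up by simp
    then have "norm (grad \<psi> p) \<le> 1 * norm (grad \<phi> p)" unfolding g norm_scaleR by (rule mult_right_mono) simp
    then show "(norm (grad \<psi> p))\<^sup>2 \<le> (norm (grad \<phi> p))\<^sup>2" by (intro power_mono) auto
  qed
  have ca: "ccs (\<lambda>p. \<bar>\<phi> p\<bar>)" by (rule ccs_abs[OF tf_ccs[OF t]])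
  have L: "L2 \<phi> - 2 * \<epsilon> * K \<le> L2 \<psi>"
  proof -
    have "L2 \<phi> - 2 * \<epsilon> * K = wint (\<lambda>p. (\<phi> p)\<^sup>2 - (2 * \<epsilon>) * \<bar>\<phi> p\<bar>)"
      unfolding L2_def K_def by (simp only: wint_diff[OF tf_sq_ccs[OF t] ccs_cmult[OF ca]] wint_cmult)
    also have "\<dots> \<le> L2 \<psi>"
      unfolding L2_def
    proof (rule wint_mono[OF ccs_diff[OF tf_sq_ccs[OF t] ccs_cmult[OF ca]] tf_sq_ccs[OF t\<psi>]])
      fix p
      have "(\<psi> p)\<^sup>2 = (u p)\<^sup>2 + \<epsilon>\<^sup>2 - 2 * \<epsilon> * u p"
        unfolding \<psi>_def power2_diff by simp
      moreover have "2 * \<epsilon> * u p \<le> 2 * \<epsilon> * (\<bar>\<phi> p\<bar> + \<epsilon>)" using u(3)[of p] \<epsilon> by (intro mult_left_mono) auto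
      ultimately show "(\<phi> p)\<^sup>2 - (2 * \<epsilon>) * \<bar>\<phi> p\<bar> \<le> (\<psi> p)\<^sup>2"
        unfolding u(4) by (simp add: distrib_left power2_eq_square)
    qed
    finally show ?thesis .
  qed
  have "En \<psi> \<le> l * L2 \<phi> - D" using E unfolding D_def l_def by simp
  also have "\<dots> < l * L2 \<phi> - l * (2 * \<epsilon> * K)" using \<epsilon>K by simp
  also have "\<dots> = l * (L2 \<phi> - 2 * \<epsilon> * K)" by (simp only: right_diff_distrib)
  also have "\<dots> \<le> l * L2 \<psi>" using L l by (intro mult_left_mono) auto
  finally have main: "En \<psi> < l * L2 \<psi>" .
  then have "0 < l * L2 \<psi>" using En_nonneg[of \<psi>] by linarith
  then have L0: "0 < L2 \<psi>" using l by (simp add: zero_less_mult_iff)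
  define c where "c = 1 / sqrt (L2 \<psi>)"
  have c: "0 \<le> c" "c\<^sup>2 = 1 / L2 \<psi>" using L0 by (auto simp: c_def power_divide)
  let ?\<phi> = "\<lambda>p. c * \<psi> p"
  have "L2 ?\<phi> = c\<^sup>2 * L2 \<psi>" unfolding L2_def wint_cmult[symmetric] by (simp only: power_mult_distrib)
  then have "L2 ?\<phi> = 1" using c(2) L0 by simp
  moreover have "En ?\<phi> = c\<^sup>2 * En \<psi>"
    unfolding En_def wint_cmult[symmetric]
    by (rule wint_cong) (simp add: grad_cmult[OF s\<psi>] power_mult_distrib)
  then have "En ?\<phi> < lam + e"
    using main L0 unfolding c(2) l_def[symmetric] by (simp add: pos_divide_less_eq)
  moreover have "\<forall>p\<in>\<M>. 0 \<le> ?\<phi> p" using u(2) c(1) by (auto simp: \<psi>_def)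
  ultimately show ?thesis using tf_cmult[OF t\<psi>] by blast
qed

text \<open>Supplies the local energy bound demanded by \<open>super_seq\<close>, from bounds on the
  energy and the norm of the uncut functions.\<close>

lemma En_mult_bound:
  assumes \<eta>: "tf \<eta>"
  obtains B where "0 \<le> B" "\<And>\<phi>. tf \<phi> \<Longrightarrow> En (\<lambda>p. \<eta> p * \<phi> p) \<le> B * En \<phi> + B * L2 \<phi>"
proof -
  obtain B1 where B1: "0 \<le> B1" "\<And>p. p \<in> \<M> \<Longrightarrow> \<bar>(\<eta> p)\<^sup>2\<bar> \<le> B1" using ccs_bounded[OF tf_sq_ccs[OF \<eta>]] by blast
  obtain B2 where B2: "0 \<le> B2" "\<And>p. p \<in> \<M> \<Longrightarrow> \<bar>(norm (grad \<eta> p))\<^sup>2\<bar> \<le> B2"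
    using ccs_bounded[OF tf_grad_sq_ccs[OF \<eta>]] by blast
  define B where "B = 2 * B1 + 2 * B2"
  have B: "2 * B1 \<le> B" "2 * B2 \<le> B" "0 \<le> B" using B1 B2 by (auto simp: B_def)
  show ?thesis
  proof (rule that[OF B(3)])
    fix \<phi> assume t: "tf \<phi>"
    let ?g = "\<lambda>p. (norm (grad \<phi> p))\<^sup>2" and ?s = "\<lambda>p. (\<phi> p)\<^sup>2"
    have cg: "ccs ?g" and cs: "ccs ?s" by (rule tf_grad_sq_ccs[OF t], rule tf_sq_ccs[OF t])
    have tm: "tf (\<lambda>p. \<eta> p * \<phi> p)" by (rule tf_mult[OF \<eta> tf_sm[OF t]])
    have "En (\<lambda>p. \<eta> p * \<phi> p) \<le> wint (\<lambda>p. B * ?g p + B * ?s p)"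
      unfolding En_def
    proof (rule wint_mono[OF tf_grad_sq_ccs[OF tm] ccs_add[OF ccs_cmult[OF cg] ccs_cmult[OF cs]]])
      fix p assume p: "p \<in> \<M>"
      have "(norm (grad (\<lambda>p. \<eta> p * \<phi> p) p))\<^sup>2 \<le> 2 * (norm (\<eta> p *\<^sub>R grad \<phi> p))\<^sup>2 + 2 * (norm (\<phi> p *\<^sub>R grad \<eta> p))\<^sup>2"
        unfolding grad_mult[OF tf_sm[OF \<eta>] tf_sm[OF t] p] by (rule norm_add_sq_le)
      also have "\<dots> = 2 * (\<eta> p)\<^sup>2 * ?g p + 2 * (norm (grad \<eta> p))\<^sup>2 * ?s p" by (simp add: power_mult_distrib)
      also have "\<dots> \<le> B * ?g p + B * ?s p"
      proof (intro add_mono mult_right_mono)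
        show "2 * (\<eta> p)\<^sup>2 \<le> B" using B1(2)[OF p] B(1) by simp
        show "2 * (norm (grad \<eta> p))\<^sup>2 \<le> B" using B2(2)[OF p] B(2) by simp
      qed simp_all
      finally show "(norm (grad (\<lambda>p. \<eta> p * \<phi> p) p))\<^sup>2 \<le> B * ?g p + B * ?s p" .
    qed
    also have "\<dots> = B * En \<phi> + B * L2 \<phi>"
      unfolding En_def L2_def by (simp only: wint_add[OF ccs_cmult[OF cg] ccs_cmult[OF cs]] wint_cmult)
    finally show "En (\<lambda>p. \<eta> p * \<phi> p) \<le> B * En \<phi> + B * L2 \<phi>" .
  qed
qed

text \<open>Properness enters here both when the escape of mass to infinity is excluded and when
  |A|^2 is maximized on a cone.\<close>

lemma norm_sublevel_compact:
  assumes "properly_immersed X F" shows "compactin X {p \<in> \<M>. norm (F p) \<le> R}"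
proof -
  have "compactin X {p \<in> \<M>. F p \<in> cball 0 R}"
    using assms compact_cball unfolding properly_immersed_def by blast
  then show ?thesis by simp
qed

theorem equality_imp_flat:
  assumes proper: "properly_immersed X F" and eq: "mu1 X A F = lambda1 X A F + ereal (1/2)"
    and p: "p \<in> \<M>"
  shows "asq p = 0"
proof (rule ccontr)
  assume "asq p \<noteq> 0"
  then have ap: "0 < asq p" using asq_nonneg[of p] by linarith
  define e :: "nat \<Rightarrow> real" where "e = (\<lambda>k. 1 / (real k + 1))"
  have e: "0 < e k" "e k \<le> 1" for k by (auto simp: e_def)
  have elim0: "e \<longlonglongrightarrow> 0" using LIMSEQ_inverse_real_of_nat by (simp add: e_def inverse_eq_divide add.commute)
  have "\<forall>k. \<exists>\<phi>. tf \<phi> \<and> (\<forall>p\<in>\<M>. 0 \<le> \<phi> p) \<and> L2 \<phi> = 1 \<and> En \<phi> < lam + e k" 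
    by (rule allI) (rule minimizing[OF e(1)])
  from choice[OF this] obtain fs where fs: "\<forall>k. tf (fs k) \<and> (\<forall>p\<in>\<M>. 0 \<le> fs k p) \<and> L2 (fs k) = 1 \<and> En (fs k) < lam + e k" ..
  note fsk = spec[OF fs]
  have t: "tf (fs k)" and L1: "L2 (fs k) = 1" and E: "En (fs k) < lam + e k" for k using fsk[of k] by simp_all
  have f0: "0 \<le> fs k q" if "q \<in> \<M>" for k q using fsk[of k] that by simp
  have E1: "En (fs k) \<le> lam + 1" for k using E[of k] e(2)[of k] by linarith
  \<comment> \<open>The excess of the energy of \<open>fs k\<close> over \<open>lam\<close> is below
    \<open>e k\<close>, and \<open>super_minimizer\<close> takes its square root.\<close>
  interpret super_seq X A F fs "\<lambda>k. sqrt (e k)"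
  proof
    show "super (fs k) (sqrt (e k))" for k
      by (rule super_minimizer[OF t f0]) (use E[of k] L1[of k] in auto)
    show "0 \<le> sqrt (e k)" for k using e(1)[of k] by simp
    show "(\<lambda>k. sqrt (e k)) \<longlonglongrightarrow> 0" using tendsto_real_sqrt[OF elim0] by simp
    fix \<eta> assume "tf \<eta>"
    then obtain B where B: "0 \<le> B" "\<And>\<phi>. tf \<phi> \<Longrightarrow> En (\<lambda>p. \<eta> p * \<phi> p) \<le> B * En \<phi> + B * L2 \<phi>"
      using En_mult_bound by blast
    have "En (\<lambda>p. \<eta> p * fs k p) \<le> B * (lam + 1) + B" for k
    proof -
      have "B * En (fs k) \<le> B * (lam + 1)" using E1 B(1) by (rule mult_left_mono)
      then show ?thesis using B(2)[OF t[of k]] L1[of k] by simp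
    qed
    then show "\<exists>C. \<forall>k. En (\<lambda>p. \<eta> p * fs k p) \<le> C" by blast
  qed
  \<comment> \<open>A level strictly between 0 and \<open>asq p\<close>: |A|^2 exceeds it near
    \<open>p\<close>, and there a bound on \<open>Asq\<close> is a bound on the L^2 norm.\<close>
  define c where "c = asq p / 2"
  have c: "0 < c" using ap by (simp add: c_def)
  define U where "U = {q \<in> \<M>. asq q \<in> {c<..}}"
  have oU: "openin X U"
    unfolding U_def by (rule openin_continuous_map_preimage[OF sm_continuous[OF sm_second_ff_sq]]) simp
  have UX: "U \<in> sets bX" by (rule openin_sets[OF oU])
  have vU: "vanishes U"
    unfolding vanishes_def
  proof (intro allI impI)
    fix \<epsilon> :: real assume \<epsilon>: "0 < \<epsilon>"
    have "0 < c * \<epsilon>" using c \<epsilon> by simp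
    from order_tendstoD(2)[OF elim0 this]
    show "\<forall>\<^sub>F k in sequentially. (\<integral>\<^sup>+p\<in>U. ennreal ((fs k p)\<^sup>2) \<partial>vol) \<le> ennreal \<epsilon>"
    proof (rule eventually_mono)
      fix k assume k: "e k < c * \<epsilon>"
      have "ennreal c * (\<integral>\<^sup>+p\<in>U. ennreal ((fs k p)\<^sup>2) \<partial>vol) = (\<integral>\<^sup>+p. ennreal c * (ennreal ((fs k p)\<^sup>2) * indicator U p) \<partial>vol)"
        by (rule nn_integral_cmult[symmetric]) (unfold measurable_vol, rule fs_sq_measurable[OF UX])
      also have "\<dots> \<le> (\<integral>\<^sup>+p. ennreal ((asq p * (fs k p)\<^sup>2) * wgt p) \<partial>vol)"
      proof (rule nn_integral_mono)
        fix q
        show "ennreal c * (ennreal ((fs k q)\<^sup>2) * indicator U q) \<le> ennreal ((asq q * (fs k q)\<^sup>2) * wgt q)"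
        proof (cases "q \<in> U")
          case True
          have w: "1 \<le> wgt q" by (simp add: wgt_def)
          have "c * (fs k q)\<^sup>2 * 1 \<le> (asq q * (fs k q)\<^sup>2) * wgt q"
            using True c w asq_nonneg[of q] by (intro mult_mono mult_nonneg_nonneg) (auto simp: U_def)
          then show ?thesis using True c by (simp add: ennreal_mult[symmetric] ennreal_leI)
        qed simp
      qed
      also have "\<dots> = ennreal (Asq (fs k))"
        unfolding Asq_def by (rule ennreal_wint[OF Asq_ccs[OF t]]) (simp add: asq_nonneg)
      also have "\<dots> \<le> ennreal (c * \<epsilon>)"
        using mu1_eq_bound[OF eq t L1, of k] E[of k] k by (intro ennreal_leI) simp
      also have "\<dots> = ennreal c * ennreal \<epsilon>" using c \<epsilon> by (simp add: ennreal_mult)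
      finally show "(\<integral>\<^sup>+p\<in>U. ennreal ((fs k p)\<^sup>2) \<partial>vol) \<le> ennreal \<epsilon>" using c by (simp add: ennreal_mult_le_mult_iff)
    qed
  qed
  have "p \<in> U" using p ap by (simp add: U_def c_def)
  then have neU: "U \<noteq> {}" by blast
  \<comment> \<open>By \<open>position_bounds\<close> the mass outside \<open>K\<close> is at most
    16 (lam + 1) / R^2 = 1/4. On \<open>K\<close> the weight is at most \<open>M\<close>, so the
    threshold \<open>1 / (4 * M)\<close> gives another 1/4, contradicting total mass 1.\<close>
  define R where "R = 8 * sqrt (lam + 1)"
  define K where "K = {q \<in> \<M>. norm (F q) \<le> R}"
  have l1: "0 < lam + 1" using lam_nonneg by simp
  have R: "0 < R" "R\<^sup>2 = 64 * (lam + 1)" using l1 by (auto simp: R_def power_mult_distrib)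
  have cK: "compactin X K" unfolding K_def by (rule norm_sublevel_compact[OF proper])
  have KX: "K \<in> sets bX" by (rule closedin_sets[OF compactin_closed[OF cK]])
  define M where "M = exp (R\<^sup>2 / 4)"
  have M: "0 < M" by (simp add: M_def)
  have "vanishes K" by (rule vanish_compact[OF oU vU neU cK])
  then have "\<forall>\<^sub>F k in sequentially. (\<integral>\<^sup>+p\<in>K. ennreal ((fs k p)\<^sup>2) \<partial>vol) \<le> ennreal (1 / (4 * M))"
    unfolding vanishes_def using M by simp
  then obtain k where k: "(\<integral>\<^sup>+p\<in>K. ennreal ((fs k p)\<^sup>2) \<partial>vol) \<le> ennreal (1 / (4 * M))"
    using eventually_happens sequentially_bot by blast
  let ?b = "\<lambda>p. (fs k p)\<^sup>2 * (norm (F p))\<^sup>2"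
  have cb: "ccs ?b" by (rule ccs_mult[OF tf_sq_ccs[OF t] F_continuous])
  have mK: "(\<lambda>p. ennreal ((fs k p)\<^sup>2) * indicator K p) \<in> borel_measurable vol"
    unfolding measurable_vol by (rule fs_sq_measurable[OF KX])
  have mb: "(\<lambda>p. ennreal (?b p * wgt p)) \<in> borel_measurable vol"
  proof -
    have "(\<lambda>p. ?b p * wgt p) \<in> borel_measurable bX"
      by (rule continuous_measurable[OF ccs_continuous[OF ccs_mult[OF cb wgt_continuous]]])
    then have "(\<lambda>p. ennreal (?b p * wgt p)) \<in> borel_measurable bX" by simp
    then show ?thesis by (simp add: measurable_vol)
  qed
  have "1 = ennreal (L2 (fs k))" using L1 by simp
  also have "\<dots> = (\<integral>\<^sup>+q. ennreal ((fs k q)\<^sup>2 * wgt q) \<partial>vol)"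
    unfolding L2_def by (rule ennreal_wint[OF tf_sq_ccs[OF t], symmetric]) simp
  also have "\<dots> \<le> (\<integral>\<^sup>+q. ennreal M * (ennreal ((fs k q)\<^sup>2) * indicator K q) + ennreal (1 / R\<^sup>2) * ennreal (?b q * wgt q) \<partial>vol)"
  proof (rule nn_integral_mono)
    fix q assume "q \<in> space vol"
    then have q: "q \<in> \<M>" by (simp add: space_vol)
    show "ennreal ((fs k q)\<^sup>2 * wgt q) \<le> ennreal M * (ennreal ((fs k q)\<^sup>2) * indicator K q) + ennreal (1 / R\<^sup>2) * ennreal (?b q * wgt q)"
    proof (cases "q \<in> K")
      case True
      have "wgt q \<le> M" using True by (simp add: wgt_def M_def K_def power_mono)
      then have "(fs k q)\<^sup>2 * wgt q \<le> M * (fs k q)\<^sup>2" by (simp add: mult.commute mult_right_mono)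
      then have "ennreal ((fs k q)\<^sup>2 * wgt q) \<le> ennreal (M * (fs k q)\<^sup>2)" by (rule ennreal_leI)
      also have "\<dots> = ennreal M * (ennreal ((fs k q)\<^sup>2) * indicator K q)" using True M by (simp add: ennreal_mult)
      finally show ?thesis by (rule order_trans) simp
    next
      case False
      then have "R \<le> norm (F q)" using q by (simp add: K_def)
      then have "R\<^sup>2 \<le> (norm (F q))\<^sup>2" using R(1) by (intro power_mono) auto
      then have "1 \<le> 1 / R\<^sup>2 * (norm (F q))\<^sup>2" using R(1) by (simp add: pos_le_divide_eq)
      then have "((fs k q)\<^sup>2 * wgt q) * 1 \<le> ((fs k q)\<^sup>2 * wgt q) * (1 / R\<^sup>2 * (norm (F q))\<^sup>2)"
        using wgt_pos[of q] by (intro mult_left_mono) auto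
      then have "ennreal ((fs k q)\<^sup>2 * wgt q) \<le> ennreal (1 / R\<^sup>2 * (?b q * wgt q))" by (intro ennreal_leI) (simp add: mult_ac)
      also have "\<dots> = ennreal (1 / R\<^sup>2) * ennreal (?b q * wgt q)"
        using wgt_pos[of q] by (intro ennreal_mult) auto
      finally show ?thesis by (rule order_trans) simp
    qed
  qed
  also have "\<dots> = ennreal M * (\<integral>\<^sup>+q\<in>K. ennreal ((fs k q)\<^sup>2) \<partial>vol) + ennreal (1 / R\<^sup>2) * (\<integral>\<^sup>+q. ennreal (?b q * wgt q) \<partial>vol)"
    using mK mb by (simp add: nn_integral_add nn_integral_cmult)
  also have "\<dots> \<le> ennreal M * ennreal (1 / (4 * M)) + ennreal (1 / R\<^sup>2) * ennreal (16 * (lam + 1))"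
  proof (intro add_mono mult_left_mono k)
    have "(\<integral>\<^sup>+q. ennreal (?b q * wgt q) \<partial>vol) = ennreal (wint ?b)" by (rule ennreal_wint[OF cb]) simp
    also have "\<dots> \<le> ennreal (16 * (lam + 1))" using position_bounds(2)[OF t, of k] E1[of k] by (intro ennreal_leI) simp
    finally show "(\<integral>\<^sup>+q. ennreal (?b q * wgt q) \<partial>vol) \<le> ennreal (16 * (lam + 1))" .
  qed simp_all
  also have "\<dots> = ennreal (1 / 4) + ennreal (1 / 4)"
    using M l1 unfolding R(2) by (simp add: ennreal_mult[symmetric])
  also have "\<dots> = ennreal (1 / 2)" by (simp add: ennreal_plus[symmetric] del: ennreal_plus)
  finally have "ennreal 1 \<le> ennreal (1 / 2)" by (simp only: ennreal_1)
  then have "(1::real) \<le> 1 / 2" by (subst (asm) ennreal_le_iff) simp_all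
  then show False by simp
qed

end

section \<open>The mean convex case\<close>

context oriented_expander
begin

text \<open>Twice the mean curvature with respect to \<open>N\<close>, hence nonnegative in the mean
  convex case.\<close>

definition h :: "'a \<Rightarrow> real" where "h p = - f p"

lemma sm_h: "sm \<M> h"
  using sm_mult[OF sm_const[OF openin_topspace] sm_f, of "- 1"] by (simp add: h_def[abs_def])

lemma grad_h: assumes p: "p \<in> \<M>" shows "grad h p = - grad f p"
  using grad_cmult[OF sm_f p, of "- 1"] by (simp add: h_def[abs_def])

lemma weak_equation_h:
  assumes t: "tf \<xi>"
  shows "wint (\<lambda>p. grad h p \<bullet> grad \<xi> p) = wint (\<lambda>p. (\<alpha> p + 1/2) * h p * \<xi> p)"
proof -
  have "wint (\<lambda>p. grad h p \<bullet> grad \<xi> p) = wint (\<lambda>p. - 1 * (grad \<xi> p \<bullet> grad f p))"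
    by (rule wint_cong) (simp add: grad_h inner_commute)
  also have "\<dots> = wint (\<lambda>p. - 1 * ((\<alpha> p + 1/2) * f p * \<xi> p))"
    unfolding wint_cmult weak_equation_f[OF t] ..
  also have "\<dots> = wint (\<lambda>p. (\<alpha> p + 1/2) * h p * \<xi> p)"
    by (rule wint_cong) (simp add: h_def)
  finally show ?thesis .
qed

lemma alpha_nonneg: "0 \<le> \<alpha> p"
  unfolding \<alpha>_def by (intro sum_nonneg) simp

lemma Asq_alpha: assumes t: "tf \<phi>" shows "wint (\<lambda>p. (\<alpha> p + 1/2) * (\<phi> p)\<^sup>2) = Asq \<phi> + 1/2 * L2 \<phi>"
proof -
  have "wint (\<lambda>p. (\<alpha> p + 1/2) * (\<phi> p)\<^sup>2) = wint (\<lambda>p. asq p * (\<phi> p)\<^sup>2 + 1/2 * (\<phi> p)\<^sup>2)"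
    by (rule wint_cong) (simp add: second_ff_sq_alpha distrib_right)
  also have "\<dots> = Asq \<phi> + 1/2 * L2 \<phi>"
    unfolding Asq_def L2_def by (simp only: wint_add[OF Asq_ccs[OF t] ccs_cmult[OF tf_sq_ccs[OF t]]] wint_cmult)
  finally show ?thesis .
qed

text \<open>Moving in direction \<open>- F\<close> from a maximum of \<open>|A|\<^sup>2\<close> on a sublevel set of \<open>|F|\<close> increases \<open>|A|\<^sup>2\<close> but
  stays in the sublevel set.\<close>

lemma cone_flat:
  assumes proper: "properly_immersed X F" and f0: "\<And>q. q \<in> \<M> \<Longrightarrow> f q = 0" and p: "p \<in> \<M>"
  shows "\<alpha> p = 0"
proof (rule ccontr)
  assume "\<alpha> p \<noteq> 0"
  then have ap: "0 < \<alpha> p" using alpha_nonneg[of p] by linarith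
  define K where "K = {q \<in> \<M>. norm (F q) \<le> norm (F p)}"
  have pK: "p \<in> K" using p by (simp add: K_def)
  have "compact (\<alpha> ` K)"
    using image_compactin[OF norm_sublevel_compact[OF proper] sm_continuous[OF sm_alpha]] unfolding K_def by simp
  then obtain q where q: "q \<in> K" "\<And>y. y \<in> K \<Longrightarrow> \<alpha> y \<le> \<alpha> q"
    using compact_attains_sup[of "\<alpha> ` K"] pK by blast
  have qX: "q \<in> \<M>" using q(1) by (simp add: K_def)
  have aq: "0 < \<alpha> q" using q(2)[OF pK] ap by linarith
  note cone = cone_alpha_derivative[OF f0 qX]
  obtain V \<psi> x where c: "(V, \<psi>) \<in> A" "x \<in> V" "\<psi> x = q" using chart_cover[OF qX] .
  obtain a where a: "Df (F \<circ> \<psi>) x a = F q"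
    using cone(1) tangent_space_chart[OF c(1,2)] c(3) by auto
  \<comment> \<open>The line in the chart whose image under \<open>F\<close> has velocity
    \<open>- F q\<close> at time 0.\<close>
  define L where "L = (\<lambda>t::real. x + t *\<^sub>R (- a))"
  have L: "L 0 = x" "(L has_derivative (\<lambda>t. t *\<^sub>R (- a))) (at 0)" unfolding L_def by (auto intro!: derivative_eq_intros)
  have qT: "\<psi> x \<in> \<M>" using c qX by simp
  have along: "((\<lambda>t. g (\<psi> (L t))) has_real_derivative - mD g q (F q)) (at 0)" if g: "sm \<M> g" for g
  proof -
    have d: "((g \<circ> \<psi>) has_derivative Df (g \<circ> \<psi>) x) (at (L 0))"
      using sm_chart_has_derivative[OF g c(1,2) qT] L(1) by simp
    have e: "Df (g \<circ> \<psi>) x (t *\<^sub>R (- a)) = - mD g q (F q) * t" for t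
    proof -
      have lin: "linear (Df (g \<circ> \<psi>) x)"
        using has_derivative_linear[OF d] .
      show ?thesis
        using mD_chart_dG[OF c(1,2) g qT, of a] a c(3) linear_cmul[OF lin, of "- t" a] by simp
    qed
    from has_derivative_compose[OF L(2) d] show ?thesis
      unfolding has_field_derivative_def e by (simp only: o_def)
  qed
  define N2 where "N2 = (\<lambda>p. F p \<bullet> F p)"
  have sN: "sm \<M> N2" unfolding N2_def by (rule sm_inner[OF sm_F sm_F])
  \<comment> \<open>The maximum is not at the vertex of the cone: there the derivative along
    \<open>F q = 0\<close> would be 0 instead of \<open>- 2 * \<alpha> q\<close>.\<close>
  have Fq: "F q \<noteq> 0"
  proof
    assume "F q = 0"
    then have "mD \<alpha> q (F q) = 0" using linear_0[OF mD_linear[OF sm_alpha qX]] by simp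
    then show False using cone(2) aq by simp
  qed
  have "mD N2 q (F q) = 2 * (F q \<bullet> F q)"
    using tproj_id[OF qX cone(1)] unfolding N2_def mD_inner[OF sm_F sm_F qX] mD_F[OF qX] by simp
  then have "- mD N2 q (F q) < 0" using Fq by simp
  from DERIV_neg_dec_right[OF along[OF sN] this]
  obtain d1 where d1: "0 < d1" "\<And>t. 0 < t \<Longrightarrow> t < d1 \<Longrightarrow> N2 (\<psi> (L t)) < N2 (\<psi> (L 0))" by auto
  have "0 < - mD \<alpha> q (F q)" using cone(2) aq by simp
  from DERIV_pos_inc_right[OF along[OF sm_alpha] this]
  obtain d2 where d2: "0 < d2" "\<And>t. 0 < t \<Longrightarrow> t < d2 \<Longrightarrow> \<alpha> (\<psi> (L 0)) < \<alpha> (\<psi> (L t))" by auto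
  have "isCont L 0" using L(2) has_derivative_continuous by blast
  then have "\<forall>\<^sub>F t in at 0. L t \<in> V"
    using topological_tendstoD[of L "L 0" "at 0" V] chart_open[OF c(1)] c(2) L(1) by (simp add: isCont_def)
  then obtain d3 where d3: "0 < d3" "\<And>t. t \<noteq> 0 \<Longrightarrow> dist t 0 < d3 \<Longrightarrow> L t \<in> V" unfolding eventually_at by auto
  define t where "t = min d1 (min d2 d3) / 2"
  have t: "0 < t" "t < d1" "t < d2" "t < d3" using d1(1) d2(1) d3(1) by (auto simp: t_def)
  have LV: "\<psi> (L t) \<in> \<M>" by (rule chart_topspace[OF c(1) d3(2)]) (use t in auto)
  have "(norm (F (\<psi> (L t))))\<^sup>2 \<le> (norm (F q))\<^sup>2"
    using d1(2)[OF t(1,2)] c(3) L(1) unfolding N2_def power2_norm_eq_inner by simp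
  then have "norm (F (\<psi> (L t))) \<le> norm (F q)" by simp
  then have "\<psi> (L t) \<in> K" using LV q(1) by (simp add: K_def)
  then show False using q(2) d2(2)[OF t(1,3)] c(3) L(1) by fastforce
qed

context
  assumes f_le: "\<And>p. p \<in> \<M> \<Longrightarrow> f p \<le> 0"
begin

lemma h_nonneg: "p \<in> \<M> \<Longrightarrow> 0 \<le> h p"
  using f_le by (simp add: h_def)

text \<open>\<open>h\<close> solves the same linear equation as \<open>f\<close>, and the
  coefficient \<open>\<alpha> p + 1/2\<close> of its zeroth-order term is nonnegative.\<close>

lemma super_h: "super h 0"
  unfolding super_def
proof (intro conjI allI impI ballI sm_h h_nonneg)
  fix \<xi> assume t: "tf \<xi>" and nn: "\<forall>p\<in>\<M>. 0 \<le> \<xi> p"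
  have "0 \<le> wint (\<lambda>p. (\<alpha> p + 1/2) * h p * \<xi> p)"
  proof (rule wint_nonneg)
    fix p assume p: "p \<in> \<M>"
    show "0 \<le> (\<alpha> p + 1/2) * h p * \<xi> p"
      by (intro mult_nonneg_nonneg h_nonneg[OF p]) (use alpha_nonneg[of p] nn p in auto)
  qed
  then show "- 0 * sqrt (En \<xi>) \<le> wint (\<lambda>p. grad h p \<bullet> grad \<xi> p)" by (simp add: weak_equation_h[OF t])
qed

text \<open>Barta's trick, with \<open>\<phi>\<^sup>2 / (h + \<epsilon>)\<close> as a test function since \<open>h\<close> may vanish.\<close>

lemma barta:
  assumes t: "tf \<phi>" and \<epsilon>: "0 < \<epsilon>"
  shows "wint (\<lambda>p. (\<alpha> p + 1/2) * h p * (\<phi> p * \<phi> p * (1 / (h p + \<epsilon>)))) \<le> En \<phi>"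
    and "ccs (\<lambda>p. (\<alpha> p + 1/2) * h p * (\<phi> p * \<phi> p * (1 / (h p + \<epsilon>))))"
proof -
  have pos: "0 < h p + \<epsilon>" if "p \<in> \<M>" for p using h_nonneg[OF that] \<epsilon> by simp
  have sc: "sm \<M> (\<lambda>p. c)" for c :: real by (rule sm_const) simp
  let ?u = "\<lambda>p. 1 / (h p + \<epsilon>)"
  define \<xi> where "\<xi> = (\<lambda>p. (\<phi> p * \<phi> p) * ?u p)"
  have pos': "\<forall>p\<in>\<M>. 0 < h p + \<epsilon>" using pos by blast
  note quotient = quotient_test_function[OF sm_h pos' t]
  have tx: "tf \<xi>" unfolding \<xi>_def by (rule quotient(2))
  have "ccs (\<lambda>p. \<xi> p * ((\<alpha> p + 1/2) * h p))"
    by (rule ccs_mult[OF tf_ccs[OF tx] sm_continuous[OF sm_mult[OF sm_add[OF sm_alpha sc] sm_h]]])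
  then show "ccs (\<lambda>p. (\<alpha> p + 1/2) * h p * (\<phi> p * \<phi> p * (1 / (h p + \<epsilon>))))"
    by (simp only: \<xi>_def mult.commute[of "(\<phi> _ * \<phi> _) * _"])
  have gx: "grad \<xi> p = (2 * (\<phi> p * ?u p)) *\<^sub>R grad \<phi> p - ((\<phi> p * ?u p)\<^sup>2) *\<^sub>R grad h p" if p: "p \<in> \<M>" for p
    unfolding \<xi>_def by (rule quotient(3)[OF p])
  have "wint (\<lambda>p. (\<alpha> p + 1/2) * h p * \<xi> p) = wint (\<lambda>p. grad h p \<bullet> grad \<xi> p)" by (rule weak_equation_h[OF tx, symmetric])
  also have "\<dots> \<le> En \<phi>"
    unfolding En_def
  proof (rule wint_mono[OF _ tf_grad_sq_ccs[OF t]])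
    show "ccs (\<lambda>p. grad h p \<bullet> grad \<xi> p)" using tf_grad_ccs[OF tx sm_grad[OF sm_h]] by (simp add: inner_commute)
    fix p assume p: "p \<in> \<M>"
    \<comment> \<open>Completing the square, with c = \<phi> / (h + \<epsilon>), x the gradient of
      \<phi> and y that of h.\<close>
    have sq: "2 * c * (y \<bullet> x) - c\<^sup>2 * (y \<bullet> y) \<le> (norm x)\<^sup>2" for c and x y :: "real^'m"
    proof -
      have "0 \<le> (x - c *\<^sub>R y) \<bullet> (x - c *\<^sub>R y)" by simp
      also have "\<dots> = (norm x)\<^sup>2 - 2 * c * (y \<bullet> x) + c\<^sup>2 * (y \<bullet> y)"
        unfolding power2_norm_eq_inner
        by (simp add: inner_diff_left inner_diff_right inner_commute[of x y] power2_eq_square right_diff_distrib)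
      finally show ?thesis by linarith
    qed
    show "grad h p \<bullet> grad \<xi> p \<le> (norm (grad \<phi> p))\<^sup>2"
      unfolding gx[OF p] inner_diff_right inner_scaleR_right by (rule sq)
  qed
  finally show "wint (\<lambda>p. (\<alpha> p + 1/2) * h p * (\<phi> p * \<phi> p * (1 / (h p + \<epsilon>)))) \<le> En \<phi>"
    unfolding \<xi>_def .
qed

text \<open>Let \<epsilon> tend to 0 in \<open>barta\<close>. The factor h / (h + \<epsilon>) lies
  in [0, 1] and tends to 1 where h \<noteq> 0; at zeros of h it is 0 for every \<epsilon>, so the
  zero set has to be null.\<close>

lemma stability_inequality:
  assumes t: "tf \<phi>" and ae: "AE p in vol. h p \<noteq> 0"
  shows "wint (\<lambda>p. (\<alpha> p + 1/2) * (\<phi> p)\<^sup>2) \<le> En \<phi>"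
proof -
  define e :: "nat \<Rightarrow> real" where "e = (\<lambda>k. 1 / (real k + 1))"
  have e: "0 < e k" for k by (auto simp: e_def)
  have e0: "e \<longlonglongrightarrow> 0" using LIMSEQ_inverse_real_of_nat by (simp add: e_def inverse_eq_divide add.commute)
  let ?g = "\<lambda>k p. (\<alpha> p + 1/2) * h p * (\<phi> p * \<phi> p * (1 / (h p + e k)))" and ?G = "\<lambda>p. (\<alpha> p + 1/2) * (\<phi> p)\<^sup>2"
  have sc: "sm \<M> (\<lambda>p. c)" for c :: real by (rule sm_const) simp
  have cG: "ccs ?G"
    using ccs_mult[OF tf_sq_ccs[OF t] sm_continuous[OF sm_add[OF sm_alpha sc]], of "1/2"] by (simp only: mult.commute)
  have "(\<lambda>k. LINT p|vol. ?g k p * wgt p) \<longlonglongrightarrow> (LINT p|vol. ?G p * wgt p)"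
  proof (rule integral_dominated_convergence[where w="\<lambda>p. ?G p * wgt p"])
    show "integrable vol (\<lambda>p. ?G p * wgt p)" by (rule integrable_wgt[OF cG])
    show "(\<lambda>p. ?G p * wgt p) \<in> borel_measurable vol" by (rule borel_measurable_integrable[OF integrable_wgt[OF cG]])
    show "(\<lambda>p. ?g k p * wgt p) \<in> borel_measurable vol" for k
      by (rule borel_measurable_integrable[OF integrable_wgt[OF barta(2)[OF t e]]])
    show "AE p in vol. (\<lambda>k. ?g k p * wgt p) \<longlonglongrightarrow> ?G p * wgt p"
      using ae
    proof (rule AE_mp, intro AE_I2 impI)
      fix p assume hp: "h p \<noteq> 0"
      have "(\<lambda>k. (\<alpha> p + 1/2) * h p * (\<phi> p * \<phi> p * (1 / (h p + e k))) * wgt p) \<longlonglongrightarrow>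
          (\<alpha> p + 1/2) * h p * (\<phi> p * \<phi> p * (1 / (h p + 0))) * wgt p"
        by (intro tendsto_intros e0) (simp add: hp)
      then show "(\<lambda>k. ?g k p * wgt p) \<longlonglongrightarrow> ?G p * wgt p" using hp by (simp add: power2_eq_square)
    qed
    show "AE p in vol. norm (?g k p * wgt p) \<le> ?G p * wgt p" for k
    proof (rule AE_I2)
      fix p assume "p \<in> space vol"
      then have p: "p \<in> \<M>" by (simp add: space_vol)
      have q: "0 \<le> h p / (h p + e k)" "h p / (h p + e k) \<le> 1" using h_nonneg[OF p] e[of k] by auto
      have g: "?g k p = (\<alpha> p + 1/2) * (\<phi> p)\<^sup>2 * (h p / (h p + e k))" by (simp add: power2_eq_square)
      have a0: "0 \<le> (\<alpha> p + 1/2) * (\<phi> p)\<^sup>2" using alpha_nonneg[of p] by simp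
      have "?g k p \<le> ?G p * 1" unfolding g using q(2) a0 by (rule mult_left_mono)
      moreover have "0 \<le> ?g k p" unfolding g using a0 q(1) by (rule mult_nonneg_nonneg)
      ultimately show "norm (?g k p * wgt p) \<le> ?G p * wgt p"
        using wgt_pos[of p] by (simp only: real_norm_def abs_mult abs_of_nonneg abs_of_pos mult_right_mono less_imp_le mult_1_right)
    qed
  qed
  then show ?thesis
    unfolding wint_eq[symmetric] by (rule LIMSEQ_le_const2) (use barta(1)[OF t e] in blast)
qed

text \<open>A strong maximum principle with a zero set of positive measure in place of an interior
  zero. The constant sequence \<open>h\<close> is exactly superharmonic, so such a zero set in a
  small ball makes \<open>h\<close> vanish near it, and propagation does the same
  everywhere.\<close>

lemma zero_dichotomy: "(AE p in vol. h p \<noteq> 0) \<or> (\<forall>p\<in>\<M>. h p = 0)"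
proof -
  define Z where "Z = {p \<in> \<M>. h p \<in> {0}}"
  have "closedin X Z" unfolding Z_def by (rule closedin_continuous_map_preimage[OF sm_continuous[OF sm_h]]) simp
  then have Zs: "Z \<in> sets bX" by (rule closedin_sets)
  let ?S = "\<lambda>V \<psi>. {x \<in> V. \<psi> x \<in> Z}"
  show ?thesis
  proof (cases "\<forall>V \<psi>. (V, \<psi>) \<in> A \<longrightarrow> negligible (?S V \<psi>)")
    case True
    have null: "Z \<inter> \<psi> ` V \<in> null_sets vol" if c: "(V, \<psi>) \<in> A" for V \<psi>
    proof -
      have E: "Z \<inter> \<psi> ` V \<in> sets bX" using Zs openin_sets[OF chart_openin[OF c]] by auto
      have eq: "{x \<in> V. \<psi> x \<in> Z \<inter> \<psi> ` V} = ?S V \<psi>" by auto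
      have "?S V \<psi> \<in> null_sets lebesgue" using True c by (simp add: negligible_iff_null_sets)
      then have "?S V \<psi> \<in> null_sets lborel" using chart_preimage_borel[OF c Zs] by (simp add: null_sets_def)
      then have "\<nu> V \<psi> (Z \<inter> \<psi> ` V) = 0" unfolding \<nu>_def eq by (rule nn_integral_null_set)
      then show ?thesis using emeasure_vol[OF c E] E by (auto simp: null_sets_def sets_vol)
    qed
    obtain c :: "nat \<Rightarrow> (real^'n) set \<times> (real^'n \<Rightarrow> 'a)"
      where c: "(\<forall>i. c i \<in> A) \<and> (\<Union>i. snd (c i) ` fst (c i)) = \<M>"
      using countable_atlas ..
    have "(\<Union>i. Z \<inter> snd (c i) ` fst (c i)) \<in> null_sets vol"
      by (rule null_sets_UN) (use null c in simp)
    moreover have "{p \<in> space vol. \<not> h p \<noteq> 0} \<subseteq> (\<Union>i. Z \<inter> snd (c i) ` fst (c i))"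
    proof
      fix p assume "p \<in> {p \<in> space vol. \<not> h p \<noteq> 0}"
      then have p: "p \<in> \<M>" "p \<in> Z" by (auto simp: space_vol Z_def)
      then have "p \<in> (\<Union>i. snd (c i) ` fst (c i))" using c by simp
      then show "p \<in> (\<Union>i. Z \<inter> snd (c i) ` fst (c i))" using p(2) by blast
    qed
    ultimately have "AE p in vol. h p \<noteq> 0" by (rule AE_I')
    then show ?thesis by (rule disjI1)
  next
    case False
    then obtain V \<psi> where c: "(V, \<psi>) \<in> A" and nS: "\<not> negligible (?S V \<psi>)" by blast
    \<comment> \<open>Every neighbourhood of this point meets the zero set in positive measure, so
      the ball can be shrunk to fit into the chart.\<close>
    obtain x where x: "x \<in> ?S V \<psi>" "\<And>U. openin (top_of_set (?S V \<psi>)) U \<Longrightarrow> x \<in> U \<Longrightarrow> \<not> negligible U"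
      using nS locally_negligible_alt[of "?S V \<psi>"] by blast
    obtain s where s: "0 < s" "cball x s \<subseteq> V" using open_contains_cball chart_open[OF c] x(1) by blast
    define r where "r = s / 2"
    have r: "0 < r" "cball x (2 * r) \<subseteq> V" using s by (auto simp: r_def)
    define Y where "Y = ?S V \<psi> \<inter> ball x r"
    have Yb: "Y \<in> sets borel" "Y \<subseteq> ball x r" using chart_preimage_borel[OF c Zs] by (auto simp: Y_def)
    have "\<not> negligible Y"
      by (rule x(2)) (use x(1) r(1) in \<open>auto simp: Y_def openin_open\<close>)
    have Ypos: "0 < emeasure lborel Y"
    proof (rule ccontr)
      assume "\<not> 0 < emeasure lborel Y"
      then have "Y \<in> null_sets lborel" using Yb(1) by (auto simp: null_sets_def not_less)
      then have "negligible Y" using null_sets_completionI[of Y lborel] by (simp add: negligible_iff_null_sets)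
      then show False using \<open>\<not> negligible Y\<close> by simp
    qed
    interpret s: super_seq X A F "\<lambda>k. h" "\<lambda>k. 0"
      by unfold_locales (use super_h in auto)
    have vx: "s.vanishes (\<psi> ` ball x (r / 2))"
    proof (rule s.local_vanish[OF c r Yb Ypos])
      fix e :: real assume "0 < e"
      have "(\<integral>\<^sup>+y\<in>Y. ennreal (h (\<psi> y)) \<partial>lborel) = (\<integral>\<^sup>+y. 0 \<partial>(lborel :: (real^'n) measure))"
        by (rule nn_integral_cong) (auto simp: Y_def Z_def indicator_def)
      then show "\<forall>\<^sub>F k in sequentially. (\<integral>\<^sup>+y\<in>Y. ennreal (h (\<psi> y)) \<partial>lborel) \<le> ennreal e" by simp
    qed
    have ox: "openin X (\<psi> ` ball x (r / 2))" by (rule chart_image_open[OF c open_ball]) (use r in auto)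
    have nx: "\<psi> ` ball x (r / 2) \<noteq> {}" using r(1) by simp
    have "h p = 0" if p: "p \<in> \<M>" for p
    proof (rule ccontr)
      assume "h p \<noteq> 0"
      then have hp: "0 < h p" using h_nonneg[OF p] by simp
      obtain U where U: "openin X U" "p \<in> U" "s.vanishes U" using s.vanish_everywhere[OF ox vx nx p] .
      \<comment> \<open>For a constant sequence, vanishing means that the integral over
        \<open>U\<close> is 0, while near \<open>p\<close> the integrand stays above a positive
        constant.\<close>
      define B where "B = U \<inter> {q \<in> \<M>. h q \<in> {h p / 2<..}}"
      have oB: "openin X B"
        unfolding B_def by (intro openin_Int U(1) openin_continuous_map_preimage[OF sm_continuous[OF sm_h]]) simp
      have "p \<in> B" using U(2) p hp by (simp add: B_def)
      then have vB: "0 < emeasure vol B" using vol_open_pos[OF oB] by blast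
      have "ennreal ((h p / 2)\<^sup>2) * emeasure vol B = (\<integral>\<^sup>+q. ennreal ((h p / 2)\<^sup>2) * indicator B q \<partial>vol)"
        using openin_sets[OF oB] by (simp add: nn_integral_cmult_indicator sets_vol)
      also have "\<dots> \<le> (\<integral>\<^sup>+q\<in>U. ennreal ((h q)\<^sup>2) \<partial>vol)"
      proof (rule nn_integral_mono)
        fix q
        show "ennreal ((h p / 2)\<^sup>2) * indicator B q \<le> ennreal ((h q)\<^sup>2) * indicator U q"
        proof (cases "q \<in> B")
          case True
          then have "h p / 2 \<le> h q" "q \<in> U" by (auto simp: B_def)
          then have "(h p / 2)\<^sup>2 \<le> (h q)\<^sup>2" using hp by (intro power_mono) auto
          then show ?thesis using True \<open>q \<in> U\<close> by (simp add: ennreal_leI)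
        qed simp
      qed
      finally have le: "ennreal ((h p / 2)\<^sup>2) * emeasure vol B \<le> (\<integral>\<^sup>+q\<in>U. ennreal ((h q)\<^sup>2) \<partial>vol)" .
      have "0 < ennreal ((h p / 2)\<^sup>2) * emeasure vol B" using vB hp by (simp add: ennreal_zero_less_mult_iff)
      then have "0 < (\<integral>\<^sup>+q\<in>U. ennreal ((h q)\<^sup>2) \<partial>vol)" using le by (rule less_le_trans)
      moreover have "(\<integral>\<^sup>+q\<in>U. ennreal ((h q)\<^sup>2) \<partial>vol) \<le> 0 + ennreal e" if "0 < e" for e
        using U(3) that unfolding s.vanishes_def by simp
      then have "(\<integral>\<^sup>+q\<in>U. ennreal ((h q)\<^sup>2) \<partial>vol) \<le> 0" by (rule ennreal_le_epsilon)
      ultimately show False by simp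
    qed
    then show ?thesis by blast
  qed
qed

theorem mean_convex_mu1:
  assumes proper: "properly_immersed X F" shows "1 \<le> mu1 X A F"
proof -
  have "ereal 1 \<le> mu1 X A F"
  proof (rule mu1_ge)
    fix \<phi> assume t: "tf \<phi>"
    show "Asq \<phi> + (1 - 1/2) * L2 \<phi> \<le> En \<phi>"
    proof (cases "\<forall>p\<in>\<M>. h p = 0")
      case False
      then have "AE p in vol. h p \<noteq> 0" using zero_dichotomy by blast
      from stability_inequality[OF t this] show ?thesis unfolding Asq_alpha[OF t] by simp
    next
      case True
      then have f0: "f q = 0" if "q \<in> \<M>" for q using that by (simp add: h_def)
      have "asq p = 0" if "p \<in> \<M>" for p
        using cone_flat[OF proper f0 that] second_ff_sq_alpha[OF that] by simp
      then have "Asq \<phi> = 0"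
        unfolding Asq_def using wint_cong[of "\<lambda>p. asq p * (\<phi> p)\<^sup>2" "\<lambda>p. 0 * 0"] wint_cmult[of 0 "\<lambda>p. 0"] by simp
      \<comment> \<open>In the flat case the claim reduces to L2 \<le> 2 En, which follows from the
        bound with factor n because the dimension is at least 1.\<close>
      moreover have "1 * L2 \<phi> \<le> real CARD('n) * L2 \<phi>"
        using L2_nonneg[of \<phi>] by (intro mult_right_mono) (simp_all add: Suc_le_eq)
      ultimately show ?thesis using position_bounds(1)[OF t] by simp
    qed
  qed
  then show ?thesis by (simp only: one_ereal_def)
qed

end

end

section \<open>Flat self-expanders\<close>

text \<open>
  By properness, a section over a ball extends by a uniform distance. The image of the resulting
  global section is open and closed.
\<close>

locale proper_local_homeo =
  fixes X :: "'a topology" and \<Phi> :: "'a \<Rightarrow> 'b::euclidean_space"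
  assumes H: "Hausdorff_space X" and conn: "connected_space X" and cont: "continuous_map X euclidean \<Phi>"
    and proper: "\<And>y r. compactin X {p \<in> topspace X. \<Phi> p \<in> cball y r}"
    and local_inverse: "\<And>q. q \<in> topspace X \<Longrightarrow> \<exists>N r \<sigma>. openin X N \<and> q \<in> N \<and> inj_on \<Phi> N \<and> 0 < r \<and>
      continuous_map (top_of_set (ball (\<Phi> q) r)) X \<sigma> \<and> (\<forall>y\<in>ball (\<Phi> q) r. \<sigma> y \<in> N \<and> \<Phi> (\<sigma> y) = y)"
begin

definition sec :: "'b set \<Rightarrow> ('b \<Rightarrow> 'a) \<Rightarrow> bool" where
  "sec U s \<longleftrightarrow> continuous_map (top_of_set U) X s \<and> (\<forall>y\<in>U. \<Phi> (s y) = y)"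

lemma sec_subset: "sec U s \<Longrightarrow> T \<subseteq> U \<Longrightarrow> sec T s"
  unfolding sec_def using continuous_map_from_subtopology_mono by blast

lemma sec_topspace: "sec U s \<Longrightarrow> y \<in> U \<Longrightarrow> s y \<in> topspace X"
  unfolding sec_def using continuous_map_image_subset_topspace[of "top_of_set U" X s] by auto

lemma sec_preimage: assumes "sec U s" "open U" "openin X W" shows "open {y \<in> U. s y \<in> W}"
proof -
  have "openin (top_of_set U) {y \<in> topspace (top_of_set U). s y \<in> W}"
    using assms openin_continuous_map_preimage unfolding sec_def by blast
  then show ?thesis using openin_open_trans assms(2) by simp
qed

lemma sec_Union:
  assumes "\<And>z. z \<in> C \<Longrightarrow> open (B z)" "\<And>z. z \<in> C \<Longrightarrow> sec (B z) (\<sigma> z)"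
    and eq: "\<And>z y. z \<in> C \<Longrightarrow> y \<in> B z \<Longrightarrow> s y = \<sigma> z y"
  shows "sec (\<Union>z\<in>C. B z) s"
  unfolding sec_def continuous_map_def
proof (intro conjI allI impI ballI)
  show "s \<in> topspace (top_of_set (\<Union>z\<in>C. B z)) \<rightarrow> topspace X"
    using sec_topspace[OF assms(2)] eq by auto
  fix W assume W: "openin X W"
  have "open (\<Union>z\<in>C. {y \<in> B z. \<sigma> z y \<in> W})" using sec_preimage[OF assms(2,1) W] by blast
  moreover have "{y \<in> topspace (top_of_set (\<Union>z\<in>C. B z)). s y \<in> W} = (\<Union>z\<in>C. {y \<in> B z. \<sigma> z y \<in> W})"
    using eq by auto
  ultimately show "openin (top_of_set (\<Union>z\<in>C. B z)) {y \<in> topspace (top_of_set (\<Union>z\<in>C. B z)). s y \<in> W}"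
    by (simp add: open_openin_trans openin_open_eq) (use assms(1) in \<open>auto simp: openin_open_eq open_UN\<close>)
next
  fix y assume "y \<in> (\<Union>z\<in>C. B z)"
  then show "\<Phi> (s y) = y" using assms(2) eq by (auto simp: sec_def)
qed

text \<open>The set where two sections agree is closed by the Hausdorff property and open by local
  injectivity of \<open>\<Phi>\<close>.\<close>

lemma sec_unique:
  assumes s: "sec U s" "sec U s'" and U: "connected U" and y: "y \<in> U" "s y = s' y" and z: "z \<in> U"
  shows "s z = s' z"
proof -
  let ?E = "{y \<in> topspace (top_of_set U). s y = s' y}"
  have "closedin (top_of_set U) ?E"
    by (rule closedin_continuous_maps_eq[OF H]) (use s in \<open>auto simp: sec_def\<close>)
  moreover have "openin (top_of_set U) ?E"
  proof (subst openin_subopen, rule ballI)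
    fix x assume x: "x \<in> ?E"
    then have xU: "x \<in> U" and xe: "s x = s' x" by auto
    obtain N where N: "openin X N" "s x \<in> N" "inj_on \<Phi> N" using local_inverse[OF sec_topspace[OF s(1) xU]] by blast
    let ?W = "{y \<in> topspace (top_of_set U). s y \<in> N} \<inter> {y \<in> topspace (top_of_set U). s' y \<in> N}"
    have "openin (top_of_set U) ?W"
      using s N(1) unfolding sec_def by (intro openin_Int openin_continuous_map_preimage) auto
    moreover have "x \<in> ?W" using x N(2) by auto
    moreover have "?W \<subseteq> ?E"
    proof
      fix w assume w: "w \<in> ?W"
      then have "\<Phi> (s w) = \<Phi> (s' w)" using s by (simp add: sec_def)
      then show "w \<in> ?E" using w N(3) by (auto dest: inj_onD)
    qed
    ultimately show "\<exists>T. openin (top_of_set U) T \<and> x \<in> T \<and> T \<subseteq> ?E" by blast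
  qed
  ultimately have "?E = {} \<or> ?E = U" using U unfolding connected_clopen by blast
  then show ?thesis using y z by auto
qed

text \<open>A Lebesgue number argument: half the radius of a local inverse at \<open>q\<close>
  serves all nearby points, and finitely many such neighbourhoods cover the compact preimage of the
  closed ball.\<close>

lemma uniform_sections:
  "\<exists>\<delta>>0. \<forall>q\<in>topspace X. \<Phi> q \<in> cball y M \<longrightarrow> (\<exists>\<sigma>. sec (ball (\<Phi> q) \<delta>) \<sigma> \<and> \<sigma> (\<Phi> q) = q)"
proof -
  define Q where "Q = (\<lambda>r q. \<exists>\<sigma>. sec (ball (\<Phi> q) r) \<sigma> \<and> \<sigma> (\<Phi> q) = q)"
  let ?\<U> = "{U. openin X U \<and> (\<exists>r>0. \<forall>q\<in>U. Q r q)}"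
  let ?K = "{p \<in> topspace X. \<Phi> p \<in> cball y M}"
  have cover: "?K \<subseteq> \<Union>?\<U>"
  proof
    fix q assume "q \<in> ?K"
    then have q: "q \<in> topspace X" by simp
    obtain N r \<sigma> where N: "openin X N" "q \<in> N" "inj_on \<Phi> N" "0 < r" "continuous_map (top_of_set (ball (\<Phi> q) r)) X \<sigma>"
      "\<forall>y\<in>ball (\<Phi> q) r. \<sigma> y \<in> N \<and> \<Phi> (\<sigma> y) = y" using local_inverse[OF q] by blast
    have \<sigma>: "sec (ball (\<Phi> q) r) \<sigma>" using N(5,6) by (simp add: sec_def)
    define U where "U = N \<inter> {p \<in> topspace X. \<Phi> p \<in> ball (\<Phi> q) (r / 2)}"
    have "openin X U" unfolding U_def by (intro openin_Int N(1) openin_continuous_map_preimage[OF cont]) simp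
    moreover have "q \<in> U" using N(2,4) q by (simp add: U_def)
    moreover have "Q (r / 2) p" if p: "p \<in> U" for p
    proof -
      have sub: "ball (\<Phi> p) (r / 2) \<subseteq> ball (\<Phi> q) r"
      proof
        fix z assume "z \<in> ball (\<Phi> p) (r / 2)"
        then show "z \<in> ball (\<Phi> q) r"
          using p dist_triangle[of "\<Phi> q" z "\<Phi> p"] by (auto simp: U_def)
      qed
      have "\<Phi> p \<in> ball (\<Phi> q) r" using sub N(4) by (meson centre_in_ball half_gt_zero subsetD)
      then have "\<sigma> (\<Phi> p) \<in> N" "\<Phi> (\<sigma> (\<Phi> p)) = \<Phi> p" using N(6) by auto
      then have "\<sigma> (\<Phi> p) = p" using N(3) p by (auto simp: U_def dest: inj_onD)
      then show ?thesis unfolding Q_def using sec_subset[OF \<sigma> sub] by blast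
    qed
    moreover have "0 < r / 2" using N(4) by simp
    ultimately show "q \<in> \<Union>?\<U>" by blast
  qed
  have "\<forall>U\<in>?\<U>. openin X U" by blast
  then have "\<exists>\<F>. finite \<F> \<and> \<F> \<subseteq> ?\<U> \<and> ?K \<subseteq> \<Union>\<F>"
    using cover by (intro mp[OF spec[OF conjunct2[OF proper[of y M, unfolded compactin_def]]]] conjI)
  then obtain \<F> where F: "finite \<F>" "\<F> \<subseteq> ?\<U>" "?K \<subseteq> \<Union>\<F>" by (elim exE conjE)
  have "\<exists>\<delta>>0. \<forall>q\<in>\<Union>\<F>. Q \<delta> q"
    using F(1,2)
  proof (induction \<F> rule: finite_induct)
    case empty
    show ?case by (rule exI[of _ 1]) simp
  next
    case (insert U \<F>)
    then obtain \<delta> where \<delta>: "0 < \<delta>" "\<forall>q\<in>\<Union>\<F>. Q \<delta> q" by blast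
    obtain r where r: "0 < r" "\<forall>q\<in>U. Q r q" using insert.prems by blast
    have mono: "Q (min \<delta> r) q" if Qt: "Q t q" and le: "min \<delta> r \<le> t" for t q
    proof -
      obtain \<sigma> where "sec (ball (\<Phi> q) t) \<sigma>" "\<sigma> (\<Phi> q) = q" using Qt unfolding Q_def by (elim exE conjE)
      then show ?thesis unfolding Q_def using sec_subset[OF _ subset_ball[OF le]] by (intro exI[of _ \<sigma>] conjI)
    qed
    have "\<forall>q\<in>\<Union>(insert U \<F>). Q (min \<delta> r) q"
    proof
      fix q assume "q \<in> \<Union>(insert U \<F>)"
      then consider "q \<in> U" | "q \<in> \<Union>\<F>" by blast
      then show "Q (min \<delta> r) q"
      proof cases
        case 1
        then show ?thesis using mono[of r q] r(2) by simp
      next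
        case 2
        then show ?thesis using mono[of \<delta> q] \<delta>(2) by simp
      qed
    qed
    then show ?case using \<delta>(1) r(1) by (intro exI[of _ "min \<delta> r"]) simp
  qed
  then obtain \<delta> where \<delta>: "0 < \<delta>" "\<forall>q\<in>\<Union>\<F>. Q \<delta> q" by blast
  have "\<forall>q\<in>topspace X. \<Phi> q \<in> cball y M \<longrightarrow> Q \<delta> q" using F(3) \<delta>(2) by blast
  then show ?thesis unfolding Q_def using \<delta>(1) by blast
qed

text \<open>Sections over the balls around points of \<open>C\<close>, matching \<open>s\<close> at
  the centres, are glued. If two balls meet, the midpoint of their centres lies in both and, by
  convexity, in \<open>C\<close>, where both sections equal \<open>s\<close>; hence they agree on
  the connected overlap.\<close>

lemma extend_section:
  assumes C: "convex C" "open C" and s: "sec C s" and \<delta>: "0 < \<delta>"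
    and loc: "\<And>q. q \<in> topspace X \<Longrightarrow> \<Phi> q \<in> C \<Longrightarrow> \<exists>\<sigma>. sec (ball (\<Phi> q) \<delta>) \<sigma> \<and> \<sigma> (\<Phi> q) = q"
  shows "\<exists>s'. sec (\<Union>z\<in>C. ball z \<delta>) s' \<and> (\<forall>y\<in>C. s' y = s y)"
proof -
  have "\<forall>z\<in>C. \<exists>\<sigma>. sec (ball z \<delta>) \<sigma> \<and> \<sigma> z = s z"
  proof
    fix z assume z: "z \<in> C"
    have "\<Phi> (s z) = z" using s z by (simp add: sec_def)
    then show "\<exists>\<sigma>. sec (ball z \<delta>) \<sigma> \<and> \<sigma> z = s z" using loc[OF sec_topspace[OF s z]] z by simp
  qed
  from bchoice[OF this] obtain \<sigma> where \<sigma>: "\<forall>z\<in>C. sec (ball z \<delta>) (\<sigma> z) \<and> \<sigma> z z = s z" ..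
  then have \<sigma>s: "sec (ball z \<delta>) (\<sigma> z)" and \<sigma>z: "\<sigma> z z = s z" if "z \<in> C" for z using that by auto
  have agree: "\<sigma> z y = s y" if z: "z \<in> C" and y: "y \<in> C" "y \<in> ball z \<delta>" for z y
  proof (rule sec_unique)
    show "sec (ball z \<delta> \<inter> C) (\<sigma> z)" "sec (ball z \<delta> \<inter> C) s"
      using sec_subset[OF \<sigma>s[OF z]] sec_subset[OF s] by auto
    show "connected (ball z \<delta> \<inter> C)" by (intro convex_connected convex_Int C convex_ball)
    show "z \<in> ball z \<delta> \<inter> C" using z \<delta> by simp
    show "\<sigma> z z = s z" by (rule \<sigma>z[OF z])
    show "y \<in> ball z \<delta> \<inter> C" using y by simp
  qed
  have consistent: "\<sigma> z y = \<sigma> z' y" if z: "z \<in> C" "z' \<in> C" and y: "y \<in> ball z \<delta>" "y \<in> ball z' \<delta>" for z z' y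
  proof -
    let ?m = "midpoint z z'"
    have "dist z z' < 2 * \<delta>" using y dist_triangle[of z z' y] by (simp add: dist_commute)
    then have m: "?m \<in> ball z \<delta>" "?m \<in> ball z' \<delta>" by (simp_all add: dist_midpoint)
    have mC: "?m \<in> C" using C(1) z midpoint_in_closed_segment closed_segment_subset by blast
    show ?thesis
    proof (rule sec_unique)
      show "sec (ball z \<delta> \<inter> ball z' \<delta>) (\<sigma> z)" "sec (ball z \<delta> \<inter> ball z' \<delta>) (\<sigma> z')"
        using sec_subset[OF \<sigma>s[OF z(1)]] sec_subset[OF \<sigma>s[OF z(2)]] by auto
      show "connected (ball z \<delta> \<inter> ball z' \<delta>)" by (intro convex_connected convex_Int convex_ball)
      show "?m \<in> ball z \<delta> \<inter> ball z' \<delta>" "y \<in> ball z \<delta> \<inter> ball z' \<delta>" using m y by auto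
      show "\<sigma> z ?m = \<sigma> z' ?m" using agree[OF z(1) mC m(1)] agree[OF z(2) mC m(2)] by simp
    qed
  qed
  define s' where "s' = (\<lambda>y. \<sigma> (SOME z. z \<in> C \<and> y \<in> ball z \<delta>) y)"
  have s': "s' y = \<sigma> z y" if "z \<in> C" "y \<in> ball z \<delta>" for z y
  proof -
    have "(SOME z. z \<in> C \<and> y \<in> ball z \<delta>) \<in> C \<and> y \<in> ball (SOME z. z \<in> C \<and> y \<in> ball z \<delta>) \<delta>"
      using someI[of "\<lambda>z. z \<in> C \<and> y \<in> ball z \<delta>" z] that by blast
    then show ?thesis unfolding s'_def using consistent that by blast
  qed
  have "sec (\<Union>z\<in>C. ball z \<delta>) s'" by (rule sec_Union[OF open_ball \<sigma>s s'])
  moreover have "\<forall>y\<in>C. s' y = s y" using s' \<sigma>z \<delta> by simp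
  ultimately show ?thesis by blast
qed

lemma ball_sections:
  assumes p: "p \<in> topspace X" and M: "0 < M" shows "\<exists>s. sec (ball (\<Phi> p) M) s \<and> s (\<Phi> p) = p"
proof -
  let ?y = "\<Phi> p"
  obtain \<delta> where \<delta>: "0 < \<delta>" and loc: "\<forall>q\<in>topspace X. \<Phi> q \<in> cball ?y M \<longrightarrow> (\<exists>\<sigma>. sec (ball (\<Phi> q) \<delta>) \<sigma> \<and> \<sigma> (\<Phi> q) = q)"
    using uniform_sections by blast
  have step: "\<exists>s. sec (ball ?y (real (Suc k) * \<delta>)) s \<and> s ?y = p" if "real k * \<delta> \<le> M" for k
    using that
  proof (induction k)
    case 0
    show ?case using loc p M by simp
  next
    case (Suc k)
    have kM: "real k * \<delta> \<le> M" using Suc.prems \<delta> by (simp add: algebra_simps)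
    let ?C = "ball ?y (real (Suc k) * \<delta>)"
    obtain s where s: "sec ?C s" "s ?y = p" using Suc.IH[OF kM] by blast
    have l: "\<exists>\<sigma>. sec (ball (\<Phi> q) \<delta>) \<sigma> \<and> \<sigma> (\<Phi> q) = q" if "q \<in> topspace X" "\<Phi> q \<in> ?C" for q
      using loc that Suc.prems by auto
    obtain s' where s': "sec (\<Union>z\<in>?C. ball z \<delta>) s'" "\<forall>y\<in>?C. s' y = s y"
      using extend_section[OF convex_ball open_ball s(1) \<delta> l] by blast
    have R: "0 < real (Suc k) * \<delta>" using \<delta> by simp
    have "ball ?y (real (Suc (Suc k)) * \<delta>) \<subseteq> (\<Union>z\<in>?C. ball z \<delta>)"
    proof
      fix x assume x: "x \<in> ball ?y (real (Suc (Suc k)) * \<delta>)"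
      let ?R = "real (Suc k) * \<delta>"
      \<comment> \<open>Divides the segment from the centre to \<open>x\<close> in the ratio k + 1
        to 1: \<open>?z\<close> lies in the old ball and \<open>x\<close> within
        \<open>\<delta>\<close> of \<open>?z\<close>.\<close>
      let ?z = "?y + (real (Suc k) / real (Suc (Suc k))) *\<^sub>R (x - ?y)"
      have d: "dist ?y x < real (Suc (Suc k)) * \<delta>" using x by simp
      have "dist ?y ?z = real (Suc k) / real (Suc (Suc k)) * dist ?y x" by (simp add: dist_norm norm_minus_commute)
      also have "\<dots> < real (Suc k) / real (Suc (Suc k)) * (real (Suc (Suc k)) * \<delta>)"
        using d by (intro mult_strict_left_mono) auto
      also have "\<dots> = ?R" by simp
      finally have z: "?z \<in> ?C" by simp
      have "x - ?z = (1 / real (Suc (Suc k))) *\<^sub>R (x - ?y)"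
      proof -
        have "1 - real (Suc k) / real (Suc (Suc k)) = 1 / real (Suc (Suc k))" by (simp add: field_simps)
        moreover have "x - ?z = (1 - real (Suc k) / real (Suc (Suc k))) *\<^sub>R (x - ?y)"
          by (simp only: scaleR_left_diff_distrib scaleR_one diff_diff_eq)
        ultimately show ?thesis by simp
      qed
      then have "dist ?z x = 1 / real (Suc (Suc k)) * dist ?y x" by (simp only: dist_norm norm_minus_commute[of ?z x] norm_minus_commute[of ?y x] norm_scaleR abs_of_nonneg zero_le_divide_1_iff of_nat_0_le_iff)
      also have "\<dots> < 1 / real (Suc (Suc k)) * (real (Suc (Suc k)) * \<delta>)"
        using d by (intro mult_strict_left_mono) auto
      also have "\<dots> = \<delta>" by simp
      finally show "x \<in> (\<Union>z\<in>?C. ball z \<delta>)" using z by (intro UN_I[of ?z]) auto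
    qed
    then have "sec (ball ?y (real (Suc (Suc k)) * \<delta>)) s'" by (rule sec_subset[OF s'(1)])
    moreover have "s' ?y = p" using s'(2) s(2) R by simp
    ultimately show ?case by blast
  qed
  define k where "k = nat \<lfloor>M / \<delta>\<rfloor>"
  have "real k \<le> M / \<delta>" "M / \<delta> < real (Suc k)" using M \<delta> unfolding k_def by (simp_all add: floor_less_iff) linarith+
  then have k: "real k * \<delta> \<le> M" "M \<le> real (Suc k) * \<delta>" using \<delta> by (simp_all only: pos_le_divide_eq pos_divide_less_eq less_imp_le)
  show ?thesis using step[OF k(1)] sec_subset subset_ball[OF k(2)] by blast
qed

theorem homeomorphism: assumes ne: "topspace X \<noteq> {}" shows "\<exists>s. homeomorphic_maps X euclidean \<Phi> s"
proof -
  obtain p where p: "p \<in> topspace X" using ne by blast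
  let ?y = "\<Phi> p"
  let ?B = "\<lambda>n::nat. ball ?y (real (Suc n))"
  have "\<forall>n::nat. \<exists>s. sec (?B n) s \<and> s ?y = p" by (rule allI, rule ball_sections[OF p]) simp
  from choice[OF this] obtain \<sigma> where \<sigma>: "\<forall>n. sec (?B n) (\<sigma> n) \<and> \<sigma> n ?y = p" ..
  have consistent: "\<sigma> m x = \<sigma> n x" if "x \<in> ?B m" "x \<in> ?B n" for m n x
  proof (rule sec_unique)
    show "sec (?B m \<inter> ?B n) (\<sigma> m)" "sec (?B m \<inter> ?B n) (\<sigma> n)" using \<sigma> sec_subset by blast+
    show "connected (?B m \<inter> ?B n)" by (intro convex_connected convex_Int convex_ball)
    show "\<sigma> m ?y = \<sigma> n ?y" using \<sigma> by simp
  qed (use that in auto)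
  define s where "s = (\<lambda>x. \<sigma> (SOME n. x \<in> ?B n) x)"
  have s_eq: "s x = \<sigma> n x" if "x \<in> ?B n" for n x
    unfolding s_def by (rule consistent[OF someI[of "\<lambda>n. x \<in> ?B n"] that]) (rule that)
  have "sec (\<Union>n\<in>UNIV. ?B n) s" by (rule sec_Union[where \<sigma>=\<sigma>, OF open_ball _ s_eq]) (use \<sigma> in auto)
  moreover have "(\<Union>n\<in>UNIV. ?B n) = UNIV"
  proof -
    have "x \<in> (\<Union>n\<in>UNIV. ?B n)" for x
    proof -
      obtain n :: nat where "dist ?y x < real n" using reals_Archimedean2 by blast
      then show ?thesis by (intro UN_I[of n]) auto
    qed
    then show ?thesis by blast
  qed
  ultimately have "sec UNIV s" by (simp only:)
  then have s: "continuous_map euclidean X s" "\<And>x. \<Phi> (s x) = x" by (simp_all add: sec_def)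
  have sp: "s ?y = p" using s_eq[of ?y 0] \<sigma> by simp
  have sP: "continuous_map X X (\<lambda>q. s (\<Phi> q))" using continuous_map_compose[OF cont s(1)] by (simp add: o_def)
  \<comment> \<open>This is the image of the global section: it is closed by the Hausdorff property,
    open by local injectivity, and contains \<open>p\<close>.\<close>
  let ?E = "{q \<in> topspace X. s (\<Phi> q) = q}"
  have "closedin X ?E" by (rule closedin_continuous_maps_eq[OF H sP]) simp
  moreover have "openin X ?E"
  proof (subst openin_subopen, rule ballI)
    fix q assume q: "q \<in> ?E"
    then obtain N where N: "openin X N" "q \<in> N" "inj_on \<Phi> N" using local_inverse[of q] by blast
    let ?W = "N \<inter> {x \<in> topspace X. s (\<Phi> x) \<in> N}"
    have "openin X ?W" by (intro openin_Int N(1) openin_continuous_map_preimage[OF sP])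
    moreover have "q \<in> ?W" using q N(2) by simp
    moreover have "?W \<subseteq> ?E" using s(2) N(3) by (auto dest: inj_onD)
    ultimately show "\<exists>T. openin X T \<and> q \<in> T \<and> T \<subseteq> ?E" by blast
  qed
  moreover have "p \<in> ?E" using p sp by simp
  ultimately have "?E = topspace X" using conn unfolding connected_space_clopen_in by blast
  then have "\<forall>q\<in>topspace X. s (\<Phi> q) = q" by blast
  then have "homeomorphic_maps X euclidean \<Phi> s"
    unfolding homeomorphic_maps_def using cont s by simp
  then show ?thesis by blast
qed

end

section \<open>Vanishing second fundamental form\<close>

context immersed
begin

lemma constant_of_mD_zero:
  assumes Y: "sm \<M> Y" and d: "\<And>p u. p \<in> \<M> \<Longrightarrow> mD Y p u = 0"
    and p: "p \<in> \<M>" and q: "q \<in> \<M>"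
  shows "Y q = Y p"
proof -
  let ?E = "{q \<in> \<M>. Y q \<in> {Y p}}"
  have "closedin X ?E" by (rule closedin_continuous_map_preimage[OF sm_continuous[OF Y]]) simp
  moreover have "openin X ?E"
  proof (subst openin_subopen, rule ballI)
    fix a assume a: "a \<in> ?E"
    then have aX: "a \<in> \<M>" by simp
    obtain V \<psi> x r where c: "(V, \<psi>) \<in> A" "0 < r" "cball x r \<subseteq> V" "\<psi> x = a" using chart_ball[OF aX] .
    have BV: "ball x r \<subseteq> V" using c(3) ball_subset_cball by blast
    have "(Y \<circ> \<psi>) y = (Y \<circ> \<psi>) x" if y: "y \<in> ball x r" for y
    proof (rule has_derivative_zero_unique[OF convex_ball _ y])
      fix z assume z: "z \<in> ball x r"
      then have zV: "z \<in> V" using BV by blast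
      have "Df (Y \<circ> \<psi>) z = (\<lambda>h. 0)"
        by (rule ext) (simp add: mD_chart_dG[OF c(1) zV Y chart_topspace[OF c(1) zV], symmetric] d[OF chart_topspace[OF c(1) zV]])
      then have "((Y \<circ> \<psi>) has_derivative (\<lambda>h. 0)) (at z)"
        using sm_chart_has_derivative[OF Y c(1) zV chart_topspace[OF c(1) zV]] by simp
      then show "((Y \<circ> \<psi>) has_derivative (\<lambda>h. 0)) (at z within ball x r)" by (rule has_derivative_at_withinI)
    qed (use c(2) in simp)
    then have "\<psi> ` ball x r \<subseteq> ?E" using a c(4) BV chart_topspace[OF c(1)] by auto
    moreover have "a \<in> \<psi> ` ball x r" using c(2,4) by force
    moreover have "openin X (\<psi> ` ball x r)" by (rule chart_image_open[OF c(1) open_ball BV])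
    ultimately show "\<exists>T. openin X T \<and> a \<in> T \<and> T \<subseteq> ?E" by blast
  qed
  moreover have "p \<in> ?E" using p by simp
  ultimately have "?E = \<M>" using connected unfolding connected_space_clopen_in by blast
  then show ?thesis using q by blast
qed

text \<open>The hypothesis only gives \<open>dT = 0\<close> on tangent vectors. For general
  \<open>v\<close>, \<open>dT_idem\<close> then makes \<open>dT p u v\<close> tangential, and
  self-adjointness moves the operator onto this tangent vector, so its squared norm is 0.\<close>

lemma flat_dT: assumes p: "p \<in> \<M>" and a: "second_ff_sq X A F p = 0" shows "dT p u v = 0"
proof -
  have "(\<Sum>i\<in>Basis. \<Sum>j\<in>Basis. (norm (dT p i (tproj p j)))\<^sup>2) = 0" using a second_ff_sq_eq[OF p] by simp
  then have z: "dT p i (tproj p j) = 0" if "i \<in> Basis" "j \<in> Basis" for i j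
    using that by (simp add: sum_nonneg_eq_0_iff sum_nonneg)
  have t: "dT p u (tproj p v) = 0" for u v
  proof -
    have l1: "linear (\<lambda>u. dT p u (tproj p v))" for v by (rule dT_linear_left[OF p])
    have l2: "linear (\<lambda>v. dT p u (tproj p v))" for u
      using linear_compose[OF tproj_linear[of p] dT_linear_right[OF p, of u]] by (simp add: o_def)
    have "dT p i (tproj p v) = 0" if i: "i \<in> Basis" for i v
      using linear_eq_on[OF l2 linear_zero, of v Basis i] z[OF i] by (simp add: span_Basis)
    then show ?thesis using linear_eq_on[OF l1[of v] linear_zero, of u Basis] by (simp add: span_Basis)
  qed
  have "tproj p (dT p u v) = dT p u v" using dT_idem[OF p, of u v] t by simp
  then have "dT p u v \<bullet> dT p u v = dT p u v \<bullet> tproj p (dT p u v)" by simp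
  also have "\<dots> = v \<bullet> dT p u (tproj p (dT p u v))" by (rule dT_selfadjoint[OF p])
  also have "\<dots> = 0" unfolding t by simp
  finally show ?thesis by simp
qed

end

context expander
begin

text \<open>The mean curvature vanishes, so the self-expander equation puts \<open>F p\<close> into
  the common tangent space; this is why the hyperplane passes through the origin. Linear coordinates
  on that space turn \<open>F\<close> into a map to \<open>real^'n\<close>, to which the inverse
  function theorem applies.\<close>

lemma flat_imp_hyperplane:
  assumes proper: "properly_immersed X F" and flat: "\<And>p. p \<in> \<M> \<Longrightarrow> asq p = 0"
  shows "hyperplane_through_origin X F"
proof -
  obtain p0 where p0: "p0 \<in> \<M>" using nonempty by blast
  obtain \<nu> where \<nu>: "unit_normal_at A F p0 \<nu>" using unit_normal_exists[OF p0] .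
  let ?H = "{x. \<nu> \<bullet> x = 0}"
  have tp: "tproj p v = tproj p0 v" if p: "p \<in> \<M>" for p v
    by (rule constant_of_mD_zero[OF sm_tproj _ p0 p]) (simp add: dT_def[symmetric] flat_dT flat)
  obtain V0 \<psi>0 x0 where c0: "(V0, \<psi>0) \<in> A" "x0 \<in> V0" "\<psi>0 x0 = p0" using chart_cover[OF p0] .
  interpret c0: local_immersion V0 "F \<circ> \<psi>0" by (rule chart_immersion[OF c0(1)])
  \<comment> \<open>The chart at \<open>p0\<close> only provides linear coordinates on the common
    tangent space: \<open>D\<close> parametrizes it, and \<open>L\<close> inverts \<open>D\<close>
    and annihilates normal vectors.\<close>
  define L where "L = c0.coord x0"
  define D where "D = Df (F \<circ> \<psi>0) x0"
  have LD: "L (D a) = a" for a unfolding L_def D_def by (rule c0.coord_dG[OF c0(2)])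
  have DL: "D (L v) = tproj p0 v" for v
    unfolding L_def D_def c0.dG_coord[OF c0(2)] using tproj_chart[OF c0(1,2)] c0(3) by simp
  have linL: "linear L"
    unfolding L_def c0.coord_def by (rule linearI) (simp_all add: vec_eq_iff inner_add_right)
  have linD: "linear D"
    unfolding D_def by (rule has_derivative_linear[OF sm_chart_has_derivative[OF sm_F c0(1,2)]]) (simp add: c0(3) p0)
  have cL: "continuous_on S L" and cD: "continuous_on T D" for S T
    by (intro linear_continuous_on linear_conv_bounded_linear[THEN iffD1] linL linD)+
  have FP: "tproj p0 (F p) = F p" if p: "p \<in> \<M>" for p
  proof -
    have "mean_curv_vector X A F p = 0"
      unfolding mean_curv_vector_eq[OF p] by (simp add: flat_dT[OF p flat[OF p]])
    then show ?thesis using mean_curv_vector_expander[OF p] tp[OF p, of "F p"] by simp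
  qed
  define \<Phi> where "\<Phi> = (\<lambda>p. L (F p))"
  have D\<Phi>: "D (\<Phi> p) = F p" if "p \<in> \<M>" for p unfolding \<Phi>_def DL by (rule FP[OF that])
  interpret h: proper_local_homeo X \<Phi>
  proof
    show "Hausdorff_space X" by (rule Hausdorff)
    show "connected_space X" by (rule connected)
    have "continuous_map euclidean euclidean L" using cL by simp
    from continuous_map_compose[OF sm_continuous[OF sm_F] this]
    show "continuous_map X euclidean \<Phi>" by (simp add: \<Phi>_def[abs_def] o_def)
    fix y r
    have "compact (D ` cball y r)" by (rule compact_continuous_image[OF cD compact_cball])
    then have "compactin X {p \<in> \<M>. F p \<in> D ` cball y r}" using proper unfolding properly_immersed_def by blast
    moreover have "F p \<in> D ` cball y r \<longleftrightarrow> \<Phi> p \<in> cball y r" if p: "p \<in> \<M>" for p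
    proof
      assume "F p \<in> D ` cball y r"
      then obtain b where "b \<in> cball y r" "F p = D b" by blast
      then show "\<Phi> p \<in> cball y r" unfolding \<Phi>_def by (simp only: LD)
    next
      assume "\<Phi> p \<in> cball y r"
      then show "F p \<in> D ` cball y r" by (subst D\<Phi>[OF p, symmetric]) (rule imageI)
    qed
    then have "{p \<in> \<M>. F p \<in> D ` cball y r} = {p \<in> \<M>. \<Phi> p \<in> cball y r}" by blast
    ultimately show "compactin X {p \<in> \<M>. \<Phi> p \<in> cball y r}" by (simp only:)
  next
    fix q assume q: "q \<in> \<M>"
    obtain V \<psi> x where c: "(V, \<psi>) \<in> A" "x \<in> V" "\<psi> x = q" using chart_cover[OF q] .
    define G where "G = F \<circ> \<psi>"
    interpret c: local_immersion V G unfolding G_def by (rule chart_immersion[OF c(1)])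
    let ?dG = "\<lambda>y. Df G y"
    have dG: "(G has_derivative ?dG y) (at y)" if "y \<in> V" for y
      by (rule smooth_on_has_derivative[OF c.smooth_G that])
    define f where "f = (\<lambda>y. L (G y))"
    \<comment> \<open>The inverse function theorem takes derivatives as bounded linear functions;
      the value 0 off \<open>V\<close> is arbitrary.\<close>
    define f' where "f' = (\<lambda>y. if y \<in> V then Blinfun (\<lambda>a. L (?dG y a)) else 0)"
    have lin: "linear (\<lambda>a. L (?dG y a))" if "y \<in> V" for y
      using linear_compose[OF has_derivative_linear[OF dG[OF that]] linL] by (simp add: o_def)
    have f': "blinfun_apply (f' y) = (\<lambda>a. L (?dG y a))" if "y \<in> V" for y
      using that lin[OF that] by (simp add: f'_def bounded_linear_Blinfun_apply linear_conv_bounded_linear)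
    have der: "(f has_derivative blinfun_apply (f' y)) (at y)" if "y \<in> V" for y
      unfolding f'[OF that] f_def
      by (rule bounded_linear.has_derivative[OF linear_conv_bounded_linear[THEN iffD1, OF linL] dG[OF that]])
    have contf': "continuous_on V f'"
    proof (rule continuous_on_blinfun_componentwise)
      fix i :: "real^'n"
      have "continuous_on V (\<lambda>y. L (?dG y i))"
        by (rule continuous_on_compose2[OF cL smooth_on_imp_continuous_on[OF smooth_on_frechet[OF c.smooth_G]] subset_UNIV])
      then show "continuous_on V (\<lambda>y. blinfun_apply (f' y) i)"
        by (rule continuous_on_eq) (simp add: f')
    qed
    \<comment> \<open>\<open>D\<close> after \<open>L\<close> is the projection, which fixes the
      tangent vector \<open>?dG x a\<close>, so \<open>L\<close> is injective on such
      vectors.\<close>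
    have "inj (\<lambda>a. L (?dG x a))"
    proof (rule linear_injective_0[OF lin[OF c(2)], THEN iffD2], intro allI impI)
      fix a assume a: "L (?dG x a) = 0"
      have "?dG x a \<in> tangent_space A F q"
        using tangent_space_chart[OF c(1,2)] c(3) unfolding G_def by auto
      then have "?dG x a = D (L (?dG x a))" unfolding DL using tproj_id[OF q] tp[OF q] by simp
      also have "\<dots> = 0" unfolding a by (rule linear_0[OF linD])
      finally have "?dG x a = ?dG x 0" using linear_0[OF has_derivative_linear[OF dG[OF c(2)]]] by simp
      then show "a = 0" by (rule injD[OF c.inj_G[OF c(2)]])
    qed
    from linear_injective_left_inverse[OF lin[OF c(2)] this]
    obtain g0 where g0: "linear g0" "g0 \<circ> (\<lambda>a. L (?dG x a)) = id" by blast
    have "Blinfun g0 o\<^sub>L f' x = id_blinfun"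
    proof (rule blinfun_eqI)
      fix a
      show "blinfun_apply (Blinfun g0 o\<^sub>L f' x) a = blinfun_apply id_blinfun a"
        using fun_cong[OF g0(2), of a] g0(1) f'[OF c(2)]
        by (simp add: bounded_linear_Blinfun_apply linear_conv_bounded_linear)
    qed
    from inverse_function_theorem[OF c.open_V der contf' c(2) this]
    obtain U' V' g where U': "open U'" "U' \<subseteq> V" "x \<in> U'" "open V'" "f x \<in> V'" "homeomorphism U' V' f g" by metis
    have \<Phi>f: "\<Phi> (\<psi> y) = f y" for y by (simp add: \<Phi>_def f_def G_def)
    obtain r where r: "0 < r" "ball (\<Phi> q) r \<subseteq> V'" using U'(4,5) \<Phi>f[of x] c(3) openE by metis
    have gU: "g y \<in> U'" "f (g y) = y" if "y \<in> V'" for y using U'(6) that unfolding homeomorphism_def by auto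
    have gf: "g (f y) = y" if "y \<in> U'" for y using U'(6) that unfolding homeomorphism_def by auto
    have "continuous_map (top_of_set (ball (\<Phi> q) r)) (top_of_set V) g"
    proof -
      have "continuous_on (ball (\<Phi> q) r) g"
        by (rule continuous_on_subset[OF homeomorphism_cont2[OF U'(6)] r(2)])
      moreover have "g ` ball (\<Phi> q) r \<subseteq> V" using gU(1) U'(2) r(2) by blast
      ultimately show ?thesis by (simp add: image_subset_iff_funcset)
    qed
    from continuous_map_compose[OF this chart_continuous[OF c(1)]]
    have cg: "continuous_map (top_of_set (ball (\<Phi> q) r)) X (\<psi> \<circ> g)" .
    have inj: "inj_on \<Phi> (\<psi> ` U')"
    proof (rule inj_onI)
      fix a b assume "a \<in> \<psi> ` U'" "b \<in> \<psi> ` U'" and e: "\<Phi> a = \<Phi> b"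
      then obtain y z where yz: "y \<in> U'" "z \<in> U'" "a = \<psi> y" "b = \<psi> z" by blast
      then have "g (f y) = g (f z)" using e by (simp add: \<Phi>f)
      then show "a = b" using gf yz by simp
    qed
    show "\<exists>N r \<sigma>. openin X N \<and> q \<in> N \<and> inj_on \<Phi> N \<and> 0 < r \<and>
      continuous_map (top_of_set (ball (\<Phi> q) r)) X \<sigma> \<and> (\<forall>y\<in>ball (\<Phi> q) r. \<sigma> y \<in> N \<and> \<Phi> (\<sigma> y) = y)"
    proof (intro exI conjI ballI)
      show "openin X (\<psi> ` U')" by (rule chart_image_open[OF c(1) U'(1,2)])
      show "q \<in> \<psi> ` U'" using U'(3) c(3) by blast
      fix y assume "y \<in> ball (\<Phi> q) r"
      then have y: "y \<in> V'" using r(2) by blast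
      show "(\<psi> \<circ> g) y \<in> \<psi> ` U'" using gU(1)[OF y] by simp
      show "\<Phi> ((\<psi> \<circ> g) y) = y" using gU(2)[OF y] by (simp add: \<Phi>f)
    qed (rule inj r(1) cg)+
  qed
  obtain s where s: "homeomorphic_maps X euclidean \<Phi> s" using h.homeomorphism[OF nonempty] ..
  have s1: "continuous_map euclidean X s" "\<And>p. p \<in> \<M> \<Longrightarrow> s (\<Phi> p) = p" "\<And>y. \<Phi> (s y) = y"
    using s unfolding homeomorphic_maps_def by auto
  have sX: "s y \<in> \<M>" for y using continuous_map_image_subset_topspace[OF s1(1)] by auto
  have FH: "F p \<in> ?H" if p: "p \<in> \<M>" for p
  proof -
    have "\<nu> \<bullet> F p = \<nu> \<bullet> tproj p0 (F p)" by (simp only: FP[OF p])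
    then show ?thesis using unit_normalD(2)[OF \<nu> tproj_in[OF p0]] by simp
  qed
  have "homeomorphic_maps X (top_of_set ?H) F (\<lambda>y. s (L y))"
    unfolding homeomorphic_maps_def
  proof (intro conjI ballI)
    show "continuous_map X (top_of_set ?H) F"
      using sm_continuous[OF sm_F] FH by (simp add: continuous_map_in_subtopology image_subset_iff)
    have "continuous_map (top_of_set ?H) euclidean L" using cL by simp
    from continuous_map_compose[OF this s1(1)] show "continuous_map (top_of_set ?H) X (\<lambda>y. s (L y))" by (simp add: o_def)
    show "s (L (F p)) = p" if "p \<in> \<M>" for p using s1(2)[OF that] by (simp add: \<Phi>_def)
    fix y assume "y \<in> topspace (top_of_set ?H)"
    then have "tproj p0 y = y" using tproj_unit_normal[OF p0 \<nu>, of y] by (simp add: inner_commute)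
    then show "F (s (L y)) = y" using D\<Phi>[OF sX, of "L y"] s1(3) DL by simp
  qed
  then have "homeomorphic_map X (top_of_set ?H) F" unfolding homeomorphic_map_maps by blast
  moreover have "\<nu> \<noteq> 0" using unit_normalD(1)[OF \<nu>] by auto
  ultimately show ?thesis unfolding hyperplane_through_origin_def by blast
qed

text \<open>Since \<open>F\<close> takes values in the hyperplane, the normal of the hyperplane is a
  unit normal at every point. The projection is then constant and has derivative 0.\<close>

lemma hyperplane_imp_flat:
  assumes h: "hyperplane_through_origin X F" and p: "p \<in> \<M>" shows "asq p = 0"
proof -
  obtain v where v: "v \<noteq> 0" "homeomorphic_map X (top_of_set {x. v \<bullet> x = 0}) F"
    using h unfolding hyperplane_through_origin_def by blast
  have Fv: "F q \<bullet> v = 0" if "q \<in> \<M>" for q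
    using homeomorphic_imp_surjective_map[OF v(2)] that by (auto simp: inner_commute)
  define \<nu> where "\<nu> = v /\<^sub>R norm v"
  have sc: "sm \<M> (\<lambda>q. v)" by (rule sm_const) simp
  have \<nu>: "unit_normal_at A F q \<nu>" if q: "q \<in> \<M>" for q
  proof -
    have "v \<bullet> t = 0" if t: "t \<in> tangent_space A F q" for t
    proof -
      have "mD (\<lambda>q. F q \<bullet> v) q t = mD (\<lambda>q. 0) q t"
        by (rule mD_cong(1)[OF sm_inner[OF sm_F sc] q]) (rule Fv)
      then have "tproj q t \<bullet> v = 0" by (simp add: mD_inner[OF sm_F sc q] mD_F[OF q] mD_const[OF q])
      then show ?thesis by (simp add: tproj_id[OF q t] inner_commute)
    qed
    then have "\<nu> \<in> (tangent_space A F q)\<^sup>\<bottom>" by (simp add: \<nu>_def orthogonal_comp_def orthogonal_def inner_commute)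
    then show ?thesis using v(1) by (simp add: unit_normal_at_def \<nu>_def)
  qed
  have "dT p u w = 0" for u w
  proof -
    have "dT p u w = mD (\<lambda>q. w - (w \<bullet> \<nu>) *\<^sub>R \<nu>) p u"
      unfolding dT_def by (rule mD_cong(1)[OF sm_tproj p]) (rule tproj_unit_normal[OF _ \<nu>])
    then show ?thesis by (simp add: mD_const[OF p])
  qed
  then show ?thesis by (simp add: second_ff_sq_eq[OF p])
qed

end

section \<open>The spectral inequalities and the case of equality\<close>

theorem theorem1p5:
  fixes X :: "'a topology"
    and A :: "('n::finite, 'a) atlas"
    and F :: "'a \<Rightarrow> real^'m::finite"
  assumes "CARD('m) = CARD('n) + 1"
    and "connected_manifold X A"
    and "smooth_immersion X A F"
    and "riem_complete X F"
    and "properly_immersed X F"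
    and "self_expander X A F"
  shows "mu1 X A F \<le> lambda1 X A F + ereal (1/2) \<and>
         (mu1 X A F = lambda1 X A F + ereal (1/2) \<longleftrightarrow> hyperplane_through_origin X F) \<and>
         (mean_convex X A F \<longrightarrow>
            1 \<le> mu1 X A F \<and> mu1 X A F \<le> lambda1 X A F + ereal (1/2))"
proof -
  interpret expander X A F by unfold_locales (use assms in auto)
  have eq: "mu1 X A F = lambda1 X A F + ereal (1/2) \<longleftrightarrow> hyperplane_through_origin X F"
  proof
    assume e: "mu1 X A F = lambda1 X A F + ereal (1/2)"
    show "hyperplane_through_origin X F"
      by (rule flat_imp_hyperplane[OF assms(5)]) (rule equality_imp_flat[OF assms(5) e])
  next
    assume "hyperplane_through_origin X F"
    then show "mu1 X A F = lambda1 X A F + ereal (1/2)"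
      by (intro mu1_eq_flat) (rule hyperplane_imp_flat)
  qed
  have mc: "1 \<le> mu1 X A F" if "mean_convex X A F"
  proof -
    obtain N where N: "smooth_map A (topspace X) N"
      "\<And>p. p \<in> topspace X \<Longrightarrow> unit_normal_at A F p (N p) \<and> 0 \<le> mean_curv X A F p (N p)"
      using \<open>mean_convex X A F\<close> unfolding mean_convex_def by blast
    interpret o: oriented_expander X A F N
      by unfold_locales (use N in \<open>auto simp: sm_topspace\<close>)
    show ?thesis
    proof (rule o.mean_convex_mu1[OF _ assms(5)])
      fix p assume p: "p \<in> topspace X"
      \<comment> \<open>By the self-expander equation, nonnegative mean curvature means a
        nonpositive support function.\<close>
      have "0 \<le> - (1/2) * (F p \<bullet> N p)"
        using assms(6) p N(2)[OF p] unfolding self_expander_def by force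
      then show "o.f p \<le> 0" by (simp add: o.f_def)
    qed
  qed
  show ?thesis using mu1_le eq mc by blast
qed

end
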